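(* Assume the hard constraint, drift and source assumption, the initial data assumption, the hard constraint restriction, and the complimentary relationship condition described in the context. Let $p_\infty$ be the limit of $p_k$ in $L^1(Q_T)$ as $k\to\infty$. Then for every $\varphi\in C_c^\infty(Q_T)$ $$\iint_{Q_T}-m\,p_\infty\,\nabla\varphi\cdot\nabla p_\infty-m\,\varphi\,|\nabla p_\infty|^2+\varphi\,p_\infty\,mF=0.$$ That is, $p_\infty\left[\nabla\cdot(m\nabla p_\infty)+mF\right]=0$ in $Q_T$ in the sense of distributions.
   Context: Fix $d\ge 1$, $T>0$, and let $Q_T=\mathbb{R}^d\times(0,T)$. The operators $\nabla$, $\nabla\cdot$ act in the space variables only. Hard constraint, drift and source assumption: $m,f:Q_T\to\mathbb{R}$ and $\vec b:Q_T\to\mathbb{R}^d$ are in $C^\infty(Q_T)$ with bounded derivatives of all orders (order zero included), and there is $\delta>0$ with $m(x,t)\ge\delta$. Set $F=(\nabla\cdot(m\vec b)+mf-\partial_t m)/m$. Initial data assumption: for each $k>1$, $\varrho_k^{(0)}\in W^{1,1}(\mathbb{R}^d)$, $\varrho_k^{(0)}\ge 0$ a.e.; put $p_k^{(0)}=\frac{k}{k-1}\left(\varrho_k^{(0)}/m(\cdot,0)\right)^{k-1}$. There are a compact $K\subset\mathbb{R}^d$ and a constant $C$ with $\operatorname{supp}\varrho_k^{(0)}\subset K$, $\|\varrho_k^{(0)}\|_{L^\infty}\le C$, $\|\varrho_k^{(0)}\|_{W^{1,1}}\le C$, $\|p_k^{(0)}\|_{L^\infty}\le C$ for all $k>1$.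 There is $\varrho_\infty^{(0)}$ with $\varrho_k^{(0)}\to\varrho_\infty^{(0)}$ in $L^1(\mathbb{R}^d)$ as $k\to\infty$. Hard constraint restriction: at least one of the following holds: $m$ is radial in space, $m(x,t)=m(|x|,t)$; or $d=1$; or there is $R>0$ such that $|\nabla m(x,t)|\le\varepsilon/|x|$ for $|x|\ge R$, where $\varepsilon=\varepsilon(\delta)>0$ is a sufficiently small constant depending on $\delta$ (the result asserts that such an $\varepsilon(\delta)$ exists). Complimentary relationship condition: there is $C>0$ independent of $k$ with $\int_{\mathbb{R}^d}|\nabla p_k(x,0)|^2dx\le C$. For $k>1$, $\varrho_k$ is the (nonnegative) weak solution of $\partial_t\varrho_k=\nabla\cdot(\varrho_k(\nabla p_k+\vec b))+f\varrho_k$ in $Q_T$ with initial data $\varrho_k^{(0)}$, where $p_k=\frac{k}{k-1}(\varrho_k/m)^{k-1}$: with $v_k=\varrho_k/m$, one has $\varrho_k\in L^2(Q_T)$, $v_k^k\in H^1(Q_T)$ and for all $\varphi\in C_c^\infty(\mathbb{R}^d\times[0,T))$ $$\iint_{Q_T}-\varrho_k\partial_t\varphi=\int_{\mathbb{R}^d}\varphi(x,0)\varrho_k^{(0)}(x)\,dx+\iint_{Q_T}-m\nabla\varphi\cdot\nabla v_k^k-\varrho_k\nabla\varphi\cdot\vec b+f\varphi\varrho_k.$$ It is known that, under the first three assumptions, $(\varrho_k,p_k)$ converges in $L^1(Q_T)$ as $k\to\infty$ to a pair $(\varrho_\infty,p_\infty)$ with $p_\infty\in L^2(0,T;H^1(\mathbb{R}^d)\cap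 L^\infty(\mathbb{R}^d))$. *)

theory Defs
  imports "HOL-Analysis.Analysis"
begin

section \<open>Smooth functions and test functions\<close>

definition dir_deriv :: "'a::euclidean_space \<Rightarrow> ('a \<Rightarrow> 'b::real_normed_vector) \<Rightarrow> 'a \<Rightarrow> 'b" where
  "dir_deriv v u x = frechet_derivative u (at x) v"

text \<open>Iterated partial derivatives; the list of coordinate directions plays the role of a multi-index.\<close>

definition iter_deriv :: "'a::euclidean_space list \<Rightarrow> ('a \<Rightarrow> 'b::real_normed_vector) \<Rightarrow> 'a \<Rightarrow> 'b" where
  "iter_deriv vs u = foldr dir_deriv vs u"

text \<open>Only meant for open \<open>S\<close>: there it is equivalent to all iterated partial derivatives existing
  and being continuous on \<open>S\<close>. It does not depend on the values of \<open>u\<close> outside \<open>S\<close>.\<close>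

definition smooth_on :: "'a::euclidean_space set \<Rightarrow> ('a \<Rightarrow> 'b::real_normed_vector) \<Rightarrow> bool" where
  "smooth_on S u \<longleftrightarrow>
     (\<forall>vs. set vs \<subseteq> Basis \<longrightarrow> (\<forall>x\<in>S. iter_deriv vs u differentiable (at x)))"

definition smooth_bounded_on :: "'a::euclidean_space set \<Rightarrow> ('a \<Rightarrow> 'b::real_normed_vector) \<Rightarrow> bool" where
  "smooth_bounded_on S u \<longleftrightarrow>
     smooth_on S u \<and> (\<forall>vs. set vs \<subseteq> Basis \<longrightarrow> bounded (iter_deriv vs u ` S))"

text \<open>\<open>C\<^sub>c\<^sup>\<infinity>(\<Omega>)\<close> for open \<open>\<Omega>\<close>, its elements being extended by zero to the whole space.\<close>

definition test_function :: "'a::euclidean_space set \<Rightarrow> ('a \<Rightarrow> real) \<Rightarrow> bool" where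
  "test_function \<Omega> \<phi> \<longleftrightarrow>
     smooth_on UNIV \<phi> \<and> compact (closure {x. \<phi> x \<noteq> 0}) \<and> closure {x. \<phi> x \<noteq> 0} \<subseteq> \<Omega>"


section \<open>Lebesgue and Sobolev spaces\<close>

text \<open>Elements are functions, not equivalence classes; every notion in this section is invariant under
  changing a function on a null set.\<close>

definition Lp :: "real \<Rightarrow> 'a::euclidean_space set \<Rightarrow> ('a \<Rightarrow> 'b::euclidean_space) set" where
  "Lp p \<Omega> = {u. u \<in> borel_measurable (lebesgue_on \<Omega>) \<and>
                integrable (lebesgue_on \<Omega>) (\<lambda>x. norm (u x) powr p)}"

text \<open>Convergence in \<open>L\<^sup>1(\<Omega>)\<close> of a family with real parameter \<open>k \<rightarrow> \<infinity>\<close>. Membership in \<open>L\<^sup>1\<close> is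
  required explicitly because the integral of a non-integrable function is \<open>0\<close>.\<close>

definition L1_tendsto ::
  "'a::euclidean_space set \<Rightarrow> (real \<Rightarrow> 'a \<Rightarrow> real) \<Rightarrow> ('a \<Rightarrow> real) \<Rightarrow> bool" where
  "L1_tendsto \<Omega> u U \<longleftrightarrow>
     U \<in> Lp 1 \<Omega> \<and> (\<forall>\<^sub>F k in at_top. u k \<in> Lp 1 \<Omega>) \<and>
     ((\<lambda>k. LINT x|lebesgue_on \<Omega>. \<bar>u k x - U x\<bar>) \<longlongrightarrow> 0) at_top"

definition locally_integrable :: "'a::euclidean_space set \<Rightarrow> ('a \<Rightarrow> real) \<Rightarrow> bool" where
  "locally_integrable \<Omega> u \<longleftrightarrow> (\<forall>K. compact K \<and> K \<subseteq> \<Omega> \<longrightarrow> integrable (lebesgue_on K) u)"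

definition is_weak_deriv ::
  "'a::euclidean_space set \<Rightarrow> 'a \<Rightarrow> ('a \<Rightarrow> real) \<Rightarrow> ('a \<Rightarrow> real) \<Rightarrow> bool" where
  "is_weak_deriv \<Omega> v u g \<longleftrightarrow>
     locally_integrable \<Omega> u \<and> locally_integrable \<Omega> g \<and>
     (\<forall>\<phi>. test_function \<Omega> \<phi> \<longrightarrow>
        (LINT x|lebesgue_on \<Omega>. u x * dir_deriv v \<phi> x) = - (LINT x|lebesgue_on \<Omega>. g x * \<phi> x))"

definition is_weak_grad :: "'a::euclidean_space set \<Rightarrow> ('a \<Rightarrow> real) \<Rightarrow> ('a \<Rightarrow> 'a) \<Rightarrow> bool" where
  "is_weak_grad \<Omega> u G \<longleftrightarrow> (\<forall>v\<in>Basis. is_weak_deriv \<Omega> v u (\<lambda>x. G x \<bullet> v))"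

definition W1 :: "real \<Rightarrow> 'a::euclidean_space set \<Rightarrow> ('a \<Rightarrow> real) set" where
  "W1 p \<Omega> = {u \<in> Lp p \<Omega>. \<exists>G\<in>Lp p \<Omega>. is_weak_grad \<Omega> u G}"

text \<open>Weak gradients are unique up to null sets, so the choice is immaterial.\<close>

definition weak_grad :: "'a::euclidean_space set \<Rightarrow> ('a \<Rightarrow> real) \<Rightarrow> 'a \<Rightarrow> 'a" where
  "weak_grad \<Omega> u = (SOME G. is_weak_grad \<Omega> u G)"

definition W11_norm :: "('a::euclidean_space \<Rightarrow> real) \<Rightarrow> real" where
  "W11_norm u = (LINT x|lebesgue. \<bar>u x\<bar>) + (LINT x|lebesgue. norm (weak_grad UNIV u x))"


section \<open>Space-time\<close>

type_synonym 'n spacetime = "(real^'n) \<times> real"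

definition QT :: "real \<Rightarrow> 'n::finite spacetime set" where
  "QT T = UNIV \<times> {0<..<T}"

definition time_deriv :: "('n::finite spacetime \<Rightarrow> real) \<Rightarrow> 'n spacetime \<Rightarrow> real" where
  "time_deriv u z = dir_deriv (0, 1) u z"

definition space_grad :: "('n::finite spacetime \<Rightarrow> real) \<Rightarrow> 'n spacetime \<Rightarrow> real^'n" where
  "space_grad u z = (\<chi> i. dir_deriv (axis i 1, 0) u z)"

definition space_div :: "('n::finite spacetime \<Rightarrow> real^'n) \<Rightarrow> 'n spacetime \<Rightarrow> real" where
  "space_div w z = (\<Sum>i\<in>UNIV. dir_deriv (axis i 1, 0) (\<lambda>y. w y $ i) z)"

definition is_weak_space_grad ::
  "real \<Rightarrow> ('n::finite spacetime \<Rightarrow> real) \<Rightarrow> ('n spacetime \<Rightarrow> real^'n) \<Rightarrow> bool" where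
  "is_weak_space_grad T u G \<longleftrightarrow> (\<forall>i. is_weak_deriv (QT T) (axis i 1, 0) u (\<lambda>z. G z $ i))"

definition weak_space_grad ::
  "real \<Rightarrow> ('n::finite spacetime \<Rightarrow> real) \<Rightarrow> 'n spacetime \<Rightarrow> real^'n" where
  "weak_space_grad T u = (SOME G. is_weak_space_grad T u G)"

text \<open>\<open>L\<^sup>2(0,T; H\<^sup>1(\<real>\<^sup>d) \<inter> L\<^sup>\<infinity>(\<real>\<^sup>d))\<close>, with \<open>L\<^sup>2(0,T; H\<^sup>1(\<real>\<^sup>d))\<close> identified as usual with the functions in
  \<open>L\<^sup>2(Q\<^sub>T)\<close> whose distributional spatial gradient is in \<open>L\<^sup>2(Q\<^sub>T)\<close>. The function \<open>N\<close> dominates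
  \<open>t \<mapsto> \<parallel>u(\<cdot>,t)\<parallel>\<close> in the norm of \<open>L\<^sup>\<infinity>(\<real>\<^sup>d)\<close>.\<close>

definition L2_H1_Linf :: "real \<Rightarrow> ('n::finite spacetime \<Rightarrow> real) set" where
  "L2_H1_Linf T = {u \<in> Lp 2 (QT T).
     (\<exists>G\<in>Lp 2 (QT T). is_weak_space_grad T u G) \<and>
     (\<exists>N::real \<Rightarrow> real. N \<in> Lp 2 {0<..<T} \<and>
        (AE t in lebesgue_on {0<..<T}. AE x in lebesgue. \<bar>u (x, t)\<bar> \<le> N t))}"

text \<open>The value at \<open>t = 0\<close> of a function given on \<open>Q\<^sub>T\<close>: \<open>m\<close> is prescribed only for \<open>0 < t < T\<close>, but it
  extends continuously to \<open>t = 0\<close> since its derivatives are bounded.\<close>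

definition initial_trace :: "('n::finite spacetime \<Rightarrow> real) \<Rightarrow> real^'n \<Rightarrow> real" where
  "initial_trace u x = Lim (at_right 0) (\<lambda>t. u (x, t))"


section \<open>The equation and the assumptions\<close>

definition pressure :: "real \<Rightarrow> ('a \<Rightarrow> real) \<Rightarrow> ('a \<Rightarrow> real) \<Rightarrow> 'a \<Rightarrow> real" where
  "pressure k m r x = k / (k - 1) * (r x / m x) powr (k - 1)"

definition source_F ::
  "('n::finite spacetime \<Rightarrow> real) \<Rightarrow> ('n spacetime \<Rightarrow> real^'n) \<Rightarrow> ('n spacetime \<Rightarrow> real) \<Rightarrow>
   'n spacetime \<Rightarrow> real" where
  "source_F m b f z =
     (space_div (\<lambda>y. m y *\<^sub>R b y) z + m z * f z - time_deriv m z) / m z"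

definition constraint_drift_source_assumption ::
  "real \<Rightarrow> real \<Rightarrow> ('n::finite spacetime \<Rightarrow> real) \<Rightarrow> ('n spacetime \<Rightarrow> real^'n) \<Rightarrow>
   ('n spacetime \<Rightarrow> real) \<Rightarrow> bool" where
  "constraint_drift_source_assumption T \<delta> m b f \<longleftrightarrow>
     smooth_bounded_on (QT T) m \<and> smooth_bounded_on (QT T) b \<and> smooth_bounded_on (QT T) f \<and>
     (\<forall>z\<in>QT T. m z \<ge> \<delta>)"

text \<open>As \<open>K\<close> is closed, the (essential) support of a function lies in \<open>K\<close> iff the function vanishes
  a.e. outside \<open>K\<close>.\<close>

definition initial_data_assumption ::
  "('n::finite spacetime \<Rightarrow> real) \<Rightarrow> (real \<Rightarrow> real^'n \<Rightarrow> real) \<Rightarrow> bool" where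
  "initial_data_assumption m \<rho>0 \<longleftrightarrow>
     (\<forall>k>1. \<rho>0 k \<in> W1 1 UNIV \<and> (AE x in lebesgue. \<rho>0 k x \<ge> 0)) \<and>
     (\<exists>K C. compact K \<and>
        (\<forall>k>1. (AE x in lebesgue. x \<notin> K \<longrightarrow> \<rho>0 k x = 0) \<and>
               (AE x in lebesgue. \<bar>\<rho>0 k x\<bar> \<le> C) \<and>
               W11_norm (\<rho>0 k) \<le> C \<and>
               (AE x in lebesgue. \<bar>pressure k (initial_trace m) (\<rho>0 k) x\<bar> \<le> C))) \<and>
     (\<exists>\<rho>0_inf. L1_tendsto UNIV \<rho>0 \<rho>0_inf)"

definition hard_constraint_restriction ::
  "real \<Rightarrow> real \<Rightarrow> ('n::finite spacetime \<Rightarrow> real) \<Rightarrow> bool" where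
  "hard_constraint_restriction T \<epsilon> m \<longleftrightarrow>
     (\<exists>\<mu>. \<forall>x. \<forall>t\<in>{0<..<T}. m (x, t) = \<mu> (norm x) t) \<or>
     CARD('n) = 1 \<or>
     (\<exists>R>0. \<forall>x. \<forall>t\<in>{0<..<T}. norm x \<ge> R \<longrightarrow> norm (space_grad m (x, t)) \<le> \<epsilon> / norm x)"

definition complementary_relationship_condition ::
  "('n::finite spacetime \<Rightarrow> real) \<Rightarrow> (real \<Rightarrow> real^'n \<Rightarrow> real) \<Rightarrow> bool" where
  "complementary_relationship_condition m \<rho>0 \<longleftrightarrow>
     (\<exists>C. \<forall>k>1. \<exists>G\<in>Lp 2 UNIV. is_weak_grad UNIV (pressure k (initial_trace m) (\<rho>0 k)) G \<and>
        (LINT x|lebesgue. (norm (G x))\<^sup>2) \<le> C)"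

text \<open>Test functions in \<open>C\<^sub>c\<^sup>\<infinity>(\<real>\<^sup>d \<times> [0,T))\<close> are the restrictions to \<open>t \<ge> 0\<close> of those on
  \<open>\<real>\<^sup>d \<times> (-\<infinity>,T)\<close>; they need not vanish at \<open>t = 0\<close>. The diffusive flux is written as \<open>m \<nabla>(v\<^sup>k)\<close>, where
  \<open>v = \<rho>/m\<close>, because \<open>\<rho> \<nabla>p = m \<nabla>(v\<^sup>k)\<close>.\<close>

definition nonneg_weak_solution ::
  "real \<Rightarrow> ('n::finite spacetime \<Rightarrow> real) \<Rightarrow> ('n spacetime \<Rightarrow> real^'n) \<Rightarrow>
   ('n spacetime \<Rightarrow> real) \<Rightarrow> real \<Rightarrow> (real^'n \<Rightarrow> real) \<Rightarrow> ('n spacetime \<Rightarrow> real) \<Rightarrow> bool" where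
  "nonneg_weak_solution T m b f k r0 \<rho> \<longleftrightarrow>
     (AE z in lebesgue_on (QT T). \<rho> z \<ge> 0) \<and>
     \<rho> \<in> Lp 2 (QT T) \<and>
     (\<lambda>z. (\<rho> z / m z) powr k) \<in> W1 2 (QT T) \<and>
     (\<forall>\<phi>. test_function (UNIV \<times> {..<T}) \<phi> \<longrightarrow>
        (LINT z|lebesgue_on (QT T). - \<rho> z * time_deriv \<phi> z) =
        (LINT x|lebesgue. \<phi> (x, 0) * r0 x) +
        (LINT z|lebesgue_on (QT T).
           - m z * (space_grad \<phi> z \<bullet> weak_space_grad T (\<lambda>y. (\<rho> y / m y) powr k) z)
           - \<rho> z * (space_grad \<phi> z \<bullet> b z) + f z * \<phi> z * \<rho> z))"

end

theory Submission
  imports Defs "HOL-Analysis.Analysis"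
begin

text \<open>
  Put \<open>v = \<rho>/m\<close> and \<open>w = v\<^sup>k\<close>. Testing the equation for \<open>\<rho>\<^sub>k\<close> with a cut-off times a regularised power of
  \<open>w\<close>, namely the one of order \<open>v\<^sup>k\<^sup>-\<^sup>2\<close>, bounds \<open>\<nabla>p\<^sub>k\<close> locally in \<open>L\<^sup>2\<close> uniformly in \<open>k\<close>. Since
  \<open>\<nabla>w = v \<nabla>p\<^sub>k\<close>, passing to the limit gives
  \<open>\<partial>\<^sub>t(m v\<^sub>\<infinity>) = \<nabla>\<cdot>(m \<nabla>p\<^sub>\<infinity> + m v\<^sub>\<infinity> b) + f m v\<^sub>\<infinity>\<close> with \<open>0 \<le> v\<^sub>\<infinity> \<le> 1\<close>, \<open>p\<^sub>\<infinity> \<ge> 0\<close> and \<open>v\<^sub>\<infinity> = 1\<close> where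
  \<open>p\<^sub>\<infinity> > 0\<close>. This equation is tested with \<open>\<phi> p\<^sub>\<infinity>\<close>, whose missing time regularity is replaced by a sign:
  \<open>p\<^sub>\<infinity>(t) (v\<^sub>\<infinity>(t \<plusminus> h) - v\<^sub>\<infinity>(t)) \<le> 0\<close> for \<open>h > 0\<close>, so forward and backward difference quotients in time give
  the two opposite inequalities. Finally \<open>v\<^sub>\<infinity> \<nabla>p\<^sub>\<infinity> = \<nabla>p\<^sub>\<infinity>\<close>, because \<open>\<nabla>p\<^sub>\<infinity> = 0\<close> almost everywhere on
  \<open>{p\<^sub>\<infinity> = 0}\<close>.
\<close>

section \<open>Square integrable functions, translations and averages\<close>

text \<open>The nonlinear tests are carried out for finite \<open>k\<close>, where \<open>w\<close>
  has a weak time derivative because \<open>v^k\<close> lies in H^1 of space-time; the limit has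
  none, which is why a sign must do that work there. The gradient bound is local, and a cut-off
  \<open>\<theta>\<close> produces the term \<open>m \<nabla>w h(w) \<nabla>\<theta>\<close>, for
  which no bound uniform in \<open>k\<close> is at hand. The space domain is unbounded, so for each
  single \<open>k\<close> the cut-off can be made so flat in space that this term is at most 1,
  while its time derivative and its lower bound on the given compact set stay under fixed control.
  All other terms are dominated by \<open>w^(1-1/k)\<close>, hence by the pressure, whose L^1 norm
  stays bounded. Powers of \<open>w\<close> are singular at 0 and are replaced by powers of
  \<open>w + \<eta>\<close>. The choice \<open>\<eta> = 1/k\<close> has a second use:
  \<open>(w + 1/k)^(1/k)\<close> tends to 1 also where the density vanishes, so the flux
  \<open>\<nabla>w\<close> is the gradient of a regularised pressure times a factor that differs
  from 1 by a quantity small in L^2 on compact sets. Hence weak convergence of gradients is enough,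
  without strong compactness.\<close>

definition L2 :: "('a::euclidean_space \<Rightarrow> real) set" where
  "L2 = {f. f \<in> borel_measurable borel \<and> integrable lborel (\<lambda>x. (f x)\<^sup>2)}"

lemma L2_measurable: "f \<in> L2 \<Longrightarrow> f \<in> borel_measurable borel"
  and L2_integrable_sq: "f \<in> L2 \<Longrightarrow> integrable lborel (\<lambda>x. (f x)\<^sup>2)"
  by (auto simp: L2_def)

lemma L2_dominated:
  assumes "f \<in> borel_measurable borel" "g \<in> L2" "\<And>x. \<bar>f x\<bar> \<le> C * \<bar>g x\<bar>"
  shows "f \<in> L2"
proof -
  have [measurable]: "f \<in> borel_measurable borel" by fact
  have le: "norm ((f x)\<^sup>2) \<le> norm (C\<^sup>2 * (g x)\<^sup>2)" for x
    using power_mono[OF assms(3)[of x], of 2] by (simp add: power_mult_distrib)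
  have "integrable lborel (\<lambda>x. C\<^sup>2 * (g x)\<^sup>2)"
    by (intro integrable_mult_right L2_integrable_sq assms)
  then have "integrable lborel (\<lambda>x. (f x)\<^sup>2)"
    by (rule Bochner_Integration.integrable_bound[OF _ _ AE_I2[OF le]]) measurable
  with assms(1) show ?thesis by (simp add: L2_def)
qed

lemma L2_mult_integrable:
  assumes "f \<in> L2" "g \<in> L2" shows "integrable lborel (\<lambda>x. f x * g x)"
proof -
  have m[measurable]: "f \<in> borel_measurable borel" "g \<in> borel_measurable borel"
    using assms by (auto simp: L2_def)
  have le: "norm (f x * g x) \<le> norm ((f x)\<^sup>2 + (g x)\<^sup>2)" for x
    using sum_squares_bound[of "\<bar>f x\<bar>" "\<bar>g x\<bar>"] mult_nonneg_nonneg[of "\<bar>f x\<bar>" "\<bar>g x\<bar>"]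
    unfolding real_norm_def abs_mult power2_abs by linarith
  show ?thesis
    by (rule Bochner_Integration.integrable_bound[OF Bochner_Integration.integrable_add[OF
          L2_integrable_sq[OF assms(1)] L2_integrable_sq[OF assms(2)]] _ AE_I2[OF le]]) measurable
qed

lemma L2_add: assumes "f \<in> L2" "g \<in> L2" shows "(\<lambda>x. f x + g x) \<in> L2"
proof -
  have m[measurable]: "f \<in> borel_measurable borel" "g \<in> borel_measurable borel"
    using assms by (auto simp: L2_def)
  have "integrable lborel (\<lambda>x. (f x)\<^sup>2 + (g x)\<^sup>2 + 2 * (f x * g x))"
    using assms by (intro Bochner_Integration.integrable_add integrable_mult_right L2_mult_integrable L2_integrable_sq)
  then show ?thesis by (simp add: L2_def power2_sum mult.assoc)
qed

lemma L2_cmult: "f \<in> L2 \<Longrightarrow> (\<lambda>x. c * f x) \<in> L2"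
  by (rule L2_dominated[where C="\<bar>c\<bar>" and g=f]) (auto simp: L2_def abs_mult)

lemma L2_diff: assumes "f \<in> L2" "g \<in> L2" shows "(\<lambda>x. f x - g x) \<in> L2"
  using L2_add[OF assms(1) L2_cmult[OF assms(2), of "-1"]] by simp

lemma L2_bounded_mult:
  assumes "f \<in> L2" "h \<in> borel_measurable borel" "\<And>x. \<bar>h x\<bar> \<le> B"
  shows "(\<lambda>x. h x * f x) \<in> L2"
proof (rule L2_dominated)
  have [measurable]: "f \<in> borel_measurable borel" "h \<in> borel_measurable borel"
    using assms by (auto simp: L2_def)
  show "(\<lambda>x. h x * f x) \<in> borel_measurable borel" by measurable
  show "f \<in> L2" by fact
  show "\<bar>h x * f x\<bar> \<le> B * \<bar>f x\<bar>" for x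
    unfolding abs_mult by (rule mult_right_mono[OF assms(3)]) simp
qed

lemma L2_zero [simp]: "(\<lambda>x. 0) \<in> L2"
  by (simp add: L2_def)

lemma integrable_indicator_cball: "integrable lborel (\<lambda>x::'a::euclidean_space. c * indicator (cball a r) x :: real)"
  by (intro integrable_mult_right integrable_real_indicator)
     (auto simp: emeasure_bounded_finite[OF bounded_cball, unfolded infinity_ennreal_def])

lemma L2_bounded_support:
  assumes m: "f \<in> borel_measurable borel" and b: "\<And>x. \<bar>f x\<bar> \<le> B"
    and K: "bounded K" "\<And>x. x \<notin> K \<Longrightarrow> f x = 0"
  shows "f \<in> L2"
proof -
  obtain r where r: "K \<subseteq> cball 0 r" using K(1) unfolding bounded_iff subset_iff mem_cball_0 by blast
  have [measurable]: "f \<in> borel_measurable borel" by fact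
  have le: "norm ((f x)\<^sup>2) \<le> norm (B\<^sup>2 * indicator (cball 0 r) x)" for x
    using power_mono[OF b[of x], of 2] K(2)[of x] r by (cases "x \<in> K") (auto simp: indicator_def)
  have "integrable lborel (\<lambda>x::'a. B\<^sup>2 * indicator (cball 0 r) x)" by (rule integrable_indicator_cball)
  then have "integrable lborel (\<lambda>x. (f x)\<^sup>2)"
    by (rule Bochner_Integration.integrable_bound[OF _ _ AE_I2[OF le]]) measurable
  with m show ?thesis by (simp add: L2_def)
qed

lemma integrable_bounded_support:
  fixes f :: "'a::euclidean_space \<Rightarrow> real"
  assumes m: "f \<in> borel_measurable borel" and b: "\<And>x. \<bar>f x\<bar> \<le> B"
    and K: "bounded K" "\<And>x. x \<notin> K \<Longrightarrow> f x = 0"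
  shows "integrable lborel f"
proof -
  obtain r where r: "K \<subseteq> cball 0 r" using K(1) unfolding bounded_iff subset_iff mem_cball_0 by blast
  have [measurable]: "f \<in> borel_measurable borel" by fact
  have le: "norm (f x) \<le> norm (B * indicator (cball 0 r) x)" for x
    using b[of x] K(2)[of x] r by (cases "x \<in> K") (auto simp: indicator_def)
  have "integrable lborel (\<lambda>x::'a. B * indicator (cball 0 r) x)" by (rule integrable_indicator_cball)
  then show ?thesis
    by (rule Bochner_Integration.integrable_bound[OF _ _ AE_I2[OF le]]) measurable
qed

lemma L2_Cauchy_Schwarz:
  assumes "f \<in> L2" "g \<in> L2"
  shows "\<bar>\<integral>x. f x * g x \<partial>lborel\<bar> \<le> sqrt (\<integral>x. (f x)\<^sup>2 \<partial>lborel) * sqrt (\<integral>x. (g x)\<^sup>2 \<partial>lborel)"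
proof -
  have m[measurable]: "f \<in> borel_measurable borel" "g \<in> borel_measurable borel"
    using assms by (auto simp: L2_def)
  define A B D where "A = (\<integral>x. (f x)\<^sup>2 \<partial>lborel)" and "B = (\<integral>x. (g x)\<^sup>2 \<partial>lborel)"
    and "D = (\<integral>x. \<bar>f x * g x\<bar> \<partial>lborel)"
  have i: "integrable lborel (\<lambda>x. \<bar>f x * g x\<bar>)"
    using L2_mult_integrable[OF assms] by (rule integrable_abs)
  have pos: "A \<ge> 0" "B \<ge> 0" "D \<ge> 0" by (auto simp: A_def B_def D_def)
  have "(\<integral>\<^sup>+x. ennreal \<bar>f x\<bar> * ennreal \<bar>g x\<bar> \<partial>lborel)\<^sup>2
      \<le> (\<integral>\<^sup>+x. (ennreal \<bar>f x\<bar>)\<^sup>2 \<partial>lborel) * (\<integral>\<^sup>+x. (ennreal \<bar>g x\<bar>)\<^sup>2 \<partial>lborel)"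
    by (rule Cauchy_Schwarz_nn_integral) auto
  also have "(\<integral>\<^sup>+x. ennreal \<bar>f x\<bar> * ennreal \<bar>g x\<bar> \<partial>lborel) = ennreal D"
    unfolding D_def using i by (subst nn_integral_eq_integral[symmetric]) (auto simp: ennreal_mult' abs_mult)
  also have "(\<integral>\<^sup>+x. (ennreal \<bar>f x\<bar>)\<^sup>2 \<partial>lborel) = ennreal A"
    unfolding A_def using L2_integrable_sq[OF assms(1)]
    by (subst nn_integral_eq_integral[symmetric]) (auto simp: ennreal_power)
  also have "(\<integral>\<^sup>+x. (ennreal \<bar>g x\<bar>)\<^sup>2 \<partial>lborel) = ennreal B"
    unfolding B_def using L2_integrable_sq[OF assms(2)]
    by (subst nn_integral_eq_integral[symmetric]) (auto simp: ennreal_power)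
  finally have "D\<^sup>2 \<le> A * B"
    using pos by (simp add: ennreal_power ennreal_mult[symmetric])
  then have "D \<le> sqrt A * sqrt B"
    using real_sqrt_le_mono[of "D\<^sup>2" "A * B"] pos by (simp add: real_sqrt_mult)
  moreover have "\<bar>\<integral>x. f x * g x \<partial>lborel\<bar> \<le> D"
    unfolding D_def by (rule integral_abs_bound)
  ultimately show ?thesis by (simp add: A_def B_def)
qed

lemma L2_tendsto_integral:
  assumes "\<And>n. f n \<in> L2" "g \<in> L2" "h \<in> L2"
    and lim: "(\<lambda>n. \<integral>x. (f n x - g x)\<^sup>2 \<partial>lborel) \<longlonglongrightarrow> 0"
  shows "(\<lambda>n. \<integral>x. h x * f n x \<partial>lborel) \<longlonglongrightarrow> (\<integral>x. h x * g x \<partial>lborel)"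
proof -
  have lim': "(\<lambda>n. sqrt (\<integral>x. (h x)\<^sup>2 \<partial>lborel) * sqrt (\<integral>x. (f n x - g x)\<^sup>2 \<partial>lborel)) \<longlonglongrightarrow> 0"
    by (rule tendsto_mult_right_zero[OF tendsto_real_sqrt[OF lim, unfolded real_sqrt_zero]])
  have "norm ((\<integral>x. h x * f n x \<partial>lborel) - (\<integral>x. h x * g x \<partial>lborel))
      \<le> sqrt (\<integral>x. (h x)\<^sup>2 \<partial>lborel) * sqrt (\<integral>x. (f n x - g x)\<^sup>2 \<partial>lborel)" for n
    using L2_Cauchy_Schwarz[OF assms(3) L2_diff[OF assms(1,2)], of n]
    by (simp add: right_diff_distrib L2_mult_integrable assms)
  then have "(\<lambda>n. (\<integral>x. h x * f n x \<partial>lborel) - (\<integral>x. h x * g x \<partial>lborel)) \<longlonglongrightarrow> 0"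
    by (intro Lim_null_comparison[OF always_eventually[OF allI] lim'])
  then show ?thesis by (simp add: LIM_zero_iff)
qed

lemma L2_triangle_sq:
  assumes "f \<in> L2" "g \<in> L2"
  shows "(\<integral>x. (f x + g x)\<^sup>2 \<partial>lborel) \<le> 2 * (\<integral>x. (f x)\<^sup>2 \<partial>lborel) + 2 * (\<integral>x. (g x)\<^sup>2 \<partial>lborel)"
proof -
  have "(f x + g x)\<^sup>2 \<le> 2 * (f x)\<^sup>2 + 2 * (g x)\<^sup>2" for x
    using sum_squares_bound[of "f x" "g x"] by (simp add: power2_sum)
  then have "(\<integral>x. (f x + g x)\<^sup>2 \<partial>lborel) \<le> (\<integral>x. 2 * (f x)\<^sup>2 + 2 * (g x)\<^sup>2 \<partial>lborel)"
    using assms by (intro integral_mono L2_integrable_sq L2_add Bochner_Integration.integrable_add integrable_mult_right)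
  also have "\<dots> = 2 * (\<integral>x. (f x)\<^sup>2 \<partial>lborel) + 2 * (\<integral>x. (g x)\<^sup>2 \<partial>lborel)"
    using assms by (subst Bochner_Integration.integral_add) (auto intro: L2_integrable_sq)
  finally show ?thesis .
qed

section \<open>Translation invariance and continuity of translations in L^2\<close>

lemma lborel_translate:
  fixes f :: "'a::euclidean_space \<Rightarrow> real"
  assumes [measurable]: "f \<in> borel_measurable borel"
  shows integral_translate: "(\<integral>x. f (x + y) \<partial>lborel) = (\<integral>x. f x \<partial>lborel)"
    and integrable_translate: "integrable lborel (\<lambda>x. f (x + y)) \<longleftrightarrow> integrable lborel f"
    and nn_integral_translate: "(\<integral>\<^sup>+x. ennreal (f (x + y)) \<partial>lborel) = (\<integral>\<^sup>+x. ennreal (f x) \<partial>lborel)"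
proof -
  have *: "(lborel :: 'a measure) = distr lborel borel ((+) y)" by (rule lborel_distr_plus[symmetric])
  show "(\<integral>x. f (x + y) \<partial>lborel) = (\<integral>x. f x \<partial>lborel)"
    by (subst (2) *, subst integral_distr) (auto simp: add.commute)
  show "integrable lborel (\<lambda>x. f (x + y)) \<longleftrightarrow> integrable lborel f"
    by (subst (2) *, subst integrable_distr_eq) (auto simp: add.commute)
  show "(\<integral>\<^sup>+x. ennreal (f (x + y)) \<partial>lborel) = (\<integral>\<^sup>+x. ennreal (f x) \<partial>lborel)"
    by (subst (2) *, subst nn_integral_distr) (auto simp: add.commute)
qed

lemma L2_translate:
  assumes "f \<in> L2" shows "(\<lambda>x. f (x + y)) \<in> L2"
proof -
  have [measurable]: "f \<in> borel_measurable borel" using assms by (simp add: L2_def)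
  show ?thesis
    using integrable_translate[of "\<lambda>x. (f x)\<^sup>2" y] assms by (simp add: L2_def)
qed

text \<open>Measurability on the whole space supplies continuous functions \<open>G n\<close>
  converging almost everywhere, but without any domination. Truncating both values and domain, for
  \<open>f\<close> and in the same way for \<open>G n\<close>, makes dominated convergence
  available; truncation keeps continuity and adds bounded support.\<close>

lemma L2_approx_continuous:
  fixes f :: "'a::euclidean_space \<Rightarrow> real"
  assumes f: "f \<in> L2" and e: "e > 0"
  obtains g R where "continuous_on UNIV g" "\<And>x. norm x > R \<Longrightarrow> g x = 0"
    "(\<integral>x. (f x - g x)\<^sup>2 \<partial>lborel) < e" "g \<in> L2"
proof -
  have fm[measurable]: "f \<in> borel_measurable borel" using f by (simp add: L2_def)
  have "f measurable_on UNIV"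
    by (subst measurable_on_iff_borel_measurable) (auto simp: lebesgue_on_UNIV_eq intro: measurable_completion)
  then obtain N G where N: "negligible N" and G: "\<And>n. continuous_on UNIV (G n)"
    and lim: "\<And>x. x \<notin> N \<Longrightarrow> (\<lambda>n. G n x) \<longlonglongrightarrow> f x"
    unfolding measurable_on_def by auto
  have AEN: "AE x in lborel. x \<notin> N"
    using N AE_not_in[of N lebesgue] by (simp add: negligible_iff_null_sets AE_completion_iff)
  define c :: "nat \<Rightarrow> 'a \<Rightarrow> real" where "c M x = max 0 (min 1 (real M + 1 - norm x))" for M x
  define cl :: "nat \<Rightarrow> real \<Rightarrow> real" where "cl M t = max (- real M) (min (real M) t)" for M t
  have c01: "0 \<le> c M x" "c M x \<le> 1" for M x by (auto simp: c_def)
  have c0: "norm x > real M + 1 \<Longrightarrow> c M x = 0" for M x by (auto simp: c_def)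
  have ccont: "continuous_on UNIV (c M)" for M unfolding c_def by (intro continuous_intros)
  have clcont: "continuous_on UNIV (cl M)" for M unfolding cl_def by (intro continuous_intros)
  have [measurable]: "c M \<in> borel_measurable borel" "cl M \<in> borel_measurable borel"
    "G n \<in> borel_measurable borel" for M n
    using ccont clcont G by (auto intro!: borel_measurable_continuous_onI)
  have clb: "\<bar>cl M t\<bar> \<le> real M" for M t by (auto simp: cl_def)
  \<comment> \<open>The truncation error is dominated by \<open>\<bar>f\<bar>\<close> itself, so its
    square has the integrable majorant \<open>f\<^sup>2\<close>.\<close>
  have clt: "\<bar>cl M t\<bar> \<le> \<bar>t\<bar>" "\<bar>t - c M x * cl M t\<bar> \<le> \<bar>t\<bar>" for M t x
  proof -
    show "\<bar>cl M t\<bar> \<le> \<bar>t\<bar>" by (auto simp: cl_def)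
    have *: "0 \<le> a \<and> a \<le> t \<longrightarrow> 0 \<le> c M x * a \<and> c M x * a \<le> t" for a t
      using c01[of M x] mult_left_le_one_le[of a "c M x"] by auto
    show "\<bar>t - c M x * cl M t\<bar> \<le> \<bar>t\<bar>"
    proof (cases "t \<ge> 0")
      case True then show ?thesis using *[of "cl M t" t] by (auto simp: cl_def)
    next
      case False then show ?thesis using *[of "- cl M t" "- t"] by (auto simp: cl_def)
    qed
  qed
  define F where "F M x = c M x * cl M (f x)" for M x
  define H where "H M n x = c M x * cl M (G n x)" for M n x
  have [measurable]: "F M \<in> borel_measurable borel" "H M n \<in> borel_measurable borel" for M n
    unfolding F_def H_def by auto
  have bd: "\<bar>F M x\<bar> \<le> real M" "\<bar>H M n x\<bar> \<le> real M" for M n x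
    using c01[of M x] clb[of M] mult_mono[of "c M x" 1 "\<bar>cl M (f x)\<bar>" "real M"]
      mult_mono[of "c M x" 1 "\<bar>cl M (G n x)\<bar>" "real M"]
    by (auto simp: F_def H_def abs_mult)
  have supp: "x \<notin> cball 0 (real M + 1) \<Longrightarrow> F M x = 0" "x \<notin> cball 0 (real M + 1) \<Longrightarrow> H M n x = 0" for M n x
    using c0[of M x] by (auto simp: F_def H_def)
  have FL: "F M \<in> L2" and HL: "H M n \<in> L2" for M n
    using bd supp by (auto intro!: L2_bounded_support[where K="cball 0 (real M + 1)" and B="real M"])
  have "(\<lambda>M. \<integral>x. (f x - F M x)\<^sup>2 \<partial>lborel) \<longlonglongrightarrow> (\<integral>x. 0 \<partial>(lborel::'a measure))"
  proof (rule integral_dominated_convergence[where w="\<lambda>x. (f x)\<^sup>2"])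
    show "AE x in lborel. (\<lambda>M. (f x - F M x)\<^sup>2) \<longlonglongrightarrow> 0"
    proof (rule AE_I2)
      fix x :: 'a
      have "\<forall>\<^sub>F M in sequentially. F M x = f x"
      proof -
        have "\<forall>\<^sub>F M in sequentially. real M \<ge> norm x + \<bar>f x\<bar>"
          by (rule eventually_ge_at_top[THEN filterlim_real_sequentially[THEN filterlim_iff[THEN iffD1, rule_format]]])
        then show ?thesis
        proof eventually_elim
          case (elim M)
          have "c M x = 1" "cl M (f x) = f x" using elim norm_ge_zero[of x] unfolding c_def cl_def by linarith+
          then show ?case by (simp add: F_def)
        qed
      qed
      then have "\<forall>\<^sub>F M in sequentially. (f x - F M x)\<^sup>2 = 0" by eventually_elim simp
      then show "(\<lambda>M. (f x - F M x)\<^sup>2) \<longlonglongrightarrow> 0" by (rule tendsto_eventually)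
    qed
    show "AE x in lborel. norm ((f x - F M x)\<^sup>2) \<le> (f x)\<^sup>2" for M
      using clt(2)[of "f _" M] by (auto simp: F_def abs_le_square_iff[symmetric])
  qed (use f in \<open>auto intro: L2_integrable_sq\<close>)
  then have "\<forall>\<^sub>F M in sequentially. (\<integral>x. (f x - F M x)\<^sup>2 \<partial>lborel) < e/4"
    using e by (intro order_tendstoD(2)) auto
  then obtain M where M: "(\<integral>x. (f x - F M x)\<^sup>2 \<partial>lborel) < e/4"
    by (auto simp: eventually_sequentially)
  have "(\<lambda>n. \<integral>x. (F M x - H M n x)\<^sup>2 \<partial>lborel) \<longlonglongrightarrow> (\<integral>x. 0 \<partial>(lborel::'a measure))"
  proof (rule integral_dominated_convergence[where w="\<lambda>x. (2 * real M)\<^sup>2 * indicator (cball 0 (real M + 1)) x"])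
    show "AE x in lborel. (\<lambda>n. (F M x - H M n x)\<^sup>2) \<longlonglongrightarrow> 0"
      using AEN
    proof eventually_elim
      case (elim x)
      have "isCont (cl M) (f x)" using clcont[of M] by (simp add: continuous_on_eq_continuous_at)
      then have "(\<lambda>n. cl M (G n x)) \<longlonglongrightarrow> cl M (f x)"
        using lim[OF elim] by (rule isCont_tendsto_compose)
      then have "(\<lambda>n. (F M x - H M n x)\<^sup>2) \<longlonglongrightarrow> (F M x - c M x * cl M (f x))\<^sup>2"
        unfolding H_def by (intro tendsto_intros)
      then show ?case by (simp add: F_def)
    qed
    show "AE x in lborel. norm ((F M x - H M n x)\<^sup>2) \<le> (2 * real M)\<^sup>2 * indicator (cball 0 (real M + 1)) x" for n
    proof (rule AE_I2)
      fix x
      have "\<bar>F M x - H M n x\<bar> \<le> 2 * real M" using bd(1)[of M x] bd(2)[of M n x] by linarith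
      then have "(F M x - H M n x)\<^sup>2 \<le> (2 * real M)\<^sup>2" using power_mono[of "\<bar>F M x - H M n x\<bar>" "2 * real M" 2] by simp
      then show "norm ((F M x - H M n x)\<^sup>2) \<le> (2 * real M)\<^sup>2 * indicator (cball 0 (real M + 1)) x"
        using supp[of x M] by (auto simp: indicator_def)
    qed
    show "integrable lborel (\<lambda>x::'a. (2 * real M)\<^sup>2 * indicator (cball 0 (real M + 1)) x)" by (rule integrable_indicator_cball)
  qed auto
  then have "\<forall>\<^sub>F n in sequentially. (\<integral>x. (F M x - H M n x)\<^sup>2 \<partial>lborel) < e/4"
    using e by (intro order_tendstoD(2)) auto
  then obtain n where n: "(\<integral>x. (F M x - H M n x)\<^sup>2 \<partial>lborel) < e/4"
    by (auto simp: eventually_sequentially)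
  have "(\<integral>x. (f x - H M n x)\<^sup>2 \<partial>lborel) < e"
    using L2_triangle_sq[OF L2_diff[OF f FL[of M]] L2_diff[OF FL[of M] HL[of M n]]] M n by simp
  moreover have "continuous_on UNIV (H M n)"
    unfolding H_def by (intro continuous_intros ccont continuous_on_compose2[OF clcont] G) auto
  ultimately show ?thesis
    using that[of "H M n" "real M + 1"] supp(2)[of _ M n] HL by auto
qed

text \<open>Compare \<open>f\<close> with a continuous function \<open>g\<close> of bounded support:
  translation is an isometry, so only the translates of \<open>g\<close> have to be controlled, and
  these converge pointwise within a common ball once the shift is shorter than 1.\<close>

lemma L2_translation_continuous:
  fixes f :: "'a::euclidean_space \<Rightarrow> real"
  assumes f: "f \<in> L2" and e: "e > 0"
  shows "\<exists>d>0. \<forall>y. norm y \<le> d \<longrightarrow> (\<integral>x. (f (x + y) - f x)\<^sup>2 \<partial>lborel) \<le> e"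
proof -
  \<comment> \<open>The tenth is what two nested uses of
    \<open>(a + b)\<^sup>2 \<le> 2 * a\<^sup>2 + 2 * b\<^sup>2\<close> on three error terms require:
    \<open>2 * (2 + 2) + 2 = 10\<close>.\<close>
  obtain g R where g: "continuous_on UNIV g" "\<And>x. norm x > R \<Longrightarrow> g x = 0"
    "(\<integral>x. (f x - g x)\<^sup>2 \<partial>lborel) < e/10" "g \<in> L2"
    using L2_approx_continuous[OF f, of "e/10"] e by auto
  have [measurable]: "f \<in> borel_measurable borel" "g \<in> borel_measurable borel"
    using f g(4) by (auto simp: L2_def)
  have "compact (g ` cball 0 R)" using g(1) by (intro compact_continuous_image) (auto intro: continuous_on_subset)
  then have "bounded (g ` cball 0 R)" by (rule compact_imp_bounded)
  then obtain B where B: "\<And>x. x \<in> cball 0 R \<Longrightarrow> \<bar>g x\<bar> \<le> B"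
    unfolding bounded_iff by (metis imageI real_norm_def)
  have gB: "\<bar>g x\<bar> \<le> \<bar>B\<bar>" for x using B[of x] g(2)[of x] by (cases "x \<in> cball 0 R") auto
  have lim: "((\<lambda>y. \<integral>x. (g (x + y) - g x)\<^sup>2 \<partial>lborel) \<longlongrightarrow> (\<integral>x. 0 \<partial>(lborel::'a measure))) (at 0)"
    unfolding tendsto_at_iff_sequentially comp_def
  proof (intro allI impI)
    fix Y :: "nat \<Rightarrow> 'a" assume Y: "\<forall>i. Y i \<in> UNIV - {0}" "Y \<longlonglongrightarrow> 0"
    from Y(2) have "\<forall>\<^sub>F n in sequentially. norm (Y n) < 1"
      by (intro order_tendstoD(2)[OF tendsto_norm_zero]) auto
    then obtain N where N: "\<And>n. n \<ge> N \<Longrightarrow> norm (Y n) < 1" by (auto simp: eventually_sequentially)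
    have "(\<lambda>n. \<integral>x. (g (x + Y (n + N)) - g x)\<^sup>2 \<partial>lborel) \<longlonglongrightarrow> (\<integral>x. 0 \<partial>(lborel::'a measure))"
    proof (rule integral_dominated_convergence[where w="\<lambda>x. (2 * \<bar>B\<bar>)\<^sup>2 * indicator (cball 0 (R + 1)) x"])
      show "AE x in lborel. (\<lambda>n. (g (x + Y (n + N)) - g x)\<^sup>2) \<longlonglongrightarrow> 0"
      proof (rule AE_I2)
        fix x
        have "(\<lambda>n. x + Y (n + N)) \<longlonglongrightarrow> x + 0" using LIMSEQ_ignore_initial_segment[OF Y(2), of N] by (intro tendsto_intros)
        moreover have "isCont g x" using g(1) by (simp add: continuous_on_eq_continuous_at)
        ultimately have "(\<lambda>n. g (x + Y (n + N))) \<longlonglongrightarrow> g x"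
          using isCont_tendsto_compose[of x g] by simp
        then have "(\<lambda>n. (g (x + Y (n + N)) - g x)\<^sup>2) \<longlonglongrightarrow> (g x - g x)\<^sup>2" by (intro tendsto_intros)
        then show "(\<lambda>n. (g (x + Y (n + N)) - g x)\<^sup>2) \<longlonglongrightarrow> 0" by simp
      qed
      show "AE x in lborel. norm ((g (x + Y (n + N)) - g x)\<^sup>2) \<le> (2 * \<bar>B\<bar>)\<^sup>2 * indicator (cball 0 (R + 1)) x" for n
      proof (rule AE_I2)
        fix x
        have "\<bar>g (x + Y (n + N)) - g x\<bar> \<le> 2 * \<bar>B\<bar>" using gB[of x] gB[of "x + Y (n + N)"] by linarith
        then have "(g (x + Y (n + N)) - g x)\<^sup>2 \<le> (2 * \<bar>B\<bar>)\<^sup>2" using power_mono[of "\<bar>g (x + Y (n + N)) - g x\<bar>" "2 * \<bar>B\<bar>" 2] by simp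
        moreover have "(g (x + Y (n + N)) - g x) = 0" if "norm x > R + 1"
        proof -
          have "norm x \<le> norm (x + Y (n + N)) + norm (Y (n + N))" by norm
          then show ?thesis using that g(2)[of x] g(2)[of "x + Y (n + N)"] N[of "n + N"] by simp
        qed
        ultimately show "norm ((g (x + Y (n + N)) - g x)\<^sup>2) \<le> (2 * \<bar>B\<bar>)\<^sup>2 * indicator (cball 0 (R + 1)) x"
          by (auto simp: indicator_def not_le)
      qed
      show "integrable lborel (\<lambda>x::'a. (2 * \<bar>B\<bar>)\<^sup>2 * indicator (cball 0 (R + 1)) x)" by (rule integrable_indicator_cball)
    qed auto
    then show "(\<lambda>n. \<integral>x. (g (x + Y n) - g x)\<^sup>2 \<partial>lborel) \<longlonglongrightarrow> (\<integral>x. 0 \<partial>(lborel::'a measure))"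
      by (rule LIMSEQ_offset)
  qed
  then have "\<forall>\<^sub>F y in at 0. (\<integral>x. (g (x + y) - g x)\<^sup>2 \<partial>lborel) < e/10"
    using e by (intro order_tendstoD(2)) auto
  then obtain d where d: "d > 0" "\<And>y. y \<noteq> 0 \<Longrightarrow> norm y < d \<Longrightarrow> (\<integral>x. (g (x + y) - g x)\<^sup>2 \<partial>lborel) < e/10"
    by (auto simp: eventually_at)
  show ?thesis
  proof (intro exI conjI allI impI)
    show "d / 2 > 0" using d by simp
    fix y :: 'a assume "norm y \<le> d / 2"
    then have gy: "(\<integral>x. (g (x + y) - g x)\<^sup>2 \<partial>lborel) \<le> e/10"
      using d e by (cases "y = 0") (auto intro: less_imp_le)
    define D where "D x = f x - g x" for x
    have DL: "D \<in> L2" unfolding D_def by (intro L2_diff f g)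
    then have [measurable]: "D \<in> borel_measurable borel" by (simp add: L2_def)
    have Dy: "(\<integral>x. (D (x + y))\<^sup>2 \<partial>lborel) < e/10" "(\<integral>x. (- D x)\<^sup>2 \<partial>lborel) < e/10"
      using integral_translate[of "\<lambda>x. (D x)\<^sup>2" y] g(3) unfolding power2_minus by (simp_all add: D_def)
    have eq: "f (x + y) - f x = (D (x + y) + (- D x)) + (g (x + y) - g x)" for x by (simp add: D_def)
    have DL': "(\<lambda>x. - D x) \<in> L2" using L2_cmult[OF DL, of "-1"] by simp
    have L: "(\<lambda>x. D (x + y) + (- D x)) \<in> L2" by (intro L2_add L2_translate DL DL')
    have "(\<integral>x. (f (x + y) - f x)\<^sup>2 \<partial>lborel) \<le> 2 * (\<integral>x. (D (x + y) + (- D x))\<^sup>2 \<partial>lborel) + 2 * (\<integral>x. (g (x + y) - g x)\<^sup>2 \<partial>lborel)"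
      unfolding eq by (rule L2_triangle_sq[OF L L2_diff[OF L2_translate[OF g(4)] g(4)]])
    also have "\<dots> \<le> 2 * (2 * (e/10) + 2 * (e/10)) + 2 * (e/10)"
      by (intro add_mono mult_left_mono order_trans[OF L2_triangle_sq[OF L2_translate[OF DL, of y] DL']] gy
          less_imp_le[OF Dy(1)] less_imp_le[OF Dy(2)]) auto
    also have "\<dots> \<le> e" using e by simp
    finally show "(\<integral>x. (f (x + y) - f x)\<^sup>2 \<partial>lborel) \<le> e" .
  qed
qed

text \<open>Mollification and Steklov averaging are both averages of translates.\<close>

lemma L2_average:
  fixes f :: "'a::euclidean_space \<Rightarrow> real" and y :: "'s \<Rightarrow> 'a"
  assumes f: "f \<in> L2" and M: "emeasure M (space M) = 1" and y[measurable]: "y \<in> borel_measurable M"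
    and e: "\<And>s. s \<in> space M \<Longrightarrow> (\<integral>x. (f (x + y s) - f x)\<^sup>2 \<partial>lborel) \<le> e" and e0: "e \<ge> 0"
  shows "(\<lambda>x. \<integral>s. f (x + y s) \<partial>M) \<in> L2"
    and "(\<integral>x. ((\<integral>s. f (x + y s) \<partial>M) - f x)\<^sup>2 \<partial>lborel) \<le> e"
proof -
  interpret M: finite_measure M by (rule finite_measureI) (simp add: M)
  interpret pair_sigma_finite lborel M ..
  have fm[measurable]: "f \<in> borel_measurable borel" using f by (simp add: L2_def)
  have M1: "measure M (space M) = 1" using M by (simp add: measure_def)
  let ?A = "\<lambda>x. \<integral>s. f (x + y s) \<partial>M"
  have Am[measurable]: "?A \<in> borel_measurable borel" by measurable
  \<comment> \<open>Jensen's inequality for the square, from the nonnegativity of a variance. Where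
    the right-hand side is infinite there is nothing to show, which also disposes of the points at
    which the averaged function may fail to be integrable.\<close>
  have jen: "ennreal ((?A x - f x)\<^sup>2) \<le> (\<integral>\<^sup>+s. ennreal ((f (x + y s) - f x)\<^sup>2) \<partial>M)" for x
  proof (cases "(\<integral>\<^sup>+s. ennreal ((f (x + y s) - f x)\<^sup>2) \<partial>M) < \<infinity>")
    case True
    let ?X = "\<lambda>s. f (x + y s) - f x"
    have sq: "integrable M (\<lambda>s. (?X s)\<^sup>2)"
      using True by (intro integrableI_bounded) auto
    have X: "integrable M ?X" by (rule M.square_integrable_imp_integrable[OF _ sq]) measurable
    have "integrable M (\<lambda>s. ?X s + f x)" using X by (intro Bochner_Integration.integrable_add) auto
    then have i: "integrable M (\<lambda>s. f (x + y s))" by simp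
    define a where "a = ?A x - f x"
    have a: "(\<integral>s. ?X s \<partial>M) = a" using i M1 by (simp add: a_def)
    have "0 \<le> (\<integral>s. (?X s - a)\<^sup>2 \<partial>M)" by simp
    also have "\<dots> = (\<integral>s. (?X s)\<^sup>2 - 2 * a * ?X s + a\<^sup>2 \<partial>M)"
      by (intro Bochner_Integration.integral_cong) (auto simp: power2_diff)
    also have "\<dots> = (\<integral>s. (?X s)\<^sup>2 \<partial>M) - 2 * a * (\<integral>s. ?X s \<partial>M) + a\<^sup>2"
      using sq X M1 by simp
    also have "\<dots> = (\<integral>s. (?X s)\<^sup>2 \<partial>M) - a\<^sup>2" unfolding a by (simp add: power2_eq_square)
    finally have "a\<^sup>2 \<le> (\<integral>s. (?X s)\<^sup>2 \<partial>M)" by simp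
    then show ?thesis unfolding a_def[symmetric]
      by (subst nn_integral_eq_integral[OF sq]) (auto intro: ennreal_leI)
  next
    case False then show ?thesis unfolding infinity_ennreal_def by (metis top.not_eq_extremum top_greatest)
  qed
  have "(\<integral>\<^sup>+x. ennreal ((?A x - f x)\<^sup>2) \<partial>lborel) \<le> (\<integral>\<^sup>+x. (\<integral>\<^sup>+s. ennreal ((f (x + y s) - f x)\<^sup>2) \<partial>M) \<partial>lborel)"
    by (intro nn_integral_mono jen)
  also have "\<dots> = (\<integral>\<^sup>+s. (\<integral>\<^sup>+x. ennreal ((f (x + y s) - f x)\<^sup>2) \<partial>lborel) \<partial>M)"
    by (rule Fubini'[symmetric]) measurable
  also have "\<dots> \<le> (\<integral>\<^sup>+s. ennreal e \<partial>M)"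
  proof (intro nn_integral_mono)
    fix s assume "s \<in> space M"
    then show "(\<integral>\<^sup>+x. ennreal ((f (x + y s) - f x)\<^sup>2) \<partial>lborel) \<le> ennreal e"
      using L2_integrable_sq[OF L2_diff[OF L2_translate[OF f, of "y s"] f]] e
      by (subst nn_integral_eq_integral) (auto intro: ennreal_leI)
  qed
  also have "\<dots> = ennreal e" by (simp add: M)
  finally have le: "(\<integral>\<^sup>+x. ennreal ((?A x - f x)\<^sup>2) \<partial>lborel) \<le> ennreal e" .
  have int: "integrable lborel (\<lambda>x. (?A x - f x)\<^sup>2)"
    using le by (intro integrableI_bounded) (auto simp: le_less_trans)
  show "(\<integral>x. (?A x - f x)\<^sup>2 \<partial>lborel) \<le> e"
    using le e0 by (subst (asm) nn_integral_eq_integral[OF int]) auto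
  have "(\<lambda>x. ?A x - f x) \<in> L2" using int by (simp add: L2_def)
  from L2_add[OF this f] show "?A \<in> L2" by simp
qed

section \<open>Smooth test functions and mollification\<close>

lemma iter_deriv_Nil [simp]: "iter_deriv [] u = u"
  and iter_deriv_Cons: "iter_deriv (v # vs) u = dir_deriv v (iter_deriv vs u)"
  and iter_deriv_snoc: "iter_deriv (vs @ [v]) u = iter_deriv vs (dir_deriv v u)"
  by (simp_all add: iter_deriv_def)

text \<open>Induction on the list of directions keeps every iterated derivative inside
  \<open>X\<close>. Smoothness thus reduces to naming a class of differentiable functions closed
  under partial derivatives, with no formula for the higher derivatives.\<close>

lemma smooth_on_UNIV_coinduct:
  assumes "u \<in> X" and diff: "\<And>w x. w \<in> X \<Longrightarrow> w differentiable (at x)"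
    and step: "\<And>w e. w \<in> X \<Longrightarrow> e \<in> Basis \<Longrightarrow> dir_deriv e w \<in> X"
  shows "smooth_on UNIV u"
proof -
  have "iter_deriv vs u \<in> X" if "set vs \<subseteq> Basis" for vs
    using that by (induction vs) (auto simp: iter_deriv_Cons assms)
  then show ?thesis by (auto simp: smooth_on_def diff)
qed

lemma dir_deriv_eq:
  assumes "(u has_derivative u') (at x)" shows "dir_deriv v u x = u' v"
  using frechet_derivative_at[OF assms] by (simp add: dir_deriv_def)

lemma sum_inner_Basis_mult:
  fixes e :: "'a::euclidean_space" and f :: "'a \<Rightarrow> real"
  assumes "e \<in> Basis" shows "(\<Sum>i\<in>Basis. (e \<bullet> i) * f i) = f e"
proof -
  have "(\<Sum>i\<in>Basis. (e \<bullet> i) * f i) = (\<Sum>i\<in>Basis. if i = e then f i else 0)"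
    using assms by (intro sum.cong) (auto simp: inner_Basis)
  then show ?thesis using assms by simp
qed

lemma has_derivative_dir_deriv:
  fixes u :: "'a::euclidean_space \<Rightarrow> real"
  assumes "u differentiable (at x)"
  shows "(u has_derivative (\<lambda>h. \<Sum>e\<in>Basis. (h \<bullet> e) * dir_deriv e u x)) (at x)"
proof -
  have d: "(u has_derivative frechet_derivative u (at x)) (at x)"
    using assms by (simp add: frechet_derivative_works)
  then have l: "linear (frechet_derivative u (at x))" by (rule has_derivative_linear)
  have "frechet_derivative u (at x) h = (\<Sum>e\<in>Basis. (h \<bullet> e) * dir_deriv e u x)" for h
  proof -
    have "frechet_derivative u (at x) h = frechet_derivative u (at x) (\<Sum>e\<in>Basis. (h \<bullet> e) *\<^sub>R e)"
      by (simp add: euclidean_representation)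
    also have "\<dots> = (\<Sum>e\<in>Basis. (h \<bullet> e) * dir_deriv e u x)"
      by (simp add: linear_sum[OF l] linear_scale[OF l] dir_deriv_def)
    finally show ?thesis .
  qed
  then have "frechet_derivative u (at x) = (\<lambda>h. \<Sum>e\<in>Basis. (h \<bullet> e) * dir_deriv e u x)" by (rule ext)
  with d show ?thesis by simp
qed

text \<open>The classical flat function \<open>exp (- 1 / t)\<close>, divided by powers of
  \<open>t\<close>. The powers are included because differentiating the flat function produces them:
  the family indexed by \<open>n\<close> is closed under derivatives up to linear
  combinations.\<close>

definition exp_cutoff :: "nat \<Rightarrow> real \<Rightarrow> real" where
  "exp_cutoff n t = (if t > 0 then exp (- 1 / t) / t ^ n else 0)"

lemma power_le_fact_exp:
  assumes "(s::real) \<ge> 0" shows "s ^ n \<le> fact n * exp s"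
proof -
  have "(\<Sum>k\<in>{n}. s ^ k /\<^sub>R fact k) \<le> (\<Sum>k. s ^ k /\<^sub>R fact k)"
    by (rule sum_le_suminf[OF summable_exp_generic]) (use assms in auto)
  then have "s ^ n / fact n \<le> exp s" by (simp add: exp_def divide_inverse mult.commute)
  then show ?thesis by (simp add: divide_le_eq mult.commute)
qed

text \<open>A single term of the exponential series, of index \<open>n + 2\<close>, beats
  \<open>(1 / t) ^ (n + 2)\<close>. The two extra powers make the bound quadratic, which forces the
  derivative at 0 to vanish.\<close>

lemma exp_cutoff_le: "\<bar>exp_cutoff n t\<bar> \<le> fact (n + 2) * t\<^sup>2"
proof (cases "t > 0")
  case True
  have "(1/t) ^ (n + 2) \<le> fact (n + 2) * exp (1/t)" using True by (intro power_le_fact_exp) simp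
  then have "exp (- 1 / t) * (1/t) ^ (n + 2) \<le> exp (- 1 / t) * (fact (n + 2) * exp (1/t))"
    by (intro mult_left_mono) auto
  also have "\<dots> = fact (n + 2)" by (simp add: exp_minus field_simps)
  finally have "exp (- 1 / t) / t ^ n \<le> fact (n + 2) * t\<^sup>2"
    using True by (simp add: power_add power_one_over field_simps power2_eq_square)
  then show ?thesis using True by (simp add: exp_cutoff_def)
qed (simp add: exp_cutoff_def)

lemma exp_cutoff_deriv:
  "(exp_cutoff n has_real_derivative (exp_cutoff (n + 2) t - of_nat n * exp_cutoff (n + 1) t)) (at t)"
proof -
  consider "t > 0" | "t < 0" | "t = 0" by linarith
  then show ?thesis
  proof cases
    case 1
    have "((\<lambda>t. exp (- 1 / t) / t ^ n) has_real_derivative (exp_cutoff (n + 2) t - of_nat n * exp_cutoff (n + 1) t)) (at t)"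
      using 1 by (cases n) (auto intro!: derivative_eq_intros simp: exp_cutoff_def field_simps power2_eq_square, metis One_nat_def power_eq_if)
    then show ?thesis
      by (rule DERIV_cong_ev[THEN iffD1, rotated -1])
         (use 1 in \<open>auto simp: exp_cutoff_def intro!: eventually_mono[OF eventually_nhds_in_open[of "{0<..}"]]\<close>)
  next
    case 2
    have "((\<lambda>t. 0) has_real_derivative (exp_cutoff (n + 2) t - of_nat n * exp_cutoff (n + 1) t)) (at t)"
      using 2 by (auto simp: exp_cutoff_def)
    then show ?thesis
      by (rule DERIV_cong_ev[THEN iffD1, rotated -1])
         (use 2 in \<open>auto simp: exp_cutoff_def intro!: eventually_mono[OF eventually_nhds_in_open[of "{..<0}"]]\<close>)
  next
    case 3
    have "(exp_cutoff n has_derivative (\<lambda>h. 0)) (at 0)"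
    proof (rule has_derivativeI_sandwich[where e=1 and H="\<lambda>y. fact (n + 2) * \<bar>y\<bar>"])
      fix y :: real assume "y \<noteq> 0"
      then show "norm (exp_cutoff n y - exp_cutoff n 0 - 0) / norm (y - 0) \<le> fact (n + 2) * \<bar>y\<bar>"
        using exp_cutoff_le[of n y] by (simp add: exp_cutoff_def divide_le_eq power2_eq_square mult.assoc)
    next
      show "((\<lambda>y. fact (n + 2) * \<bar>y\<bar>) \<longlongrightarrow> 0) (at (0::real))"
        by (intro tendsto_eq_intros) auto
    qed auto
    then show ?thesis using 3 by (simp add: has_field_derivative_def exp_cutoff_def lambda_zero)
  qed
qed

text \<open>An algebra rather than the single bump function: the chain rule applied to a generator
  yields generators with larger \<open>n\<close> times coordinates and constants, so the algebra is
  closed under partial derivatives and all its members are smooth at once.\<close>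

inductive_set bump_algebra :: "'a::euclidean_space \<Rightarrow> real \<Rightarrow> ('a \<Rightarrow> real) set" for c r where
  const: "(\<lambda>x. a) \<in> bump_algebra c r"
| coord: "(\<lambda>x. x \<bullet> e) \<in> bump_algebra c r"
| cutoff: "(\<lambda>x. exp_cutoff n (r\<^sup>2 - (x - c) \<bullet> (x - c))) \<in> bump_algebra c r"
| add: "u \<in> bump_algebra c r \<Longrightarrow> w \<in> bump_algebra c r \<Longrightarrow> (\<lambda>x. u x + w x) \<in> bump_algebra c r"
| mult: "u \<in> bump_algebra c r \<Longrightarrow> w \<in> bump_algebra c r \<Longrightarrow> (\<lambda>x. u x * w x) \<in> bump_algebra c r"

lemma bump_algebra_deriv:
  assumes "u \<in> bump_algebra c r"
  shows "\<exists>u'. (\<forall>x. (u has_derivative u' x) (at x)) \<and> (\<forall>e. (\<lambda>x. u' x e) \<in> bump_algebra c r)"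
  using assms
proof induction
  case (const a)
  show ?case
    by (rule exI[of _ "\<lambda>x h. 0"]) (auto intro: bump_algebra.const)
next
  case (coord e)
  show ?case
    by (rule exI[of _ "\<lambda>x h. h \<bullet> e"])
       (auto intro: bump_algebra.const intro!: derivative_eq_intros)
next
  case (cutoff n)
  define q where "q x = r\<^sup>2 - (x - c) \<bullet> (x - c)" for x
  define d where "d x = exp_cutoff (n + 2) (q x) + (- real n) * exp_cutoff (n + 1) (q x)" for x
  have q': "(q has_derivative (\<lambda>h. - 2 * ((x - c) \<bullet> h))) (at x)" for x
    unfolding q_def by (auto intro!: derivative_eq_intros simp: inner_commute)
  have D: "((\<lambda>x. exp_cutoff n (q x)) has_derivative (\<lambda>h. d x * (- 2 * ((x - c) \<bullet> h)))) (at x)" for x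
    using has_derivative_compose[OF q' exp_cutoff_deriv[of n "q x", unfolded has_field_derivative_def]]
    by (simp add: d_def algebra_simps)
  have "(\<lambda>x. (exp_cutoff (n + 2) (q x) + (\<lambda>x. - real n) x * exp_cutoff (n + 1) (q x))
      * ((\<lambda>x. 2 * (c \<bullet> e)) x + (\<lambda>x. - 2) x * (x \<bullet> e))) \<in> bump_algebra c r" for e
    unfolding q_def by (intro bump_algebra.intros)
  then have "(\<lambda>x. d x * (- 2 * ((x - c) \<bullet> e))) \<in> bump_algebra c r" for e
    by (simp add: d_def inner_diff_left algebra_simps)
  with D show ?case unfolding q_def by (intro exI[of _ "\<lambda>x h. d x * (- 2 * ((x - c) \<bullet> h))"]) auto
next
  case (add u w)
  then obtain u' w' where "\<forall>x. (u has_derivative u' x) (at x)" "\<forall>e. (\<lambda>x. u' x e) \<in> bump_algebra c r"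
    "\<forall>x. (w has_derivative w' x) (at x)" "\<forall>e. (\<lambda>x. w' x e) \<in> bump_algebra c r" by blast
  then show ?case
    by (intro exI[of _ "\<lambda>x h. u' x h + w' x h"]) (auto intro!: has_derivative_add bump_algebra.add)
next
  case (mult u w)
  then obtain u' w' where *: "\<forall>x. (u has_derivative u' x) (at x)" "\<forall>e. (\<lambda>x. u' x e) \<in> bump_algebra c r"
    "\<forall>x. (w has_derivative w' x) (at x)" "\<forall>e. (\<lambda>x. w' x e) \<in> bump_algebra c r" by blast
  have "((\<lambda>x. u x * w x) has_derivative (\<lambda>h. u x * w' x h + u' x h * w x)) (at x)" for x
    using * has_derivative_mult by blast
  moreover have "(\<lambda>x. u x * w' x e + u' x e * w x) \<in> bump_algebra c r" for e
    using * mult by (intro bump_algebra.add bump_algebra.mult) auto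
  ultimately show ?case by (intro exI[of _ "\<lambda>x h. u x * w' x h + u' x h * w x"]) auto
qed

lemma bump_algebra_smooth:
  assumes "u \<in> bump_algebra c r" shows "smooth_on UNIV u"
proof (rule smooth_on_UNIV_coinduct[OF assms])
  fix w assume "w \<in> bump_algebra c r"
  then obtain w' where w': "\<forall>x. (w has_derivative w' x) (at x)" "\<forall>e. (\<lambda>x. w' x e) \<in> bump_algebra c r"
    using bump_algebra_deriv by blast
  show "w differentiable (at x)" for x using w' differentiableI by blast
  have "dir_deriv e w = (\<lambda>x. w' x e)" for e using w'(1) by (auto simp: dir_deriv_eq)
  then show "dir_deriv e w \<in> bump_algebra c r" for e using w'(2) by simp
qed

definition bump :: "real \<Rightarrow> 'a::euclidean_space \<Rightarrow> 'a \<Rightarrow> real" where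
  "bump r c x = exp_cutoff 0 (r\<^sup>2 - (x - c) \<bullet> (x - c))"

text \<open>The normalising integral is taken at centre 0 for every \<open>c\<close>, so that
  kernels of one radius are visibly translates of each other and one computation of the mass serves
  them all.\<close>

definition mollifier :: "real \<Rightarrow> 'a::euclidean_space \<Rightarrow> 'a \<Rightarrow> real" where
  "mollifier r c x = (1 / (\<integral>y. bump r 0 (y::'a) \<partial>lborel)) * bump r c x"

lemma exp_cutoff_nonneg: "exp_cutoff n t \<ge> 0"
  by (simp add: exp_cutoff_def)

lemma bump_nonneg: "bump r c x \<ge> 0" by (simp add: bump_def exp_cutoff_nonneg)

lemma mollifier_nonneg: "mollifier r c x \<ge> 0"
  by (simp add: mollifier_def bump_nonneg)

lemma mollifier_eq_0: "r > 0 \<Longrightarrow> norm (x - c) \<ge> r \<Longrightarrow> mollifier r c x = 0"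
proof -
  assume "r > 0" "norm (x - c) \<ge> r"
  then have "r\<^sup>2 \<le> (norm (x - c))\<^sup>2" by (intro power_mono) auto
  then have "\<not> r\<^sup>2 - (x - c) \<bullet> (x - c) > 0" by (simp add: dot_square_norm)
  then show ?thesis by (simp add: mollifier_def bump_def exp_cutoff_def)
qed

lemma mollifier_shift: "mollifier r c x = mollifier r 0 (x - c)"
  by (simp add: mollifier_def bump_def)

lemma test_function_mollifier:
  assumes "r > 0" "cball c r \<subseteq> \<Omega>" shows "test_function \<Omega> (mollifier r c)"
proof -
  have "(\<lambda>x. (\<lambda>x. 1 / (\<integral>y. bump r 0 (y::'a) \<partial>lborel)) x * bump r c x) \<in> bump_algebra c r"
    unfolding bump_def by (intro bump_algebra.intros)
  then have "smooth_on UNIV (mollifier r c)"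
    by (auto simp: mollifier_def[abs_def] intro: bump_algebra_smooth)
  moreover have "closure {x. mollifier r c x \<noteq> 0} \<subseteq> cball c r"
  proof (rule closure_minimal)
    show "{x. mollifier r c x \<noteq> 0} \<subseteq> cball c r"
      using mollifier_eq_0[OF assms(1), of _ c] by (force simp: dist_norm norm_minus_commute)
  qed simp
  moreover from this have "compact (closure {x. mollifier r c x \<noteq> 0})"
    by (meson bounded_cball bounded_subset closed_closure compact_eq_bounded_closed)
  ultimately show ?thesis using assms by (auto simp: test_function_def)
qed

section \<open>Test functions: supports, bounds and Taylor remainder\<close>

lemma test_function_mono: "test_function \<Omega> \<phi> \<Longrightarrow> \<Omega> \<subseteq> \<Omega>' \<Longrightarrow> test_function \<Omega>' \<phi>"
  by (auto simp: test_function_def)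

lemma test_function_differentiable: "test_function \<Omega> \<phi> \<Longrightarrow> \<phi> differentiable (at x)"
  unfolding test_function_def smooth_on_def by (metis UNIV_I empty_set empty_subsetI iter_deriv_Nil)

lemma test_function_continuous: "test_function \<Omega> \<phi> \<Longrightarrow> continuous_on UNIV \<phi>"
  by (simp add: continuous_at_imp_continuous_on differentiable_imp_continuous_within test_function_differentiable)

lemma test_function_borel: "test_function \<Omega> \<phi> \<Longrightarrow> \<phi> \<in> borel_measurable borel"
  by (intro borel_measurable_continuous_onI test_function_continuous)

lemma dir_deriv_eq_0_outside:
  assumes "closed K" "\<And>x. x \<notin> K \<Longrightarrow> u x = 0" "x \<notin> K"
  shows "dir_deriv e u x = 0"
proof -
  have "((\<lambda>x. 0) has_derivative (\<lambda>h. 0)) (at x)" by simp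
  then have "(u has_derivative (\<lambda>h. 0)) (at x)"
    by (rule has_derivative_transform_within_open[of _ _ _ _ "- K"]) (use assms in auto)
  then show ?thesis by (simp add: dir_deriv_eq)
qed

lemma not_in_closure_supportD: "x \<notin> closure {x. u x \<noteq> (0::real)} \<Longrightarrow> u x = 0"
  using closure_subset[of "{x. u x \<noteq> 0}"] by auto

lemma test_function_dir_deriv:
  assumes t: "test_function \<Omega> \<phi>" and e: "e \<in> Basis"
  shows "test_function \<Omega> (dir_deriv e \<phi>)"
proof -
  let ?S = "closure {x. \<phi> x \<noteq> 0}"
  have "iter_deriv vs (dir_deriv e \<phi>) differentiable (at x)" if "set vs \<subseteq> Basis" for vs x
    using t e that unfolding test_function_def smooth_on_def iter_deriv_snoc[symmetric] by auto
  then have 1: "smooth_on UNIV (dir_deriv e \<phi>)" by (auto simp: smooth_on_def)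
  have "dir_deriv e \<phi> x = 0" if "x \<notin> ?S" for x
    by (rule dir_deriv_eq_0_outside[OF closed_closure _ that]) (rule not_in_closure_supportD)
  then have 2: "closure {x. dir_deriv e \<phi> x \<noteq> 0} \<subseteq> ?S" by (intro closure_minimal) auto
  moreover have "compact ?S" using t by (simp add: test_function_def)
  ultimately have "compact (closure {x. dir_deriv e \<phi> x \<noteq> 0})"
    by (meson compact_imp_bounded bounded_subset closed_closure compact_eq_bounded_closed)
  with 1 2 t show ?thesis by (auto simp: test_function_def)
qed

lemma test_functionE:
  assumes "test_function \<Omega> \<phi>"
  obtains K where "compact K" "K \<subseteq> \<Omega>" "\<And>x. x \<notin> K \<Longrightarrow> \<phi> x = 0" "\<And>x e. x \<notin> K \<Longrightarrow> dir_deriv e \<phi> x = 0"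
proof -
  let ?S = "closure {x. \<phi> x \<noteq> 0}"
  have "compact ?S" "?S \<subseteq> \<Omega>" using assms by (auto simp: test_function_def)
  moreover have z: "\<phi> x = 0" if "x \<notin> ?S" for x using that by (rule not_in_closure_supportD)
  moreover have "dir_deriv e \<phi> x = 0" if "x \<notin> ?S" for x e
    by (rule dir_deriv_eq_0_outside[OF closed_closure z that])
  ultimately show ?thesis using that by blast
qed

lemma continuous_compact_support_bounded:
  fixes u :: "'a::euclidean_space \<Rightarrow> real"
  assumes "continuous_on UNIV u" "compact K" "\<And>x. x \<notin> K \<Longrightarrow> u x = 0"
  obtains B where "B \<ge> 0" "\<And>x. \<bar>u x\<bar> \<le> B"
proof -
  have "bounded (u ` K)"
    using assms by (intro compact_imp_bounded compact_continuous_image) (auto intro: continuous_on_subset)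
  then obtain B where B: "\<And>x. x \<in> K \<Longrightarrow> \<bar>u x\<bar> \<le> B" unfolding bounded_iff by (metis imageI real_norm_def)
  have "\<bar>u x\<bar> \<le> max 0 B" for x using B[of x] assms(3)[of x] by (cases "x \<in> K") (auto simp: max_def)
  then show ?thesis using that[of "max 0 B"] by auto
qed

lemma test_function_bounded:
  assumes "test_function \<Omega> \<phi>" obtains B where "B \<ge> 0" "\<And>x. \<bar>\<phi> x\<bar> \<le> B"
proof -
  obtain K where K: "compact K" "\<And>x. x \<notin> K \<Longrightarrow> \<phi> x = 0" by (rule test_functionE[OF assms]) (rule that)
  obtain B where "B \<ge> 0" "\<And>x. \<bar>\<phi> x\<bar> \<le> B"
    by (rule continuous_compact_support_bounded[OF test_function_continuous[OF assms] K(1)]) (erule K(2), rule that)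
  then show ?thesis by (rule that)
qed

lemma onorm_coordinates_le:
  fixes a :: "'a::euclidean_space \<Rightarrow> real"
  shows "onorm (\<lambda>h. \<Sum>e\<in>Basis. (h \<bullet> e) * a e) \<le> (\<Sum>e\<in>Basis. \<bar>a e\<bar>)"
proof (rule onorm_le)
  fix h :: 'a
  have "norm (\<Sum>e\<in>Basis. (h \<bullet> e) * a e) \<le> (\<Sum>e\<in>Basis. \<bar>a e\<bar> * norm h)"
  proof (rule sum_norm_le)
    fix e :: 'a assume "e \<in> Basis"
    then show "norm ((h \<bullet> e) * a e) \<le> \<bar>a e\<bar> * norm h"
      using mult_left_mono[OF Basis_le_norm[of e h], of "\<bar>a e\<bar>"] by (simp add: abs_mult mult.commute)
  qed
  then show "norm (\<Sum>e\<in>Basis. (h \<bullet> e) * a e) \<le> (\<Sum>e\<in>Basis. \<bar>a e\<bar>) * norm h"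
    by (simp add: sum_distrib_right)
qed

lemma test_function_Lipschitz:
  assumes t: "test_function \<Omega> \<phi>" obtains L where "L \<ge> 0" "\<And>x y. \<bar>\<phi> x - \<phi> y\<bar> \<le> L * norm (x - y)"
proof -
  have "\<exists>B\<ge>0. \<forall>x. \<bar>dir_deriv e \<phi> x\<bar> \<le> B" if "e \<in> Basis" for e
    using test_function_bounded[OF test_function_dir_deriv[OF t that]] by metis
  then obtain B where B: "\<And>e. e \<in> Basis \<Longrightarrow> B e \<ge> 0" "\<And>e x. e \<in> Basis \<Longrightarrow> \<bar>dir_deriv e \<phi> x\<bar> \<le> B e"
    by metis
  have "norm (\<phi> x - \<phi> y) \<le> (\<Sum>e\<in>Basis. B e) * norm (x - y)" for x y
  proof (rule differentiable_bound[of UNIV \<phi> "\<lambda>x h. \<Sum>e\<in>Basis. (h \<bullet> e) * dir_deriv e \<phi> x"])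
    show "onorm (\<lambda>h. \<Sum>e\<in>Basis. (h \<bullet> e) * dir_deriv e \<phi> x) \<le> sum B Basis" for x
      by (rule order_trans[OF onorm_coordinates_le]) (auto intro: sum_mono B)
  qed (auto intro: has_derivative_dir_deriv[OF test_function_differentiable[OF t]])
  then show ?thesis using that[of "\<Sum>e\<in>Basis. B e"] B by (auto intro: sum_nonneg)
qed

text \<open>First derivatives of a test function are again test functions, hence Lipschitz, and this
  makes the linearisation error quadratic with a constant independent of the base point. That
  uniformity allows differentiation under a convolution integral.\<close>

lemma test_function_quadratic_remainder:
  assumes t: "test_function \<Omega> \<phi>"
  obtains C where "C \<ge> 0"
    "\<And>a h. \<bar>\<phi> (a + h) - \<phi> a - (\<Sum>e\<in>Basis. (h \<bullet> e) * dir_deriv e \<phi> a)\<bar> \<le> C * (norm h)\<^sup>2"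
proof -
  have "\<exists>L\<ge>0. \<forall>x y. \<bar>dir_deriv e \<phi> x - dir_deriv e \<phi> y\<bar> \<le> L * norm (x - y)" if "e \<in> Basis" for e
    using test_function_Lipschitz[OF test_function_dir_deriv[OF t that]] by metis
  then obtain L where L: "\<And>e. e \<in> Basis \<Longrightarrow> L e \<ge> 0"
    "\<And>e x y. e \<in> Basis \<Longrightarrow> \<bar>dir_deriv e \<phi> x - dir_deriv e \<phi> y\<bar> \<le> L e * norm (x - y)"
    by metis
  define D where "D x = (\<lambda>h. \<Sum>e\<in>Basis. (h \<bullet> e) * dir_deriv e \<phi> x)" for x
  have "\<bar>\<phi> (a + h) - \<phi> a - D a h\<bar> \<le> (\<Sum>e\<in>Basis. L e) * (norm h)\<^sup>2" for a h
  proof -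
    have "norm (\<phi> (a + h) - \<phi> a - D a (a + h - a)) \<le> norm (a + h - a) * ((\<Sum>e\<in>Basis. L e) * norm h)"
    proof (rule differentiable_bound_linearization[of a "a + h" "cball a (norm h)" \<phi> D a])
      show "a + t *\<^sub>R (a + h - a) \<in> cball a (norm h)" if "t \<in> {0..1}" for t
        using that mult_left_le_one_le[of "norm h" "\<bar>t\<bar>"] by (simp add: dist_norm)
      show "(\<phi> has_derivative D x) (at x within cball a (norm h))" for x
        unfolding D_def by (rule has_derivative_at_withinI[OF has_derivative_dir_deriv[OF test_function_differentiable[OF t]]])
      show "onorm (D x - D a) \<le> (\<Sum>e\<in>Basis. L e) * norm h" if x: "x \<in> cball a (norm h)" for x
      proof -
        have "D x - D a = (\<lambda>h. \<Sum>e\<in>Basis. (h \<bullet> e) * (dir_deriv e \<phi> x - dir_deriv e \<phi> a))"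
          by (rule ext) (simp add: D_def sum_subtractf right_diff_distrib)
        then have "onorm (D x - D a) \<le> (\<Sum>e\<in>Basis. \<bar>dir_deriv e \<phi> x - dir_deriv e \<phi> a\<bar>)"
          using onorm_coordinates_le[of "\<lambda>e. dir_deriv e \<phi> x - dir_deriv e \<phi> a"] by simp
        also have "\<dots> \<le> (\<Sum>e\<in>Basis. L e * norm h)"
          using x by (intro sum_mono order_trans[OF L(2)] mult_left_mono L) (auto simp: dist_norm norm_minus_commute)
        finally show ?thesis by (simp add: sum_distrib_right)
      qed
    qed simp
    then show ?thesis by (simp add: power2_eq_square algebra_simps)
  qed
  then show ?thesis using that[of "\<Sum>e\<in>Basis. L e"] L(1) by (auto simp: D_def intro: sum_nonneg)
qed

definition loc_int :: "('a::euclidean_space \<Rightarrow> real) \<Rightarrow> bool" where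
  "loc_int u \<longleftrightarrow> u \<in> borel_measurable borel \<and> (\<forall>R. integrable lborel (\<lambda>x. indicator (cball 0 R) x * u x))"

lemma loc_int_mult_integrable:
  assumes u: "loc_int u" and m: "\<phi> \<in> borel_measurable borel" and b: "\<And>x. \<bar>\<phi> x\<bar> \<le> B"
    and K: "bounded K" "\<And>x. x \<notin> K \<Longrightarrow> \<phi> x = 0"
  shows "integrable lborel (\<lambda>x. u x * \<phi> x)"
proof -
  obtain r where r: "K \<subseteq> cball 0 r" using K(1) unfolding bounded_iff subset_iff mem_cball_0 by blast
  have [measurable]: "u \<in> borel_measurable borel" "\<phi> \<in> borel_measurable borel" using u m by (auto simp: loc_int_def)
  have le: "norm (u x * \<phi> x) \<le> norm (B * (indicator (cball 0 r) x * u x))" for x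
  proof (cases "x \<in> cball 0 r")
    case True
    have "\<bar>u x\<bar> * \<bar>\<phi> x\<bar> \<le> \<bar>u x\<bar> * \<bar>B\<bar>" using b[of x] by (intro mult_left_mono) auto
    with True show ?thesis by (simp add: abs_mult mult.commute)
  next
    case False
    then have "x \<notin> K" using r by blast
    then show ?thesis using K(2)[of x] False by simp
  qed
  have "integrable lborel (\<lambda>x. B * (indicator (cball 0 r) x * u x))"
    using u by (intro integrable_mult_right) (auto simp: loc_int_def)
  then show ?thesis by (rule Bochner_Integration.integrable_bound[OF _ _ AE_I2[OF le]]) measurable
qed

lemma loc_int_test_integrable:
  assumes "loc_int u" "test_function \<Omega> \<phi>"
  shows "integrable lborel (\<lambda>y. u y * \<phi> (y - x))"
proof -
  obtain B where B: "\<And>x. \<bar>\<phi> x\<bar> \<le> B" by (rule test_function_bounded[OF assms(2)]) (rule that)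
  obtain K where K: "compact K" "\<And>x. x \<notin> K \<Longrightarrow> \<phi> x = 0" by (rule test_functionE[OF assms(2)]) (rule that)
  have [measurable]: "\<phi> \<in> borel_measurable borel" using assms(2) by (rule test_function_borel)
  show ?thesis
  proof (rule loc_int_mult_integrable[OF assms(1)])
    show "bounded ((+) x ` K)" using K compact_imp_bounded bounded_translation by blast
    show "\<phi> (y - x) = 0" if "y \<notin> (+) x ` K" for y
      using that K(2)[of "y - x"] by (metis add.commute diff_add_cancel imageI)
  qed (use B in \<open>auto simp: measurable\<close>)
qed

lemma L2_loc_int: assumes "u \<in> L2" shows "loc_int u"
  unfolding loc_int_def
proof (intro conjI allI)
  show "u \<in> borel_measurable borel" using assms by (simp add: L2_def)
  show "integrable lborel (\<lambda>x. indicator (cball 0 R) x * u x)" for R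
    by (intro L2_mult_integrable[OF _ assms] L2_bounded_support[where B=1 and K="cball 0 R"])
       (auto intro!: borel_measurable_indicator)
qed

text \<open>The Taylor remainder of the kernel is at most \<open>C * (norm h)\<^sup>2\<close> on a
  fixed ball and zero off it, so the error of the linearised integral is quadratic in
  \<open>h\<close>. The minus sign comes from evaluating the kernel at \<open>y - x\<close>.\<close>

lemma convolution_has_derivative:
  assumes u: "loc_int u" and t: "test_function UNIV \<phi>"
  shows "((\<lambda>x. \<integral>y. u y * \<phi> (y - x) \<partial>lborel) has_derivative
    (\<lambda>h. \<Sum>e\<in>Basis. (h \<bullet> e) * (- (\<integral>y. u y * dir_deriv e \<phi> (y - x) \<partial>lborel)))) (at x)"
proof -
  obtain C where C: "C \<ge> 0"
    "\<And>a h. \<bar>\<phi> (a + h) - \<phi> a - (\<Sum>e\<in>Basis. (h \<bullet> e) * dir_deriv e \<phi> a)\<bar> \<le> C * (norm h)\<^sup>2"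
    by (rule test_function_quadratic_remainder[OF t]) (rule that)
  obtain K where K: "compact K" "\<And>x. x \<notin> K \<Longrightarrow> \<phi> x = 0" "\<And>x e. x \<notin> K \<Longrightarrow> dir_deriv e \<phi> x = 0"
    by (rule test_functionE[OF t]) (rule that)
  obtain a where a: "K \<subseteq> cball 0 a" using K(1) unfolding compact_eq_bounded_closed bounded_iff subset_iff mem_cball_0 by blast
  \<comment> \<open>Large enough for the ball to contain the supports of
    \<open>y \<mapsto> \<phi> (y - z)\<close> for all \<open>z\<close> within distance 1 of
    \<open>x\<close>; the distance 1 is that of the sandwich argument below.\<close>
  define r where "r = norm x + a + 1"
  define W where "W y = \<bar>indicator (cball 0 r) y * u y\<bar>" for y
  have Wi: "integrable lborel W" using u unfolding W_def loc_int_def by (intro integrable_abs) auto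
  have int1: "integrable lborel (\<lambda>y. u y * \<phi> (y - z))" for z by (rule loc_int_test_integrable[OF u t])
  have int2: "integrable lborel (\<lambda>y. u y * dir_deriv e \<phi> (y - z))" if "e \<in> Basis" for e z
    by (rule loc_int_test_integrable[OF u test_function_dir_deriv[OF t that]])
  let ?D = "\<lambda>h. \<Sum>e\<in>Basis. (h \<bullet> e) * (- (\<integral>y. u y * dir_deriv e \<phi> (y - x) \<partial>lborel))"
  show ?thesis
  proof (rule has_derivativeI_sandwich[where e=1 and H="\<lambda>z. C * (\<integral>y. W y \<partial>lborel) * norm (z - x)"])
    show "bounded_linear ?D"
      by (intro bounded_linear_sum bounded_linear_mult_const bounded_linear_inner_left)
    fix z assume z: "z \<noteq> x" "dist z x < 1"
    define h where "h = z - x"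
    have hn: "norm h < 1" using z by (simp add: h_def dist_norm)
    have eqD: "?D h = (\<integral>y. u y * (\<Sum>e\<in>Basis. (- h \<bullet> e) * dir_deriv e \<phi> (y - x)) \<partial>lborel)"
    proof -
      have "(\<integral>y. u y * (\<Sum>e\<in>Basis. (- h \<bullet> e) * dir_deriv e \<phi> (y - x)) \<partial>lborel)
        = (\<integral>y. (\<Sum>e\<in>Basis. (- h \<bullet> e) * (u y * dir_deriv e \<phi> (y - x))) \<partial>lborel)"
        by (intro Bochner_Integration.integral_cong) (auto simp: sum_distrib_left mult_ac)
      also have "\<dots> = (\<Sum>e\<in>Basis. \<integral>y. (- h \<bullet> e) * (u y * dir_deriv e \<phi> (y - x)) \<partial>lborel)"
        by (intro Bochner_Integration.integral_sum integrable_mult_right int2)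
      finally show ?thesis by simp
    qed
    have "(\<integral>y. u y * \<phi> (y - z) \<partial>lborel) - (\<integral>y. u y * \<phi> (y - x) \<partial>lborel) - ?D h
      = (\<integral>y. u y * \<phi> (y - z) - u y * \<phi> (y - x) - u y * (\<Sum>e\<in>Basis. (- h \<bullet> e) * dir_deriv e \<phi> (y - x)) \<partial>lborel)"
    proof -
      have "integrable lborel (\<lambda>y. \<Sum>e\<in>Basis. (- h \<bullet> e) * (u y * dir_deriv e \<phi> (y - x)))"
        by (intro Bochner_Integration.integrable_sum integrable_mult_right int2)
      then have "integrable lborel (\<lambda>y. u y * (\<Sum>e\<in>Basis. (- h \<bullet> e) * dir_deriv e \<phi> (y - x)))"
        by (simp add: sum_distrib_left mult_ac)
      then show ?thesis unfolding eqD by (simp add: int1)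
    qed
    also have "norm \<dots> \<le> (\<integral>y. (C * (norm h)\<^sup>2) * W y \<partial>lborel)"
    proof (rule Bochner_Integration.integral_norm_bound_integral)
      show "integrable lborel (\<lambda>y. (C * (norm h)\<^sup>2) * W y)" using Wi by (rule integrable_mult_right)
      show "integrable lborel (\<lambda>y. u y * \<phi> (y - z) - u y * \<phi> (y - x) - u y * (\<Sum>e\<in>Basis. (- h \<bullet> e) * dir_deriv e \<phi> (y - x)))"
      proof -
        have "integrable lborel (\<lambda>y. \<Sum>e\<in>Basis. (- h \<bullet> e) * (u y * dir_deriv e \<phi> (y - x)))"
          by (intro Bochner_Integration.integrable_sum integrable_mult_right int2)
        then have "integrable lborel (\<lambda>y. u y * (\<Sum>e\<in>Basis. (- h \<bullet> e) * dir_deriv e \<phi> (y - x)))"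
          by (simp add: sum_distrib_left mult_ac)
        then show ?thesis by (intro Bochner_Integration.integrable_diff int1)
      qed
      fix y :: 'a
      define p where "p = \<phi> (y - z) - \<phi> (y - x) - (\<Sum>e\<in>Basis. (- h \<bullet> e) * dir_deriv e \<phi> (y - x))"
      have "\<bar>p\<bar> \<le> C * (norm h)\<^sup>2" unfolding p_def
        using C(2)[of "y - x" "- h"] by (simp add: h_def norm_minus_commute[of x z])
      moreover have "p = 0" if "y \<notin> cball 0 r"
      proof -
        have "norm y \<le> norm (y - x) + norm x" "norm y \<le> norm (y - z) + norm h + norm x"
          unfolding h_def by norm+
        then have "y - x \<notin> K" "y - z \<notin> K" using that hn a unfolding r_def subset_iff mem_cball_0 by fastforce+
        then show ?thesis by (simp add: p_def K)
      qed
      ultimately have "\<bar>u y\<bar> * \<bar>p\<bar> \<le> (C * (norm h)\<^sup>2) * W y"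
        using mult_left_mono[of "\<bar>p\<bar>" "C * (norm h)\<^sup>2" "\<bar>u y\<bar>"]
        by (cases "y \<in> cball 0 r") (simp_all add: W_def mult.commute)
      moreover have "u y * \<phi> (y - z) - u y * \<phi> (y - x) - u y * (\<Sum>e\<in>Basis. (- h \<bullet> e) * dir_deriv e \<phi> (y - x)) = u y * p"
        by (simp add: p_def right_diff_distrib)
      ultimately show "norm (u y * \<phi> (y - z) - u y * \<phi> (y - x) - u y * (\<Sum>e\<in>Basis. (- h \<bullet> e) * dir_deriv e \<phi> (y - x)))
        \<le> (C * (norm h)\<^sup>2) * W y" by (simp add: abs_mult)
    qed
    also have "\<dots> = C * (\<integral>y. W y \<partial>lborel) * norm h * norm h" by (simp add: power2_eq_square)
    finally show "norm ((\<integral>y. u y * \<phi> (y - z) \<partial>lborel) - (\<integral>y. u y * \<phi> (y - x) \<partial>lborel) - ?D (z - x)) / norm (z - x)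
       \<le> C * (\<integral>y. W y \<partial>lborel) * norm (z - x)"
      using z by (simp add: h_def divide_le_eq)
  next
    show "((\<lambda>z. C * (\<integral>y. W y \<partial>lborel) * norm (z - x)) \<longlongrightarrow> 0) (at x)"
      by (intro tendsto_eq_intros) auto
  qed simp
qed

lemma convolution_smooth:
  assumes u: "loc_int u" and t: "test_function UNIV \<phi>"
  shows "smooth_on UNIV (\<lambda>x. \<integral>y. u y * \<phi> (y - x) \<partial>lborel)"
\<comment> \<open>The scalar \<open>c\<close> belongs to the class because differentiating in
  \<open>x\<close> changes the sign.\<close>
proof (rule smooth_on_UNIV_coinduct[where X="{(\<lambda>x. c * (\<integral>y. u y * \<psi> (y - x) \<partial>lborel)) |c \<psi>. test_function UNIV \<psi>}"])
  show "(\<lambda>x. \<integral>y. u y * \<phi> (y - x) \<partial>lborel) \<in> {(\<lambda>x. c * (\<integral>y. u y * \<psi> (y - x) \<partial>lborel)) |c \<psi>. test_function UNIV \<psi>}"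
    using t by (intro CollectI exI[of _ 1] exI[of _ \<phi>]) auto
  fix w assume "w \<in> {(\<lambda>x. c * (\<integral>y. u y * \<psi> (y - x) \<partial>lborel)) |c \<psi>. test_function UNIV \<psi>}"
  then obtain c \<psi> where w: "w = (\<lambda>x. c * (\<integral>y. u y * \<psi> (y - x) \<partial>lborel))" and \<psi>: "test_function UNIV \<psi>" by auto
  note d = has_derivative_mult_right[OF convolution_has_derivative[OF u \<psi>], of c]
  show "w differentiable (at x)" for x unfolding w using d differentiableI by blast
  show "dir_deriv e w \<in> {(\<lambda>x. c * (\<integral>y. u y * \<psi> (y - x) \<partial>lborel)) |c \<psi>. test_function UNIV \<psi>}" if e: "e \<in> Basis" for e
  proof -
    have "dir_deriv e w = (\<lambda>x. - c * (\<integral>y. u y * dir_deriv e \<psi> (y - x) \<partial>lborel))"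
      unfolding w using e by (intro ext) (subst dir_deriv_eq[OF d], subst sum_inner_Basis_mult, auto)
    then show ?thesis using test_function_dir_deriv[OF \<psi> e] by blast
  qed
qed

lemma bump_integral_pos: assumes "r > 0" shows "(\<integral>y. bump r 0 (y::'a::euclidean_space) \<partial>lborel) > 0"
  and bump_integrable: "integrable lborel (bump r (0::'a))"
proof -
  let ?K = "cball (0::'a) r"
  have "continuous_on UNIV (bump r (0::'a))"
  proof -
    have "bump r (0::'a) \<in> bump_algebra 0 r" unfolding bump_def[abs_def] by (rule bump_algebra.cutoff)
    then obtain u' where "\<forall>x. (bump r (0::'a) has_derivative u' x) (at x)" using bump_algebra_deriv by blast
    then show ?thesis by (meson continuous_at_imp_continuous_on has_derivative_continuous)
  qed
  then have m[measurable]: "bump r (0::'a) \<in> borel_measurable borel" by (rule borel_measurable_continuous_onI)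
  have b: "\<bar>bump r (0::'a) x\<bar> \<le> 1" for x by (simp add: bump_def exp_cutoff_def)
  have z: "bump r (0::'a) x = 0" if "x \<notin> ?K" for x
    using that power_strict_mono[of r "norm x" 2] assms by (simp add: bump_def exp_cutoff_def dot_square_norm)
  show i: "integrable lborel (bump r (0::'a))"
    by (rule integrable_bounded_support[OF m b bounded_cball z])
  have "(\<integral>y. bump r 0 (y::'a) \<partial>lborel) \<noteq> 0"
  proof
    assume "(\<integral>y. bump r 0 (y::'a) \<partial>lborel) = 0"
    then have "AE y in lborel. bump r 0 (y::'a) = 0"
      using integral_nonneg_eq_0_iff_AE[OF i] bump_nonneg by auto
    then have "AE y in lborel. (y::'a) \<notin> ball 0 r"
    proof eventually_elim
      case (elim y)
      show ?case
      proof
        assume "y \<in> ball 0 r"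
        then have "(norm y)\<^sup>2 < r\<^sup>2" by (simp add: power_strict_mono)
        with elim show False by (simp add: bump_def exp_cutoff_def dot_square_norm)
      qed
    qed
    then have "ball (0::'a) r \<in> null_sets lborel" by (subst (asm) AE_iff_null_sets[symmetric]) auto
    then have "negligible (ball (0::'a) r)" by (simp add: negligible_iff_null_sets null_sets_completionI)
    then show False using assms by (metis open_not_negligible open_ball ball_eq_empty not_less)
  qed
  moreover have "(\<integral>y. bump r 0 (y::'a) \<partial>lborel) \<ge> 0" using bump_nonneg by (intro Bochner_Integration.integral_nonneg) auto
  ultimately show "(\<integral>y. bump r 0 (y::'a) \<partial>lborel) > 0" by linarith
qed

lemma mollifier_integral: assumes "r > 0"
  shows "(\<integral>y. mollifier r 0 (y::'a::euclidean_space) \<partial>lborel) = 1" "integrable lborel (mollifier r (0::'a))"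
  using bump_integral_pos[OF assms, where ?'a='a] bump_integrable[OF assms, where ?'a='a]
  unfolding mollifier_def[abs_def] by auto

text \<open>The kernel is centred at the evaluation point, so \<open>mollifier r x\<close> is itself
  a test function and can be inserted into a weak formulation.\<close>

definition moll :: "real \<Rightarrow> ('a::euclidean_space \<Rightarrow> real) \<Rightarrow> 'a \<Rightarrow> real" where
  "moll r u x = (\<integral>y. u y * mollifier r x y \<partial>lborel)"

lemma mollifier_borel: "r > 0 \<Longrightarrow> mollifier r c \<in> borel_measurable borel"
  by (rule test_function_borel[OF test_function_mollifier[of r c UNIV]]) auto

lemma moll_conv: "moll r u = (\<lambda>x. \<integral>y. u y * mollifier r 0 (y - x) \<partial>lborel)"
  unfolding moll_def by (subst mollifier_shift) (rule refl)

lemma moll_smooth: "r > 0 \<Longrightarrow> loc_int u \<Longrightarrow> smooth_on UNIV (moll r u)"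
  unfolding moll_conv by (rule convolution_smooth) (auto intro: test_function_mollifier)

lemma moll_nonneg: "(\<And>x. u x \<ge> 0) \<Longrightarrow> moll r u x \<ge> 0"
  unfolding moll_def by (intro Bochner_Integration.integral_nonneg) (auto simp: mollifier_nonneg)

lemma moll_eq_0:
  assumes "r > 0" "\<And>y. norm (y - x) < r \<Longrightarrow> u y = 0" shows "moll r u x = 0"
proof -
  have "u y * mollifier r x y = 0" for y
    using assms mollifier_eq_0[of r y x] by (cases "norm (y - x) < r") auto
  then have "(\<lambda>y. u y * mollifier r x y) = (\<lambda>_. 0)" by (rule ext)
  then show ?thesis by (simp add: moll_def)
qed

text \<open>Integrals run over the whole space even when \<open>\<Omega>\<close> is smaller, because
  test functions vanish outside \<open>\<Omega>\<close>. Integrability of \<open>u\<close> and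
  \<open>g\<close> is kept out of this notion and supplied separately where it is used.\<close>

definition wderiv :: "'a::euclidean_space set \<Rightarrow> 'a \<Rightarrow> ('a \<Rightarrow> real) \<Rightarrow> ('a \<Rightarrow> real) \<Rightarrow> bool" where
  "wderiv \<Omega> e u g \<longleftrightarrow> (\<forall>\<phi>. test_function \<Omega> \<phi> \<longrightarrow>
     (\<integral>x. u x * dir_deriv e \<phi> x \<partial>lborel) = - (\<integral>x. g x * \<phi> x \<partial>lborel))"

lemma moll_has_derivative:
  assumes "r > 0" "loc_int u"
  shows "(moll r u has_derivative (\<lambda>h. \<Sum>e\<in>Basis. (h \<bullet> e) * dir_deriv e (moll r u) x)) (at x)"
proof -
  have "moll r u differentiable (at x)"
    using moll_smooth[OF assms] unfolding smooth_on_def by (metis UNIV_I empty_set empty_subsetI iter_deriv_Nil)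
  then show ?thesis by (rule has_derivative_dir_deriv)
qed

lemma moll_continuous: "r > 0 \<Longrightarrow> loc_int u \<Longrightarrow> continuous_on UNIV (moll r u)"
  using moll_has_derivative by (meson continuous_at_imp_continuous_on has_derivative_continuous)

text \<open>The derivative falls on the kernel, and the kernel centred at \<open>x\<close> is an
  admissible test function as soon as the closed ball of radius \<open>r\<close> about
  \<open>x\<close> lies in \<open>\<Omega>\<close>. At such points mollification commutes with the
  weak derivative.\<close>

lemma moll_dir_deriv:
  assumes r: "r > 0" and u: "loc_int u" and w: "wderiv \<Omega> e u g" and x: "cball x r \<subseteq> \<Omega>" and e: "e \<in> Basis"
  shows "dir_deriv e (moll r u) x = moll r g x"
proof -
  have t: "test_function UNIV (mollifier r (0::'a))" using r by (intro test_function_mollifier) auto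
  have "dir_deriv e (moll r u) x = - (\<integral>y. u y * dir_deriv e (mollifier r 0) (y - x) \<partial>lborel)"
    unfolding moll_conv using e
    by (subst dir_deriv_eq[OF convolution_has_derivative[OF u t]]) (rule sum_inner_Basis_mult)
  also have "(\<lambda>y. dir_deriv e (mollifier r 0) (y - x)) = dir_deriv e (mollifier r x)"
  proof
    fix y
    have "((\<lambda>y. y - x) has_derivative (\<lambda>h. h)) (at y)" by (auto intro!: derivative_eq_intros)
    then have "((\<lambda>y. mollifier r 0 (y - x)) has_derivative frechet_derivative (mollifier r 0) (at (y - x))) (at y)"
      using has_derivative_compose[of "\<lambda>y. y - x" "\<lambda>h. h" y UNIV "mollifier r 0" "frechet_derivative (mollifier r 0) (at (y - x))"]
        test_function_differentiable[OF t] by (auto simp: frechet_derivative_works intro: derivative_eq_intros)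
    then have "(mollifier r x has_derivative frechet_derivative (mollifier r 0) (at (y - x))) (at y)"
      by (simp add: mollifier_shift[of r x, abs_def])
    then show "dir_deriv e (mollifier r 0) (y - x) = dir_deriv e (mollifier r x) y"
      by (simp add: dir_deriv_eq) (simp add: dir_deriv_def)
  qed
  then have "(\<integral>y. u y * dir_deriv e (mollifier r 0) (y - x) \<partial>lborel) = (\<integral>y. u y * dir_deriv e (mollifier r x) y \<partial>lborel)"
    by metis
  also have "\<dots> = - (\<integral>y. g y * mollifier r x y \<partial>lborel)"
    using w test_function_mollifier[OF r x] by (simp add: wderiv_def)
  finally show ?thesis unfolding moll_def[of r g x] by simp
qed

lemma moll_test_function:
  assumes r: "r > 0" and u: "loc_int u" and K: "compact K" "\<And>x. x \<notin> K \<Longrightarrow> u x = 0"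
    and \<Omega>: "\<And>x. x \<in> K \<Longrightarrow> cball x r \<subseteq> \<Omega>"
  shows "test_function \<Omega> (moll r u)"
proof -
  define K' where "K' = {x + y |x y. x \<in> K \<and> y \<in> cball 0 r}"
  have K': "compact K'" unfolding K'_def by (intro compact_sums K) simp
  have z: "moll r u x = 0" if "x \<notin> K'" for x
  proof (rule moll_eq_0[OF r])
    fix y assume "norm (y - x) < r"
    then have "y + (x - y) \<in> K'" if "y \<in> K"
      unfolding K'_def using that by (intro CollectI exI[of _ y] exI[of _ "x - y"]) (auto simp: norm_minus_commute)
    then have "y \<notin> K" using \<open>x \<notin> K'\<close> by auto
    then show "u y = 0" by (rule K)
  qed
  have "closure {x. moll r u x \<noteq> 0} \<subseteq> K'" using z K' by (intro closure_minimal) (auto intro: compact_imp_closed)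
  moreover have "K' \<subseteq> \<Omega>"
  proof
    fix z assume "z \<in> K'"
    then obtain x y where "z = x + y" "x \<in> K" "norm y \<le> r" by (auto simp: K'_def)
    then show "z \<in> \<Omega>" using \<Omega>[of x] by (auto simp: subset_iff dist_norm)
  qed
  moreover have "compact (closure {x. moll r u x \<noteq> 0})"
    using calculation(1) K' by (meson compact_imp_bounded bounded_subset closed_closure compact_eq_bounded_closed)
  ultimately show ?thesis using moll_smooth[OF r u] by (auto simp: test_function_def)
qed

lemma moll_bounded:
  assumes r: "r > 0" and m: "u \<in> borel_measurable borel" and b: "\<And>x. \<bar>u x\<bar> \<le> B"
  shows "\<bar>moll r u x\<bar> \<le> B"
proof -
  have [measurable]: "u \<in> borel_measurable borel" "mollifier r x \<in> borel_measurable borel"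
    "mollifier r (0::'a) \<in> borel_measurable borel"
    using m mollifier_borel[OF r] by auto
  have i: "integrable lborel (mollifier r x)" "(\<integral>y. mollifier r x y \<partial>lborel) = 1"
    using mollifier_integral[OF r, where ?'a='a] integrable_translate[of "mollifier r 0" "- x"]
      integral_translate[of "mollifier r 0" "- x"] by (simp_all add: mollifier_shift[of r x, abs_def])
  have "norm (moll r u x) \<le> (\<integral>y. B * mollifier r x y \<partial>lborel)"
    unfolding moll_def
  proof (rule Bochner_Integration.integral_norm_bound_integral)
    show *: "norm (u y * mollifier r x y) \<le> B * mollifier r x y" for y
      using b[of y] mollifier_nonneg[of r x y] by (simp add: abs_mult mult_right_mono)
    show 1: "integrable lborel (\<lambda>y. B * mollifier r x y)" using i by (intro integrable_mult_right)
    have "norm (u y * mollifier r x y) \<le> norm (B * mollifier r x y)" for y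
      using *[of y] by (rule order_trans) simp
    then show "integrable lborel (\<lambda>y. u y * mollifier r x y)"
      by (intro Bochner_Integration.integrable_bound[OF 1] AE_I2) measurable
  qed
  also have "\<dots> = B" using i by simp
  finally show ?thesis by simp
qed

lemma moll_L2:
  assumes r: "r > 0" and u: "u \<in> L2"
    and e: "\<And>y. norm y \<le> r \<Longrightarrow> (\<integral>x. (u (x + y) - u x)\<^sup>2 \<partial>lborel) \<le> e"
  shows "moll r u \<in> L2" "(\<integral>x. (moll r u x - u x)\<^sup>2 \<partial>lborel) \<le> e"
proof -
  define M where "M = density lborel (\<lambda>y. ennreal (mollifier r (0::'a) y))"
  \<comment> \<open>The shift is set to 0 outside the ball, where the density of \<open>M\<close>
    vanishes anyway; this makes the hypothesis on short shifts applicable at every point of the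
    measure space.\<close>
  define Y where "Y s = (if norm s \<le> r then s else 0)" for s :: 'a
  have [measurable]: "u \<in> borel_measurable borel" "mollifier r (0::'a) \<in> borel_measurable borel"
    using u mollifier_borel[OF r] by (auto simp: L2_def)
  have [measurable]: "Y \<in> borel_measurable M" unfolding Y_def M_def by measurable
  have 1: "emeasure M (space M) = 1"
    unfolding M_def using mollifier_integral[OF r, where ?'a='a] mollifier_nonneg
    by (simp add: emeasure_density) (subst nn_integral_eq_integral, auto)
  have eq: "moll r u = (\<lambda>x. \<integral>s. u (x + Y s) \<partial>M)"
  proof
    fix x
    have "moll r u x = (\<integral>y. u y * mollifier r 0 (y - x) \<partial>lborel)" by (simp add: moll_conv)
    also have "\<dots> = (\<integral>y. u (y + x) * mollifier r 0 (y + x - x) \<partial>lborel)"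
      by (rule integral_translate[symmetric]) measurable
    also have "\<dots> = (\<integral>s. mollifier r 0 s *\<^sub>R u (x + Y s) \<partial>lborel)"
      using mollifier_eq_0[OF r, of _ "0::'a"]
      by (intro Bochner_Integration.integral_cong) (auto simp: Y_def add.commute)
    also have "\<dots> = (\<integral>s. u (x + Y s) \<partial>M)"
      unfolding M_def Y_def by (rule integral_density[symmetric]) (auto simp: mollifier_nonneg)
    finally show "moll r u x = (\<integral>s. u (x + Y s) \<partial>M)" .
  qed
  have e': "(\<integral>x. (u (x + Y s) - u x)\<^sup>2 \<partial>lborel) \<le> e" for s
    using e[of s] e[of 0] r by (auto simp: Y_def)
  have e0: "e \<ge> 0" using e[of 0] r by simp
  show "moll r u \<in> L2" "(\<integral>x. (moll r u x - u x)\<^sup>2 \<partial>lborel) \<le> e"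
    unfolding eq using L2_average[OF u 1 \<open>Y \<in> borel_measurable M\<close> e' e0] by auto
qed

lemma moll_in_L2:
  assumes r: "r > 0" and u: "u \<in> L2" shows "moll r u \<in> L2"
proof (rule moll_L2(1)[OF r u])
  fix y
  have "(\<lambda>x. - u x) \<in> L2" using L2_cmult[OF u, of "-1"] by simp
  from L2_triangle_sq[OF L2_translate[OF u, of y] this]
  show "(\<integral>x. (u (x + y) - u x)\<^sup>2 \<partial>lborel) \<le> 4 * (\<integral>x. (u x)\<^sup>2 \<partial>lborel)"
    using integral_translate[of "\<lambda>x. (u x)\<^sup>2" y] u unfolding power2_minus by (auto simp: L2_def)
qed

lemma moll_tendsto_L2:
  assumes u: "u \<in> L2" and r: "r > 0"
  shows "(\<lambda>n. \<integral>x. (moll (r / Suc n) u x - u x)\<^sup>2 \<partial>lborel) \<longlonglongrightarrow> 0"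
proof (rule LIMSEQ_I)
  fix e :: real assume "e > 0"
  then obtain d where d: "d > 0" "\<And>y. norm y \<le> d \<Longrightarrow> (\<integral>x. (u (x + y) - u x)\<^sup>2 \<partial>lborel) \<le> e/2"
    using L2_translation_continuous[OF u, of "e/2"] by auto
  have "(\<lambda>n. r / real (Suc n)) \<longlonglongrightarrow> 0" by (rule lim_const_over_n[THEN LIMSEQ_Suc])
  then have "\<forall>\<^sub>F n in sequentially. r / real (Suc n) < d" using d by (intro order_tendstoD(2))
  then obtain N where N: "\<And>n. n \<ge> N \<Longrightarrow> r / real (Suc n) < d" by (auto simp: eventually_sequentially)
  show "\<exists>N. \<forall>n\<ge>N. norm ((\<integral>x. (moll (r / Suc n) u x - u x)\<^sup>2 \<partial>lborel) - 0) < e"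
  proof (intro exI allI impI)
    fix n assume "n \<ge> N"
    then have "(\<integral>x. (moll (r / Suc n) u x - u x)\<^sup>2 \<partial>lborel) \<le> e/2"
      using r N[of n] d by (intro moll_L2 u) auto
    then show "norm ((\<integral>x. (moll (r / Suc n) u x - u x)\<^sup>2 \<partial>lborel) - 0) < e" using \<open>e > 0\<close> by simp
  qed
qed

section \<open>Calculus of weak derivatives\<close>

text \<open>Testing a single weak derivative takes one continuous derivative in that direction. The
  class is this large because cut-offs built from squared positive parts are not smooth, and because
  multiplication by a coefficient then asks only for the derivative of that coefficient in direction
  \<open>e\<close>.\<close>

definition tdir :: "'a::euclidean_space set \<Rightarrow> 'a \<Rightarrow> ('a \<Rightarrow> real) \<Rightarrow> ('a \<Rightarrow> real) \<Rightarrow> bool" where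
  "tdir \<Omega> e \<Theta> \<Theta>' \<longleftrightarrow> continuous_on UNIV \<Theta> \<and> continuous_on UNIV \<Theta>' \<and>
     (\<forall>x. ((\<lambda>s. \<Theta> (x + s *\<^sub>R e)) has_real_derivative \<Theta>' x) (at 0)) \<and>
     (\<exists>K. compact K \<and> K \<subseteq> \<Omega> \<and> (\<forall>x. x \<notin> K \<longrightarrow> \<Theta> x = 0 \<and> \<Theta>' x = 0))"

section \<open>Differentiation along a line and compactly supported test functions\<close>

lemma has_derivative_along:
  fixes u :: "'a::euclidean_space \<Rightarrow> real"
  assumes "(u has_derivative D) (at x)"
  shows "((\<lambda>s. u (x + s *\<^sub>R e)) has_real_derivative D e) (at 0)"
proof -
  have 1: "((\<lambda>s. x + s *\<^sub>R e) has_derivative (\<lambda>s. s *\<^sub>R e)) (at 0)"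
    by (auto intro!: derivative_eq_intros)
  have "((\<lambda>s. u (x + s *\<^sub>R e)) has_derivative (\<lambda>s. D (s *\<^sub>R e))) (at 0)"
    by (rule has_derivative_compose[OF 1]) (use assms in simp)
  moreover have "(\<lambda>s. D (s *\<^sub>R e)) = (\<lambda>s. D e * s)"
    using linear_scale[OF has_derivative_linear[OF assms]] by (auto simp: mult.commute)
  ultimately show ?thesis by (simp add: has_field_derivative_def)
qed

lemma has_derivative_along_zero:
  fixes F :: "'a::euclidean_space \<Rightarrow> real"
  assumes "closed K" "x \<notin> K" "\<And>x. x \<notin> K \<Longrightarrow> F x = 0"
  shows "((\<lambda>s. F (x + s *\<^sub>R e)) has_real_derivative 0) (at 0)"
proof -
  have "((\<lambda>x. 0) has_derivative (\<lambda>h. 0)) (at x)" by simp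
  then have "(F has_derivative (\<lambda>h. 0)) (at x)"
    by (rule has_derivative_transform_within_open[of _ _ _ _ "- K"]) (use assms in auto)
  from has_derivative_along[OF this] show ?thesis .
qed

lemma line_derivative:
  fixes F :: "'a::real_normed_vector \<Rightarrow> real"
  assumes "\<And>x. ((\<lambda>s. F (x + s *\<^sub>R e)) has_real_derivative F' x) (at 0)"
  shows "((\<lambda>s. F (x + s *\<^sub>R e)) has_real_derivative F' (x + t *\<^sub>R e)) (at t)"
proof -
  have "((\<lambda>s. F (x + (s + t) *\<^sub>R e)) has_real_derivative F' (x + t *\<^sub>R e)) (at 0)"
    using assms[of "x + t *\<^sub>R e"] by (simp add: scaleR_add_left add_ac)
  then show ?thesis
    using DERIV_shift[of "\<lambda>s. F (x + s *\<^sub>R e)" "F' (x + t *\<^sub>R e)" 0 t] by simp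
qed

lemma line_increment_le:
  fixes F :: "'a::real_normed_vector \<Rightarrow> real"
  assumes "\<And>x. ((\<lambda>s. F (x + s *\<^sub>R e)) has_real_derivative F' x) (at 0)"
    and B: "\<And>x. \<bar>F' x\<bar> \<le> B"
  shows "\<bar>F (x + h *\<^sub>R e) - F x\<bar> \<le> B * \<bar>h\<bar>"
proof -
  have "norm ((\<lambda>s. F (x + s *\<^sub>R e)) h - (\<lambda>s. F (x + s *\<^sub>R e)) 0) \<le> B * norm (h - 0)"
  proof (rule field_differentiable_bound[of UNIV])
    show "((\<lambda>s. F (x + s *\<^sub>R e)) has_real_derivative F' (x + t *\<^sub>R e)) (at t within UNIV)" for t
      using line_derivative[OF assms(1)] by simp
    show "norm (F' (x + t *\<^sub>R e)) \<le> B" for t using B by simp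
  qed auto
  then show ?thesis unfolding scaleR_zero_left add_0_right by simp
qed

lemma tdirD:
  assumes "tdir \<Omega> e \<Theta> \<Theta>'"
  shows "continuous_on UNIV \<Theta>" "continuous_on UNIV \<Theta>'"
    "\<Theta> \<in> borel_measurable borel" "\<Theta>' \<in> borel_measurable borel"
    "((\<lambda>s. \<Theta> (x + s *\<^sub>R e)) has_real_derivative \<Theta>' x) (at 0)"
  using assms by (auto simp: tdir_def intro: borel_measurable_continuous_onI)

lemma tdirE:
  assumes "tdir \<Omega> e \<Theta> \<Theta>'"
  obtains K B where "compact K" "K \<subseteq> \<Omega>" "\<And>x. x \<notin> K \<Longrightarrow> \<Theta> x = 0" "\<And>x. x \<notin> K \<Longrightarrow> \<Theta>' x = 0"
    "B \<ge> 0" "\<And>x. \<bar>\<Theta> x\<bar> \<le> B" "\<And>x. \<bar>\<Theta>' x\<bar> \<le> B"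
proof -
  obtain K where K: "compact K" "K \<subseteq> \<Omega>" "\<And>x. x \<notin> K \<Longrightarrow> \<Theta> x = 0" "\<And>x. x \<notin> K \<Longrightarrow> \<Theta>' x = 0"
    using assms unfolding tdir_def by auto
  obtain B1 where B1: "B1 \<ge> 0" "\<And>x. \<bar>\<Theta> x\<bar> \<le> B1"
    by (rule continuous_compact_support_bounded[OF tdirD(1)[OF assms] K(1)]) (erule K(3), rule that)
  obtain B2 where B2: "B2 \<ge> 0" "\<And>x. \<bar>\<Theta>' x\<bar> \<le> B2"
    by (rule continuous_compact_support_bounded[OF tdirD(2)[OF assms] K(1)]) (erule K(4), rule that)
  show ?thesis
  proof (rule that[OF K])
    show "max B1 B2 \<ge> 0" using B1 by simp
    show "\<bar>\<Theta> x\<bar> \<le> max B1 B2" for x using B1(2)[of x] by simp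
    show "\<bar>\<Theta>' x\<bar> \<le> max B1 B2" for x using B2(2)[of x] by simp
  qed
qed

lemma tdir_L2:
  assumes "tdir \<Omega> e \<Theta> \<Theta>'" shows "\<Theta> \<in> L2" "\<Theta>' \<in> L2"
proof -
  obtain K B where K: "compact K" "K \<subseteq> \<Omega>" "\<And>x. x \<notin> K \<Longrightarrow> \<Theta> x = 0" "\<And>x. x \<notin> K \<Longrightarrow> \<Theta>' x = 0"
    "B \<ge> 0" "\<And>x. \<bar>\<Theta> x\<bar> \<le> B" "\<And>x. \<bar>\<Theta>' x\<bar> \<le> B" by (rule tdirE[OF assms]) (rule that)
  show "\<Theta> \<in> L2" by (rule L2_bounded_support[OF tdirD(3)[OF assms] K(6) compact_imp_bounded[OF K(1)] K(3)])
  show "\<Theta>' \<in> L2" by (rule L2_bounded_support[OF tdirD(4)[OF assms] K(7) compact_imp_bounded[OF K(1)] K(4)])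
qed

lemma tdir_integrable:
  assumes "tdir \<Omega> e \<Theta> \<Theta>'" shows "integrable lborel \<Theta>" "integrable lborel \<Theta>'"
proof -
  obtain K B where K: "compact K" "K \<subseteq> \<Omega>" "\<And>x. x \<notin> K \<Longrightarrow> \<Theta> x = 0" "\<And>x. x \<notin> K \<Longrightarrow> \<Theta>' x = 0"
    "B \<ge> 0" "\<And>x. \<bar>\<Theta> x\<bar> \<le> B" "\<And>x. \<bar>\<Theta>' x\<bar> \<le> B" by (rule tdirE[OF assms]) (rule that)
  show "integrable lborel \<Theta>" by (rule integrable_bounded_support[OF tdirD(3)[OF assms] K(6) compact_imp_bounded[OF K(1)] K(3)])
  show "integrable lborel \<Theta>'" by (rule integrable_bounded_support[OF tdirD(4)[OF assms] K(7) compact_imp_bounded[OF K(1)] K(4)])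
qed

lemma tdir_test_function:
  assumes t: "test_function \<Omega> \<phi>" and e: "e \<in> Basis"
  shows "tdir \<Omega> e \<phi> (dir_deriv e \<phi>)"
proof -
  obtain K where K: "compact K" "K \<subseteq> \<Omega>" "\<And>x. x \<notin> K \<Longrightarrow> \<phi> x = 0" "\<And>x e. x \<notin> K \<Longrightarrow> dir_deriv e \<phi> x = 0"
    by (rule test_functionE[OF t]) (rule that)
  have "((\<lambda>s. \<phi> (x + s *\<^sub>R e)) has_real_derivative dir_deriv e \<phi> x) (at 0)" for x
    using has_derivative_along[OF has_derivative_dir_deriv[OF test_function_differentiable[OF t]], of x e]
      sum_inner_Basis_mult[OF e, of "\<lambda>e. dir_deriv e \<phi> x"] by simp
  then show ?thesis
    using test_function_continuous[OF t] test_function_continuous[OF test_function_dir_deriv[OF t e]] K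
    unfolding tdir_def by auto
qed

lemma continuous_on_UNIV_glue:
  fixes g :: "'a::euclidean_space \<Rightarrow> real"
  assumes "open \<Omega>" "continuous_on \<Omega> g" "compact K" "K \<subseteq> \<Omega>" "\<And>x. x \<notin> K \<Longrightarrow> g x = 0"
  shows "continuous_on UNIV g"
proof -
  have "continuous_on (- K) g" using assms(5) by (subst continuous_on_cong[of _ _ _ "\<lambda>x. 0"]) auto
  then have "continuous_on (\<Omega> \<union> - K) g"
    using assms(1,2) open_Compl[OF compact_imp_closed[OF assms(3)]] by (intro continuous_on_open_Un)
  moreover have "\<Omega> \<union> - K = UNIV" using assms(4) by auto
  ultimately show ?thesis by simp
qed

lemma tdir_mult_local:
  assumes o: "open \<Omega>" and A: "continuous_on \<Omega> A" "continuous_on \<Omega> A'"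
    and d: "\<And>x. x \<in> \<Omega> \<Longrightarrow> ((\<lambda>s. A (x + s *\<^sub>R e)) has_real_derivative A' x) (at 0)"
    and t: "tdir \<Omega> e \<Theta> \<Theta>'"
  shows "tdir \<Omega> e (\<lambda>x. A x * \<Theta> x) (\<lambda>x. A' x * \<Theta> x + A x * \<Theta>' x)"
proof -
  obtain K where K: "compact K" "K \<subseteq> \<Omega>" "\<And>x. x \<notin> K \<Longrightarrow> \<Theta> x = 0" "\<And>x. x \<notin> K \<Longrightarrow> \<Theta>' x = 0"
    using t unfolding tdir_def by auto
  have c: "continuous_on \<Omega> \<Theta>" "continuous_on \<Omega> \<Theta>'"
    using tdirD[OF t] by (auto intro: continuous_on_subset)
  have "continuous_on UNIV (\<lambda>x. A x * \<Theta> x)"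
    by (rule continuous_on_UNIV_glue[OF o _ K(1,2)]) (use K A c in \<open>auto intro!: continuous_intros\<close>)
  moreover have "continuous_on UNIV (\<lambda>x. A' x * \<Theta> x + A x * \<Theta>' x)"
    by (rule continuous_on_UNIV_glue[OF o _ K(1,2)]) (use K A c in \<open>auto intro!: continuous_intros\<close>)
  moreover have "((\<lambda>s. A (x + s *\<^sub>R e) * \<Theta> (x + s *\<^sub>R e)) has_real_derivative A' x * \<Theta> x + A x * \<Theta>' x) (at 0)" for x
  proof (cases "x \<in> \<Omega>")
    case True
    show ?thesis
      using DERIV_mult[OF d[OF True] tdirD(5)[OF t, of x]] by (simp add: algebra_simps)
  next
    case False
    then have x: "x \<notin> K" using K by auto
    have "((\<lambda>s. (\<lambda>x. A x * \<Theta> x) (x + s *\<^sub>R e)) has_real_derivative 0) (at 0)"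
      by (rule has_derivative_along_zero[OF compact_imp_closed[OF K(1)] x]) (use K in auto)
    then show ?thesis using x K by simp
  qed
  ultimately show ?thesis unfolding tdir_def using K by auto
qed

lemma tdir_mult:
  assumes "tdir \<Omega> e \<Theta> \<Theta>'" "tdir UNIV e \<zeta> \<zeta>'"
  shows "tdir \<Omega> e (\<lambda>x. \<Theta> x * \<zeta> x) (\<lambda>x. \<Theta>' x * \<zeta> x + \<Theta> x * \<zeta>' x)"
proof -
  obtain K where K: "compact K" "K \<subseteq> \<Omega>" "\<And>x. x \<notin> K \<Longrightarrow> \<Theta> x = 0" "\<And>x. x \<notin> K \<Longrightarrow> \<Theta>' x = 0"
    using assms(1) unfolding tdir_def by auto
  have "tdir UNIV e (\<lambda>x. \<Theta> x * \<zeta> x) (\<lambda>x. \<Theta>' x * \<zeta> x + \<Theta> x * \<zeta>' x)"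
    by (rule tdir_mult_local[OF open_UNIV tdirD(1,2,5)[OF assms(1)] assms(2)])
  then show ?thesis using K unfolding tdir_def by (auto intro!: exI[of _ K])
qed

text \<open>Difference quotients of \<open>F\<close> have integral zero by translation invariance,
  and they converge to \<open>F'\<close> under the bound \<open>B\<close> on a ball that contains
  all shifted supports.\<close>

lemma tdir_integral_zero:
  assumes t: "tdir \<Omega> e F F'"
  shows "(\<integral>x. F' x \<partial>lborel) = 0"
proof -
  obtain K B where K: "compact K" "K \<subseteq> \<Omega>" "\<And>x. x \<notin> K \<Longrightarrow> F x = 0" "\<And>x. x \<notin> K \<Longrightarrow> F' x = 0"
    "B \<ge> 0" "\<And>x. \<bar>F x\<bar> \<le> B" "\<And>x. \<bar>F' x\<bar> \<le> B" by (rule tdirE[OF t]) (rule that)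
  obtain r where r: "K \<subseteq> cball 0 r"
    using compact_imp_bounded[OF K(1)] unfolding bounded_iff subset_iff mem_cball_0 by blast
  have [measurable]: "F \<in> borel_measurable borel" "F' \<in> borel_measurable borel" using tdirD[OF t] by auto
  define h where "h n = 1 / real (Suc n)" for n
  have h: "h n > 0" "h n \<le> 1" for n by (auto simp: h_def)
  have hl: "h \<longlonglongrightarrow> 0" unfolding h_def using LIMSEQ_inverse_real_of_nat by (simp add: inverse_eq_divide)
  define f where "f n x = (F (x + h n *\<^sub>R e) - F x) / h n" for n x
  have [measurable]: "f n \<in> borel_measurable borel" for n unfolding f_def by measurable
  have "(\<lambda>n. \<integral>x. f n x \<partial>lborel) \<longlonglongrightarrow> (\<integral>x. F' x \<partial>lborel)"
  proof (rule integral_dominated_convergence[where w="\<lambda>x. B * indicator (cball 0 (r + norm e)) x"])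
    show "integrable lborel (\<lambda>x::'a. B * indicator (cball 0 (r + norm e)) x)" by (rule integrable_indicator_cball)
    show "AE x in lborel. (\<lambda>n. f n x) \<longlonglongrightarrow> F' x"
    proof (rule AE_I2)
      fix x
      have "((\<lambda>s. (F (x + s *\<^sub>R e) - F x) / s) \<longlongrightarrow> F' x) (at 0)"
        using tdirD(5)[OF t, of x] by (simp add: has_field_derivative_iff)
      then show "(\<lambda>n. f n x) \<longlonglongrightarrow> F' x"
        unfolding f_def by (rule filterlim_compose) (use hl h in \<open>auto simp: filterlim_at less_imp_neq[symmetric]\<close>)
    qed
    show "AE x in lborel. norm (f n x) \<le> B * indicator (cball 0 (r + norm e)) x" for n
    proof (rule AE_I2)
      fix x
      show "norm (f n x) \<le> B * indicator (cball 0 (r + norm e)) x"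
      proof (cases "x \<in> cball 0 (r + norm e)")
        case True
        have "\<bar>F (x + h n *\<^sub>R e) - F x\<bar> \<le> B * \<bar>h n\<bar>"
          by (rule line_increment_le[OF tdirD(5)[OF t] K(7)])
        with True h[of n] show ?thesis by (simp add: f_def divide_le_eq abs_divide)
      next
        case False
        have "norm x \<le> norm (x + h n *\<^sub>R e) + norm (h n *\<^sub>R e)"
          using norm_triangle_ineq4[of "x + h n *\<^sub>R e" "h n *\<^sub>R e"] by simp
        moreover have "norm (h n *\<^sub>R e) \<le> norm e" using h[of n] by (simp add: mult_left_le_one_le)
        ultimately have "x + h n *\<^sub>R e \<notin> cball 0 r" "x \<notin> cball 0 r"
          using False norm_ge_zero[of e] unfolding mem_cball_0 by linarith+
        then have "x + h n *\<^sub>R e \<notin> K" "x \<notin> K" using r by blast+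
        then show ?thesis using K(3) False by (simp add: f_def)
      qed
    qed
  qed measurable
  moreover have "(\<integral>x. f n x \<partial>lborel) = 0" for n
  proof -
    have i: "integrable lborel F" using tdir_integrable[OF t] by simp
    then have "integrable lborel (\<lambda>x. F (x + h n *\<^sub>R e))" by (subst integrable_translate) auto
    then show ?thesis using i by (simp add: f_def integral_translate)
  qed
  ultimately show ?thesis by (simp add: LIMSEQ_const_iff)
qed

section \<open>The chain rule for weak derivatives\<close>

lemma L2_AE_subseq:
  assumes "\<And>n. f n \<in> L2" "g \<in> L2" and lim: "(\<lambda>n. \<integral>x. (f n x - g x)\<^sup>2 \<partial>lborel) \<longlonglongrightarrow> 0"
  obtains r :: "nat \<Rightarrow> nat" where "strict_mono r" "AE x in lborel. (\<lambda>n. f (r n) x) \<longlonglongrightarrow> g x"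
proof -
  have "\<exists>r::nat\<Rightarrow>nat. strict_mono r \<and> (AE x in lborel. (\<lambda>n. (f (r n) x - g x)\<^sup>2) \<longlonglongrightarrow> 0)"
    by (rule tendsto_L1_AE_subseq) (use assms in \<open>auto intro!: L2_integrable_sq L2_diff\<close>)
  then obtain r :: "nat \<Rightarrow> nat" where r: "strict_mono r" "AE x in lborel. (\<lambda>n. (f (r n) x - g x)\<^sup>2) \<longlonglongrightarrow> 0" by auto
  from r(2) have "AE x in lborel. (\<lambda>n. f (r n) x) \<longlonglongrightarrow> g x"
  proof eventually_elim
    case (elim x)
    from tendsto_real_sqrt[OF elim] have "(\<lambda>n. \<bar>f (r n) x - g x\<bar>) \<longlonglongrightarrow> 0" by simp
    then have "(\<lambda>n. f (r n) x - g x) \<longlonglongrightarrow> 0" by (rule tendsto_rabs_zero_cancel)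
    then show ?case by (simp add: LIM_zero_iff)
  qed
  with r(1) show ?thesis by (rule that)
qed

lemma squeeze_sq_tendsto:
  assumes "(\<lambda>n. \<integral>x. (d n x)\<^sup>2 \<partial>lborel) \<longlonglongrightarrow> 0" "\<And>n. d n \<in> L2"
    and f: "\<And>n. f n \<in> borel_measurable borel" "\<And>n x. \<bar>f n x\<bar> \<le> B * \<bar>d n x\<bar>"
  shows "(\<lambda>n. \<integral>x. (f n x)\<^sup>2 \<partial>lborel) \<longlonglongrightarrow> 0" "\<And>n. f n \<in> L2"
proof -
  show fL: "f n \<in> L2" for n by (rule L2_dominated[OF f(1) assms(2) f(2)])
  have le: "(\<integral>x. (f n x)\<^sup>2 \<partial>lborel) \<le> B\<^sup>2 * (\<integral>x. (d n x)\<^sup>2 \<partial>lborel)" for n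
  proof -
    have "(\<integral>x. (f n x)\<^sup>2 \<partial>lborel) \<le> (\<integral>x. B\<^sup>2 * (d n x)\<^sup>2 \<partial>lborel)"
    proof (rule integral_mono)
      show "(f n x)\<^sup>2 \<le> B\<^sup>2 * (d n x)\<^sup>2" for x
        using power_mono[OF f(2)[of n x], of 2] by (simp add: power_mult_distrib)
    qed (intro integrable_mult_right L2_integrable_sq fL assms)+
    then show ?thesis by simp
  qed
  have "(\<lambda>n. B\<^sup>2 * (\<integral>x. (d n x)\<^sup>2 \<partial>lborel)) \<longlonglongrightarrow> 0" by (rule tendsto_mult_right_zero[OF assms(1)])
  then show "(\<lambda>n. \<integral>x. (f n x)\<^sup>2 \<partial>lborel) \<longlonglongrightarrow> 0"
    by (rule Lim_null_comparison[OF always_eventually[OF allI], rotated]) (use le in simp)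
qed

text \<open>The nonlinearities are continuous on the half-line only; precomposition with
  \<open>max 0\<close> extends them continuously without changing the composite.\<close>

lemma continuous_on_nonneg_borel:
  assumes "continuous_on {0..} (b :: real \<Rightarrow> real)" "u \<in> borel_measurable M" "\<And>x. u x \<ge> 0"
  shows "(\<lambda>x. b (u x)) \<in> borel_measurable M"
proof -
  have "continuous_on UNIV (\<lambda>s. b (max 0 s))"
    by (rule continuous_on_compose2[OF assms(1)]) (auto intro!: continuous_intros)
  then have [measurable]: "(\<lambda>s. b (max 0 s)) \<in> borel_measurable borel" by (rule borel_measurable_continuous_onI)
  have [measurable]: "u \<in> borel_measurable M" by fact
  have "(\<lambda>x. (\<lambda>s. b (max 0 s)) (u x)) \<in> borel_measurable M" by measurable
  then show ?thesis using assms(3) by (simp add: max_def)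
qed

context
  fixes \<beta> b :: "real \<Rightarrow> real" and B :: real
  assumes bc: "continuous_on {0..} b" and bB: "\<And>s. s \<ge> 0 \<Longrightarrow> \<bar>b s\<bar> \<le> B"
    and \<beta>: "\<And>s. s \<ge> 0 \<Longrightarrow> (\<beta> has_real_derivative b s) (at s within {0..})"
begin

lemma chain_Lipschitz:
  assumes "s \<ge> 0" "t \<ge> 0" shows "\<bar>\<beta> s - \<beta> t\<bar> \<le> B * \<bar>s - t\<bar>"
  using field_differentiable_bound[of "{0..}" \<beta> b B s t] \<beta> bB assms by (auto simp: convex_real_interval)

lemma chain_continuous: "continuous_on {0..} \<beta>"
  using \<beta> by (meson DERIV_continuous atLeast_iff continuous_on_eq_continuous_within)

lemma chain_integrable:
  assumes t: "tdir \<Omega> e \<Theta> \<Theta>'" and u: "u \<in> L2" "\<And>x. u x \<ge> 0" and g: "g \<in> L2"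
  shows "integrable lborel (\<lambda>x. \<Theta>' x * \<beta> (u x))" "integrable lborel (\<lambda>x. \<Theta> x * b (u x) * g x)"
proof -
  have um[measurable]: "u \<in> borel_measurable borel" "g \<in> borel_measurable borel" using u g by (auto simp: L2_def)
  have bm[measurable]: "(\<lambda>x. b (u x)) \<in> borel_measurable borel" "(\<lambda>x. \<beta> (u x)) \<in> borel_measurable borel"
    by (rule continuous_on_nonneg_borel[OF bc um(1) u(2)], rule continuous_on_nonneg_borel[OF chain_continuous um(1) u(2)])
  \<comment> \<open>\<open>\<beta> 0\<close> need not vanish, and a nonzero constant is not square
    integrable; it is split off and paired with the integrable \<open>\<Theta>'\<close>.\<close>
  have L: "(\<lambda>x. \<beta> (u x) - \<beta> 0) \<in> L2"
  proof (rule L2_dominated[OF _ u(1)])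
    show "(\<lambda>x. \<beta> (u x) - \<beta> 0) \<in> borel_measurable borel" by measurable
    show "\<bar>\<beta> (u x) - \<beta> 0\<bar> \<le> B * \<bar>u x\<bar>" for x using chain_Lipschitz[OF u(2), of 0 x] by simp
  qed
  have "integrable lborel (\<lambda>x. \<Theta>' x * (\<beta> (u x) - \<beta> 0) + \<beta> 0 * \<Theta>' x)"
    by (intro Bochner_Integration.integrable_add L2_mult_integrable tdir_L2[OF t] L integrable_mult_right tdir_integrable[OF t])
  then show "integrable lborel (\<lambda>x. \<Theta>' x * \<beta> (u x))" by (simp add: algebra_simps)
  have "(\<lambda>x. b (u x) * g x) \<in> L2"
    by (rule L2_bounded_mult[OF g bm(1)]) (rule bB[OF u(2)])
  from L2_mult_integrable[OF tdir_L2(1)[OF t] this]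
  show "integrable lborel (\<lambda>x. \<Theta> x * b (u x) * g x)" by (simp add: mult.assoc)
qed

text \<open>The mollified functions \<open>U n\<close> satisfy the identity classically on the
  support of \<open>\<Theta>\<close>, where mollification commutes with the weak derivative. In the
  limit \<open>\<beta> (U n) - \<beta> (u)\<close> tends to 0 in L^2 by the Lipschitz bound and
  \<open>G n\<close> tends to \<open>g\<close> in L^2, while \<open>b (U n)\<close> converges only
  almost everywhere along a subsequence and is handled through its bound \<open>B\<close>.\<close>

lemma weak_chain_rule:
  assumes o: "open \<Omega>" and e: "e \<in> Basis" and u: "u \<in> L2" "\<And>x. u x \<ge> 0" and g: "g \<in> L2"
    and w: "wderiv \<Omega> e u g" and t: "tdir \<Omega> e \<Theta> \<Theta>'"
  shows "(\<integral>x. \<Theta>' x * \<beta> (u x) + \<Theta> x * b (u x) * g x \<partial>lborel) = 0"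
proof -
  obtain K CC where K: "compact K" "K \<subseteq> \<Omega>" "\<And>x. x \<notin> K \<Longrightarrow> \<Theta> x = 0" "\<And>x. x \<notin> K \<Longrightarrow> \<Theta>' x = 0"
    "CC \<ge> 0" "\<And>x. \<bar>\<Theta> x\<bar> \<le> CC" "\<And>x. \<bar>\<Theta>' x\<bar> \<le> CC" by (rule tdirE[OF t]) (rule that)
  obtain d where d: "d > 0" "(\<Union>x\<in>K. cball x d) \<subseteq> \<Omega>"
    using compact_subset_open_imp_cball_epsilon_subset[OF K(1) o K(2)] by blast
  define r where "r n = d / real (Suc n)" for n
  have r: "r n > 0" "r n \<le> d" for n using d by (auto simp: r_def divide_le_eq)
  have cb: "cball x (r n) \<subseteq> \<Omega>" if "x \<in> K" for x n
    using d(2) that subset_cball[OF r(2)[of n], of x] by blast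
  define U where "U n = moll (r n) u" for n
  define G where "G n = moll (r n) g" for n
  have UL: "U n \<in> L2" and GL: "G n \<in> L2" for n
    unfolding U_def G_def by (rule moll_in_L2[OF r(1) u(1)], rule moll_in_L2[OF r(1) g])
  have U0: "U n x \<ge> 0" for n x unfolding U_def by (rule moll_nonneg[OF u(2)])
  have Uc: "continuous_on UNIV (U n)" "continuous_on UNIV (G n)" for n
    unfolding U_def G_def by (rule moll_continuous[OF r(1) L2_loc_int[OF u(1)]], rule moll_continuous[OF r(1) L2_loc_int[OF g]])
  have Ulim: "(\<lambda>n. \<integral>x. (U n x - u x)\<^sup>2 \<partial>lborel) \<longlonglongrightarrow> 0" "(\<lambda>n. \<integral>x. (G n x - g x)\<^sup>2 \<partial>lborel) \<longlonglongrightarrow> 0"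
    unfolding U_def G_def r_def by (rule moll_tendsto_L2[OF u(1) d(1)], rule moll_tendsto_L2[OF g d(1)])
  have um[measurable]: "u \<in> borel_measurable borel" "g \<in> borel_measurable borel"
    "U n \<in> borel_measurable borel" "G n \<in> borel_measurable borel" for n using u g UL GL by (auto simp: L2_def)
  have tm[measurable]: "\<Theta> \<in> borel_measurable borel" "\<Theta>' \<in> borel_measurable borel" using tdirD[OF t] by auto
  have bm[measurable]: "(\<lambda>x. b (u x)) \<in> borel_measurable borel" "(\<lambda>x. \<beta> (u x)) \<in> borel_measurable borel"
    by (rule continuous_on_nonneg_borel[OF bc um(1) u(2)], rule continuous_on_nonneg_borel[OF chain_continuous um(1) u(2)])
  have bUm[measurable]: "(\<lambda>x. b (U n x)) \<in> borel_measurable borel" "(\<lambda>x. \<beta> (U n x)) \<in> borel_measurable borel" for n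
    by (rule continuous_on_nonneg_borel[OF bc um(3) U0], rule continuous_on_nonneg_borel[OF chain_continuous um(3) U0])
  have classical: "(\<integral>x. \<Theta>' x * \<beta> (U n x) + \<Theta> x * b (U n x) * G n x \<partial>lborel) = 0" for n
  proof (rule tdir_integral_zero)
    have c: "continuous_on UNIV (\<lambda>x. \<beta> (U n x))" "continuous_on UNIV (\<lambda>x. b (U n x))"
      by (rule continuous_on_compose2[OF chain_continuous Uc(1)], use U0 in auto)
         (rule continuous_on_compose2[OF bc Uc(1)], use U0 in auto)
    have "((\<lambda>s. \<Theta> (x + s *\<^sub>R e) * \<beta> (U n (x + s *\<^sub>R e))) has_real_derivative \<Theta>' x * \<beta> (U n x) + \<Theta> x * b (U n x) * G n x) (at 0)" for x
    proof (cases "x \<in> K")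
      case True
      have "dir_deriv e (U n) x = G n x"
        unfolding U_def G_def by (rule moll_dir_deriv[OF r(1) L2_loc_int[OF u(1)] w cb[OF True] e])
      then have dU: "((\<lambda>s. U n (x + s *\<^sub>R e)) has_real_derivative G n x) (at 0)"
        using has_derivative_along[OF moll_has_derivative[OF r(1) L2_loc_int[OF u(1)]], of n x e]
          sum_inner_Basis_mult[OF e, of "\<lambda>e. dir_deriv e (U n) x"] by (simp add: U_def)
      have "(\<beta> has_real_derivative b (U n (x + 0 *\<^sub>R e))) (at (U n (x + 0 *\<^sub>R e)) within range (\<lambda>s. U n (x + s *\<^sub>R e)))"
        by (rule DERIV_subset[OF \<beta>]) (use U0 in auto)
      from DERIV_image_chain[OF this dU]
      have "((\<lambda>s. \<beta> (U n (x + s *\<^sub>R e))) has_real_derivative b (U n x) * G n x) (at 0)" by (simp add: o_def)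
      from DERIV_mult[OF tdirD(5)[OF t, of x] this] show ?thesis by (simp add: algebra_simps)
    next
      case False
      have "((\<lambda>s. (\<lambda>x. \<Theta> x * \<beta> (U n x)) (x + s *\<^sub>R e)) has_real_derivative 0) (at 0)"
        by (rule has_derivative_along_zero[OF compact_imp_closed[OF K(1)] False]) (use K in auto)
      then show ?thesis using K False by simp
    qed
    moreover have "continuous_on UNIV (\<lambda>x. \<Theta>' x * \<beta> (U n x) + \<Theta> x * b (U n x) * G n x)"
      "continuous_on UNIV (\<lambda>x. \<Theta> x * \<beta> (U n x))"
      by (intro continuous_intros c Uc tdirD(1,2)[OF t])+
    ultimately show "tdir UNIV e (\<lambda>x. \<Theta> x * \<beta> (U n x)) (\<lambda>x. \<Theta>' x * \<beta> (U n x) + \<Theta> x * b (U n x) * G n x)"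
      unfolding tdir_def using K by (auto intro!: exI[of _ K])
  qed
  obtain q :: "nat \<Rightarrow> nat" where q: "strict_mono q" "AE x in lborel. (\<lambda>n. U (q n) x) \<longlonglongrightarrow> u x"
    by (rule L2_AE_subseq[OF UL u(1) Ulim(1)]) (rule that)
  have lim0: "(\<lambda>n. \<integral>x. (U (q n) x - u x)\<^sup>2 \<partial>lborel) \<longlonglongrightarrow> 0" "(\<lambda>n. \<integral>x. (G (q n) x - g x)\<^sup>2 \<partial>lborel) \<longlonglongrightarrow> 0"
    using LIMSEQ_subseq_LIMSEQ[OF Ulim(1) q(1)] LIMSEQ_subseq_LIMSEQ[OF Ulim(2) q(1)] by (auto simp: o_def)
  define f1 where "f1 n x = \<beta> (U (q n) x) - \<beta> (u x)" for n x
  define f2 where "f2 n x = b (U (q n) x) * (G (q n) x - g x)" for n x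
  define f3 where "f3 n x = \<Theta> x * (b (U (q n) x) - b (u x)) * g x" for n x
  have m123[measurable]: "f1 n \<in> borel_measurable borel" "f2 n \<in> borel_measurable borel" "f3 n \<in> borel_measurable borel" for n
    unfolding f1_def f2_def f3_def by measurable
  have f1b: "\<bar>f1 n x\<bar> \<le> B * \<bar>U (q n) x - u x\<bar>" for n x unfolding f1_def by (rule chain_Lipschitz[OF U0 u(2)])
  have f2b: "\<bar>f2 n x\<bar> \<le> B * \<bar>G (q n) x - g x\<bar>" for n x
    unfolding f2_def abs_mult by (rule mult_right_mono[OF bB[OF U0]]) simp
  note s1 = squeeze_sq_tendsto[OF lim0(1) L2_diff[OF UL u(1)] m123(1) f1b]
  note s2 = squeeze_sq_tendsto[OF lim0(2) L2_diff[OF GL g] m123(2) f2b]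
  have T1: "(\<lambda>n. \<integral>x. \<Theta>' x * f1 n x \<partial>lborel) \<longlonglongrightarrow> 0"
    using L2_tendsto_integral[OF s1(2) L2_zero tdir_L2(2)[OF t]] s1(1) by simp
  have T2: "(\<lambda>n. \<integral>x. \<Theta> x * f2 n x \<partial>lborel) \<longlonglongrightarrow> 0"
    using L2_tendsto_integral[OF s2(2) L2_zero tdir_L2(1)[OF t]] s2(1) by simp
  have ti: "integrable lborel (\<lambda>x. \<Theta> x * g x)" by (rule L2_mult_integrable[OF tdir_L2(1)[OF t] g])
  have f3b: "norm (f3 n x) \<le> 2 * B * \<bar>\<Theta> x * g x\<bar>" for n x
  proof -
    have "\<bar>b (U (q n) x) - b (u x)\<bar> \<le> 2 * B" using bB[OF U0[of "q n" x]] bB[OF u(2)[of x]] by linarith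
    then have "\<bar>b (U (q n) x) - b (u x)\<bar> * \<bar>\<Theta> x * g x\<bar> \<le> 2 * B * \<bar>\<Theta> x * g x\<bar>" by (rule mult_right_mono) simp
    then show ?thesis by (simp add: f3_def abs_mult mult_ac)
  qed
  have f3i: "integrable lborel (f3 n)" for n
    by (rule Bochner_Integration.integrable_bound[OF integrable_mult_right[OF integrable_abs[OF ti], of "2 * B"] _ AE_I2[OF order_trans[OF f3b]]])
       (use m123(3) in simp, simp only: real_norm_def abs_ge_self)
  have T3: "(\<lambda>n. \<integral>x. f3 n x \<partial>lborel) \<longlonglongrightarrow> (\<integral>x. 0 \<partial>(lborel::'a measure))"
  proof (rule integral_dominated_convergence[where w="\<lambda>x. 2 * B * \<bar>\<Theta> x * g x\<bar>"])
    show "AE x in lborel. (\<lambda>n. f3 n x) \<longlonglongrightarrow> 0"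
      using q(2)
    proof eventually_elim
      case (elim x)
      have "(\<lambda>n. b (U (q n) x)) \<longlonglongrightarrow> b (u x)"
        by (rule continuous_on_tendsto_compose[OF bc elim]) (use U0 u(2) in auto)
      then have "(\<lambda>n. f3 n x) \<longlonglongrightarrow> \<Theta> x * (b (u x) - b (u x)) * g x"
        unfolding f3_def by (intro tendsto_intros)
      then show ?case by simp
    qed
  qed (use f3b in \<open>auto intro!: integrable_mult_right integrable_abs ti\<close>)
  have "(\<lambda>n. (\<integral>x. \<Theta>' x * f1 n x \<partial>lborel) + (\<integral>x. \<Theta> x * f2 n x \<partial>lborel) + (\<integral>x. f3 n x \<partial>lborel)) \<longlonglongrightarrow> 0 + 0 + 0"
    using T3 by (intro tendsto_add T1 T2) simp
  moreover have "(\<integral>x. \<Theta>' x * f1 n x \<partial>lborel) + (\<integral>x. \<Theta> x * f2 n x \<partial>lborel) + (\<integral>x. f3 n x \<partial>lborel)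
    = - (\<integral>x. \<Theta>' x * \<beta> (u x) + \<Theta> x * b (u x) * g x \<partial>lborel)" for n
  proof -
    note i1 = L2_mult_integrable[OF tdir_L2(2)[OF t] s1(2)[of n]]
    note i2 = L2_mult_integrable[OF tdir_L2(1)[OF t] s2(2)[of n]]
    have "(\<integral>x. \<Theta>' x * f1 n x \<partial>lborel) + (\<integral>x. \<Theta> x * f2 n x \<partial>lborel) + (\<integral>x. f3 n x \<partial>lborel)
      = (\<integral>x. \<Theta>' x * f1 n x + \<Theta> x * f2 n x + f3 n x \<partial>lborel)"
      using i1 i2 f3i[of n] by simp
    also have "\<dots> = (\<integral>x. (\<Theta>' x * \<beta> (U (q n) x) + \<Theta> x * b (U (q n) x) * G (q n) x)
        - (\<Theta>' x * \<beta> (u x) + \<Theta> x * b (u x) * g x) \<partial>lborel)"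
      by (intro Bochner_Integration.integral_cong refl) (simp add: f1_def f2_def f3_def algebra_simps)
    also have "\<dots> = 0 - (\<integral>x. \<Theta>' x * \<beta> (u x) + \<Theta> x * b (u x) * g x \<partial>lborel)"
      unfolding classical[of "q n", symmetric]
      by (rule Bochner_Integration.integral_diff[OF
            Bochner_Integration.integrable_add[OF chain_integrable(1)[OF t UL U0 g] chain_integrable(2)[OF t UL U0 GL]]
            Bochner_Integration.integrable_add[OF chain_integrable(1)[OF t u g] chain_integrable(2)[OF t u g]]])
    finally show ?thesis by simp
  qed
  ultimately have "- (\<integral>x. \<Theta>' x * \<beta> (u x) + \<Theta> x * b (u x) * g x \<partial>lborel) = 0"
    by (simp add: LIMSEQ_const_iff)
  then show ?thesis by simp
qed

end

lemma weak_integration_by_parts: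
  assumes o: "open \<Omega>" and e: "e \<in> Basis" and u: "u \<in> L2" "\<And>x. u x \<ge> 0" and g: "g \<in> L2"
    and w: "wderiv \<Omega> e u g" and t: "tdir \<Omega> e \<Theta> \<Theta>'"
  shows "(\<integral>x. \<Theta>' x * u x \<partial>lborel) = - (\<integral>x. \<Theta> x * g x \<partial>lborel)"
proof -
  have "(\<integral>x. \<Theta>' x * (\<lambda>s. s) (u x) + \<Theta> x * (\<lambda>s. 1) (u x) * g x \<partial>lborel) = 0"
    by (rule weak_chain_rule[where B=1, OF _ _ _ o e u g w t]) (auto intro!: derivative_eq_intros)
  moreover have "integrable lborel (\<lambda>x. \<Theta>' x * u x)" "integrable lborel (\<lambda>x. \<Theta> x * g x)"
    using L2_mult_integrable tdir_L2[OF t] u g by auto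
  ultimately show ?thesis by simp
qed

text \<open>Mollifying \<open>\<Psi>\<close> with radii so small that the neighbourhoods of
  \<open>K\<close> stay in \<open>\<Omega>\<close> gives admissible smooth test functions, and
  coefficients in L^2 make the form continuous under L^2 convergence of the derivatives. The weak
  derivatives \<open>D\<close> are required on the whole space, so that they also account for
  \<open>\<Psi>\<close> being zero off \<open>K\<close>.\<close>

lemma weak_form_extends:
  fixes a D :: "'a::euclidean_space \<Rightarrow> 'a \<Rightarrow> real"
  assumes o: "open \<Omega>" and a: "\<And>e. e \<in> Basis \<Longrightarrow> a e \<in> L2" and a0: "a0 \<in> L2"
    and eq: "\<And>\<psi>. test_function \<Omega> \<psi> \<Longrightarrow> (\<Sum>e\<in>Basis. \<integral>x. a e x * dir_deriv e \<psi> x \<partial>lborel) + (\<integral>x. a0 x * \<psi> x \<partial>lborel) = 0"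
    and \<Psi>: "\<Psi> \<in> L2" and D: "\<And>e. e \<in> Basis \<Longrightarrow> D e \<in> L2" "\<And>e. e \<in> Basis \<Longrightarrow> wderiv UNIV e \<Psi> (D e)"
    and K: "compact K" "K \<subseteq> \<Omega>" "\<And>x. x \<notin> K \<Longrightarrow> \<Psi> x = 0"
  shows "(\<Sum>e\<in>Basis. \<integral>x. a e x * D e x \<partial>lborel) + (\<integral>x. a0 x * \<Psi> x \<partial>lborel) = 0"
proof -
  obtain d where d: "d > 0" "(\<Union>x\<in>K. cball x d) \<subseteq> \<Omega>"
    using compact_subset_open_imp_cball_epsilon_subset[OF K(1) o K(2)] by blast
  define r where "r n = d / real (Suc n)" for n
  have r: "r n > 0" "r n \<le> d" for n using d by (auto simp: r_def divide_le_eq)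
  have cb: "cball x (r n) \<subseteq> \<Omega>" if "x \<in> K" for x n
    using d(2) that subset_cball[OF r(2)[of n], of x] by blast
  have test: "test_function \<Omega> (moll (r n) \<Psi>)" for n
    by (rule moll_test_function[OF r(1) L2_loc_int[OF \<Psi>] K(1) K(3) cb])
  have "dir_deriv e (moll (r n) \<Psi>) = moll (r n) (D e)" if "e \<in> Basis" for e n
    by (rule ext) (rule moll_dir_deriv[OF r(1) L2_loc_int[OF \<Psi>] D(2)[OF that] subset_UNIV that])
  then have "(\<Sum>e\<in>Basis. \<integral>x. a e x * moll (r n) (D e) x \<partial>lborel) + (\<integral>x. a0 x * moll (r n) \<Psi> x \<partial>lborel) = 0" for n
    using eq[OF test[of n]] by simp
  moreover have "(\<lambda>n. (\<Sum>e\<in>Basis. \<integral>x. a e x * moll (r n) (D e) x \<partial>lborel) + (\<integral>x. a0 x * moll (r n) \<Psi> x \<partial>lborel))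
    \<longlonglongrightarrow> (\<Sum>e\<in>Basis. \<integral>x. a e x * D e x \<partial>lborel) + (\<integral>x. a0 x * \<Psi> x \<partial>lborel)"
  proof (intro tendsto_add tendsto_sum)
    show "(\<lambda>n. \<integral>x. a0 x * moll (r n) \<Psi> x \<partial>lborel) \<longlonglongrightarrow> (\<integral>x. a0 x * \<Psi> x \<partial>lborel)"
      by (rule L2_tendsto_integral[OF moll_in_L2[OF r(1) \<Psi>] \<Psi> a0]) (unfold r_def, rule moll_tendsto_L2[OF \<Psi> d(1)])
    fix e :: 'a assume e: "e \<in> Basis"
    show "(\<lambda>n. \<integral>x. a e x * moll (r n) (D e) x \<partial>lborel) \<longlonglongrightarrow> (\<integral>x. a e x * D e x \<partial>lborel)"
      by (rule L2_tendsto_integral[OF moll_in_L2[OF r(1) D(1)[OF e]] D(1)[OF e] a[OF e]]) (unfold r_def, rule moll_tendsto_L2[OF D(1)[OF e] d(1)])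
  qed
  ultimately show ?thesis by (simp add: LIMSEQ_const_iff)
qed

text \<open>Test with mollifications of the sign of \<open>g\<close> on a compact set
  \<open>K\<close>: they are bounded by 1 and converge almost everywhere along a subsequence, so the
  integral of \<open>\<bar>g\<bar>\<close> over \<open>K\<close> vanishes. Countably many compact
  sets exhaust \<open>\<Omega>\<close>.\<close>

lemma du_Bois_Reymond:
  fixes g :: "'a::euclidean_space \<Rightarrow> real"
  assumes o: "open \<Omega>" and gm: "g \<in> borel_measurable borel"
    and gi: "\<And>K. compact K \<Longrightarrow> K \<subseteq> \<Omega> \<Longrightarrow> integrable lborel (\<lambda>x. indicator K x * g x)"
    and z: "\<And>\<psi>. test_function \<Omega> \<psi> \<Longrightarrow> (\<integral>x. g x * \<psi> x \<partial>lborel) = 0"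
  shows "AE x in lborel. x \<in> \<Omega> \<longrightarrow> g x = 0"
proof -
  have [measurable]: "g \<in> borel_measurable borel" by fact
  have main: "AE x in lborel. x \<in> K \<longrightarrow> g x = 0" if K: "compact K" "K \<subseteq> \<Omega>" for K
  proof -
    have [measurable]: "K \<in> sets borel" using K by (simp add: borel_compact)
    obtain d where d: "d > 0" "(\<Union>x\<in>K. cball x d) \<subseteq> \<Omega>"
      using compact_subset_open_imp_cball_epsilon_subset[OF K(1) o K(2)] by blast
    define r where "r n = d / real (Suc n)" for n
    have r: "r n > 0" "r n \<le> d" for n using d by (auto simp: r_def divide_le_eq)
    have cb: "cball x (r n) \<subseteq> \<Omega>" if "x \<in> K" for x n
      using d(2) that subset_cball[OF r(2)[of n], of x] by blast
    define s where "s x = indicator K x * sgn (g x)" for x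
    have sm[measurable]: "s \<in> borel_measurable borel" unfolding s_def by measurable
    have sb: "\<bar>s x\<bar> \<le> 1" for x by (auto simp: s_def indicator_def sgn_if)
    have s0: "x \<notin> K \<Longrightarrow> s x = 0" for x by (simp add: s_def)
    have sL: "s \<in> L2" by (rule L2_bounded_support[OF sm sb compact_imp_bounded[OF K(1)] s0])
    define K' where "K' = {x + y |x y. x \<in> K \<and> y \<in> cball 0 d}"
    have K': "compact K'" unfolding K'_def by (intro compact_sums K) simp
    have [measurable]: "K' \<in> sets borel" using K' by (simp add: borel_compact)
    have "K' \<subseteq> \<Omega>"
    proof
      fix z assume "z \<in> K'"
      then obtain x y where "z = x + y" "x \<in> K" "norm y \<le> d" by (auto simp: K'_def)
      then have "z \<in> cball x d" by (simp add: dist_norm)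
      then show "z \<in> \<Omega>" using d(2) \<open>x \<in> K\<close> by blast
    qed
    have supp: "moll (r n) s x = 0" if "x \<notin> K'" for n x
    proof (rule moll_eq_0[OF r(1)])
      fix y assume "norm (y - x) < r n"
      then have "y + (x - y) \<in> K'" if "y \<in> K"
        unfolding K'_def using that r(2)[of n] by (intro CollectI exI[of _ y] exI[of _ "x - y"]) (auto simp: norm_minus_commute)
      then have "y \<notin> K" using \<open>x \<notin> K'\<close> by auto
      then show "s y = 0" by (rule s0)
    qed
    note mL = moll_in_L2[OF r(1) sL]
    have mm[measurable]: "moll (r n) s \<in> borel_measurable borel" for n using mL[of n] by (simp add: L2_def)
    have "(\<lambda>n. \<integral>x. (moll (r n) s x - s x)\<^sup>2 \<partial>lborel) \<longlonglongrightarrow> 0"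
      unfolding r_def by (rule moll_tendsto_L2[OF sL d(1)])
    then obtain q :: "nat \<Rightarrow> nat" where q: "strict_mono q" "AE x in lborel. (\<lambda>n. moll (r (q n)) s x) \<longlonglongrightarrow> s x"
      by (rule L2_AE_subseq[OF mL sL]) (rule that)
    have "(\<lambda>n. \<integral>x. g x * moll (r (q n)) s x \<partial>lborel) \<longlonglongrightarrow> (\<integral>x. g x * s x \<partial>lborel)"
    proof (rule integral_dominated_convergence[where w="\<lambda>x. \<bar>indicator K' x * g x\<bar>"])
      show "AE x in lborel. (\<lambda>n. g x * moll (r (q n)) s x) \<longlonglongrightarrow> g x * s x"
        using q(2) by eventually_elim (intro tendsto_intros)
      show "AE x in lborel. norm (g x * moll (r (q n)) s x) \<le> \<bar>indicator K' x * g x\<bar>" for n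
      proof (rule AE_I2)
        fix x
        show "norm (g x * moll (r (q n)) s x) \<le> \<bar>indicator K' x * g x\<bar>"
          using supp[of x "q n"] moll_bounded[OF r(1) sm sb, of "q n" x] mult_left_le[of "\<bar>moll (r (q n)) s x\<bar>" "\<bar>g x\<bar>"]
          by (cases "x \<in> K'") (auto simp: abs_mult)
      qed
    qed (use gi[OF K' \<open>K' \<subseteq> \<Omega>\<close>] in \<open>measurable, auto intro!: integrable_abs\<close>)
    moreover have "(\<integral>x. g x * moll (r (q n)) s x \<partial>lborel) = 0" for n
      by (rule z) (rule moll_test_function[OF r(1) L2_loc_int[OF sL] K(1) s0 cb])
    ultimately have "(\<integral>x. g x * s x \<partial>lborel) = 0" by (simp add: LIMSEQ_const_iff)
    also have "(\<lambda>x. g x * s x) = (\<lambda>x. \<bar>indicator K x * g x\<bar>)"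
      by (auto simp: s_def sgn_if indicator_def)
    finally have "AE x in lborel. \<bar>indicator K x * g x\<bar> = 0"
      using integral_nonneg_eq_0_iff_AE[OF integrable_abs[OF gi[OF K]]] by simp
    then show ?thesis by eventually_elim (auto simp: indicator_def)
  qed
  obtain C :: "nat \<Rightarrow> 'a set" where C: "\<And>n. compact (C n)" "\<And>n. C n \<subseteq> \<Omega>"
    "\<And>n. C n \<subseteq> interior (C (Suc n))" "\<Union>(range C) = \<Omega>"
    "\<And>K. compact K \<Longrightarrow> K \<subseteq> \<Omega> \<Longrightarrow> \<exists>N. \<forall>n\<ge>N. K \<subseteq> C n"
    by (rule open_Union_compact_subsets[OF o]) (rule that)
  have "AE x in lborel. \<forall>n::nat. x \<in> C n \<longrightarrow> g x = 0"
    unfolding AE_all_countable by (intro allI main C)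
  then show ?thesis by eventually_elim (use C(4) in blast)
qed

text \<open>The functions \<open>s / (1 + n * s)\<close> tend to 0 for every
  \<open>s \<ge> 0\<close>, while their derivatives \<open>1 / (1 + n * s)\<^sup>2\<close> tend to
  the indicator of \<open>s = 0\<close>. In the limit the chain rule says that \<open>g\<close>,
  restricted to the zero set of \<open>u\<close>, has vanishing integral against every test
  function.\<close>

lemma weak_derivative_zero_level:
  assumes o: "open \<Omega>" and e: "e \<in> Basis" and u: "u \<in> L2" "\<And>x. u x \<ge> 0" and g: "g \<in> L2"
    and w: "wderiv \<Omega> e u g"
  shows "AE x in lborel. x \<in> \<Omega> \<longrightarrow> u x = 0 \<longrightarrow> g x = 0"
proof -
  have um[measurable]: "u \<in> borel_measurable borel" "g \<in> borel_measurable borel" using u g by (auto simp: L2_def)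
  define G where "G x = indicator {x. u x = 0} x * g x" for x
  have GL: "G \<in> L2" unfolding G_def by (rule L2_bounded_mult[OF g, of _ 1]) (auto simp: indicator_def)
  then have [measurable]: "G \<in> borel_measurable borel" by (simp add: L2_def)
  have "AE x in lborel. x \<in> \<Omega> \<longrightarrow> G x = 0"
  proof (rule du_Bois_Reymond[OF o])
    fix K :: "'a set" assume "compact K"
    then show "integrable lborel (\<lambda>x. indicator K x * G x)"
      by (intro L2_mult_integrable[OF _ GL] L2_bounded_support[where B=1 and K=K])
         (auto simp: borel_compact compact_imp_bounded intro!: borel_measurable_indicator)
  next
    fix \<psi> :: "'a \<Rightarrow> real" assume \<psi>: "test_function \<Omega> \<psi>"
    note t = tdir_test_function[OF \<psi> e]
    have [measurable]: "\<psi> \<in> borel_measurable borel" "dir_deriv e \<psi> \<in> borel_measurable borel" using tdirD[OF t] by auto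
    let ?b = "\<lambda>n s::real. 1 / (1 + real n * s)\<^sup>2" and ?\<beta> = "\<lambda>n s::real. s / (1 + real n * s)"
    have pos: "1 + real n * s \<ge> 1" if "s \<ge> 0" for n s using that by simp
    have b1: "\<bar>?b n s\<bar> \<le> 1" if "s \<ge> 0" for n s
      using power_mono[OF pos[OF that, of n], of 2] by (simp add: divide_le_eq)
    have bc: "continuous_on {0..} (?b n)" for n
      using pos[of _ n] by (intro continuous_intros) fastforce
    have d: "(?\<beta> n has_real_derivative ?b n s) (at s within {0..})" if "s \<ge> 0" for n s
      using pos[OF that, of n] by (auto intro!: derivative_eq_intros simp: power2_eq_square field_simps)
    have eq: "(\<integral>x. dir_deriv e \<psi> x * ?\<beta> n (u x) + \<psi> x * ?b n (u x) * g x \<partial>lborel) = 0" for n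
      by (rule weak_chain_rule[where \<beta>="?\<beta> n" and b="?b n" and B=1, OF bc b1 d o e u g w t])
    have i: "integrable lborel (\<lambda>x. dir_deriv e \<psi> x * ?\<beta> n (u x))" "integrable lborel (\<lambda>x. \<psi> x * ?b n (u x) * g x)" for n
      using chain_integrable[where \<beta>="?\<beta> n" and b="?b n" and B=1, OF bc b1 d t u g] by auto
    have "(\<lambda>n. \<integral>x. dir_deriv e \<psi> x * ?\<beta> n (u x) + \<psi> x * ?b n (u x) * g x \<partial>lborel) \<longlonglongrightarrow> (\<integral>x. G x * \<psi> x \<partial>lborel)"
    proof (rule integral_dominated_convergence[where w="\<lambda>x. \<bar>dir_deriv e \<psi> x * u x\<bar> + \<bar>\<psi> x * g x\<bar>"])
      show "integrable lborel (\<lambda>x. \<bar>dir_deriv e \<psi> x * u x\<bar> + \<bar>\<psi> x * g x\<bar>)"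
        by (intro Bochner_Integration.integrable_add integrable_abs L2_mult_integrable tdir_L2[OF t] u g)
      show "AE x in lborel. (\<lambda>n. dir_deriv e \<psi> x * ?\<beta> n (u x) + \<psi> x * ?b n (u x) * g x) \<longlonglongrightarrow> G x * \<psi> x"
      proof (rule AE_I2)
        fix x
        show "(\<lambda>n. dir_deriv e \<psi> x * ?\<beta> n (u x) + \<psi> x * ?b n (u x) * g x) \<longlonglongrightarrow> G x * \<psi> x"
        proof (cases "u x = 0")
          case True then show ?thesis by (simp add: G_def mult.commute)
        next
          case False
          then have ux: "u x > 0" using u(2)[of x] by simp
          have inf: "filterlim (\<lambda>n. 1 + real n * u x) at_top sequentially"
            using ux by (intro filterlim_tendsto_add_at_top[OF tendsto_const]
              filterlim_at_top_mult_tendsto_pos[OF tendsto_const _ filterlim_real_sequentially]) auto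
          have l: "(\<lambda>n. 1 / (1 + real n * u x)) \<longlonglongrightarrow> 0"
            using tendsto_inverse_0_at_top[OF inf] by (simp add: inverse_eq_divide)
          have "(\<lambda>n. dir_deriv e \<psi> x * (u x * (1 / (1 + real n * u x))) + \<psi> x * (1 / (1 + real n * u x))\<^sup>2 * g x)
            \<longlonglongrightarrow> dir_deriv e \<psi> x * (u x * 0) + \<psi> x * 0\<^sup>2 * g x" by (intro tendsto_intros l)
          then show ?thesis using False by (simp add: G_def power_one_over)
        qed
      qed
      show "AE x in lborel. norm (dir_deriv e \<psi> x * ?\<beta> n (u x) + \<psi> x * ?b n (u x) * g x) \<le> \<bar>dir_deriv e \<psi> x * u x\<bar> + \<bar>\<psi> x * g x\<bar>" for n
      proof (rule AE_I2)
        fix x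
        have "0 < 1 + real n * u x" using pos[OF u(2)[of x], of n] by linarith
        then have 1: "\<bar>?\<beta> n (u x)\<bar> \<le> \<bar>u x\<bar>"
          using mult_left_mono[OF pos[OF u(2)[of x], of n] u(2)[of x]] u(2)[of x] by (simp add: divide_le_eq)
        have "\<bar>dir_deriv e \<psi> x\<bar> * \<bar>?\<beta> n (u x)\<bar> \<le> \<bar>dir_deriv e \<psi> x\<bar> * \<bar>u x\<bar>" by (rule mult_left_mono[OF 1]) simp
        moreover have "\<bar>\<psi> x * g x\<bar> * \<bar>?b n (u x)\<bar> \<le> \<bar>\<psi> x * g x\<bar> * 1" by (rule mult_left_mono[OF b1[OF u(2)]]) simp
        moreover have "norm (dir_deriv e \<psi> x * ?\<beta> n (u x) + \<psi> x * ?b n (u x) * g x)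
           \<le> \<bar>dir_deriv e \<psi> x * ?\<beta> n (u x)\<bar> + \<bar>\<psi> x * ?b n (u x) * g x\<bar>" unfolding real_norm_def by (rule abs_triangle_ineq)
        moreover have "\<bar>dir_deriv e \<psi> x * ?\<beta> n (u x)\<bar> = \<bar>dir_deriv e \<psi> x\<bar> * \<bar>?\<beta> n (u x)\<bar>"
          "\<bar>\<psi> x * ?b n (u x) * g x\<bar> = \<bar>\<psi> x * g x\<bar> * \<bar>?b n (u x)\<bar>"
          "\<bar>dir_deriv e \<psi> x * u x\<bar> = \<bar>dir_deriv e \<psi> x\<bar> * \<bar>u x\<bar>" by (simp_all only: abs_mult mult_ac)
        ultimately show "norm (dir_deriv e \<psi> x * ?\<beta> n (u x) + \<psi> x * ?b n (u x) * g x) \<le> \<bar>dir_deriv e \<psi> x * u x\<bar> + \<bar>\<psi> x * g x\<bar>"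
          by linarith
      qed
    qed measurable
    then show "(\<integral>x. G x * \<psi> x \<partial>lborel) = 0" unfolding eq by (simp add: LIMSEQ_const_iff)
  qed measurable
  then show ?thesis by eventually_elim (auto simp: G_def indicator_def)
qed

section \<open>Shifting the pressure in time\<close>

text \<open>The chain rule with \<open>\<theta> x * \<zeta> x\<close> in place of
  \<open>\<Theta> x\<close>, sorted by which factor is differentiated. Since \<open>\<zeta>\<close>
  need not be supported in \<open>\<Omega>\<close>, this exhibits a weak derivative of the cut-off
  function on the whole space, the form in which test functions enter
  \<open>weak_form_extends\<close>.\<close>

lemma cutoff_chain_weak_derivative:
  assumes bc: "continuous_on {0..} b" and bB: "\<And>s. s \<ge> 0 \<Longrightarrow> \<bar>b s\<bar> \<le> B"
    and \<beta>: "\<And>s. s \<ge> 0 \<Longrightarrow> (\<beta> has_real_derivative b s) (at s within {0..})"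
    and o: "open \<Omega>" and e: "e \<in> Basis" and u: "u \<in> L2" "\<And>x. u x \<ge> 0" and g: "g \<in> L2"
    and w: "wderiv \<Omega> e u g" and t: "tdir \<Omega> e \<theta> \<theta>'" and z: "tdir UNIV e \<zeta> \<zeta>'"
  shows "(\<integral>x. (\<theta> x * \<beta> (u x)) * \<zeta>' x \<partial>lborel) = - (\<integral>x. (\<theta>' x * \<beta> (u x) + \<theta> x * b (u x) * g x) * \<zeta> x \<partial>lborel)"
proof -
  note t2 = tdir_mult[OF t z]
  have ch: "(\<integral>x. \<Theta>' x * \<beta> (u x) + \<Theta> x * b (u x) * g x \<partial>lborel) = 0"
    "integrable lborel (\<lambda>x. \<Theta>' x * \<beta> (u x))" "integrable lborel (\<lambda>x. \<Theta> x * b (u x) * g x)"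
    if "tdir \<Omega> e \<Theta> \<Theta>'" for \<Theta> \<Theta>'
    by (rule weak_chain_rule[OF bc bB \<beta> o e u g w that], assumption+)
       (rule chain_integrable[OF bc bB \<beta> that u g], assumption+)+
  obtain B2 where zb: "\<And>x. \<bar>\<zeta> x\<bar> \<le> B2" by (rule tdirE[OF z]) (rule that)
  have [measurable]: "\<zeta> \<in> borel_measurable borel" using tdirD[OF z] by auto
  have i1: "integrable lborel (\<lambda>x. \<zeta> x * (\<theta>' x * \<beta> (u x)))"
  proof (rule Bochner_Integration.integrable_bound[OF integrable_mult_right[OF ch(2)[OF t], of B2]])
    show "(\<lambda>x. \<zeta> x * (\<theta>' x * \<beta> (u x))) \<in> borel_measurable lborel"
      using borel_measurable_integrable[OF ch(2)[OF t]] by measurable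
    show "AE x in lborel. norm (\<zeta> x * (\<theta>' x * \<beta> (u x))) \<le> norm (B2 * (\<theta>' x * \<beta> (u x)))"
      using zb by (intro AE_I2) (simp add: abs_mult mult_right_mono order_trans[OF _ abs_ge_self])
  qed
  have i2: "integrable lborel (\<lambda>x. \<theta> x * \<zeta> x * b (u x) * g x)" by (rule ch(3)[OF t2])
  have i3: "integrable lborel (\<lambda>x. (\<theta>' x * \<zeta> x + \<theta> x * \<zeta>' x) * \<beta> (u x))" by (rule ch(2)[OF t2])
  have i4: "integrable lborel (\<lambda>x. \<theta> x * \<beta> (u x) * \<zeta>' x)"
    using Bochner_Integration.integrable_diff[OF i3 i1] by (simp add: algebra_simps)
  have "0 = (\<integral>x. (\<theta>' x * \<zeta> x + \<theta> x * \<zeta>' x) * \<beta> (u x) + \<theta> x * \<zeta> x * b (u x) * g x \<partial>lborel)"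
    by (rule ch(1)[OF t2, symmetric])
  also have "\<dots> = (\<integral>x. \<theta> x * \<beta> (u x) * \<zeta>' x + (\<zeta> x * (\<theta>' x * \<beta> (u x)) + \<theta> x * \<zeta> x * b (u x) * g x) \<partial>lborel)"
    by (intro Bochner_Integration.integral_cong refl) (simp add: algebra_simps)
  also have "\<dots> = (\<integral>x. \<theta> x * \<beta> (u x) * \<zeta>' x \<partial>lborel) + (\<integral>x. \<zeta> x * (\<theta>' x * \<beta> (u x)) + \<theta> x * \<zeta> x * b (u x) * g x \<partial>lborel)"
    by (rule Bochner_Integration.integral_add[OF i4 Bochner_Integration.integrable_add[OF i1 i2]])
  also have "(\<integral>x. \<zeta> x * (\<theta>' x * \<beta> (u x)) + \<theta> x * \<zeta> x * b (u x) * g x \<partial>lborel) = (\<integral>x. (\<theta>' x * \<beta> (u x) + \<theta> x * b (u x) * g x) * \<zeta> x \<partial>lborel)"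
    by (intro Bochner_Integration.integral_cong refl) (simp add: algebra_simps)
  finally show ?thesis by simp
qed

lemma cutoff_weak_derivative:
  assumes o: "open \<Omega>" and e: "e \<in> Basis" and u: "u \<in> L2" "\<And>x. u x \<ge> 0" and g: "g \<in> L2"
    and w: "wderiv \<Omega> e u g" and t: "tdir \<Omega> e \<theta> \<theta>'" and z: "tdir UNIV e \<zeta> \<zeta>'"
  shows "(\<integral>x. (\<theta> x * u x) * \<zeta>' x \<partial>lborel) = - (\<integral>x. (\<theta>' x * u x + \<theta> x * g x) * \<zeta> x \<partial>lborel)"
  using cutoff_chain_weak_derivative[where \<beta>="\<lambda>s. s" and b="\<lambda>s. 1" and B=1, OF _ _ _ o e u g w t z]
  by (auto intro!: derivative_eq_intros)

text \<open>The average is over a parameter in the unit interval, not over an interval of length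
  \<open>h\<close>: this is a probability measure for either sign of \<open>h\<close>, so that
  positive \<open>h\<close> averages backwards and negative \<open>h\<close> forwards along
  \<open>e\<close>, with the same formulas.\<close>

definition steklov :: "real \<Rightarrow> 'a::euclidean_space \<Rightarrow> ('a \<Rightarrow> real) \<Rightarrow> 'a \<Rightarrow> real" where
  "steklov h e u x = (\<integral>s. u (x + (- (h * s)) *\<^sub>R e) \<partial>(restrict_space lborel {0..1}))"

abbreviation unit_interval :: "real measure" where "unit_interval \<equiv> restrict_space lborel {0..1}"

lemma unit_interval: "emeasure unit_interval (space unit_interval) = 1" "space unit_interval = {0..1}"
  by (auto simp: space_restrict_space emeasure_restrict_space)

lemma unit_interval_borel: "f \<in> borel_measurable borel \<Longrightarrow> f \<in> borel_measurable unit_interval"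
  by (rule measurable_restrict_space1) simp

lemma steklov_L2:
  assumes u: "u \<in> L2" shows "steklov h e u \<in> L2"
proof -
  have [measurable]: "u \<in> borel_measurable borel" using u by (simp add: L2_def)
  have "(\<lambda>x. - u x) \<in> L2" using L2_cmult[OF u, of "-1"] by simp
  then have b: "(\<integral>x. (u (x + y) - u x)\<^sup>2 \<partial>lborel) \<le> 4 * (\<integral>x. (u x)\<^sup>2 \<partial>lborel)" for y
    using integral_translate[of "\<lambda>x. (u x)\<^sup>2" y] \<open>(\<lambda>x. - u x) \<in> L2\<close> L2_triangle_sq[OF L2_translate[OF u, of y], of "\<lambda>x. - u x"]
    unfolding power2_minus by auto
  show ?thesis unfolding steklov_def[abs_def]
    by (rule L2_average(1)[OF u unit_interval(1) unit_interval_borel b]) auto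
qed

lemma steklov_tendsto:
  assumes u: "u \<in> L2" and h: "h \<longlonglongrightarrow> 0"
  shows "(\<lambda>n. \<integral>x. (steklov (h n) e u x - u x)\<^sup>2 \<partial>lborel) \<longlonglongrightarrow> 0"
proof (rule LIMSEQ_I)
  fix r :: real assume r: "r > 0"
  then obtain d where d: "d > 0" "\<And>y. norm y \<le> d \<Longrightarrow> (\<integral>x. (u (x + y) - u x)\<^sup>2 \<partial>lborel) \<le> r/2"
    using L2_translation_continuous[OF u, of "r/2"] by auto
  have "(\<lambda>n. \<bar>h n\<bar> * norm e) \<longlonglongrightarrow> 0 * norm e" using tendsto_rabs[OF h] by (intro tendsto_intros) simp
  then have "\<forall>\<^sub>F n in sequentially. \<bar>h n\<bar> * norm e < d" using d by (intro order_tendstoD(2)) auto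
  then obtain N where N: "\<And>n. n \<ge> N \<Longrightarrow> \<bar>h n\<bar> * norm e < d" by (auto simp: eventually_sequentially)
  show "\<exists>N. \<forall>n\<ge>N. norm ((\<integral>x. (steklov (h n) e u x - u x)\<^sup>2 \<partial>lborel) - 0) < r"
  proof (intro exI allI impI)
    fix n assume n: "n \<ge> N"
    have "(\<integral>x. (steklov (h n) e u x - u x)\<^sup>2 \<partial>lborel) \<le> r/2"
      unfolding steklov_def
    proof (rule L2_average(2)[OF u unit_interval(1)])
      show "(\<lambda>s. - (h n * s) *\<^sub>R e) \<in> borel_measurable unit_interval" by (rule unit_interval_borel) measurable
      fix s assume "s \<in> space unit_interval"
      then have "\<bar>s\<bar> \<le> 1" by (simp add: unit_interval)
      then have "\<bar>h n\<bar> * norm e * \<bar>s\<bar> \<le> \<bar>h n\<bar> * norm e" by (intro mult_left_le) auto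
      then have "norm (- (h n * s) *\<^sub>R e) \<le> d" using N[OF n] by (simp add: abs_mult mult_ac)
      then show "(\<integral>x. (u (x + - (h n * s) *\<^sub>R e) - u x)\<^sup>2 \<partial>lborel) \<le> r/2" by (rule d(2))
    qed (use r in simp)
    then show "norm ((\<integral>x. (steklov (h n) e u x - u x)\<^sup>2 \<partial>lborel) - 0) < r" using r by simp
  qed
qed

text \<open>Fubini, together with a translation of the space variable, transposes the average onto
  \<open>\<xi>\<close> with the opposite shift. The majorants are translates of
  \<open>C * \<bar>u\<bar>\<close>, whose integral does not depend on the parameter.\<close>

lemma steklov_pairing:
  fixes u :: "'a::euclidean_space \<Rightarrow> real"
  assumes u: "integrable lborel u" and um: "u \<in> borel_measurable borel"
    and \<xi>m: "\<xi> \<in> borel_measurable borel" and \<xi>b: "\<And>x. \<bar>\<xi> x\<bar> \<le> C"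
  shows "(\<integral>x. steklov h e u x * \<xi> x \<partial>lborel) = (\<integral>s. (\<integral>x. u x * \<xi> (x + (h * s) *\<^sub>R e) \<partial>lborel) \<partial>unit_interval)"
    and "(\<integral>s. (\<integral>x. u x * \<xi> (x + (h * s) *\<^sub>R e) \<partial>lborel) \<partial>unit_interval)
      = (\<integral>x. u x * (\<integral>s. \<xi> (x + (h * s) *\<^sub>R e) \<partial>unit_interval) \<partial>lborel)"
proof -
  interpret M: finite_measure unit_interval by (rule finite_measureI) (simp only: unit_interval(1), simp)
  interpret P: pair_sigma_finite unit_interval "lborel :: 'a measure" ..
  have [measurable]: "u \<in> borel_measurable borel" "\<xi> \<in> borel_measurable borel" by fact+
  have idm[measurable]: "(\<lambda>s. s) \<in> borel_measurable unit_interval" by (rule unit_interval_borel) simp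
  have C0: "C \<ge> 0" using \<xi>b[of 0] by linarith
  define f1 where "f1 s x = u (x + (- (h * s)) *\<^sub>R e) * \<xi> x" for s x
  define f2 where "f2 s x = u x * \<xi> (x + (h * s) *\<^sub>R e)" for s x
  have [measurable]: "(\<lambda>(s,x). f1 s x) \<in> borel_measurable (unit_interval \<Otimes>\<^sub>M lborel)"
    "(\<lambda>(s,x). f2 s x) \<in> borel_measurable (unit_interval \<Otimes>\<^sub>M lborel)" unfolding f1_def f2_def by measurable
  have ut: "integrable lborel (\<lambda>x. u (x + y))" "(\<integral>x. \<bar>u (x + y)\<bar> \<partial>lborel) = (\<integral>x. \<bar>u x\<bar> \<partial>lborel)" for y
    using u integrable_translate[OF um] integral_translate[of "\<lambda>x. \<bar>u x\<bar>"] by auto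
  have b1: "norm (f1 s x) \<le> C * \<bar>u (x + (- (h * s)) *\<^sub>R e)\<bar>" "norm (f2 s x) \<le> C * \<bar>u x\<bar>" for s x
    unfolding f1_def f2_def real_norm_def abs_mult by (subst mult.commute, rule mult_right_mono[OF \<xi>b], simp)+
  have i1: "integrable lborel (f1 s)" for s
  proof (rule Bochner_Integration.integrable_bound[OF integrable_mult_right[OF integrable_abs[OF ut(1)], of C]])
    show "f1 s \<in> borel_measurable lborel" unfolding f1_def by measurable
    show "AE x in lborel. norm (f1 s x) \<le> norm (C * \<bar>u (x + (- (h * s)) *\<^sub>R e)\<bar>)"
      by (rule AE_I2[OF order_trans[OF b1(1)]]) simp
  qed
  have i2: "integrable lborel (f2 s)" for s
  proof (rule Bochner_Integration.integrable_bound[OF integrable_mult_right[OF integrable_abs[OF u], of C]])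
    show "f2 s \<in> borel_measurable lborel" unfolding f2_def by measurable
    show "AE x in lborel. norm (f2 s x) \<le> norm (C * \<bar>u x\<bar>)"
      by (rule AE_I2[OF order_trans[OF b1(2)]]) simp
  qed
  have n1: "(\<integral>x. norm (f1 s x) \<partial>lborel) \<le> C * (\<integral>x. \<bar>u x\<bar> \<partial>lborel)" for s
  proof -
    have "(\<integral>x. norm (f1 s x) \<partial>lborel) \<le> (\<integral>x. C * \<bar>u (x + (- (h * s)) *\<^sub>R e)\<bar> \<partial>lborel)"
      by (intro integral_mono integrable_norm i1 integrable_mult_right integrable_abs ut b1)
    then show ?thesis unfolding integral_mult_right_zero ut(2) .
  qed
  have n2: "(\<integral>x. norm (f2 s x) \<partial>lborel) \<le> C * (\<integral>x. \<bar>u x\<bar> \<partial>lborel)" for s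
  proof -
    have "(\<integral>x. norm (f2 s x) \<partial>lborel) \<le> (\<integral>x. C * \<bar>u x\<bar> \<partial>lborel)"
      by (intro integral_mono integrable_norm i2 integrable_mult_right integrable_abs u b1)
    then show ?thesis by simp
  qed
  have P1: "integrable (unit_interval \<Otimes>\<^sub>M lborel) (\<lambda>(s,x). f1 s x)"
  proof (rule P.Fubini_integrable)
    show "integrable unit_interval (\<lambda>s. \<integral>x. norm ((\<lambda>(s,x). f1 s x) (s, x)) \<partial>lborel)"
    proof (rule M.integrable_const_bound[where B="C * (\<integral>x. \<bar>u x\<bar> \<partial>lborel)"])
      show "AE s in unit_interval. norm (\<integral>x. norm ((\<lambda>(s,x). f1 s x) (s, x)) \<partial>lborel) \<le> C * (\<integral>x. \<bar>u x\<bar> \<partial>lborel)"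
        using n1 by (intro AE_I2) simp
    qed measurable
  qed (use i1 in \<open>auto intro!: AE_I2\<close>)
  have P2: "integrable (unit_interval \<Otimes>\<^sub>M lborel) (\<lambda>(s,x). f2 s x)"
  proof (rule P.Fubini_integrable)
    show "integrable unit_interval (\<lambda>s. \<integral>x. norm ((\<lambda>(s,x). f2 s x) (s, x)) \<partial>lborel)"
    proof (rule M.integrable_const_bound[where B="C * (\<integral>x. \<bar>u x\<bar> \<partial>lborel)"])
      show "AE s in unit_interval. norm (\<integral>x. norm ((\<lambda>(s,x). f2 s x) (s, x)) \<partial>lborel) \<le> C * (\<integral>x. \<bar>u x\<bar> \<partial>lborel)"
        using n2 by (intro AE_I2) simp
    qed measurable
  qed (use i2 in \<open>auto intro!: AE_I2\<close>)
  have "(\<integral>x. steklov h e u x * \<xi> x \<partial>lborel) = (\<integral>x. (\<integral>s. f1 s x \<partial>unit_interval) \<partial>lborel)"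
    by (intro Bochner_Integration.integral_cong refl) (simp add: steklov_def f1_def)
  also have "\<dots> = (\<integral>s. (\<integral>x. f1 s x \<partial>lborel) \<partial>unit_interval)" by (rule P.Fubini_integral[OF P1])
  also have "\<dots> = (\<integral>s. (\<integral>x. f2 s x \<partial>lborel) \<partial>unit_interval)"
  proof (rule Bochner_Integration.integral_cong[OF refl])
    fix s
    have "(\<integral>x. f1 s (x + (h * s) *\<^sub>R e) \<partial>lborel) = (\<integral>x. f1 s x \<partial>lborel)"
      by (rule integral_translate) (simp add: f1_def)
    then show "(\<integral>x. f1 s x \<partial>lborel) = (\<integral>x. f2 s x \<partial>lborel)" by (simp add: f1_def f2_def)
  qed
  finally show "(\<integral>x. steklov h e u x * \<xi> x \<partial>lborel) = (\<integral>s. (\<integral>x. u x * \<xi> (x + (h * s) *\<^sub>R e) \<partial>lborel) \<partial>unit_interval)"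
    by (simp add: f2_def)
  have "(\<integral>s. (\<integral>x. f2 s x \<partial>lborel) \<partial>unit_interval) = (\<integral>x. (\<integral>s. f2 s x \<partial>unit_interval) \<partial>lborel)"
    by (rule P.Fubini_integral[OF P2, symmetric])
  then show "(\<integral>s. (\<integral>x. u x * \<xi> (x + (h * s) *\<^sub>R e) \<partial>lborel) \<partial>unit_interval)
      = (\<integral>x. u x * (\<integral>s. \<xi> (x + (h * s) *\<^sub>R e) \<partial>unit_interval) \<partial>lborel)"
    by (simp add: f2_def)
qed

lemma tdir_translate:
  assumes "tdir UNIV e \<zeta> \<zeta>'" shows "tdir UNIV e (\<lambda>x. \<zeta> (x + y)) (\<lambda>x. \<zeta>' (x + y))"
proof -
  obtain K where K: "compact K" "\<And>x. x \<notin> K \<Longrightarrow> \<zeta> x = 0 \<and> \<zeta>' x = 0" using assms unfolding tdir_def by auto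
  have c: "continuous_on UNIV (\<lambda>x. \<zeta> (x + y))" "continuous_on UNIV (\<lambda>x. \<zeta>' (x + y))"
    by (rule continuous_on_compose2[OF tdirD(1)[OF assms]], intro continuous_intros, simp)
       (rule continuous_on_compose2[OF tdirD(2)[OF assms]], intro continuous_intros, simp)
  have "((\<lambda>s. \<zeta> (x + s *\<^sub>R e + y)) has_real_derivative \<zeta>' (x + y)) (at 0)" for x
    using tdirD(5)[OF assms, of "x + y"] by (simp add: add_ac)
  moreover have "\<zeta> (x + y) = 0 \<and> \<zeta>' (x + y) = 0" if "x \<notin> (+) (- y) ` K" for x
  proof -
    have "x + y \<notin> K" using that by (auto simp: image_iff dest!: bspec[of _ _ "x + y"])
    then show ?thesis by (rule K(2))
  qed
  ultimately show ?thesis using c compact_translation[OF K(1), of "- y"] unfolding tdir_def by blast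
qed

lemma steklov_weak_derivative:
  assumes u: "integrable lborel u" "u \<in> borel_measurable borel" and g: "integrable lborel g" "g \<in> borel_measurable borel"
    and w: "\<And>\<zeta> \<zeta>'. tdir UNIV e' \<zeta> \<zeta>' \<Longrightarrow> (\<integral>x. u x * \<zeta>' x \<partial>lborel) = - (\<integral>x. g x * \<zeta> x \<partial>lborel)"
    and z: "tdir UNIV e' \<zeta> \<zeta>'"
  shows "(\<integral>x. steklov h e u x * \<zeta>' x \<partial>lborel) = - (\<integral>x. steklov h e g x * \<zeta> x \<partial>lborel)"
proof -
  obtain C where C: "\<And>x. \<bar>\<zeta> x\<bar> \<le> C" "\<And>x. \<bar>\<zeta>' x\<bar> \<le> C" by (rule tdirE[OF z]) (rule that)
  show ?thesis
    unfolding steklov_pairing(1)[OF u tdirD(4)[OF z] C(2)] steklov_pairing(1)[OF g tdirD(3)[OF z] C(1)]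
    by (subst w[OF tdir_translate[OF z]]) simp
qed

text \<open>Once the average has been moved to the test function, the fundamental theorem of
  calculus turns the averaged derivative into a difference quotient, and a translation returns it to
  \<open>u\<close>. The average of a merely integrable \<open>u\<close> thus acquires a weak
  derivative along \<open>e\<close>.\<close>

lemma steklov_shift_derivative:
  fixes u :: "'a::euclidean_space \<Rightarrow> real"
  assumes u: "integrable lborel u" "u \<in> borel_measurable borel" and h: "h \<noteq> 0" and z: "tdir UNIV e \<zeta> \<zeta>'"
  shows "(\<integral>x. steklov h e u x * \<zeta>' x \<partial>lborel) = - (\<integral>x. (u x - u (x + (- h) *\<^sub>R e)) / h * \<zeta> x \<partial>lborel)"
proof -
  obtain C where C: "\<And>x. \<bar>\<zeta> x\<bar> \<le> C" "\<And>x. \<bar>\<zeta>' x\<bar> \<le> C" by (rule tdirE[OF z]) (rule that)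
  have [measurable]: "u \<in> borel_measurable borel" "\<zeta> \<in> borel_measurable borel" using u tdirD[OF z] by auto
  have ftc: "(\<integral>s. \<zeta>' (x + (h * s) *\<^sub>R e) \<partial>unit_interval) = (\<zeta> (x + h *\<^sub>R e) - \<zeta> x) / h" for x
  proof -
    have "(\<integral>s. indicator {0..1} s *\<^sub>R \<zeta>' (x + (h * s) *\<^sub>R e) \<partial>lborel) = \<zeta> (x + (h * 1) *\<^sub>R e) / h - \<zeta> (x + (h * 0) *\<^sub>R e) / h"
    proof (rule integral_FTC_Icc)
      fix s :: real
      have "((\<lambda>s. \<zeta> (x + (h * s) *\<^sub>R e)) has_real_derivative \<zeta>' (x + (h * s) *\<^sub>R e) * h) (at s)"
        by (rule DERIV_chain2[of "\<lambda>r. \<zeta> (x + r *\<^sub>R e)" _ "\<lambda>s. h * s", OF line_derivative[OF tdirD(5)[OF z]]])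
           (auto intro!: derivative_eq_intros)
      then have "((\<lambda>s. \<zeta> (x + (h * s) *\<^sub>R e) / h) has_real_derivative \<zeta>' (x + (h * s) *\<^sub>R e)) (at s within {0..1})"
        using h by - (rule has_field_derivative_at_within, drule DERIV_cdivide[where c=h], simp)
      then show "((\<lambda>s. \<zeta> (x + (h * s) *\<^sub>R e) / h) has_vector_derivative \<zeta>' (x + (h * s) *\<^sub>R e)) (at s within {0..1})"
        by (simp add: has_real_derivative_iff_has_vector_derivative)
    next
      show "continuous_on {0..1} (\<lambda>s. \<zeta>' (x + (h * s) *\<^sub>R e))"
        by (rule continuous_on_compose2[OF tdirD(2)[OF z]]) (auto intro!: continuous_intros)
    qed simp
    then show ?thesis by (simp add: integral_restrict_space diff_divide_distrib)
  qed
  have ib: "integrable lborel (\<lambda>x. u (x + y) * \<zeta> (x + y'))" for y y'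
  proof (rule Bochner_Integration.integrable_bound[of lborel "\<lambda>x. C * \<bar>u (x + y)\<bar>"])
    have "integrable lborel (\<lambda>x. u (x + y))" using u by (subst integrable_translate) auto
    then show "integrable lborel (\<lambda>x. C * \<bar>u (x + y)\<bar>)" by (intro integrable_mult_right integrable_abs)
    show "AE x in lborel. norm (u (x + y) * \<zeta> (x + y')) \<le> norm (C * \<bar>u (x + y)\<bar>)"
      using C(1) by (intro AE_I2) (simp add: abs_mult mult.commute mult_right_mono order_trans[OF _ abs_ge_self])
  qed measurable
  have "(\<integral>x. steklov h e u x * \<zeta>' x \<partial>lborel) = (\<integral>x. u x * ((\<zeta> (x + h *\<^sub>R e) - \<zeta> x) / h) \<partial>lborel)"
    unfolding steklov_pairing[OF u tdirD(4)[OF z] C(2)] ftc ..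
  also have "\<dots> = ((\<integral>x. u x * \<zeta> (x + h *\<^sub>R e) \<partial>lborel) - (\<integral>x. u x * \<zeta> x \<partial>lborel)) / h"
    using ib[of 0 "h *\<^sub>R e"] ib[of 0 0] by (simp add: right_diff_distrib)
  also have "(\<integral>x. u x * \<zeta> (x + h *\<^sub>R e) \<partial>lborel) = (\<integral>x. u (x + (- h) *\<^sub>R e) * \<zeta> x \<partial>lborel)"
    using integral_translate[of "\<lambda>x. u (x + (- h) *\<^sub>R e) * \<zeta> x" "h *\<^sub>R e"] by simp
  also have "((\<integral>x. u (x + (- h) *\<^sub>R e) * \<zeta> x \<partial>lborel) - (\<integral>x. u x * \<zeta> x \<partial>lborel)) / h
    = - (\<integral>x. (u x - u (x + (- h) *\<^sub>R e)) / h * \<zeta> x \<partial>lborel)"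
    using ib[of "(- h) *\<^sub>R e" 0] ib[of 0 0] h by (simp add: left_diff_distrib field_simps)
  finally show ?thesis .
qed

text \<open>Where \<open>p > 0\<close> the density \<open>v\<close> has its maximal value \<open>1\<close>, so forward and backward time
  differences of \<open>v\<close> tested against \<open>p\<close> have opposite signs, and the time derivative drops out in the limit.\<close>

lemma complementarity_of_limit_equation:
  fixes \<Omega> :: "'a::euclidean_space set" and bb G :: "'a \<Rightarrow> 'a \<Rightarrow> real"
  assumes o: "open \<Omega>" and et: "et \<in> Basis"
    and m: "m \<in> borel_measurable borel" "\<And>x. \<bar>m x\<bar> \<le> M" "\<And>x. m x \<ge> 0"
    and mt: "\<And>x. \<bar>m_t x\<bar> \<le> M" "m_t \<in> borel_measurable borel"
      "\<And>x. x \<in> \<Omega> \<Longrightarrow> ((\<lambda>s. m (x + s *\<^sub>R et)) has_real_derivative m_t x) (at 0)"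
    and bb: "\<And>e. bb e \<in> borel_measurable borel" "\<And>e x. \<bar>bb e x\<bar> \<le> M"
    and f: "f \<in> borel_measurable borel" "\<And>x. \<bar>f x\<bar> \<le> M"
    and v: "v \<in> borel_measurable borel" "\<And>x. 0 \<le> v x" "\<And>x. v x \<le> 1"
    and p: "p \<in> L2" "\<And>x. p x \<ge> 0" and vp: "\<And>x. p x \<noteq> 0 \<Longrightarrow> v x = 1"
    and G: "\<And>e. e \<in> Basis - {et} \<Longrightarrow> G e \<in> L2" "\<And>e. e \<in> Basis - {et} \<Longrightarrow> wderiv \<Omega> e p (G e)"
    and eq: "\<And>\<psi>. test_function \<Omega> \<psi> \<Longrightarrow> (\<integral>x. m x * v x * dir_deriv et \<psi> x \<partial>lborel)
      - (\<Sum>e\<in>Basis - {et}. \<integral>x. (m x * G e x + m x * v x * bb e x) * dir_deriv e \<psi> x \<partial>lborel)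
      + (\<integral>x. f x * m x * v x * \<psi> x \<partial>lborel) = 0"
    and \<phi>: "\<And>x. \<phi> x \<ge> 0" "\<And>e. e \<in> Basis \<Longrightarrow> tdir \<Omega> e \<phi> (\<phi>' e)"
  shows "- (\<integral>x. m_t x * (\<phi> x * p x) \<partial>lborel)
      - (\<Sum>e\<in>Basis - {et}. \<integral>x. (m x * G e x + m x * v x * bb e x) * (\<phi>' e x * p x + \<phi> x * G e x) \<partial>lborel)
      + (\<integral>x. f x * m x * v x * (\<phi> x * p x) \<partial>lborel) = 0"
proof -
  let ?S = "Basis - {et}"
  have M0: "M \<ge> 0" using m(2)[of undefined] by linarith
  have "\<forall>e\<in>Basis. \<exists>K. compact K \<and> K \<subseteq> \<Omega> \<and> (\<forall>x. x \<notin> K \<longrightarrow> \<phi> x = 0 \<and> \<phi>' e x = 0)"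
    using \<phi>(2) unfolding tdir_def by auto
  then obtain KK where KK: "\<And>e. e \<in> Basis \<Longrightarrow> compact (KK e) \<and> KK e \<subseteq> \<Omega> \<and> (\<forall>x. x \<notin> KK e \<longrightarrow> \<phi> x = 0 \<and> \<phi>' e x = 0)"
    by metis
  define K where "K = (\<Union>e\<in>Basis. KK e)"
  have K: "compact K" "K \<subseteq> \<Omega>" using KK by (auto simp: K_def intro!: compact_UN)
  have K0: "\<phi> x = 0" if "x \<notin> K" for x using that KK[OF et] et by (auto simp: K_def)
  have K0': "\<phi>' e x = 0" if "x \<notin> K" "e \<in> Basis" for x e using that KK by (auto simp: K_def)
  obtain B where B: "\<And>x. \<bar>\<phi> x\<bar> \<le> B" by (rule tdirE[OF \<phi>(2)[OF et]]) (rule that)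
  obtain d where d: "d > 0" "(\<Union>x\<in>K. cball x d) \<subseteq> \<Omega>"
    using compact_subset_open_imp_cball_epsilon_subset[OF K(1) o K(2)] by blast
  \<comment> \<open>All translates of the support by at most \<open>d\<close> stay in
    \<open>K'\<close>, hence in \<open>\<Omega>\<close>; the same \<open>d\<close> bounds the time
    shifts \<open>h\<close> used below.\<close>
  define K' where "K' = {x + y |x y. x \<in> K \<and> y \<in> cball 0 d}"
  have K': "compact K'" unfolding K'_def by (intro compact_sums K) simp
  have K'I: "x + y \<in> K'" if "x \<in> K" "norm y \<le> d" for x y
    unfolding K'_def using that by (intro CollectI exI[of _ x] exI[of _ y]) simp
  have K'\<Omega>: "K' \<subseteq> \<Omega>"
  proof
    fix z assume "z \<in> K'"
    then obtain x y where "z = x + y" "x \<in> K" "norm y \<le> d" by (auto simp: K'_def)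
    then have "z \<in> cball x d" by (simp add: dist_norm)
    then show "z \<in> \<Omega>" using d(2) \<open>x \<in> K\<close> by blast
  qed
  obtain R where "\<And>x. x \<in> K' \<Longrightarrow> norm x \<le> R" using compact_imp_bounded[OF K'] unfolding bounded_iff by blast
  then have R: "K' \<subseteq> ball 0 (R + 1)" by force
  \<comment> \<open>The coefficients \<open>m v\<close> and \<open>f m v\<close> are bounded but
    need not be square integrable on an unbounded domain. Restricting them to a bounded open set
    containing \<open>K'\<close> does not affect tests supported there.\<close>
  define \<Omega>' where "\<Omega>' = \<Omega> \<inter> ball 0 (R + 1)"
  have o': "open \<Omega>'" unfolding \<Omega>'_def using o by auto
  have K'\<Omega>': "K' \<subseteq> \<Omega>'" using K'\<Omega> R by (auto simp: \<Omega>'_def)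
  have KK': "K \<subseteq> K'" using K'I[of _ 0] d(1) by auto
  have b\<Omega>': "bounded \<Omega>'" unfolding \<Omega>'_def by (rule bounded_subset[of "ball 0 (R + 1)"]) auto
  have [measurable]: "\<Omega>' \<in> sets borel" using o' by simp
  have pm[measurable]: "p \<in> borel_measurable borel" using p by (simp add: L2_def)
  have \<phi>m[measurable]: "\<phi> \<in> borel_measurable borel" using tdirD(3)[OF \<phi>(2)[OF et]] .
  have [measurable]: "m \<in> borel_measurable borel" "m_t \<in> borel_measurable borel" "f \<in> borel_measurable borel"
    "v \<in> borel_measurable borel" "\<And>e. bb e \<in> borel_measurable borel" by fact+
  define \<Phi> where "\<Phi> x = \<phi> x * p x" for x
  define \<Phi>' where "\<Phi>' e x = \<phi>' e x * p x + \<phi> x * G e x" for e x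
  have \<Phi>L: "\<Phi> \<in> L2" unfolding \<Phi>_def by (rule L2_bounded_mult[OF p(1) \<phi>m B])
  have \<Phi>'L: "\<Phi>' e \<in> L2" if e: "e \<in> ?S" for e
  proof -
    have eB: "e \<in> Basis" using e by simp
    obtain B' where "\<And>x. \<bar>\<phi>' e x\<bar> \<le> B'" by (rule tdirE[OF \<phi>(2)[OF eB]]) (rule that)
    then show ?thesis unfolding \<Phi>'_def
      by (intro L2_add L2_bounded_mult[OF p(1) tdirD(4)[OF \<phi>(2)[OF eB]]] L2_bounded_mult[OF G(1)[OF e] \<phi>m B])
  qed
  have \<Phi>m[measurable]: "\<Phi> \<in> borel_measurable borel" using \<Phi>L by (simp add: L2_def)
  have \<Phi>0: "x \<notin> K \<Longrightarrow> \<Phi> x = 0" for x using K0 by (simp add: \<Phi>_def)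
  have \<Phi>'0: "x \<notin> K \<Longrightarrow> e \<in> ?S \<Longrightarrow> \<Phi>' e x = 0" for e x using K0 K0' by (simp add: \<Phi>'_def)
  have indL: "indicator K \<in> L2"
    by (rule L2_bounded_support[OF _ _ compact_imp_bounded[OF K(1)], of _ 1])
       (auto simp: borel_compact K intro!: borel_measurable_indicator)
  have int_of_supp: "integrable lborel w" if "w \<in> L2" "\<And>x. x \<notin> K \<Longrightarrow> w x = 0" for w
  proof -
    have "(\<lambda>x. indicator K x * w x) = w" using that(2) by (intro ext) (auto simp: indicator_def)
    then show ?thesis using L2_mult_integrable[OF indL that(1)] by simp
  qed
  note \<Phi>i = int_of_supp[OF \<Phi>L \<Phi>0]
  have \<Phi>'i: "integrable lborel (\<Phi>' e)" "\<Phi>' e \<in> borel_measurable borel" if "e \<in> ?S" for e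
    using int_of_supp[OF \<Phi>'L[OF that] \<Phi>'0[OF _ that]] \<Phi>'L[OF that] by (auto simp: L2_def)
  define a where "a e x = indicator \<Omega>' x * (if e = et then m x * v x else - (m x * G e x + m x * v x * bb e x))" for e x
  define a0 where "a0 x = indicator \<Omega>' x * (f x * m x * v x)" for x
  have vabs: "\<bar>v x\<bar> \<le> 1" for x using v(2,3)[of x] by simp
  have mv: "\<bar>m x * v x\<bar> \<le> M" for x
    using mult_mono[OF m(2)[of x] vabs[of x]] M0 by (simp add: abs_mult)
  have aet: "a et \<in> L2"
  proof (rule L2_bounded_support[where B=M and K=\<Omega>'])
    have "a et = (\<lambda>x. indicator \<Omega>' x * (m x * v x))" by (rule ext) (simp add: a_def)
    then show "a et \<in> borel_measurable borel" by simp
  qed (use mv M0 b\<Omega>' in \<open>auto simp: a_def indicator_def\<close>)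
  have aL: "a e \<in> L2" if "e \<in> Basis" for e
  proof (cases "e = et")
    case False
    with that have e: "e \<in> ?S" by simp
    have [measurable]: "G e \<in> borel_measurable borel" using G(1)[OF e] by (simp add: L2_def)
    have "(\<lambda>x. (indicator \<Omega>' x * m x) * G e x) \<in> L2"
      by (rule L2_bounded_mult[OF G(1)[OF e], of _ M]) (use m M0 in \<open>auto simp: indicator_def\<close>)
    moreover have "(\<lambda>x. indicator \<Omega>' x * (m x * v x * bb e x)) \<in> L2"
    proof (rule L2_bounded_support[where B="M * M" and K=\<Omega>'])
      show "\<bar>indicator \<Omega>' x * (m x * v x * bb e x)\<bar> \<le> M * M" for x
        using mult_mono[OF mv[of x] bb(2)[of e x]] M0 by (auto simp: indicator_def abs_mult)
    qed (use b\<Omega>' in auto)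
    ultimately have "(\<lambda>x. (-1) * ((indicator \<Omega>' x * m x) * G e x + indicator \<Omega>' x * (m x * v x * bb e x))) \<in> L2"
      by (intro L2_cmult L2_add)
    then show ?thesis using False by (simp add: a_def[abs_def] algebra_simps)
  qed (simp add: aet)
  have a0L: "a0 \<in> L2"
  proof (rule L2_bounded_support[where B="M * M" and K=\<Omega>'])
    show "\<bar>a0 x\<bar> \<le> M * M" for x
      using mult_mono[OF f(2)[of x] mv[of x]] M0 by (auto simp: a0_def indicator_def abs_mult mult.assoc)
  qed (use b\<Omega>' in \<open>auto simp: a0_def[abs_def]\<close>)
  have sumB: "(\<Sum>e\<in>Basis. F e) = F et + (\<Sum>e\<in>?S. F e)" for F :: "'a \<Rightarrow> real"
    using et by (subst sum.remove[of _ et]) auto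
  have eq': "(\<Sum>e\<in>Basis. \<integral>x. a e x * dir_deriv e \<psi> x \<partial>lborel) + (\<integral>x. a0 x * \<psi> x \<partial>lborel) = 0"
    if \<psi>: "test_function \<Omega>' \<psi>" for \<psi>
  proof -
    obtain L where L: "compact L" "L \<subseteq> \<Omega>'" "\<And>x. x \<notin> L \<Longrightarrow> \<psi> x = 0" "\<And>x e. x \<notin> L \<Longrightarrow> dir_deriv e \<psi> x = 0"
      by (rule test_functionE[OF \<psi>]) (rule that)
    have z: "\<psi> x = 0" "dir_deriv e \<psi> x = 0" if "x \<notin> \<Omega>'" for x e using L that by auto
    have "(\<lambda>x. a et x * dir_deriv et \<psi> x) = (\<lambda>x. m x * v x * dir_deriv et \<psi> x)"
      using z(2)[of _ et] by (intro ext) (auto simp: a_def indicator_def)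
    moreover have "(\<Sum>e\<in>?S. \<integral>x. a e x * dir_deriv e \<psi> x \<partial>lborel)
      = - (\<Sum>e\<in>?S. \<integral>x. (m x * G e x + m x * v x * bb e x) * dir_deriv e \<psi> x \<partial>lborel)"
      unfolding sum_negf[symmetric]
    proof (rule sum.cong[OF refl])
      fix e assume e: "e \<in> ?S"
      have "(\<lambda>x. a e x * dir_deriv e \<psi> x) = (\<lambda>x. - ((m x * G e x + m x * v x * bb e x) * dir_deriv e \<psi> x))"
        using z(2)[of _ e] e by (intro ext) (auto simp: a_def indicator_def algebra_simps)
      then show "(\<integral>x. a e x * dir_deriv e \<psi> x \<partial>lborel) = - (\<integral>x. (m x * G e x + m x * v x * bb e x) * dir_deriv e \<psi> x \<partial>lborel)" by simp
    qed
    moreover have "(\<lambda>x. a0 x * \<psi> x) = (\<lambda>x. f x * m x * v x * \<psi> x)"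
      using z(1) by (intro ext) (auto simp: a0_def indicator_def)
    moreover have "test_function \<Omega> \<psi>" by (rule test_function_mono[OF \<psi>]) (simp add: \<Omega>'_def)
    ultimately show ?thesis using eq[of \<psi>] by (simp add: sumB)
  qed
  have \<Phi>w: "(\<integral>x. \<Phi> x * \<zeta>' x \<partial>lborel) = - (\<integral>x. \<Phi>' e x * \<zeta> x \<partial>lborel)"
    if "e \<in> ?S" "tdir UNIV e \<zeta> \<zeta>'" for e \<zeta> \<zeta>'
    unfolding \<Phi>_def \<Phi>'_def using that
    by (intro cutoff_weak_derivative[OF o _ p G(1) G(2) \<phi>(2)]) auto
  have net: "norm et = 1" using et by simp
  define Y where "Y h = (\<Sum>e\<in>?S. \<integral>x. a e x * steklov h et (\<Phi>' e) x \<partial>lborel) + (\<integral>x. a0 x * steklov h et \<Phi> x \<partial>lborel)" for h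
  \<comment> \<open>What the time term would be if \<open>v\<close> were 1 everywhere; the proof
    compares it with the true time term.\<close>
  define W where "W h = (\<integral>x. (m x - m (x + h *\<^sub>R et)) / h * \<Phi> x \<partial>lborel)" for h
  \<comment> \<open>The test function is the Steklov average of \<open>\<Phi>\<close>, whose time
    derivative is a backward difference quotient. A translation puts the quotient on
    \<open>m v\<close>, in the form \<open>(a(x) - a(x + h)) / h\<close>, which is minus the usual
    one.\<close>
  have test: "(\<integral>x. (a et x - a et (x + h *\<^sub>R et)) / h * \<Phi> x \<partial>lborel) + Y h = 0"
    if h: "h \<noteq> 0" "\<bar>h\<bar> \<le> d" for h
  proof -
    define D where "D e = (if e = et then (\<lambda>x. (\<Phi> x - \<Phi> (x + (- h) *\<^sub>R et)) / h) else steklov h et (\<Phi>' e))" for e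
    have "(\<Sum>e\<in>Basis. \<integral>x. a e x * D e x \<partial>lborel) + (\<integral>x. a0 x * steklov h et \<Phi> x \<partial>lborel) = 0"
    proof (rule weak_form_extends[OF o' aL a0L eq' steklov_L2[OF \<Phi>L] _ _ K' K'\<Omega>'])
      fix e :: 'a assume e: "e \<in> Basis"
      show "D e \<in> L2"
        using e steklov_L2[OF \<Phi>'L] L2_cmult[OF L2_diff[OF \<Phi>L L2_translate[OF \<Phi>L, of "(- h) *\<^sub>R et"]], of "1/h"]
        by (auto simp: D_def)
      show "wderiv UNIV e (steklov h et \<Phi>) (D e)"
        unfolding wderiv_def
      proof (intro allI impI)
        fix \<zeta> :: "'a \<Rightarrow> real" assume "test_function UNIV \<zeta>"
        note z = tdir_test_function[OF this e]
        show "(\<integral>x. steklov h et \<Phi> x * dir_deriv e \<zeta> x \<partial>lborel) = - (\<integral>x. D e x * \<zeta> x \<partial>lborel)"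
        proof (cases "e = et")
          case True
          then show ?thesis using steklov_shift_derivative[OF \<Phi>i \<Phi>m h(1)] z by (simp add: D_def)
        next
          case False
          then have e': "e \<in> ?S" using e by simp
          show ?thesis using steklov_weak_derivative[OF \<Phi>i \<Phi>m \<Phi>'i[OF e'] \<Phi>w[OF e'] z] False by (simp add: D_def)
        qed
      qed
    next
      fix x assume x: "x \<notin> K'"
      have "\<Phi> (x + (- (h * s)) *\<^sub>R et) = 0" if "s \<in> {0..1}" for s
      proof (rule \<Phi>0)
        show "x + (- (h * s)) *\<^sub>R et \<notin> K"
        proof
          assume "x + (- (h * s)) *\<^sub>R et \<in> K"
          moreover have "norm ((h * s) *\<^sub>R et) \<le> d"
            using that h(2) mult_left_le[of "\<bar>s\<bar>" "\<bar>h\<bar>"] by (simp add: net abs_mult)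
          ultimately have "(x + (- (h * s)) *\<^sub>R et) + (h * s) *\<^sub>R et \<in> K'" by (rule K'I)
          then show False using x by simp
        qed
      qed
      then have "steklov h et \<Phi> x = (\<integral>s. 0 \<partial>unit_interval)"
        unfolding steklov_def by (intro Bochner_Integration.integral_cong) (auto simp: unit_interval)
      then show "steklov h et \<Phi> x = 0" by simp
    qed
    moreover have "(\<integral>x. a et x * D et x \<partial>lborel) = (\<integral>x. (a et x - a et (x + h *\<^sub>R et)) / h * \<Phi> x \<partial>lborel)"
    proof -
      have [measurable]: "a et \<in> borel_measurable borel" using aet by (simp add: L2_def)
      note i1 = L2_mult_integrable[OF aet \<Phi>L] and i2 = L2_mult_integrable[OF aet L2_translate[OF \<Phi>L, of "(-h) *\<^sub>R et"]]
        and i3 = L2_mult_integrable[OF L2_translate[OF aet, of "h *\<^sub>R et"] \<Phi>L]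
      have "(\<integral>x. a et x * D et x \<partial>lborel) = (\<integral>x. (a et x * \<Phi> x - a et x * \<Phi> (x + (- h) *\<^sub>R et)) / h \<partial>lborel)"
        by (intro Bochner_Integration.integral_cong refl) (simp add: D_def algebra_simps diff_divide_distrib)
      also have "\<dots> = ((\<integral>x. a et x * \<Phi> x \<partial>lborel) - (\<integral>x. a et x * \<Phi> (x + (- h) *\<^sub>R et) \<partial>lborel)) / h"
        by (subst integral_divide_zero) (simp only: Bochner_Integration.integral_diff[OF i1 i2])
      also have "(\<integral>x. a et x * \<Phi> (x + (- h) *\<^sub>R et) \<partial>lborel) = (\<integral>x. a et (x + h *\<^sub>R et) * \<Phi> x \<partial>lborel)"
        using integral_translate[of "\<lambda>x. a et x * \<Phi> (x + (- h) *\<^sub>R et)" "h *\<^sub>R et"] by simp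
      also have "((\<integral>x. a et x * \<Phi> x \<partial>lborel) - (\<integral>x. a et (x + h *\<^sub>R et) * \<Phi> x \<partial>lborel)) / h
        = (\<integral>x. (a et x * \<Phi> x - a et (x + h *\<^sub>R et) * \<Phi> x) / h \<partial>lborel)"
        by (subst integral_divide_zero) (simp only: Bochner_Integration.integral_diff[OF i1 i3])
      also have "\<dots> = (\<integral>x. (a et x - a et (x + h *\<^sub>R et)) / h * \<Phi> x \<partial>lborel)"
        by (intro Bochner_Integration.integral_cong refl) (simp add: algebra_simps diff_divide_distrib)
      finally show ?thesis .
    qed
    moreover have "(\<Sum>e\<in>?S. \<integral>x. a e x * D e x \<partial>lborel) = (\<Sum>e\<in>?S. \<integral>x. a e x * steklov h et (\<Phi>' e) x \<partial>lborel)"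
      by (intro sum.cong refl) (simp add: D_def)
    ultimately show ?thesis by (simp add: sumB Y_def)
  qed
  \<comment> \<open>Differentiability of \<open>m\<close> is known in \<open>\<Omega>\<close> only,
    so the mean value bound is taken along segments starting in \<open>K\<close>, which do not leave
    \<open>\<Omega>\<close> for shifts up to \<open>d\<close>.\<close>
  have inc: "\<bar>m x - m (x + h *\<^sub>R et)\<bar> \<le> M * \<bar>h\<bar>" if "x \<in> K" "\<bar>h\<bar> \<le> d" for x h
  proof -
    have "norm ((\<lambda>s. m (x + s *\<^sub>R et)) 0 - (\<lambda>s. m (x + s *\<^sub>R et)) h) \<le> M * norm (0 - h)"
    proof (rule field_differentiable_bound[of "cball 0 d"])
      fix s :: real assume "s \<in> cball 0 d"
      then have "x + s *\<^sub>R et \<in> \<Omega>" using K'I[OF that(1), of "s *\<^sub>R et"] K'\<Omega> by (auto simp: net)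
      from mt(3)[OF this] have "((\<lambda>r. m (x + (r + s) *\<^sub>R et)) has_real_derivative m_t (x + s *\<^sub>R et)) (at 0)"
        by (simp add: scaleR_add_left add_ac)
      then have "((\<lambda>r. m (x + r *\<^sub>R et)) has_real_derivative m_t (x + s *\<^sub>R et)) (at s)"
        using DERIV_shift[of "\<lambda>r. m (x + r *\<^sub>R et)" "m_t (x + s *\<^sub>R et)" 0 s] by simp
      then show "((\<lambda>r. m (x + r *\<^sub>R et)) has_real_derivative m_t (x + s *\<^sub>R et)) (at s within cball 0 d)"
        by (rule has_field_derivative_at_within)
      show "norm (m_t (x + s *\<^sub>R et)) \<le> M" using mt(1) by simp
    qed (use that d in auto)
    then show ?thesis unfolding scaleR_zero_left add_0_right by simp
  qed
  have \<Phi>pos: "\<Phi> x \<ge> 0" for x using \<phi>(1) p(2) by (simp add: \<Phi>_def)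
  have Wi: "integrable lborel (\<lambda>x. (m x - m (x + h *\<^sub>R et)) / h * \<Phi> x)" if h: "h \<noteq> 0" "\<bar>h\<bar> \<le> d" for h
  proof (rule Bochner_Integration.integrable_bound[OF integrable_mult_right[OF \<Phi>i, of M]])
    show "AE x in lborel. norm ((m x - m (x + h *\<^sub>R et)) / h * \<Phi> x) \<le> norm (M * \<Phi> x)"
    proof (rule AE_I2)
      fix x
      show "norm ((m x - m (x + h *\<^sub>R et)) / h * \<Phi> x) \<le> norm (M * \<Phi> x)"
      proof (cases "x \<in> K")
        case True
        have "\<bar>(m x - m (x + h *\<^sub>R et)) / h\<bar> \<le> M" using inc[OF True h(2)] h(1) by (simp add: divide_le_eq abs_divide)
        from mult_right_mono[OF this \<Phi>pos[of x]] show ?thesis using \<Phi>pos[of x] M0 by (simp add: abs_mult)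
      qed (simp add: \<Phi>0)
    qed
  qed measurable
  have Ai: "integrable lborel (\<lambda>x. (a et x - a et (x + h *\<^sub>R et)) / h * \<Phi> x)" for h
    using L2_mult_integrable[OF L2_cmult[OF L2_diff[OF aet L2_translate[OF aet, of "h *\<^sub>R et"]], of "1/h"] \<Phi>L] by simp
  \<comment> \<open>Where \<open>\<Phi>\<close> is nonzero, \<open>v = 1\<close> at \<open>x\<close>
    and \<open>v \<le> 1\<close> at the shifted point, so replacing \<open>v\<close> by 1 can only
    lower the difference. This holds for both signs of \<open>h\<close>; the division by
    \<open>h\<close> is what separates the two cases.\<close>
  have cmp: "(a et x - a et (x + h *\<^sub>R et)) * \<Phi> x \<ge> (m x - m (x + h *\<^sub>R et)) * \<Phi> x" if h: "\<bar>h\<bar> \<le> d" for x h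
  proof (cases "\<Phi> x = 0")
    case False
    then have x: "x \<in> K" using \<Phi>0 by blast
    have "p x \<noteq> 0" using False by (auto simp: \<Phi>_def)
    then have v1: "v x = 1" by (rule vp)
    have "x + h *\<^sub>R et \<in> \<Omega>'" using K'I[OF x, of "h *\<^sub>R et"] h K'\<Omega>' by (auto simp: net)
    moreover have "x \<in> \<Omega>'" using x KK' K'\<Omega>' by auto
    moreover have "m (x + h *\<^sub>R et) * v (x + h *\<^sub>R et) \<le> m (x + h *\<^sub>R et)" by (rule mult_left_le[OF v(3) m(3)])
    ultimately have "m x - m (x + h *\<^sub>R et) \<le> a et x - a et (x + h *\<^sub>R et)" by (simp add: a_def v1)
    then show ?thesis by (rule mult_right_mono[OF _ \<Phi>pos])
  qed simp
  have pos: "W h + Y h \<le> 0" if h: "h > 0" "h \<le> d" for h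
  proof -
    have "W h \<le> (\<integral>x. (a et x - a et (x + h *\<^sub>R et)) / h * \<Phi> x \<partial>lborel)"
      unfolding W_def
    proof (rule integral_mono[OF Wi Ai])
      show "(m x - m (x + h *\<^sub>R et)) / h * \<Phi> x \<le> (a et x - a et (x + h *\<^sub>R et)) / h * \<Phi> x" for x
        using divide_right_mono[OF cmp[of h x], of h] h by simp
    qed (use h in auto)
    then show ?thesis using test[of h] h by auto
  qed
  have neg: "W h + Y h \<ge> 0" if h: "h < 0" "- h \<le> d" for h
  proof -
    have "W h \<ge> (\<integral>x. (a et x - a et (x + h *\<^sub>R et)) / h * \<Phi> x \<partial>lborel)"
      unfolding W_def
    proof (rule integral_mono[OF Ai Wi])
      show "(m x - m (x + h *\<^sub>R et)) / h * \<Phi> x \<ge> (a et x - a et (x + h *\<^sub>R et)) / h * \<Phi> x" for x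
        using divide_right_mono_neg[OF cmp[of h x], of h] h by simp
    qed (use h in auto)
    then show ?thesis using test[of h] h by auto
  qed
  define Y0 where "Y0 = (\<Sum>e\<in>?S. \<integral>x. a e x * \<Phi>' e x \<partial>lborel) + (\<integral>x. a0 x * \<Phi> x \<partial>lborel)"
  have lim: "(\<lambda>n. W (h n) + Y (h n)) \<longlonglongrightarrow> - (\<integral>x. m_t x * \<Phi> x \<partial>lborel) + Y0"
    if h: "h \<longlonglongrightarrow> 0" "\<And>n. h n \<noteq> 0" "\<And>n. \<bar>h n\<bar> \<le> d" for h
  proof (rule tendsto_add)
    show "(\<lambda>n. Y (h n)) \<longlonglongrightarrow> Y0"
      unfolding Y_def Y0_def
    proof (intro tendsto_add tendsto_sum)
      show "(\<lambda>n. \<integral>x. a0 x * steklov (h n) et \<Phi> x \<partial>lborel) \<longlonglongrightarrow> (\<integral>x. a0 x * \<Phi> x \<partial>lborel)"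
        by (rule L2_tendsto_integral[OF steklov_L2[OF \<Phi>L] \<Phi>L a0L steklov_tendsto[OF \<Phi>L h(1)]])
      fix e assume e: "e \<in> ?S"
      then have "e \<in> Basis" by simp
      then show "(\<lambda>n. \<integral>x. a e x * steklov (h n) et (\<Phi>' e) x \<partial>lborel) \<longlonglongrightarrow> (\<integral>x. a e x * \<Phi>' e x \<partial>lborel)"
        by (intro L2_tendsto_integral[OF steklov_L2[OF \<Phi>'L[OF e]] \<Phi>'L[OF e] aL steklov_tendsto[OF \<Phi>'L[OF e] h(1)]])
    qed
    have "(\<lambda>n. W (h n)) \<longlonglongrightarrow> (\<integral>x. - (m_t x * \<Phi> x) \<partial>lborel)"
      unfolding W_def
    proof (rule integral_dominated_convergence[where w="\<lambda>x. M * \<Phi> x"])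
      show "integrable lborel (\<lambda>x. M * \<Phi> x)" using \<Phi>i by simp
      show "AE x in lborel. norm ((m x - m (x + h n *\<^sub>R et)) / h n * \<Phi> x) \<le> M * \<Phi> x" for n
      proof (rule AE_I2)
        fix x
        show "norm ((m x - m (x + h n *\<^sub>R et)) / h n * \<Phi> x) \<le> M * \<Phi> x"
        proof (cases "x \<in> K")
          case True
          have "\<bar>(m x - m (x + h n *\<^sub>R et)) / h n\<bar> \<le> M" using inc[OF True h(3)] h(2) by (simp add: divide_le_eq abs_divide)
          from mult_right_mono[OF this \<Phi>pos[of x]] show ?thesis using \<Phi>pos[of x] M0 by (simp add: abs_mult)
        qed (simp add: \<Phi>0)
      qed
      show "AE x in lborel. (\<lambda>n. (m x - m (x + h n *\<^sub>R et)) / h n * \<Phi> x) \<longlonglongrightarrow> - (m_t x * \<Phi> x)"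
      proof (rule AE_I2)
        fix x
        show "(\<lambda>n. (m x - m (x + h n *\<^sub>R et)) / h n * \<Phi> x) \<longlonglongrightarrow> - (m_t x * \<Phi> x)"
        proof (cases "x \<in> K")
          case True
          then have "((\<lambda>s. (m (x + s *\<^sub>R et) - m x) / s) \<longlongrightarrow> m_t x) (at 0)"
            using mt(3)[of x] K(2) by (auto simp: has_field_derivative_iff)
          then have "(\<lambda>n. (m (x + h n *\<^sub>R et) - m x) / h n) \<longlonglongrightarrow> m_t x"
            by (rule filterlim_compose) (use h in \<open>auto simp: filterlim_at\<close>)
          then have "(\<lambda>n. - ((m (x + h n *\<^sub>R et) - m x) / h n) * \<Phi> x) \<longlonglongrightarrow> - m_t x * \<Phi> x" by (intro tendsto_intros)
          then show ?thesis by (simp add: minus_divide_left)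
        qed (simp add: \<Phi>0)
      qed
    qed measurable
    then show "(\<lambda>n. W (h n)) \<longlonglongrightarrow> - (\<integral>x. m_t x * \<Phi> x \<partial>lborel)" by simp
  qed
  define h where "h n = d / real (Suc n)" for n
  have h: "h n > 0" "h n \<le> d" for n using d by (auto simp: h_def divide_le_eq)
  have hl: "h \<longlonglongrightarrow> 0" unfolding h_def by (rule lim_const_over_n[THEN LIMSEQ_Suc])
  have "- (\<integral>x. m_t x * \<Phi> x \<partial>lborel) + Y0 \<le> 0"
    by (rule LIMSEQ_le_const2[OF lim[OF hl]]) (use h pos in \<open>auto simp: less_imp_neq[symmetric] less_imp_le\<close>)
  moreover have "- (\<integral>x. m_t x * \<Phi> x \<partial>lborel) + Y0 \<ge> 0"
  proof (rule LIMSEQ_le_const[OF lim[of "\<lambda>n. - h n"]])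
    show "(\<lambda>n. - h n) \<longlonglongrightarrow> 0" using tendsto_minus[OF hl] by simp
    show "- h n \<noteq> 0" "\<bar>- h n\<bar> \<le> d" for n using h[of n] by auto
    show "\<exists>N. \<forall>n\<ge>N. 0 \<le> W (- h n) + Y (- h n)" using neg[of "- h _"] h by auto
  qed
  moreover have "(\<Sum>e\<in>?S. \<integral>x. a e x * \<Phi>' e x \<partial>lborel)
    = - (\<Sum>e\<in>?S. \<integral>x. (m x * G e x + m x * v x * bb e x) * \<Phi>' e x \<partial>lborel)"
  proof -
    have "(\<integral>x. a e x * \<Phi>' e x \<partial>lborel) = - (\<integral>x. (m x * G e x + m x * v x * bb e x) * \<Phi>' e x \<partial>lborel)" if e: "e \<in> ?S" for e
    proof -
      have "\<Phi>' e x = 0" if "x \<notin> \<Omega>'" for x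
        using \<Phi>'0[OF _ e, of x] that KK' K'\<Omega>' by blast
      then have "(\<lambda>x. a e x * \<Phi>' e x) = (\<lambda>x. - ((m x * G e x + m x * v x * bb e x) * \<Phi>' e x))"
        using e by (intro ext) (auto simp: a_def indicator_def algebra_simps)
      then show ?thesis by simp
    qed
    then show ?thesis by (simp add: sum_negf)
  qed
  moreover have "(\<lambda>x. a0 x * \<Phi> x) = (\<lambda>x. f x * m x * v x * \<Phi> x)"
  proof
    fix x
    have "\<Phi> x = 0" if "x \<notin> \<Omega>'" using \<Phi>0[of x] that KK' K'\<Omega>' by blast
    then show "a0 x * \<Phi> x = f x * m x * v x * \<Phi> x" by (auto simp: a0_def indicator_def)
  qed
  ultimately show ?thesis unfolding Y0_def \<Phi>'_def \<Phi>_def by simp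
qed

section \<open>Uniform gradient bound for the pressure\<close>

text \<open>Subadditivity of a concave power: \<open>t \<le> t powr a\<close> on the unit interval,
  applied to the fractions \<open>x / (x + y)\<close> and \<open>y / (x + y)\<close>.\<close>

lemma powr_add_le:
  fixes x y a :: real
  assumes "x \<ge> 0" "y \<ge> 0" "0 < a" "a \<le> 1"
  shows "(x + y) powr a \<le> x powr a + y powr a"
proof (cases "x + y = 0")
  case False
  then have s: "x + y > 0" using assms by linarith
  have le: "t \<le> t powr a" if "0 \<le> t" "t \<le> 1" for t :: real
    using powr_mono'[of a 1 t] that assms by simp
  have "1 = x / (x + y) + y / (x + y)" using s by (simp add: add_divide_distrib[symmetric])
  also have "\<dots> \<le> (x / (x + y)) powr a + (y / (x + y)) powr a"
    using assms s by (intro add_mono le) auto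
  also have "\<dots> = (x powr a + y powr a) / (x + y) powr a"
    using assms s by (simp add: powr_divide add_divide_distrib)
  finally show ?thesis using s by (simp add: le_divide_eq)
qed (use assms in auto)

lemma powr_Bernoulli_le:
  fixes s a :: real
  assumes "s > 0" "0 \<le> a" "a \<le> 1"
  shows "s powr a \<le> 1 + a * (s - 1)"
  using Youngs_inequality_0[of a "1 - a" s 1] assms by (simp add: algebra_simps)

lemma primitive_from_0:
  assumes c: "continuous_on {0..} (b :: real \<Rightarrow> real)" and s: "s \<ge> 0"
  shows "((\<lambda>s. integral {0..s} b) has_real_derivative b s) (at s within {0..})"
proof -
  have "((\<lambda>s. integral {0..s} b) has_real_derivative b s) (at s within {0..s+1})"
    by (rule integral_has_real_derivative) (use s in \<open>auto intro: continuous_on_subset[OF c]\<close>)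
  moreover have "at s within {0..s+1} = at s within {0..}"
    by (rule at_within_nhd[of _ "{s-1<..<s+1}"]) auto
  ultimately show ?thesis by simp
qed

text \<open>The exponent of \<open>hb\<close> makes \<open>hb(w) (\<nabla>w)^2\<close> the square of
  \<open>(w + \<eta>)^(-1/k) \<nabla>w\<close>, a regularised pressure gradient. \<open>hh\<close>
  is the primitive of \<open>hb\<close> vanishing at 0, and \<open>\<Gamma>\<close> is chosen so
  that \<open>w^(1/k)\<close> times a derivative of \<open>hh(w)\<close> is the derivative of
  \<open>\<Gamma>(w)\<close>. The factor 3 bounds \<open>1 / (1 - 2/k)\<close> for
  \<open>k \<ge> 3\<close>, and \<open>1/k + (1 - 2/k) = 1 - 1/k\<close> is why the power occurring
  in the pressure controls everything.\<close>

lemma regularised_power_bounds: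
  fixes k \<eta> :: real
  assumes k: "k \<ge> 3" and \<eta>: "\<eta> > 0"
  defines "hb \<equiv> \<lambda>s. (s + \<eta>) powr (- (2/k))"
  defines "hh \<equiv> \<lambda>s. ((s + \<eta>) powr (1 - 2/k) - \<eta> powr (1 - 2/k)) / (1 - 2/k)"
  defines "gb \<equiv> \<lambda>s. s powr (1/k) * hb s"
  defines "\<Gamma> \<equiv> \<lambda>s. integral {0..s} gb"
  shows "continuous_on {0..} hb" "continuous_on {0..} gb"
    and "\<And>s. s \<ge> 0 \<Longrightarrow> \<bar>hb s\<bar> \<le> \<eta> powr (- (2/k))"
    and "\<And>s. s \<ge> 0 \<Longrightarrow> \<bar>gb s\<bar> \<le> \<eta> powr (- (1/k))"
    and "\<And>s. s \<ge> 0 \<Longrightarrow> (hh has_real_derivative hb s) (at s within {0..})"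
    and "\<And>s. s \<ge> 0 \<Longrightarrow> (\<Gamma> has_real_derivative gb s) (at s within {0..})"
    and "\<And>s. s \<ge> 0 \<Longrightarrow> 0 \<le> hh s"
    and "\<And>s. s \<ge> 0 \<Longrightarrow> 0 \<le> \<Gamma> s"
    and "\<And>s. s \<ge> 0 \<Longrightarrow> \<Gamma> s \<le> s powr (1/k) * hh s"
    and "\<And>s. s \<ge> 0 \<Longrightarrow> s powr (1/k) * hh s \<le> 3 * s powr (1 - 1/k)"
proof -
  have a: "1 - 2/k \<ge> 1/3" "1 - 2/k \<le> 1" "1/k > 0" using k by (auto simp: field_simps)
  show c1: "continuous_on {0..} hb" unfolding hb_def using \<eta> by (intro continuous_intros) force
  have "continuous_on {0..} (\<lambda>s::real. s powr (1/k))" using a by (intro continuous_on_powr' continuous_intros) auto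
  then show c2: "continuous_on {0..} gb" unfolding gb_def by (intro continuous_on_mult c1)
  show b1: "\<bar>hb s\<bar> \<le> \<eta> powr (- (2/k))" if "s \<ge> 0" for s
    unfolding hb_def using powr_mono2'[of "- (2/k)" \<eta> "s + \<eta>"] that \<eta> k by simp
  show b2: "\<bar>gb s\<bar> \<le> \<eta> powr (- (1/k))" if s: "s \<ge> 0" for s
  proof -
    have "\<bar>gb s\<bar> \<le> (s + \<eta>) powr (1/k) * (s + \<eta>) powr (- (2/k))"
      unfolding gb_def hb_def using s \<eta> a by (simp add: powr_mono2 mult_right_mono)
    also have "\<dots> = (s + \<eta>) powr (- (1/k))" unfolding powr_add[symmetric] by (simp add: field_simps)
    also have "\<dots> \<le> \<eta> powr (- (1/k))" using powr_mono2'[of "- (1/k)" \<eta> "s + \<eta>"] s \<eta> k by simp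
    finally show ?thesis .
  qed
  show d1: "(hh has_real_derivative hb s) (at s within {0..})" if "s \<ge> 0" for s
  proof -
    have "((\<lambda>s. (s + \<eta>) powr (1 - 2/k)) has_real_derivative (1 - 2/k) * (s + \<eta>) powr (1 - 2/k - of_nat 1) * 1) (at s)"
      by (rule DERIV_fun_powr) (use that \<eta> in \<open>auto intro!: derivative_eq_intros\<close>)
    from DERIV_cdivide[OF DERIV_diff[OF this DERIV_const[of "\<eta> powr (1 - 2/k)"]], of "1 - 2/k"]
    have "(hh has_real_derivative hb s) (at s)"
      unfolding hh_def hb_def using a k by (simp split: if_splits)
    then show ?thesis by (rule has_field_derivative_at_within)
  qed
  show "(\<Gamma> has_real_derivative gb s) (at s within {0..})" if "s \<ge> 0" for s
    unfolding \<Gamma>_def by (rule primitive_from_0[OF c2 that])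
  show "0 \<le> hh s" if "s \<ge> 0" for s
    unfolding hh_def using powr_mono2[of "1 - 2/k" \<eta> "s + \<eta>"] that \<eta> a k by (intro divide_nonneg_nonneg) auto
  have gi: "gb integrable_on {0..s}" and hi: "hb integrable_on {0..s}" for s
    by (rule integrable_continuous_interval, rule continuous_on_subset[OF c2], force,
        rule integrable_continuous_interval, rule continuous_on_subset[OF c1], force)
  show "0 \<le> \<Gamma> s" if "s \<ge> 0" for s
    unfolding \<Gamma>_def by (rule Henstock_Kurzweil_Integration.integral_nonneg[OF gi]) (auto simp: gb_def hb_def)
  \<comment> \<open>The factor \<open>x powr (1/k)\<close> is increasing, so its value at the
    endpoint may be taken out of the integral that defines \<open>\<Gamma>\<close>.\<close>
  show "\<Gamma> s \<le> s powr (1/k) * hh s" if s: "s \<ge> 0" for s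
  proof -
    have "(hb has_integral hh s - hh 0) {0..s}"
    proof (rule fundamental_theorem_of_calculus[OF s])
      fix x assume "x \<in> {0..s}"
      then have "(hh has_real_derivative hb x) (at x within {0..s})"
        by (intro DERIV_subset[OF d1]) auto
      then show "(hh has_vector_derivative hb x) (at x within {0..s})"
        by (simp add: has_real_derivative_iff_has_vector_derivative)
    qed
    then have "((\<lambda>x. s powr (1/k) * hb x) has_integral s powr (1/k) * hh s) {0..s}"
      using has_integral_mult_right[of hb "hh s - hh 0" "{0..s}" "s powr (1/k)"] by (simp add: hh_def)
    then show ?thesis
      unfolding \<Gamma>_def using gi
      by (elim has_integral_le[rotated, OF _ _, of _ _ _ gb]) (use a in \<open>auto simp: gb_def hb_def has_integral_iff intro!: mult_right_mono powr_mono2\<close>)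
  qed
  show "s powr (1/k) * hh s \<le> 3 * s powr (1 - 1/k)" if s: "s \<ge> 0" for s
  proof -
    have le: "(s + \<eta>) powr (1 - 2/k) - \<eta> powr (1 - 2/k) \<le> s powr (1 - 2/k)"
      using powr_add_le[of s \<eta> "1 - 2/k"] s \<eta> a by simp
    have "hh s \<le> s powr (1 - 2/k) / (1 - 2/k)" unfolding hh_def using a k by (intro divide_right_mono le) auto
    also have "\<dots> \<le> s powr (1 - 2/k) / (1/3)"
      using a k by (intro divide_left_mono) auto
    also have "\<dots> = 3 * s powr (1 - 2/k)" by simp
    finally have "s powr (1/k) * hh s \<le> s powr (1/k) * (3 * s powr (1 - 2/k))" by (rule mult_left_mono) simp
    also have "\<dots> = 3 * s powr (1/k + (1 - 2/k))" by (simp only: powr_add mult.left_commute)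
    also have "1/k + (1 - 2/k) = 1 - 1/k" by (simp add: field_simps)
    finally show ?thesis .
  qed
qed

text \<open>Test with \<open>\<theta> hh(w)\<close>. In the transport terms, derivatives of
  \<open>\<Gamma>(w)\<close> are moved onto coefficient and cut-off, so that these terms cost only a
  multiple of the integral of \<open>w^(1-1/k)\<close>. The constant \<open>C2\<close> precedes the
  cut-off in the order of quantifiers: it may depend on \<open>k\<close>, and a small
  \<open>\<epsilon>\<close> chosen afterwards absorbs it. The directions in \<open>S\<close> are
  those with diffusion; \<open>L\<close> bounds the derivatives of the cut-off in all directions,
  \<open>\<epsilon>\<close> those in \<open>S\<close>.\<close>

lemma energy_estimate:
  fixes \<Omega> :: "'a::euclidean_space set" and g c c' :: "'a \<Rightarrow> 'a \<Rightarrow> real" and M k \<eta> :: real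
  assumes o: "open \<Omega>" and S: "S \<subseteq> Basis" and k: "k \<ge> 3" and \<eta>: "\<eta> > 0"
    and w: "w \<in> L2" "\<And>x. w x \<ge> 0" and g: "\<And>e. e \<in> Basis \<Longrightarrow> g e \<in> L2" "\<And>e. e \<in> Basis \<Longrightarrow> wderiv \<Omega> e w (g e)"
    and v: "(\<lambda>x. w x powr (1/k)) \<in> L2" and I: "integrable lborel (\<lambda>x. w x powr (1 - 1/k))"
    and m: "m \<in> borel_measurable borel" "\<And>x. \<bar>m x\<bar> \<le> M"
    and c: "\<And>e. c e \<in> borel_measurable borel" "\<And>e x. \<bar>c e x\<bar> \<le> M" "\<And>e x. \<bar>c' e x\<bar> \<le> M"
      "\<And>e. e \<in> Basis \<Longrightarrow> continuous_on \<Omega> (c e)" "\<And>e. e \<in> Basis \<Longrightarrow> continuous_on \<Omega> (c' e)"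
      "\<And>e x. e \<in> Basis \<Longrightarrow> x \<in> \<Omega> \<Longrightarrow> ((\<lambda>s. c e (x + s *\<^sub>R e)) has_real_derivative c' e x) (at 0)"
    and f0: "f0 \<in> borel_measurable borel" "\<And>x. \<bar>f0 x\<bar> \<le> M"
    and eq: "\<And>\<psi>. test_function \<Omega> \<psi> \<Longrightarrow> (\<Sum>e\<in>Basis. \<integral>x. c e x * w x powr (1/k) * dir_deriv e \<psi> x \<partial>lborel)
      - (\<Sum>e\<in>S. \<integral>x. m x * g e x * dir_deriv e \<psi> x \<partial>lborel)
      + (\<integral>x. f0 x * w x powr (1/k) * \<psi> x \<partial>lborel) = 0"
  shows "\<exists>C2\<ge>0. \<forall>\<theta> \<theta>' (L::real) \<epsilon>. (\<forall>e\<in>Basis. tdir \<Omega> e \<theta> (\<theta>' e)) \<longrightarrow> (\<forall>x. 0 \<le> \<theta> x \<and> \<theta> x \<le> 1) \<longrightarrow>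
      (\<forall>e\<in>Basis. \<forall>x. \<bar>\<theta>' e x\<bar> \<le> L) \<longrightarrow> (\<forall>e\<in>S. \<forall>x. \<bar>\<theta>' e x\<bar> \<le> \<epsilon>) \<longrightarrow>
      (\<Sum>e\<in>S. \<integral>x. m x * \<theta> x * (w x + \<eta>) powr (- (2/k)) * (g e x)\<^sup>2 \<partial>lborel)
      \<le> 3 * M * (DIM('a) * (2 * L + 1) + 1) * (\<integral>x. w x powr (1 - 1/k) \<partial>lborel) + \<epsilon> * C2"
proof -
  define hb where "hb = (\<lambda>s. (s + \<eta>) powr (- (2/k)))"
  define hh where "hh = (\<lambda>s. ((s + \<eta>) powr (1 - 2/k) - \<eta> powr (1 - 2/k)) / (1 - 2/k))"
  define gb where "gb = (\<lambda>s. s powr (1/k) * hb s)"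
  define \<Gamma> where "\<Gamma> = (\<lambda>s. integral {0..s} gb)"
  have rp: "continuous_on {0..} hb" "continuous_on {0..} gb"
    "\<And>s. s \<ge> 0 \<Longrightarrow> \<bar>hb s\<bar> \<le> \<eta> powr (- (2/k))"
    "\<And>s. s \<ge> 0 \<Longrightarrow> \<bar>gb s\<bar> \<le> \<eta> powr (- (1/k))"
    "\<And>s. s \<ge> 0 \<Longrightarrow> (hh has_real_derivative hb s) (at s within {0..})"
    "\<And>s. s \<ge> 0 \<Longrightarrow> (\<Gamma> has_real_derivative gb s) (at s within {0..})"
    "\<And>s. s \<ge> 0 \<Longrightarrow> 0 \<le> hh s" "\<And>s. s \<ge> 0 \<Longrightarrow> 0 \<le> \<Gamma> s"
    "\<And>s. s \<ge> 0 \<Longrightarrow> \<Gamma> s \<le> s powr (1/k) * hh s"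
    "\<And>s. s \<ge> 0 \<Longrightarrow> s powr (1/k) * hh s \<le> 3 * s powr (1 - 1/k)"
    unfolding \<Gamma>_def gb_def hh_def hb_def by (fact regularised_power_bounds[OF k \<eta>])+
  define V where "V x = w x powr (1/k)" for x
  define A where "A x = w x powr (1 - 1/k)" for x
  have VL: "V \<in> L2" using v by (simp add: V_def[abs_def])
  have Ai: "integrable lborel A" using I by (simp add: A_def[abs_def])
  have A0: "A x \<ge> 0" for x by (simp add: A_def)
  have V0: "V x \<ge> 0" for x by (simp add: V_def)
  have M0: "M \<ge> 0" using m(2)[of undefined] by linarith
  have wm[measurable]: "w \<in> borel_measurable borel" using w by (simp add: L2_def)
  have Vm[measurable]: "V \<in> borel_measurable borel" unfolding V_def by measurable
  have [measurable]: "m \<in> borel_measurable borel" "f0 \<in> borel_measurable borel" "\<And>e. c e \<in> borel_measurable borel" by fact+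
  have hbm[measurable]: "(\<lambda>x. hb (w x)) \<in> borel_measurable borel"
    by (rule continuous_on_nonneg_borel[OF rp(1) wm w(2)])
  have hhm[measurable]: "(\<lambda>x. hh (w x)) \<in> borel_measurable borel" unfolding hh_def by measurable
  have Lip: "\<bar>hh s - hh t\<bar> \<le> \<eta> powr (- (2/k)) * \<bar>s - t\<bar>" if "s \<ge> 0" "t \<ge> 0" for s t
    by (rule chain_Lipschitz[OF rp(1) rp(3) rp(5) that])
  have hh0: "hh 0 = 0" by (simp add: hh_def)
  have hL: "(\<lambda>x. hh (w x)) \<in> L2"
  proof (rule L2_dominated[OF hhm w(1)])
    show "\<bar>hh (w x)\<bar> \<le> \<eta> powr (- (2/k)) * \<bar>w x\<bar>" for x using Lip[OF w(2)[of x], of 0] hh0 by simp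
  qed
  have gL: "g e \<in> L2" if "e \<in> S" for e using g(1) S that by auto
  have gm: "g e \<in> borel_measurable borel" if "e \<in> Basis" for e using g(1)[OF that] by (simp add: L2_def)
  \<comment> \<open>Finite for the given \<open>w\<close>, since both factors are square integrable;
    no bound uniform in \<open>k\<close> or \<open>\<eta>\<close> is claimed.\<close>
  define C2 where "C2 = (\<Sum>e\<in>S. M * (\<integral>x. \<bar>g e x * hh (w x)\<bar> \<partial>lborel))"
  have C20: "C2 \<ge> 0" unfolding C2_def using M0 by (intro sum_nonneg mult_nonneg_nonneg) auto
  have Vh: "V x * hh (w x) \<le> 3 * A x" "0 \<le> V x * hh (w x)" "0 \<le> hh (w x)" for x
    using rp(10)[OF w(2)[of x]] rp(7)[OF w(2)[of x]] by (auto simp: V_def A_def)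
  have \<Gamma>b: "\<bar>\<Gamma> (w x)\<bar> \<le> 3 * A x" for x
    using rp(8)[OF w(2)[of x]] rp(9)[OF w(2)[of x]] Vh(1)[of x] by (simp add: V_def)
  have bnd: "\<bar>\<integral>x. F x \<partial>lborel\<bar> \<le> C * (\<integral>x. A x \<partial>lborel)" if "\<And>x. \<bar>F x\<bar> \<le> C * A x" "F \<in> borel_measurable borel" for F C
  proof -
    have Ci: "integrable lborel (\<lambda>x. C * A x)" using Ai by simp
    have Fi: "integrable lborel F"
      by (rule Bochner_Integration.integrable_bound[OF Ci]) (use that in \<open>auto intro!: AE_I2 order_trans[OF that(1) abs_ge_self]\<close>)
    have "norm (\<integral>x. F x \<partial>lborel) \<le> (\<integral>x. C * A x \<partial>lborel)"
      by (rule Bochner_Integration.integral_norm_bound_integral[OF Fi Ci]) (use that in simp)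
    then show ?thesis by simp
  qed
  have main: "(\<Sum>e\<in>S. \<integral>x. m x * \<theta> x * (w x + \<eta>) powr (- (2/k)) * (g e x)\<^sup>2 \<partial>lborel)
      \<le> 3 * M * (DIM('a) * (2 * L + 1) + 1) * (\<integral>x. w x powr (1 - 1/k) \<partial>lborel) + \<epsilon> * C2"
    if t: "\<And>e. e \<in> Basis \<Longrightarrow> tdir \<Omega> e \<theta> (\<theta>' e)" and \<theta>0: "\<And>x. 0 \<le> \<theta> x" and \<theta>1: "\<And>x. \<theta> x \<le> 1"
      and L: "\<And>e x. e \<in> Basis \<Longrightarrow> \<bar>\<theta>' e x\<bar> \<le> L" and \<epsilon>: "\<And>e x. e \<in> S \<Longrightarrow> \<bar>\<theta>' e x\<bar> \<le> \<epsilon>" for \<theta> \<theta>' and L \<epsilon> :: real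
  proof -
    have ex: "(SOME e. e \<in> Basis) \<in> (Basis :: 'a set)" by (rule SOME_Basis)
    have L0: "L \<ge> 0" using L[OF ex, of undefined] by linarith
    have \<theta>a: "\<bar>\<theta> x\<bar> \<le> 1" for x using \<theta>0[of x] \<theta>1[of x] by simp
    have \<theta>m[measurable]: "\<theta> \<in> borel_measurable borel" using tdirD(3)[OF t[OF ex]] .
    have \<theta>m': "\<theta>' e \<in> borel_measurable borel" if "e \<in> Basis" for e using tdirD(4)[OF t[OF that]] .
    obtain K where K: "compact K" "K \<subseteq> \<Omega>" "\<And>x. x \<notin> K \<Longrightarrow> \<theta> x = 0" by (rule tdirE[OF t[OF ex]]) (rule that)
    define \<Psi> where "\<Psi> x = \<theta> x * hh (w x)" for x
    define D where "D e x = \<theta>' e x * hh (w x) + \<theta> x * hb (w x) * g e x" for e x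
    have \<Psi>L: "\<Psi> \<in> L2" unfolding \<Psi>_def by (rule L2_bounded_mult[OF hL \<theta>m \<theta>a])
    have thb: "\<bar>\<theta> x * hb (w x)\<bar> \<le> \<eta> powr (- (2/k))" for x
      using mult_mono[OF \<theta>a[of x] rp(3)[OF w(2)[of x]]] by (simp add: abs_mult)
    have DL1: "(\<lambda>x. \<theta>' e x * hh (w x)) \<in> L2" "(\<lambda>x. \<theta> x * hb (w x) * g e x) \<in> L2" if e: "e \<in> Basis" for e
      by (rule L2_bounded_mult[OF hL \<theta>m'[OF e] L[OF e]], rule L2_bounded_mult[OF g(1)[OF e] _ thb]) measurable
    have DL: "D e \<in> L2" if "e \<in> Basis" for e unfolding D_def by (intro L2_add DL1 that)
    have cV: "(\<lambda>x. c e x * V x) \<in> L2" for e by (rule L2_bounded_mult[OF VL c(1,2)])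
    have mg: "(\<lambda>x. m x * g e x) \<in> L2" if "e \<in> Basis" for e by (rule L2_bounded_mult[OF g(1)[OF that] m])
    \<comment> \<open>One linear form: transport in every direction, time included, and diffusion in
      the directions of \<open>S\<close> only.\<close>
    define a where "a e x = c e x * V x - (if e \<in> S then m x * g e x else 0)" for e x
    have aL: "a e \<in> L2" if "e \<in> Basis" for e
      unfolding a_def using L2_diff[OF cV mg[OF that]] cV by (cases "e \<in> S") auto
    have f0L: "(\<lambda>x. f0 x * V x) \<in> L2" by (rule L2_bounded_mult[OF VL f0])
    have spl: "(\<Sum>e\<in>Basis. \<integral>x. a e x * F e x \<partial>lborel)
      = (\<Sum>e\<in>Basis. \<integral>x. c e x * V x * F e x \<partial>lborel) - (\<Sum>e\<in>S. \<integral>x. m x * g e x * F e x \<partial>lborel)"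
      if F: "\<And>e. e \<in> Basis \<Longrightarrow> F e \<in> L2" for F
    proof -
      have "(\<integral>x. a e x * F e x \<partial>lborel) = (\<integral>x. c e x * V x * F e x \<partial>lborel) - (if e \<in> S then (\<integral>x. m x * g e x * F e x \<partial>lborel) else 0)"
        if e: "e \<in> Basis" for e
        using L2_mult_integrable[OF cV F[OF e], of e] L2_mult_integrable[OF mg[OF e] F[OF e]]
        by (cases "e \<in> S") (simp_all add: a_def left_diff_distrib)
      then have "(\<Sum>e\<in>Basis. \<integral>x. a e x * F e x \<partial>lborel) = (\<Sum>e\<in>Basis. (\<integral>x. c e x * V x * F e x \<partial>lborel) - (if e \<in> S then (\<integral>x. m x * g e x * F e x \<partial>lborel) else 0))"
        by (intro sum.cong refl)
      also have "\<dots> = (\<Sum>e\<in>Basis. \<integral>x. c e x * V x * F e x \<partial>lborel) - (\<Sum>e\<in>Basis. if e \<in> S then (\<integral>x. m x * g e x * F e x \<partial>lborel) else 0)"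
        by (rule sum_subtractf)
      also have "(\<Sum>e\<in>Basis. if e \<in> S then (\<integral>x. m x * g e x * F e x \<partial>lborel) else 0) = (\<Sum>e\<in>S. \<integral>x. m x * g e x * F e x \<partial>lborel)"
        using S by (subst sum.inter_restrict[symmetric]) (auto simp: Int_absorb1)
      finally show ?thesis .
    qed
    have "(\<Sum>e\<in>Basis. \<integral>x. a e x * D e x \<partial>lborel) + (\<integral>x. f0 x * V x * \<Psi> x \<partial>lborel) = 0"
    proof (rule weak_form_extends[OF o aL f0L _ \<Psi>L DL _ K(1,2)])
      fix \<psi> assume \<psi>: "test_function \<Omega> \<psi>"
      show "(\<Sum>e\<in>Basis. \<integral>x. a e x * dir_deriv e \<psi> x \<partial>lborel) + (\<integral>x. f0 x * V x * \<psi> x \<partial>lborel) = 0"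
        using eq[OF \<psi>] spl[of "\<lambda>e. dir_deriv e \<psi>"] tdir_L2(2)[OF tdir_test_function[OF \<psi>]] by (simp add: V_def)
    next
      fix e :: 'a assume e: "e \<in> Basis"
      show "wderiv UNIV e \<Psi> (D e)" unfolding wderiv_def \<Psi>_def D_def
        by (intro allI impI cutoff_chain_weak_derivative[OF rp(1) rp(3) rp(5) o e w g(1)[OF e] g(2)[OF e] t[OF e] tdir_test_function[OF _ e]])
    qed (use K in \<open>auto simp: \<Psi>_def\<close>)
    then have E: "(\<Sum>e\<in>S. \<integral>x. m x * g e x * D e x \<partial>lborel)
      = (\<Sum>e\<in>Basis. \<integral>x. c e x * V x * D e x \<partial>lborel) + (\<integral>x. f0 x * V x * \<Psi> x \<partial>lborel)"
      using spl[of D] DL by simp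
    \<comment> \<open>Of the two parts of \<open>D e\<close>, the one in which the cut-off is
      differentiated is bounded directly and contributes \<open>3 * M * L\<close>; the one
      containing \<open>g e\<close> is integrated by parts through \<open>\<Gamma>\<close> and
      contributes \<open>3 * (M + M * L)\<close>.\<close>
    have T1: "(\<integral>x. c e x * V x * D e x \<partial>lborel) \<le> 3 * M * (2 * L + 1) * (\<integral>x. A x \<partial>lborel)" if e: "e \<in> Basis" for e
    proof -
      have t2: "tdir \<Omega> e (\<lambda>x. c e x * \<theta> x) (\<lambda>x. c' e x * \<theta> x + c e x * \<theta>' e x)"
        by (rule tdir_mult_local[OF o c(4)[OF e] c(5)[OF e] c(6)[OF e] t[OF e]])
      have ch: "(\<integral>x. (c' e x * \<theta> x + c e x * \<theta>' e x) * \<Gamma> (w x) + c e x * \<theta> x * gb (w x) * g e x \<partial>lborel) = 0"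
        by (rule weak_chain_rule[OF rp(2) rp(4) rp(6) o e w g(1)[OF e] g(2)[OF e] t2])
      have ci: "integrable lborel (\<lambda>x. (c' e x * \<theta> x + c e x * \<theta>' e x) * \<Gamma> (w x))"
        "integrable lborel (\<lambda>x. c e x * \<theta> x * gb (w x) * g e x)"
        by (rule chain_integrable[OF rp(2) rp(4) rp(6) t2 w g(1)[OF e]], assumption+)+
      have chI: "(\<integral>x. (c' e x * \<theta> x + c e x * \<theta>' e x) * \<Gamma> (w x) \<partial>lborel) + (\<integral>x. c e x * \<theta> x * gb (w x) * g e x \<partial>lborel) = 0"
        by (subst Bochner_Integration.integral_add[symmetric, OF ci(1) ci(2)]) (rule ch)
      have "(\<integral>x. c e x * V x * D e x \<partial>lborel) = (\<integral>x. c e x * V x * (\<theta>' e x * hh (w x)) + c e x * V x * (\<theta> x * hb (w x) * g e x) \<partial>lborel)"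
        by (simp add: D_def distrib_left)
      also have "\<dots> = (\<integral>x. c e x * V x * (\<theta>' e x * hh (w x)) \<partial>lborel) + (\<integral>x. c e x * V x * (\<theta> x * hb (w x) * g e x) \<partial>lborel)"
        by (rule Bochner_Integration.integral_add; rule L2_mult_integrable[OF cV]; rule DL1[OF e])
      also have "(\<integral>x. c e x * V x * (\<theta> x * hb (w x) * g e x) \<partial>lborel) = (\<integral>x. c e x * \<theta> x * gb (w x) * g e x \<partial>lborel)"
        by (intro Bochner_Integration.integral_cong refl) (simp add: gb_def V_def mult_ac)
      also have "\<dots> = - (\<integral>x. (c' e x * \<theta> x + c e x * \<theta>' e x) * \<Gamma> (w x) \<partial>lborel)" using chI by linarith
      finally have eq1: "(\<integral>x. c e x * V x * D e x \<partial>lborel) = (\<integral>x. c e x * V x * (\<theta>' e x * hh (w x)) \<partial>lborel)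
        - (\<integral>x. (c' e x * \<theta> x + c e x * \<theta>' e x) * \<Gamma> (w x) \<partial>lborel)" by simp
      have [measurable]: "\<theta>' e \<in> borel_measurable borel" by (rule \<theta>m'[OF e])
      have cL: "\<bar>c e x\<bar> * \<bar>\<theta>' e x\<bar> \<le> M * L" for x by (rule mult_mono[OF c(2) L[OF e] M0]) simp
      have b1: "\<bar>\<integral>x. c e x * V x * (\<theta>' e x * hh (w x)) \<partial>lborel\<bar> \<le> (M * L * 3) * (\<integral>x. A x \<partial>lborel)"
      proof (rule bnd)
        show "\<bar>c e x * V x * (\<theta>' e x * hh (w x))\<bar> \<le> (M * L * 3) * A x" for x
        proof -
          have "\<bar>c e x * V x * (\<theta>' e x * hh (w x))\<bar> = (\<bar>c e x\<bar> * \<bar>\<theta>' e x\<bar>) * (V x * hh (w x))"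
            using V0[of x] Vh(3)[of x] by (simp add: abs_mult)
          also have "\<dots> \<le> (M * L) * (3 * A x)"
            by (rule mult_mono[OF cL Vh(1) _ Vh(2)]) (use M0 L0 in auto)
          finally show ?thesis by simp
        qed
      qed measurable
      have \<Gamma>m[measurable]: "(\<lambda>x. \<Gamma> (w x)) \<in> borel_measurable borel"
        by (rule continuous_on_nonneg_borel[OF chain_continuous[OF rp(2) rp(4) rp(6)] wm w(2)])
      have b2: "\<bar>\<integral>x. (c' e x * \<theta> x + c e x * \<theta>' e x) * \<Gamma> (w x) \<partial>lborel\<bar> \<le> ((M + M * L) * 3) * (\<integral>x. A x \<partial>lborel)"
      proof (rule bnd)
        show "\<bar>(c' e x * \<theta> x + c e x * \<theta>' e x) * \<Gamma> (w x)\<bar> \<le> ((M + M * L) * 3) * A x" for x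
        proof -
          have "\<bar>c' e x * \<theta> x\<bar> \<le> M * 1" unfolding abs_mult by (rule mult_mono[OF c(3) \<theta>a M0]) simp
          then have "\<bar>c' e x * \<theta> x + c e x * \<theta>' e x\<bar> \<le> M + M * L" using cL[of x] by (simp add: abs_mult[symmetric])
          from mult_mono[OF this \<Gamma>b[of x]] show ?thesis using M0 L0 unfolding abs_mult mult.assoc[of "M + M * L" 3] by simp
        qed
        show "(\<lambda>x. (c' e x * \<theta> x + c e x * \<theta>' e x) * \<Gamma> (w x)) \<in> borel_measurable borel"
          using tdirD(4)[OF t2] \<Gamma>m by (rule borel_measurable_times)
      qed
      have "(\<integral>x. c e x * V x * D e x \<partial>lborel) \<le> (M * L * 3) * (\<integral>x. A x \<partial>lborel) + ((M + M * L) * 3) * (\<integral>x. A x \<partial>lborel)"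
        unfolding eq1 using b1 b2 by linarith
      then show ?thesis by (simp add: algebra_simps)
    qed
    have T2: "(\<integral>x. f0 x * V x * \<Psi> x \<partial>lborel) \<le> 3 * M * (\<integral>x. A x \<partial>lborel)"
    proof -
      have "\<bar>\<integral>x. f0 x * V x * \<Psi> x \<partial>lborel\<bar> \<le> (3 * M) * (\<integral>x. A x \<partial>lborel)"
      proof (rule bnd)
        show "\<bar>f0 x * V x * \<Psi> x\<bar> \<le> (3 * M) * A x" for x
        proof -
          have "\<bar>f0 x * V x * \<Psi> x\<bar> = (\<bar>f0 x\<bar> * \<bar>\<theta> x\<bar>) * (V x * hh (w x))"
            using V0[of x] Vh(3)[of x] by (simp add: abs_mult \<Psi>_def)
          also have "\<dots> \<le> (M * 1) * (3 * A x)"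
            by (rule mult_mono[OF mult_mono[OF f0(2) \<theta>a M0] Vh(1) _ Vh(2)]) (use M0 in auto)
          finally show ?thesis by simp
        qed
        show "(\<lambda>x. f0 x * V x * \<Psi> x) \<in> borel_measurable borel" unfolding \<Psi>_def by measurable
      qed
      then show ?thesis by linarith
    qed
    \<comment> \<open>The product rule for \<open>\<theta> hh(w)\<close> splits the diffusion term
      into the energy and a remainder in which the cut-off is differentiated in a direction of
      \<open>S\<close>; the remainder therefore carries the factor
      \<open>\<epsilon>\<close>.\<close>
    have T3: "(\<integral>x. m x * \<theta> x * hb (w x) * (g e x)\<^sup>2 \<partial>lborel) \<le> (\<integral>x. m x * g e x * D e x \<partial>lborel) + \<epsilon> * (M * (\<integral>x. \<bar>g e x * hh (w x)\<bar> \<partial>lborel))"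
      if e: "e \<in> S" for e
    proof -
      have eB: "e \<in> Basis" using e S by auto
      have [measurable]: "\<theta>' e \<in> borel_measurable borel" "g e \<in> borel_measurable borel" by (rule \<theta>m'[OF eB], rule gm[OF eB])
      have ghi: "integrable lborel (\<lambda>x. \<bar>g e x * hh (w x)\<bar>)" by (intro integrable_abs L2_mult_integrable[OF gL[OF e] hL])
      have eq3: "(\<integral>x. m x * g e x * D e x \<partial>lborel) = (\<integral>x. m x * g e x * (\<theta>' e x * hh (w x)) \<partial>lborel) + (\<integral>x. m x * \<theta> x * hb (w x) * (g e x)\<^sup>2 \<partial>lborel)"
      proof -
        have "(\<integral>x. m x * g e x * D e x \<partial>lborel) = (\<integral>x. m x * g e x * (\<theta>' e x * hh (w x)) + m x * g e x * (\<theta> x * hb (w x) * g e x) \<partial>lborel)"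
          by (simp add: D_def distrib_left)
        also have "\<dots> = (\<integral>x. m x * g e x * (\<theta>' e x * hh (w x)) \<partial>lborel) + (\<integral>x. m x * g e x * (\<theta> x * hb (w x) * g e x) \<partial>lborel)"
          by (rule Bochner_Integration.integral_add; rule L2_mult_integrable[OF mg[OF eB]]; rule DL1[OF eB])
        also have "(\<integral>x. m x * g e x * (\<theta> x * hb (w x) * g e x) \<partial>lborel) = (\<integral>x. m x * \<theta> x * hb (w x) * (g e x)\<^sup>2 \<partial>lborel)"
          by (intro Bochner_Integration.integral_cong refl) (simp add: power2_eq_square mult_ac)
        finally show ?thesis .
      qed
      have "norm (\<integral>x. m x * g e x * (\<theta>' e x * hh (w x)) \<partial>lborel) \<le> (\<integral>x. (\<epsilon> * M) * \<bar>g e x * hh (w x)\<bar> \<partial>lborel)"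
      proof (rule Bochner_Integration.integral_norm_bound_integral)
        show "integrable lborel (\<lambda>x. m x * g e x * (\<theta>' e x * hh (w x)))" by (rule L2_mult_integrable[OF mg[OF eB] DL1(1)[OF eB]])
        show "integrable lborel (\<lambda>x. (\<epsilon> * M) * \<bar>g e x * hh (w x)\<bar>)" using ghi by (rule integrable_mult_right)
        show "norm (m x * g e x * (\<theta>' e x * hh (w x))) \<le> (\<epsilon> * M) * \<bar>g e x * hh (w x)\<bar>" for x
        proof -
          have \<epsilon>0: "\<epsilon> \<ge> 0" using \<epsilon>[OF e, of undefined] by linarith
          have "\<bar>\<theta>' e x\<bar> * \<bar>m x\<bar> \<le> \<epsilon> * M" by (rule mult_mono[OF \<epsilon>[OF e] m(2) \<epsilon>0]) simp
          from mult_right_mono[OF this, of "\<bar>g e x * hh (w x)\<bar>"] show ?thesis by (simp add: abs_mult mult_ac)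
        qed
      qed
      then have "\<bar>\<integral>x. m x * g e x * (\<theta>' e x * hh (w x)) \<partial>lborel\<bar> \<le> \<epsilon> * (M * (\<integral>x. \<bar>g e x * hh (w x)\<bar> \<partial>lborel))"
        by (simp add: mult.assoc)
      then show ?thesis unfolding eq3 by linarith
    qed
    have "(\<Sum>e\<in>S. \<integral>x. m x * \<theta> x * hb (w x) * (g e x)\<^sup>2 \<partial>lborel)
      \<le> (\<Sum>e\<in>S. (\<integral>x. m x * g e x * D e x \<partial>lborel) + \<epsilon> * (M * (\<integral>x. \<bar>g e x * hh (w x)\<bar> \<partial>lborel)))"
      by (rule sum_mono[OF T3])
    also have "\<dots> = (\<Sum>e\<in>Basis. \<integral>x. c e x * V x * D e x \<partial>lborel) + (\<integral>x. f0 x * V x * \<Psi> x \<partial>lborel) + \<epsilon> * C2"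
      by (simp add: sum.distrib E C2_def sum_distrib_left)
    also have "\<dots> \<le> (\<Sum>e\<in>(Basis::'a set). 3 * M * (2 * L + 1) * (\<integral>x. A x \<partial>lborel)) + 3 * M * (\<integral>x. A x \<partial>lborel) + \<epsilon> * C2"
      by (intro add_mono sum_mono T1 T2 order_refl)
    also have "\<dots> = 3 * M * (DIM('a) * (2 * L + 1) + 1) * (\<integral>x. A x \<partial>lborel) + \<epsilon> * C2"
      by (simp add: algebra_simps)
    finally show ?thesis by (simp add: hb_def A_def)
  qed
  show ?thesis by (intro exI[of _ C2] conjI C20 allI impI) (rule main; auto)
qed

section \<open>The limit equation\<close>

lemma L1_tendsto_bounded_mult:
  fixes d :: "nat \<Rightarrow> 'a::euclidean_space \<Rightarrow> real"
  assumes d: "\<And>n. integrable lborel (d n)" "(\<lambda>n. \<integral>x. \<bar>d n x\<bar> \<partial>lborel) \<longlonglongrightarrow> 0"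
    and \<xi>: "\<xi> \<in> borel_measurable borel" "\<And>x. \<bar>\<xi> x\<bar> \<le> C"
  shows "(\<lambda>n. \<integral>x. \<xi> x * d n x \<partial>lborel) \<longlonglongrightarrow> 0" "\<And>n. integrable lborel (\<lambda>x. \<xi> x * d n x)"
proof -
  have le: "norm (\<xi> x * d n x) \<le> C * \<bar>d n x\<bar>" for n x
    unfolding real_norm_def abs_mult by (rule mult_right_mono[OF \<xi>(2)]) simp
  have Ci: "integrable lborel (\<lambda>x. C * \<bar>d n x\<bar>)" for n by (intro integrable_mult_right integrable_abs d)
  show i: "integrable lborel (\<lambda>x. \<xi> x * d n x)" for n
  proof (rule Bochner_Integration.integrable_bound[OF Ci])
    show "(\<lambda>x. \<xi> x * d n x) \<in> borel_measurable lborel"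
      using \<xi>(1) borel_measurable_integrable[OF d(1)[of n]] by measurable
    show "AE x in lborel. norm (\<xi> x * d n x) \<le> norm (C * \<bar>d n x\<bar>)"
      by (rule AE_I2[OF order_trans[OF le]]) simp
  qed
  have "norm (\<integral>x. \<xi> x * d n x \<partial>lborel) \<le> C * (\<integral>x. \<bar>d n x\<bar> \<partial>lborel)" for n
    using Bochner_Integration.integral_norm_bound_integral[OF i Ci le] by simp
  then show "(\<lambda>n. \<integral>x. \<xi> x * d n x \<partial>lborel) \<longlonglongrightarrow> 0"
    by (intro Lim_null_comparison[OF always_eventually[OF allI] tendsto_mult_right_zero[OF d(2)]])
qed

text \<open>Two regimes. For \<open>s + 1/k \<le> 1\<close> the root lies between
  \<open>(1/k) powr (1/k)\<close> and 1. Otherwise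
  \<open>(V - 1)\<^sup>2 \<le> V\<^sup>2 - 1\<close>, and \<open>V\<^sup>2\<close> is the power
  \<open>2/(k-1)\<close> of \<open>(s + 1/k) powr (1 - 1/k)\<close>, to which Bernoulli's inequality
  applies. On bounded sets both terms of the bound have integrals tending to 0 as long as that of
  \<open>s powr (1 - 1/k)\<close> stays bounded.\<close>

lemma regularised_root_bound:
  fixes k s :: real
  assumes k: "k \<ge> 3" and s: "s \<ge> 0"
  shows "((s + 1/k) powr (1/k) - 1)\<^sup>2 \<le> (1 - (1/k) powr (1/k))\<^sup>2 + 2/(k-1) * s powr (1 - 1/k)"
proof -
  have p: "s + 1/k > 0" "1/k > 0" using k s by (auto intro: add_nonneg_pos)
  show ?thesis
  proof (cases "s + 1/k \<le> 1")
    case True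
    have "(1/k) powr (1/k) \<le> (s + 1/k) powr (1/k)" using p s by (intro powr_mono2) auto
    moreover have "(s + 1/k) powr (1/k) \<le> 1" using p True by (intro powr_le1) auto
    ultimately have "\<bar>(s + 1/k) powr (1/k) - 1\<bar> \<le> \<bar>1 - (1/k) powr (1/k)\<bar>" by linarith
    then have "((s + 1/k) powr (1/k) - 1)\<^sup>2 \<le> (1 - (1/k) powr (1/k))\<^sup>2" by (simp add: abs_le_square_iff)
    moreover have "0 \<le> 2/(k-1) * s powr (1 - 1/k)" using k by (intro mult_nonneg_nonneg) auto
    ultimately show ?thesis by linarith
  next
    case False
    define V where "V = (s + 1/k) powr (1/k)"
    have V1: "V \<ge> 1" unfolding V_def using False p by (intro ge_one_powr_ge_zero) auto
    define r where "r = (s + 1/k) powr (1 - 1/k)"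
    have r0: "r > 0" unfolding r_def using p by simp
    have "V\<^sup>2 = (s + 1/k) powr (2/k)" unfolding V_def power2_eq_square powr_add[symmetric] by simp
    also have "\<dots> = r powr (2/(k-1))"
      unfolding r_def powr_powr using k by (intro arg_cong[where f="\<lambda>a. (s + 1/k) powr a"]) (simp add: field_simps)
    also have "\<dots> \<le> 1 + 2/(k-1) * (r - 1)"
      by (rule powr_Bernoulli_le[OF r0]) (use k in \<open>auto simp: field_simps\<close>)
    finally have V2: "V\<^sup>2 \<le> 1 + 2/(k-1) * (r - 1)" .
    have "r \<le> s powr (1 - 1/k) + (1/k) powr (1 - 1/k)"
      unfolding r_def using k s by (intro powr_add_le) (auto simp: field_simps)
    moreover have "(1/k) powr (1 - 1/k) \<le> 1" using k by (intro powr_le1) (auto simp: field_simps)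
    ultimately have "2/(k-1) * (r - 1) \<le> 2/(k-1) * s powr (1 - 1/k)" using k by (intro mult_left_mono) auto
    moreover have "(V - 1)\<^sup>2 \<le> V\<^sup>2 - 1" using V1 by (simp add: power2_eq_square algebra_simps)
    ultimately have "(V - 1)\<^sup>2 \<le> 2/(k-1) * s powr (1 - 1/k)" using V2 by linarith
    then show ?thesis unfolding V_def by (simp add: add_increasing)
  qed
qed

text \<open>\<open>\<beta>\<close> is the pressure as a function of \<open>w\<close>, shifted by
  \<open>\<eta>\<close> and normalised to vanish at 0; the shift makes its derivative bounded, as
  the chain rule requires. Subadditivity of the power shows that the shift costs at most a constant
  tending to 0 with \<open>\<eta>\<close>, uniformly in \<open>s\<close>; the 2 bounds
  \<open>k / (k - 1)\<close>.\<close>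

lemma regularised_pressure:
  fixes k \<eta> :: real
  assumes k: "k \<ge> 3" and \<eta>: "\<eta> > 0"
  defines "\<beta> \<equiv> \<lambda>s. k/(k-1) * ((s + \<eta>) powr (1 - 1/k) - \<eta> powr (1 - 1/k))"
    and "b \<equiv> \<lambda>s. (s + \<eta>) powr (- (1/k))"
  shows "continuous_on {0..} b" "\<And>s. s \<ge> 0 \<Longrightarrow> \<bar>b s\<bar> \<le> \<eta> powr (- (1/k))"
    and "\<And>s. s \<ge> 0 \<Longrightarrow> (\<beta> has_real_derivative b s) (at s within {0..})"
    and "\<And>s. s \<ge> 0 \<Longrightarrow> \<bar>\<beta> s - k/(k-1) * s powr (1 - 1/k)\<bar> \<le> 2 * \<eta> powr (1 - 1/k)"
proof -
  show "continuous_on {0..} b" unfolding b_def using \<eta> by (intro continuous_intros) force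
  show "\<bar>b s\<bar> \<le> \<eta> powr (- (1/k))" if "s \<ge> 0" for s
    unfolding b_def using powr_mono2'[of "- (1/k)" \<eta> "s + \<eta>"] that \<eta> k by simp
  show "(\<beta> has_real_derivative b s) (at s within {0..})" if "s \<ge> 0" for s
  proof -
    have "((\<lambda>s. (s + \<eta>) powr (1 - 1/k)) has_real_derivative (1 - 1/k) * (s + \<eta>) powr (1 - 1/k - of_nat 1) * 1) (at s)"
      by (rule DERIV_fun_powr) (use that \<eta> in \<open>auto intro!: derivative_eq_intros\<close>)
    from DERIV_cmult[OF DERIV_diff[OF this DERIV_const[of "\<eta> powr (1 - 1/k)"]], of "k/(k-1)"]
    have "(\<beta> has_real_derivative k/(k-1) * ((1 - 1/k) * (s + \<eta>) powr (- (1/k)))) (at s)"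
      unfolding \<beta>_def by simp
    also have "k/(k-1) * ((1 - 1/k) * (s + \<eta>) powr (- (1/k))) = b s"
      unfolding b_def using k by (simp add: field_simps)
    finally show ?thesis by (rule has_field_derivative_at_within)
  qed
  show "\<bar>\<beta> s - k/(k-1) * s powr (1 - 1/k)\<bar> \<le> 2 * \<eta> powr (1 - 1/k)" if s: "s \<ge> 0" for s
  proof -
    have "(s + \<eta>) powr (1 - 1/k) \<le> s powr (1 - 1/k) + \<eta> powr (1 - 1/k)"
      using k s \<eta> by (intro powr_add_le) (auto simp: field_simps)
    moreover have "s powr (1 - 1/k) \<le> (s + \<eta>) powr (1 - 1/k)" using s \<eta> k by (intro powr_mono2) (auto simp: field_simps)
    ultimately have 1: "\<bar>(s + \<eta>) powr (1 - 1/k) - \<eta> powr (1 - 1/k) - s powr (1 - 1/k)\<bar> \<le> \<eta> powr (1 - 1/k)"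
      by (simp add: abs_le_iff)
    have 2: "\<bar>k/(k-1)\<bar> \<le> 2" using k by (simp add: divide_le_eq)
    have "\<beta> s - k/(k-1) * s powr (1 - 1/k) = k/(k-1) * ((s + \<eta>) powr (1 - 1/k) - \<eta> powr (1 - 1/k) - s powr (1 - 1/k))"
      unfolding \<beta>_def by (simp only: right_diff_distrib)
    then show ?thesis using mult_mono[OF 2 1] by (simp add: abs_mult)
  qed
qed

lemma sequence_limits:
  fixes N :: nat
  assumes N: "N \<ge> 3"
  shows "(\<lambda>n. (1 - (1 / real (n + N)) powr (1 / real (n + N)))\<^sup>2) \<longlonglongrightarrow> 0"
    and "(\<lambda>n. 2 / (real (n + N) - 1)) \<longlonglongrightarrow> 0"
    and "(\<lambda>n. (1 / real (n + N)) powr (1 - 1 / real (n + N))) \<longlonglongrightarrow> 0"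
proof -
  have r: "(\<lambda>n. (1 / real (n + N)) powr (1 / real (n + N))) \<longlonglongrightarrow> 1"
  proof -
    have "(\<lambda>n. inverse (root (n + N) (real (n + N)))) \<longlonglongrightarrow> inverse 1"
      by (intro tendsto_inverse LIMSEQ_ignore_initial_segment[OF LIMSEQ_root]) simp
    moreover have "inverse (root (n + N) (real (n + N))) = (1 / real (n + N)) powr (1 / real (n + N))" for n
      using N by (subst root_powr_inverse) (auto simp: powr_divide inverse_eq_divide)
    ultimately show ?thesis by simp
  qed
  have "(\<lambda>n. (1 - (1 / real (n + N)) powr (1 / real (n + N)))\<^sup>2) \<longlonglongrightarrow> (1 - 1)\<^sup>2"
    by (intro tendsto_intros r)
  then show "(\<lambda>n. (1 - (1 / real (n + N)) powr (1 / real (n + N)))\<^sup>2) \<longlonglongrightarrow> 0" by simp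
  have "(\<lambda>n. 2 / real (n + (N - 1))) \<longlonglongrightarrow> 0"
    by (rule LIMSEQ_ignore_initial_segment[OF lim_const_over_n])
  then show "(\<lambda>n. 2 / (real (n + N) - 1)) \<longlonglongrightarrow> 0" using N by (simp add: algebra_simps of_nat_diff)
  have i: "(\<lambda>n. 1 / real (n + N)) \<longlonglongrightarrow> 0"
    by (rule LIMSEQ_ignore_initial_segment[OF lim_const_over_n])
  have "(\<lambda>n. (1 / real (n + N)) powr (1/2)) \<longlonglongrightarrow> 0 powr (1/2)"
    by (rule tendsto_powr'[OF i tendsto_const]) simp
  then have h: "(\<lambda>n. (1 / real (n + N)) powr (1/2)) \<longlonglongrightarrow> 0" by simp
  \<comment> \<open>The exponent is at least 1/2 and the base at most 1, so one fixed power of the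
    base dominates.\<close>
  have "norm ((1 / real (n + N)) powr (1 - 1 / real (n + N))) \<le> (1 / real (n + N)) powr (1/2)" for n
    using N powr_mono'[of "1/2" "1 - 1 / real (n + N)" "1 / real (n + N)"] by (simp add: field_simps)
  then show "(\<lambda>n. (1 / real (n + N)) powr (1 - 1 / real (n + N))) \<longlonglongrightarrow> 0"
    by (intro Lim_null_comparison[OF always_eventually[OF allI] h])
qed

text \<open>The flux is the one term to which L^1 convergence does not apply directly. It is written
  as \<open>U Z\<close>, with \<open>Z\<close> the gradient of the regularised pressure and
  \<open>U = (w + 1/k)^(1/k)\<close>. On compact sets \<open>Z\<close> is bounded in L^2 by the
  energy estimate and \<open>U - 1\<close> tends to 0 in L^2. What remains, \<open>Z\<close> against
  a test function, passes to the limit by moving the derivative to the test function, where L^1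
  convergence of the pressures suffices.\<close>

lemma limit_equation:
  fixes \<Omega> :: "'a::euclidean_space set" and c c' G m' :: "'a \<Rightarrow> 'a \<Rightarrow> real" and g :: "nat \<Rightarrow> 'a \<Rightarrow> 'a \<Rightarrow> real"
    and M \<delta> :: real and w :: "nat \<Rightarrow> 'a \<Rightarrow> real"
  assumes o: "open \<Omega>" and S: "S \<subseteq> Basis" and N: "N \<ge> (3::nat)" and k: "\<And>n. k n = real (n + N)"
    and w: "\<And>n. w n \<in> L2" "\<And>n x. w n x \<ge> 0"
    and g: "\<And>n e. e \<in> Basis \<Longrightarrow> g n e \<in> L2" "\<And>n e. e \<in> Basis \<Longrightarrow> wderiv \<Omega> e (w n) (g n e)"
    and v: "\<And>n. (\<lambda>x. w n x powr (1 / k n)) \<in> L2" and I: "\<And>n. integrable lborel (\<lambda>x. w n x powr (1 - 1 / k n))"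
    and m: "m \<in> borel_measurable borel" "\<And>x. \<bar>m x\<bar> \<le> M" and \<delta>: "\<delta> > 0" "\<And>x. x \<in> \<Omega> \<Longrightarrow> m x \<ge> \<delta>"
      "continuous_on \<Omega> m" "\<And>e. e \<in> Basis \<Longrightarrow> continuous_on \<Omega> (m' e)"
      "\<And>e x. e \<in> Basis \<Longrightarrow> x \<in> \<Omega> \<Longrightarrow> ((\<lambda>s. m (x + s *\<^sub>R e)) has_real_derivative m' e x) (at 0)"
    and c: "\<And>e. c e \<in> borel_measurable borel" "\<And>e x. \<bar>c e x\<bar> \<le> M" "\<And>e x. \<bar>c' e x\<bar> \<le> M"
      "\<And>e. e \<in> Basis \<Longrightarrow> continuous_on \<Omega> (c e)" "\<And>e. e \<in> Basis \<Longrightarrow> continuous_on \<Omega> (c' e)"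
      "\<And>e x. e \<in> Basis \<Longrightarrow> x \<in> \<Omega> \<Longrightarrow> ((\<lambda>s. c e (x + s *\<^sub>R e)) has_real_derivative c' e x) (at 0)"
    and f0: "f0 \<in> borel_measurable borel" "\<And>x. \<bar>f0 x\<bar> \<le> M"
    and eq: "\<And>n \<psi>. test_function \<Omega> \<psi> \<Longrightarrow> (\<Sum>e\<in>Basis. \<integral>x. c e x * w n x powr (1 / k n) * dir_deriv e \<psi> x \<partial>lborel)
      - (\<Sum>e\<in>S. \<integral>x. m x * g n e x * dir_deriv e \<psi> x \<partial>lborel)
      + (\<integral>x. f0 x * w n x powr (1 / k n) * \<psi> x \<partial>lborel) = 0"
    and p: "p \<in> L2" "\<And>x. p x \<ge> 0" "integrable lborel p"
    and G: "\<And>e. e \<in> S \<Longrightarrow> G e \<in> L2" "\<And>e. e \<in> S \<Longrightarrow> wderiv \<Omega> e p (G e)"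
    and pconv: "(\<lambda>n. \<integral>x. \<bar>k n / (k n - 1) * w n x powr (1 - 1 / k n) - p x\<bar> \<partial>lborel) \<longlonglongrightarrow> 0"
    and vm: "V \<in> borel_measurable borel" "\<And>x. \<bar>V x\<bar> \<le> 1"
    and vconv: "\<And>n. integrable lborel (\<lambda>x. w n x powr (1 / k n) - V x)"
      "(\<lambda>n. \<integral>x. \<bar>w n x powr (1 / k n) - V x\<bar> \<partial>lborel) \<longlonglongrightarrow> 0"
    and cutoff: "\<And>K. compact K \<Longrightarrow> K \<subseteq> \<Omega> \<Longrightarrow> \<exists>L c0. c0 > 0 \<and> (\<forall>\<epsilon>>0. \<exists>\<theta> \<theta>'.
        (\<forall>e\<in>Basis. tdir \<Omega> e \<theta> (\<theta>' e)) \<and> (\<forall>x. 0 \<le> \<theta> x \<and> \<theta> x \<le> 1) \<and> (\<forall>x\<in>K. \<theta> x \<ge> c0) \<and>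
        (\<forall>e\<in>Basis. \<forall>x. \<bar>\<theta>' e x\<bar> \<le> L) \<and> (\<forall>e\<in>S. \<forall>x. \<bar>\<theta>' e x\<bar> \<le> \<epsilon>))"
    and \<psi>: "test_function \<Omega> \<psi>"
  shows "(\<Sum>e\<in>Basis. \<integral>x. c e x * V x * dir_deriv e \<psi> x \<partial>lborel)
      - (\<Sum>e\<in>S. \<integral>x. m x * G e x * dir_deriv e \<psi> x \<partial>lborel)
      + (\<integral>x. f0 x * V x * \<psi> x \<partial>lborel) = 0"
proof -
  have k3: "k n \<ge> 3" for n using N by (simp add: k)
  have M0: "M \<ge> 0" using m(2)[of undefined] by linarith
  have finS: "finite S" by (rule finite_subset[OF S finite_Basis])
  define \<eta> where "\<eta> n = 1 / k n" for n
  have \<eta>: "\<eta> n > 0" for n using k3[of n] by (simp add: \<eta>_def)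
  define A where "A n x = w n x powr (1 - 1 / k n)" for n x
  define q where "q n x = k n / (k n - 1) * A n x" for n x
  have Ai: "integrable lborel (A n)" for n using I by (simp add: A_def[abs_def])
  have A0: "A n x \<ge> 0" for n x by (simp add: A_def)
  have qi: "integrable lborel (q n)" for n unfolding q_def by (intro integrable_mult_right Ai)
  have qp: "(\<lambda>n. \<integral>x. \<bar>q n x - p x\<bar> \<partial>lborel) \<longlonglongrightarrow> 0" using pconv by (simp add: q_def A_def)
  \<comment> \<open>A convergent sequence is bounded; together with \<open>A n x \<le> q n x\<close>
    this yields a bound, uniform in \<open>n\<close>, on the integral that controls the
    energy.\<close>
  obtain Q where Q: "\<And>n. (\<integral>x. \<bar>q n x - p x\<bar> \<partial>lborel) \<le> Q"
  proof -
    have "Bseq (\<lambda>n. \<integral>x. \<bar>q n x - p x\<bar> \<partial>lborel)" using qp by (intro convergent_imp_Bseq) (auto simp: convergent_def)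
    then obtain Q where "\<And>n. norm (\<integral>x. \<bar>q n x - p x\<bar> \<partial>lborel) \<le> Q" unfolding Bseq_def by auto
    then show ?thesis by (intro that[of Q]) simp
  qed
  define Q1 where "Q1 = Q + (\<integral>x. p x \<partial>lborel)"
  have AQ: "(\<integral>x. A n x \<partial>lborel) \<le> Q1" for n
  proof -
    have "(\<integral>x. A n x \<partial>lborel) \<le> (\<integral>x. \<bar>q n x - p x\<bar> + p x \<partial>lborel)"
    proof (rule integral_mono[OF Ai])
      show "integrable lborel (\<lambda>x. \<bar>q n x - p x\<bar> + p x)"
        by (intro Bochner_Integration.integrable_add integrable_abs Bochner_Integration.integrable_diff qi p)
      show "A n x \<le> \<bar>q n x - p x\<bar> + p x" for x
      proof -
        have "1 * A n x \<le> q n x" unfolding q_def using k3[of n] by (intro mult_right_mono A0) (simp add: le_divide_eq)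
        then show ?thesis by linarith
      qed
    qed
    also have "\<dots> = (\<integral>x. \<bar>q n x - p x\<bar> \<partial>lborel) + (\<integral>x. p x \<partial>lborel)"
      by (intro Bochner_Integration.integral_add integrable_abs Bochner_Integration.integrable_diff qi p)
    also have "\<dots> \<le> Q1" unfolding Q1_def using Q[of n] by simp
    finally show ?thesis .
  qed
  have Q10: "Q1 \<ge> 0" using AQ[of 0] Bochner_Integration.integral_nonneg[of lborel "A 0"] A0 by fastforce
  have wm[measurable]: "w n \<in> borel_measurable borel" for n using w(1)[of n] by (simp add: L2_def)
  have [measurable]: "m \<in> borel_measurable borel" "f0 \<in> borel_measurable borel" "\<And>e. c e \<in> borel_measurable borel"
    "V \<in> borel_measurable borel" by fact+
  have gm: "g n e \<in> borel_measurable borel" if "e \<in> Basis" for n e using g(1)[OF that] by (simp add: L2_def)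

  have diffusion: "(\<lambda>n. \<integral>x. m x * g n e x * dir_deriv e \<psi> x \<partial>lborel) \<longlonglongrightarrow> (\<integral>x. m x * G e x * dir_deriv e \<psi> x \<partial>lborel)"
    if e: "e \<in> S" for e
  proof -
    have eB: "e \<in> Basis" using e S by auto
    define \<Theta> where "\<Theta> x = m x * dir_deriv e \<psi> x" for x
    define \<Theta>' where "\<Theta>' x = m' e x * dir_deriv e \<psi> x + m x * dir_deriv e (dir_deriv e \<psi>) x" for x
    have t: "tdir \<Omega> e \<Theta> \<Theta>'"
      unfolding \<Theta>_def \<Theta>'_def
      by (rule tdir_mult_local[OF o \<delta>(3) \<delta>(4)[OF eB] \<delta>(5)[OF eB] tdir_test_function[OF test_function_dir_deriv[OF \<psi> eB] eB]])
    obtain K B where K: "compact K" "K \<subseteq> \<Omega>" "\<And>x. x \<notin> K \<Longrightarrow> \<Theta> x = 0" "\<And>x. x \<notin> K \<Longrightarrow> \<Theta>' x = 0"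
      "B \<ge> 0" "\<And>x. \<bar>\<Theta> x\<bar> \<le> B" "\<And>x. \<bar>\<Theta>' x\<bar> \<le> B" by (rule tdirE[OF t]) (rule that)
    have \<Theta>m[measurable]: "\<Theta> \<in> borel_measurable borel" "\<Theta>' \<in> borel_measurable borel" using tdirD[OF t] by auto
    have [measurable]: "K \<in> sets borel" using K by (simp add: borel_compact)
    define b where "b n s = (s + \<eta> n) powr (- (1 / k n))" for n s
    define \<beta> where "\<beta> n s = k n / (k n - 1) * ((s + \<eta> n) powr (1 - 1 / k n) - \<eta> n powr (1 - 1 / k n))" for n s
    have rp: "continuous_on {0..} (b n)" "\<And>s. s \<ge> 0 \<Longrightarrow> \<bar>b n s\<bar> \<le> \<eta> n powr (- (1 / k n))"
      "\<And>s. s \<ge> 0 \<Longrightarrow> (\<beta> n has_real_derivative b n s) (at s within {0..})"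
      "\<And>s. s \<ge> 0 \<Longrightarrow> \<bar>\<beta> n s - k n / (k n - 1) * s powr (1 - 1 / k n)\<bar> \<le> 2 * \<eta> n powr (1 - 1 / k n)" for n
      unfolding b_def[abs_def] \<beta>_def[abs_def] by (fact regularised_pressure[OF k3 \<eta>])+
    define Z where "Z n x = b n (w n x) * g n e x" for n x
    define U where "U n x = (w n x + \<eta> n) powr (1 / k n)" for n x
    have [measurable]: "g n e \<in> borel_measurable borel" for n by (rule gm[OF eB])
    have bm[measurable]: "(\<lambda>x. b n (w n x)) \<in> borel_measurable borel" for n
      by (rule continuous_on_nonneg_borel[OF rp(1) wm w(2)])
    have \<beta>m[measurable]: "(\<lambda>x. \<beta> n (w n x)) \<in> borel_measurable borel" for n unfolding \<beta>_def by measurable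
    have Um[measurable]: "U n \<in> borel_measurable borel" for n unfolding U_def by measurable
    have UZ: "U n x * Z n x = g n e x" for n x
    proof -
      have "w n x + \<eta> n > 0" using w(2)[of n x] \<eta>[of n] by linarith
      then have "(w n x + \<eta> n) powr (1 / k n) * (w n x + \<eta> n) powr (- (1 / k n)) = 1"
        unfolding powr_add[symmetric] by simp
      then show ?thesis by (simp add: U_def Z_def b_def mult.assoc[symmetric])
    qed
    have ZL: "Z n \<in> L2" for n
      unfolding Z_def by (rule L2_bounded_mult[OF g(1)[OF eB] bm]) (rule rp(2)[OF w(2)])
    obtain L c0 where c0: "c0 > 0" "\<And>\<epsilon>. \<epsilon> > 0 \<Longrightarrow> \<exists>\<theta> \<theta>'.
        (\<forall>e\<in>Basis. tdir \<Omega> e \<theta> (\<theta>' e)) \<and> (\<forall>x. 0 \<le> \<theta> x \<and> \<theta> x \<le> 1) \<and> (\<forall>x\<in>K. \<theta> x \<ge> c0) \<and>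
        (\<forall>e\<in>Basis. \<forall>x. \<bar>\<theta>' e x\<bar> \<le> L) \<and> (\<forall>e\<in>S. \<forall>x. \<bar>\<theta>' e x\<bar> \<le> \<epsilon>)"
      using cutoff[OF K(1,2)] by (elim exE conjE) (rule that, assumption, blast)
    define C1 where "C1 = 3 * M * (DIM('a) * (2 * L + 1) + 1)"
    define ZK where "ZK n x = indicator K x * Z n x" for n x
    have ZKL: "ZK n \<in> L2" for n
      unfolding ZK_def by (rule L2_bounded_mult[OF ZL, of _ 1]) (auto simp: indicator_def)
    have L0: "L \<ge> 0"
    proof -
      obtain \<theta>' :: "'a \<Rightarrow> 'a \<Rightarrow> real" where "\<forall>e\<in>Basis. \<forall>x. \<bar>\<theta>' e x\<bar> \<le> L" using c0(2)[of 1] by auto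
      then have "\<bar>\<theta>' e undefined\<bar> \<le> L" using eB by blast
      then show ?thesis by linarith
    qed
    have C10: "C1 \<ge> 0" unfolding C1_def using M0 L0 by (intro mult_nonneg_nonneg add_nonneg_nonneg) auto
    \<comment> \<open>\<open>L\<close> and \<open>c0\<close> are determined by \<open>K\<close>
      alone, so the bound is uniform in \<open>n\<close>; only the flatness
      \<open>\<epsilon>\<close> of the cut-off is adapted to each \<open>n\<close>.\<close>
    have energy: "(\<integral>x. (ZK n x)\<^sup>2 \<partial>lborel) \<le> (C1 * Q1 + 1) / (\<delta> * c0)" for n
    proof -
      have "\<exists>C2\<ge>0. \<forall>\<theta> \<theta>' (L::real) \<epsilon>. (\<forall>e\<in>Basis. tdir \<Omega> e \<theta> (\<theta>' e)) \<longrightarrow> (\<forall>x. 0 \<le> \<theta> x \<and> \<theta> x \<le> 1) \<longrightarrow>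
        (\<forall>e\<in>Basis. \<forall>x. \<bar>\<theta>' e x\<bar> \<le> L) \<longrightarrow> (\<forall>e\<in>S. \<forall>x. \<bar>\<theta>' e x\<bar> \<le> \<epsilon>) \<longrightarrow>
        (\<Sum>e\<in>S. \<integral>x. m x * \<theta> x * (w n x + \<eta> n) powr (- (2 / k n)) * (g n e x)\<^sup>2 \<partial>lborel)
        \<le> 3 * M * (DIM('a) * (2 * L + 1) + 1) * (\<integral>x. w n x powr (1 - 1 / k n) \<partial>lborel) + \<epsilon> * C2"
        by (rule energy_estimate[OF o S k3[of n] \<eta>[of n] w[of n] g(1)[of _ n] g(2)[of _ n] v[of n] I[of n] m c f0 eq[of _ n]])
      then obtain C2 where C2: "C2 \<ge> 0" "\<forall>\<theta> \<theta>' (L::real) \<epsilon>. (\<forall>e\<in>Basis. tdir \<Omega> e \<theta> (\<theta>' e)) \<longrightarrow> (\<forall>x. 0 \<le> \<theta> x \<and> \<theta> x \<le> 1) \<longrightarrow>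
        (\<forall>e\<in>Basis. \<forall>x. \<bar>\<theta>' e x\<bar> \<le> L) \<longrightarrow> (\<forall>e\<in>S. \<forall>x. \<bar>\<theta>' e x\<bar> \<le> \<epsilon>) \<longrightarrow>
        (\<Sum>e\<in>S. \<integral>x. m x * \<theta> x * (w n x + \<eta> n) powr (- (2 / k n)) * (g n e x)\<^sup>2 \<partial>lborel)
        \<le> 3 * M * (DIM('a) * (2 * L + 1) + 1) * (\<integral>x. w n x powr (1 - 1 / k n) \<partial>lborel) + \<epsilon> * C2"
        by (elim exE conjE) (rule that)
      \<comment> \<open>Adding 1 avoids division by zero and leaves a cut-off remainder of at most
        1, whatever the size of \<open>C2\<close> for this \<open>n\<close>.\<close>
      define \<epsilon> where "\<epsilon> = 1 / (C2 + 1)"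
      have \<epsilon>: "\<epsilon> > 0" "\<epsilon> * C2 \<le> 1" using C2(1) by (auto simp: \<epsilon>_def divide_le_eq)
      obtain \<theta> \<theta>' where th: "(\<forall>e\<in>Basis. tdir \<Omega> e \<theta> (\<theta>' e)) \<and> (\<forall>x. 0 \<le> \<theta> x \<and> \<theta> x \<le> 1) \<and> (\<forall>x\<in>K. \<theta> x \<ge> c0) \<and>
        (\<forall>e\<in>Basis. \<forall>x. \<bar>\<theta>' e x\<bar> \<le> L) \<and> (\<forall>e\<in>S. \<forall>x. \<bar>\<theta>' e x\<bar> \<le> \<epsilon>)"
        using c0(2)[OF \<epsilon>(1)] by (elim exE) (rule that)
      note th1 = conjunct1[OF th] and th2 = conjunct1[OF conjunct2[OF th]]
        and th3 = conjunct1[OF conjunct2[OF conjunct2[OF th]]]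
        and th4 = conjunct1[OF conjunct2[OF conjunct2[OF conjunct2[OF th]]]]
        and th5 = conjunct2[OF conjunct2[OF conjunct2[OF conjunct2[OF th]]]]
      have \<theta>: "\<And>e. e \<in> Basis \<Longrightarrow> tdir \<Omega> e \<theta> (\<theta>' e)" "\<And>x. 0 \<le> \<theta> x" "\<And>x. \<theta> x \<le> 1" "\<And>x. x \<in> K \<Longrightarrow> \<theta> x \<ge> c0"
        using th1 th2 th3 by simp_all
      obtain K2 where K2: "K2 \<subseteq> \<Omega>" "\<And>x. x \<notin> K2 \<Longrightarrow> \<theta> x = 0" by (rule tdirE[OF \<theta>(1)[OF eB]]) (rule that)
      define T where "T e x = m x * \<theta> x * (w n x + \<eta> n) powr (- (2 / k n)) * (g n e x)\<^sup>2" for e x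
      have T0: "T e x \<ge> 0" for e x
      proof (cases "x \<in> \<Omega>")
        case True
        then have "m x \<ge> 0" using \<delta>(1) \<delta>(2)[OF True] by linarith
        then show ?thesis unfolding T_def using \<theta>(2)[of x] by simp
      next
        case False
        then have "\<theta> x = 0" using K2 by blast
        then show ?thesis by (simp add: T_def)
      qed
      have "(\<integral>x. T e x \<partial>lborel) \<le> (\<Sum>e\<in>S. \<integral>x. T e x \<partial>lborel)"
        by (rule member_le_sum[OF e _ finS]) (rule Bochner_Integration.integral_nonneg[OF T0])
      also have "\<dots> \<le> C1 * (\<integral>x. A n x \<partial>lborel) + \<epsilon> * C2"
        unfolding T_def C1_def A_def using C2(2) th1 th2 th4 th5 by simp
      also have "\<dots> \<le> C1 * Q1 + 1" by (intro add_mono mult_left_mono AQ C10 \<epsilon>)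
      finally have TQ: "(\<integral>x. T e x \<partial>lborel) \<le> C1 * Q1 + 1" .
      have b2: "(b n s)\<^sup>2 = (s + \<eta> n) powr (- (2 / k n))" for s
        unfolding b_def power2_eq_square powr_add[symmetric] by simp
      have Ti: "integrable lborel (T e)"
      proof -
        have \<theta>m[measurable]: "\<theta> \<in> borel_measurable borel" using tdirD(3)[OF \<theta>(1)[OF eB]] .
        have "(\<lambda>x. (m x * \<theta> x) * Z n x) \<in> L2"
        proof (rule L2_bounded_mult[OF ZL])
          show "\<bar>m x * \<theta> x\<bar> \<le> M * 1" for x unfolding abs_mult by (rule mult_mono[OF m(2) _ M0]) (use \<theta>(2,3)[of x] in auto)
        qed measurable
        from L2_mult_integrable[OF this ZL[of n]] show ?thesis
          unfolding T_def b2[symmetric] Z_def by (simp add: power2_eq_square mult_ac)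
      qed
      have "\<delta> * c0 * (\<integral>x. (ZK n x)\<^sup>2 \<partial>lborel) = (\<integral>x. \<delta> * c0 * (ZK n x)\<^sup>2 \<partial>lborel)" by simp
      also have "\<dots> \<le> (\<integral>x. T e x \<partial>lborel)"
      proof (rule integral_mono[OF integrable_mult_right[OF L2_integrable_sq[OF ZKL]] Ti])
        fix x
        show "\<delta> * c0 * (ZK n x)\<^sup>2 \<le> T e x"
        proof (cases "x \<in> K")
          case True
          then have "\<delta> \<le> m x" using K(2) by (intro \<delta>(2)) auto
          then have "\<delta> * c0 \<le> m x * \<theta> x" using \<theta>(4)[OF True] c0(1) \<delta>(1) by (intro mult_mono) linarith+
          from mult_right_mono[OF this, of "(Z n x)\<^sup>2"] show ?thesis
            using True unfolding T_def b2[symmetric] ZK_def Z_def by (simp add: power_mult_distrib mult_ac)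
        qed (use T0 in \<open>simp add: ZK_def\<close>)
      qed
      finally have "\<delta> * c0 * (\<integral>x. (ZK n x)\<^sup>2 \<partial>lborel) \<le> C1 * Q1 + 1" using TQ by linarith
      then show ?thesis using \<delta>(1) c0(1) by (simp add: le_divide_eq mult_ac)
    qed
    define F where "F n x = \<Theta> x * (U n x - 1)" for n x
    define dn where "dn n = (1 - (1 / k n) powr (1 / k n))\<^sup>2" for n
    \<comment> \<open>The first summand keeps \<open>\<Theta>\<^sup>2\<close>, since
      \<open>dn n\<close> alone is not integrable over the whole space; in the second,
      \<open>A n\<close> is integrable and the bound \<open>B\<close> on \<open>\<Theta>\<close> is
      enough.\<close>
    have F2: "(F n x)\<^sup>2 \<le> dn n * (\<Theta> x)\<^sup>2 + (B\<^sup>2 * (2 / (k n - 1))) * A n x" for n x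
    proof -
      have "(U n x - 1)\<^sup>2 \<le> dn n + 2 / (k n - 1) * A n x"
        unfolding U_def \<eta>_def dn_def A_def by (rule regularised_root_bound[OF k3 w(2)])
      then have "(\<Theta> x)\<^sup>2 * (U n x - 1)\<^sup>2 \<le> (\<Theta> x)\<^sup>2 * (dn n + 2 / (k n - 1) * A n x)" by (rule mult_left_mono) simp
      also have "\<dots> = dn n * (\<Theta> x)\<^sup>2 + (\<Theta> x)\<^sup>2 * (2 / (k n - 1) * A n x)" by (simp add: algebra_simps)
      also have "(\<Theta> x)\<^sup>2 * (2 / (k n - 1) * A n x) \<le> B\<^sup>2 * (2 / (k n - 1) * A n x)"
        using k3[of n] A0[of n x] power_mono[OF K(6)[of x], of 2] by (intro mult_right_mono) auto
      finally show ?thesis by (simp add: F_def power_mult_distrib mult.assoc)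
    qed
    have F2i: "integrable lborel (\<lambda>x. dn n * (\<Theta> x)\<^sup>2 + (B\<^sup>2 * (2 / (k n - 1))) * A n x)" for n
      by (intro Bochner_Integration.integrable_add integrable_mult_right Ai L2_integrable_sq tdir_L2(1)[OF t])
    have Fm[measurable]: "F n \<in> borel_measurable borel" for n unfolding F_def by measurable
    have FL: "F n \<in> L2" for n
    proof -
      have "norm ((F n x)\<^sup>2) \<le> norm (dn n * (\<Theta> x)\<^sup>2 + (B\<^sup>2 * (2 / (k n - 1))) * A n x)" for x
        unfolding real_norm_def by (rule order_trans[OF _ order_trans[OF F2 abs_ge_self]]) simp
      then have "integrable lborel (\<lambda>x. (F n x)\<^sup>2)"
        by (intro Bochner_Integration.integrable_bound[OF F2i] AE_I2) measurable
      then show ?thesis by (simp add: L2_def)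
    qed
    have FI: "(\<lambda>n. \<integral>x. (F n x)\<^sup>2 \<partial>lborel) \<longlonglongrightarrow> 0"
    proof -
      have "(\<lambda>n. dn n * (\<integral>x. (\<Theta> x)\<^sup>2 \<partial>lborel) + (B\<^sup>2 * (2 / (k n - 1))) * Q1) \<longlonglongrightarrow> 0 * (\<integral>x. (\<Theta> x)\<^sup>2 \<partial>lborel) + (B\<^sup>2 * 0) * Q1"
        unfolding dn_def k by (intro tendsto_intros sequence_limits[OF N])
      then have l: "(\<lambda>n. dn n * (\<integral>x. (\<Theta> x)\<^sup>2 \<partial>lborel) + (B\<^sup>2 * (2 / (k n - 1))) * Q1) \<longlonglongrightarrow> 0" by simp
      have "norm (\<integral>x. (F n x)\<^sup>2 \<partial>lborel) \<le> dn n * (\<integral>x. (\<Theta> x)\<^sup>2 \<partial>lborel) + (B\<^sup>2 * (2 / (k n - 1))) * Q1" for n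
      proof -
        have "(\<integral>x. (F n x)\<^sup>2 \<partial>lborel) \<le> (\<integral>x. dn n * (\<Theta> x)\<^sup>2 + (B\<^sup>2 * (2 / (k n - 1))) * A n x \<partial>lborel)"
          by (rule integral_mono[OF L2_integrable_sq[OF FL] F2i F2])
        also have "\<dots> = dn n * (\<integral>x. (\<Theta> x)\<^sup>2 \<partial>lborel) + (B\<^sup>2 * (2 / (k n - 1))) * (\<integral>x. A n x \<partial>lborel)"
          using Ai[of n] L2_integrable_sq[OF tdir_L2(1)[OF t]] by (subst Bochner_Integration.integral_add) auto
        also have "\<dots> \<le> dn n * (\<integral>x. (\<Theta> x)\<^sup>2 \<partial>lborel) + (B\<^sup>2 * (2 / (k n - 1))) * Q1"
          using k3[of n] by (intro add_mono mult_left_mono AQ order_refl) auto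
        finally show ?thesis by simp
      qed
      then show ?thesis by (intro Lim_null_comparison[OF always_eventually[OF allI] l])
    qed
    define Q2 where "Q2 = (C1 * Q1 + 1) / (\<delta> * c0)"
    have R: "(\<lambda>n. \<integral>x. F n x * ZK n x \<partial>lborel) \<longlonglongrightarrow> 0"
    proof -
      have l: "(\<lambda>n. sqrt (\<integral>x. (F n x)\<^sup>2 \<partial>lborel) * sqrt Q2) \<longlonglongrightarrow> 0"
        by (rule tendsto_mult_left_zero[OF tendsto_real_sqrt[OF FI, unfolded real_sqrt_zero]])
      have "norm (\<integral>x. F n x * ZK n x \<partial>lborel) \<le> sqrt (\<integral>x. (F n x)\<^sup>2 \<partial>lborel) * sqrt Q2" for n
      proof -
        have "sqrt (\<integral>x. (F n x)\<^sup>2 \<partial>lborel) * sqrt (\<integral>x. (ZK n x)\<^sup>2 \<partial>lborel) \<le> sqrt (\<integral>x. (F n x)\<^sup>2 \<partial>lborel) * sqrt Q2"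
          using energy[of n] unfolding Q2_def by (intro mult_left_mono real_sqrt_le_mono) auto
        then show ?thesis using L2_Cauchy_Schwarz[OF FL[of n] ZKL[of n]] unfolding real_norm_def by linarith
      qed
      then show ?thesis by (intro Lim_null_comparison[OF always_eventually[OF allI] l])
    qed
    have ch: "(\<integral>x. \<Theta> x * Z n x \<partial>lborel) = - (\<integral>x. \<Theta>' x * \<beta> n (w n x) \<partial>lborel)" for n
    proof -
      have i: "integrable lborel (\<lambda>x. \<Theta>' x * \<beta> n (w n x))" "integrable lborel (\<lambda>x. \<Theta> x * b n (w n x) * g n e x)"
        by (rule chain_integrable[OF rp(1,2,3) t w g(1)[OF eB]], assumption+)+
      have "(\<integral>x. \<Theta>' x * \<beta> n (w n x) + \<Theta> x * b n (w n x) * g n e x \<partial>lborel) = 0"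
        by (rule weak_chain_rule[OF rp(1,2,3) o eB w g(1)[OF eB] g(2)[OF eB] t])
      then have "(\<integral>x. \<Theta>' x * \<beta> n (w n x) \<partial>lborel) + (\<integral>x. \<Theta> x * b n (w n x) * g n e x \<partial>lborel) = 0"
        using i by simp
      then show ?thesis by (simp add: Z_def mult.assoc)
    qed
    \<comment> \<open>\<open>\<beta> n (w n)\<close> differs from the pressure by a uniformly small
      amount, which uses that \<open>\<Theta>'\<close> is integrable; the pressure converges in L^1,
      which uses that \<open>\<Theta>'\<close> is bounded.\<close>
    have P: "(\<lambda>n. \<integral>x. \<Theta>' x * \<beta> n (w n x) \<partial>lborel) \<longlonglongrightarrow> (\<integral>x. \<Theta>' x * p x \<partial>lborel)"
    proof -
      have "(\<lambda>n. (2 * \<eta> n powr (1 - 1 / k n)) * (\<integral>x. \<bar>\<Theta>' x\<bar> \<partial>lborel)) \<longlonglongrightarrow> 2 * 0 * (\<integral>x. \<bar>\<Theta>' x\<bar> \<partial>lborel)"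
        unfolding \<eta>_def k by (intro tendsto_intros sequence_limits[OF N])
      then have l: "(\<lambda>n. (2 * \<eta> n powr (1 - 1 / k n)) * (\<integral>x. \<bar>\<Theta>' x\<bar> \<partial>lborel)) \<longlonglongrightarrow> 0" by simp
      define r where "r n x = \<Theta>' x * (\<beta> n (w n x) - q n x)" for n x
      have ri: "integrable lborel (r n)" "norm (\<integral>x. r n x \<partial>lborel) \<le> (2 * \<eta> n powr (1 - 1 / k n)) * (\<integral>x. \<bar>\<Theta>' x\<bar> \<partial>lborel)" for n
      proof -
        have le: "norm (r n x) \<le> (2 * \<eta> n powr (1 - 1 / k n)) * \<bar>\<Theta>' x\<bar>" for x
          unfolding r_def q_def A_def real_norm_def abs_mult
          by (subst mult.commute, rule mult_right_mono[OF rp(4)[OF w(2)]]) simp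
        have i: "integrable lborel (\<lambda>x. (2 * \<eta> n powr (1 - 1 / k n)) * \<bar>\<Theta>' x\<bar>)"
          by (intro integrable_mult_right integrable_abs tdir_integrable(2)[OF t])
        show ri: "integrable lborel (r n)"
        proof (rule Bochner_Integration.integrable_bound[OF i])
          show "r n \<in> borel_measurable lborel" unfolding r_def q_def A_def by measurable
          show "AE x in lborel. norm (r n x) \<le> norm ((2 * \<eta> n powr (1 - 1 / k n)) * \<bar>\<Theta>' x\<bar>)"
            by (rule AE_I2[OF order_trans[OF le]]) simp
        qed
        show "norm (\<integral>x. r n x \<partial>lborel) \<le> (2 * \<eta> n powr (1 - 1 / k n)) * (\<integral>x. \<bar>\<Theta>' x\<bar> \<partial>lborel)"
          using Bochner_Integration.integral_norm_bound_integral[OF ri i le] by simp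
      qed
      have r0: "(\<lambda>n. \<integral>x. r n x \<partial>lborel) \<longlonglongrightarrow> 0"
        by (rule Lim_null_comparison[OF always_eventually[OF allI[OF ri(2)]] l])
      note q0 = L1_tendsto_bounded_mult[OF Bochner_Integration.integrable_diff[OF qi p(3)] qp \<Theta>m(2) K(7)]
      have pi: "integrable lborel (\<lambda>x. \<Theta>' x * p x)" by (rule L2_mult_integrable[OF tdir_L2(2)[OF t] p(1)])
      have "(\<integral>x. \<Theta>' x * \<beta> n (w n x) \<partial>lborel) = (\<integral>x. r n x \<partial>lborel) + (\<integral>x. \<Theta>' x * (q n x - p x) \<partial>lborel) + (\<integral>x. \<Theta>' x * p x \<partial>lborel)" for n
      proof -
        have "(\<integral>x. \<Theta>' x * \<beta> n (w n x) \<partial>lborel) = (\<integral>x. r n x + \<Theta>' x * (q n x - p x) + \<Theta>' x * p x \<partial>lborel)"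
          by (intro Bochner_Integration.integral_cong refl) (simp add: r_def algebra_simps)
        also have "\<dots> = (\<integral>x. r n x + \<Theta>' x * (q n x - p x) \<partial>lborel) + (\<integral>x. \<Theta>' x * p x \<partial>lborel)"
          by (rule Bochner_Integration.integral_add[OF Bochner_Integration.integrable_add[OF ri(1) q0(2)] pi])
        also have "(\<integral>x. r n x + \<Theta>' x * (q n x - p x) \<partial>lborel) = (\<integral>x. r n x \<partial>lborel) + (\<integral>x. \<Theta>' x * (q n x - p x) \<partial>lborel)"
          by (rule Bochner_Integration.integral_add[OF ri(1) q0(2)])
        finally show ?thesis .
      qed
      moreover have "(\<lambda>n. (\<integral>x. r n x \<partial>lborel) + (\<integral>x. \<Theta>' x * (q n x - p x) \<partial>lborel) + (\<integral>x. \<Theta>' x * p x \<partial>lborel))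
        \<longlonglongrightarrow> 0 + 0 + (\<integral>x. \<Theta>' x * p x \<partial>lborel)"
        by (intro tendsto_add r0 q0(1) tendsto_const)
      ultimately show ?thesis by simp
    qed
    \<comment> \<open>This is \<open>U Z = (U - 1) Z + Z\<close> weighted by
      \<open>\<Theta>\<close>; the indicator of \<open>K\<close> hidden in \<open>ZK\<close> costs
      nothing because \<open>\<Theta>\<close> vanishes off \<open>K\<close>.\<close>
    have split: "(\<integral>x. m x * g n e x * dir_deriv e \<psi> x \<partial>lborel) = (\<integral>x. F n x * ZK n x \<partial>lborel) - (\<integral>x. \<Theta>' x * \<beta> n (w n x) \<partial>lborel)" for n
    proof -
      have "m x * g n e x * dir_deriv e \<psi> x = F n x * ZK n x + \<Theta> x * Z n x" for x
      proof (cases "x \<in> K")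
        case True
        have "m x * g n e x * dir_deriv e \<psi> x = \<Theta> x * (U n x * Z n x)" unfolding UZ by (simp add: \<Theta>_def)
        with True show ?thesis by (simp add: F_def ZK_def algebra_simps)
      next
        case False
        then have "\<Theta> x = 0" by (rule K(3))
        then show ?thesis by (auto simp: F_def \<Theta>_def)
      qed
      then have "(\<integral>x. m x * g n e x * dir_deriv e \<psi> x \<partial>lborel) = (\<integral>x. F n x * ZK n x + \<Theta> x * Z n x \<partial>lborel)" by simp
      also have "\<dots> = (\<integral>x. F n x * ZK n x \<partial>lborel) + (\<integral>x. \<Theta> x * Z n x \<partial>lborel)"
        by (rule Bochner_Integration.integral_add[OF L2_mult_integrable[OF FL ZKL] L2_mult_integrable[OF tdir_L2(1)[OF t] ZL]])
      finally show ?thesis unfolding ch by simp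
    qed
    have "(\<integral>x. \<Theta>' x * p x \<partial>lborel) = - (\<integral>x. \<Theta> x * G e x \<partial>lborel)"
      by (rule weak_integration_by_parts[OF o eB p(1,2) G(1)[OF e] G(2)[OF e] t])
    also have "(\<integral>x. \<Theta> x * G e x \<partial>lborel) = (\<integral>x. m x * G e x * dir_deriv e \<psi> x \<partial>lborel)"
      by (intro Bochner_Integration.integral_cong refl) (simp add: \<Theta>_def mult_ac)
    finally have "0 - (\<integral>x. \<Theta>' x * p x \<partial>lborel) = (\<integral>x. m x * G e x * dir_deriv e \<psi> x \<partial>lborel)" by simp
    then show ?thesis unfolding split using tendsto_diff[OF R P] by simp
  qed

  \<comment> \<open>These terms are linear in the density, which converges in L^1 and is multiplied
    by bounded functions only.\<close>
  have transport: "(\<lambda>n. \<integral>x. \<xi> x * w n x powr (1 / k n) * \<zeta> x \<partial>lborel) \<longlonglongrightarrow> (\<integral>x. \<xi> x * V x * \<zeta> x \<partial>lborel)"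
    if \<xi>: "\<xi> \<in> borel_measurable borel" "\<And>x. \<bar>\<xi> x\<bar> \<le> M" and \<zeta>: "test_function \<Omega> \<zeta>" for \<xi> \<zeta>
  proof -
    obtain K B where K: "compact K" "\<And>x. x \<notin> K \<Longrightarrow> \<zeta> x = 0" and B: "B \<ge> 0" "\<And>x. \<bar>\<zeta> x\<bar> \<le> B"
      by (rule test_function_bounded[OF \<zeta>], rule test_functionE[OF \<zeta>]) (rule that)
    have [measurable]: "\<xi> \<in> borel_measurable borel" "\<zeta> \<in> borel_measurable borel" by (rule \<xi>(1), rule test_function_borel[OF \<zeta>])
    have \<xi>\<zeta>b: "\<bar>\<xi> x * \<zeta> x\<bar> \<le> M * B" for x unfolding abs_mult by (rule mult_mono[OF \<xi>(2) B(2) M0]) simp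
    have \<xi>\<zeta>m[measurable]: "(\<lambda>x. \<xi> x * \<zeta> x) \<in> borel_measurable borel" by measurable
    note d = L1_tendsto_bounded_mult[OF vconv \<xi>\<zeta>m \<xi>\<zeta>b]
    have Vi: "integrable lborel (\<lambda>x. \<xi> x * V x * \<zeta> x)"
    proof (rule integrable_bounded_support[OF _ _ compact_imp_bounded[OF K(1)]])
      show "\<bar>\<xi> x * V x * \<zeta> x\<bar> \<le> M * B * 1" for x
        using mult_mono[OF \<xi>\<zeta>b[of x] vm(2)[of x]] M0 B(1) by (simp add: abs_mult mult_ac)
    qed (use K in auto)
    have "(\<integral>x. \<xi> x * w n x powr (1 / k n) * \<zeta> x \<partial>lborel) = (\<integral>x. \<xi> x * \<zeta> x * (w n x powr (1 / k n) - V x) \<partial>lborel) + (\<integral>x. \<xi> x * V x * \<zeta> x \<partial>lborel)" for n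
      by (subst Bochner_Integration.integral_add[symmetric, OF d(2) Vi]) (intro Bochner_Integration.integral_cong refl, simp add: algebra_simps)
    moreover have "(\<lambda>n. (\<integral>x. \<xi> x * \<zeta> x * (w n x powr (1 / k n) - V x) \<partial>lborel) + (\<integral>x. \<xi> x * V x * \<zeta> x \<partial>lborel)) \<longlonglongrightarrow> 0 + (\<integral>x. \<xi> x * V x * \<zeta> x \<partial>lborel)"
      by (intro tendsto_add d(1) tendsto_const)
    ultimately show ?thesis by simp
  qed
  have "(\<lambda>n. (\<Sum>e\<in>Basis. \<integral>x. c e x * w n x powr (1 / k n) * dir_deriv e \<psi> x \<partial>lborel)
      - (\<Sum>e\<in>S. \<integral>x. m x * g n e x * dir_deriv e \<psi> x \<partial>lborel)
      + (\<integral>x. f0 x * w n x powr (1 / k n) * \<psi> x \<partial>lborel)) \<longlonglongrightarrow>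
    (\<Sum>e\<in>Basis. \<integral>x. c e x * V x * dir_deriv e \<psi> x \<partial>lborel)
      - (\<Sum>e\<in>S. \<integral>x. m x * G e x * dir_deriv e \<psi> x \<partial>lborel)
      + (\<integral>x. f0 x * V x * \<psi> x \<partial>lborel)"
    by (intro tendsto_add tendsto_diff tendsto_sum diffusion transport c f0 \<psi> test_function_dir_deriv[OF \<psi>])
  then show ?thesis unfolding eq[OF \<psi>] by (simp add: LIMSEQ_const_iff)
qed

section \<open>Complementarity for test functions of arbitrary sign\<close>

lemma tdir_add:
  assumes "tdir \<Omega> e \<theta> \<theta>'" "tdir \<Omega> e \<zeta> \<zeta>'"
  shows "tdir \<Omega> e (\<lambda>x. \<theta> x + \<zeta> x) (\<lambda>x. \<theta>' x + \<zeta>' x)"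
proof -
  obtain K1 where K1: "compact K1" "K1 \<subseteq> \<Omega>" "\<forall>x. x \<notin> K1 \<longrightarrow> \<theta> x = 0 \<and> \<theta>' x = 0" using assms(1) unfolding tdir_def by auto
  obtain K2 where K2: "compact K2" "K2 \<subseteq> \<Omega>" "\<forall>x. x \<notin> K2 \<longrightarrow> \<zeta> x = 0 \<and> \<zeta>' x = 0" using assms(2) unfolding tdir_def by auto
  have "compact (K1 \<union> K2)" "K1 \<union> K2 \<subseteq> \<Omega>" "\<forall>x. x \<notin> K1 \<union> K2 \<longrightarrow> \<theta> x + \<zeta> x = 0 \<and> \<theta>' x + \<zeta>' x = 0"
    using K1 K2 by (auto intro: compact_Un)
  then show ?thesis
    using assms unfolding tdir_def by (auto intro!: continuous_intros DERIV_add)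
qed

text \<open>The sign argument asks for a nonnegative test function, and the positive and negative
  parts of \<open>\<phi>\<close> are not differentiable enough. As the final expression is linear in
  \<open>\<phi>\<close> and its derivatives, it is evaluated at \<open>\<phi> + \<gamma>\<close> and
  at \<open>\<gamma>\<close>, both nonnegative, and subtracted. The density is eliminated on the
  way: it equals 1 where \<open>p\<close> is nonzero, and \<open>G\<close> vanishes almost
  everywhere in \<open>\<Omega>\<close> where \<open>p\<close> does.\<close>

lemma complementarity_signed:
  fixes \<Omega> :: "'a::euclidean_space set" and bb G ct ct' :: "'a \<Rightarrow> 'a \<Rightarrow> real"
  assumes o: "open \<Omega>" and et: "et \<in> Basis"
    and m: "m \<in> borel_measurable borel" "\<And>x. \<bar>m x\<bar> \<le> M" "\<And>x. m x \<ge> 0"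
    and mt: "\<And>x. \<bar>m_t x\<bar> \<le> M" "m_t \<in> borel_measurable borel"
      "\<And>x. x \<in> \<Omega> \<Longrightarrow> ((\<lambda>s. m (x + s *\<^sub>R et)) has_real_derivative m_t x) (at 0)"
    and bb: "\<And>e. bb e \<in> borel_measurable borel" "\<And>e x. \<bar>bb e x\<bar> \<le> M"
    and ct: "\<And>e x. ct e x = m x * bb e x"
      "\<And>e. e \<in> Basis - {et} \<Longrightarrow> continuous_on \<Omega> (ct e)" "\<And>e. e \<in> Basis - {et} \<Longrightarrow> continuous_on \<Omega> (ct' e)"
      "\<And>e x. e \<in> Basis - {et} \<Longrightarrow> x \<in> \<Omega> \<Longrightarrow> ((\<lambda>s. ct e (x + s *\<^sub>R e)) has_real_derivative ct' e x) (at 0)"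
    and f: "f \<in> borel_measurable borel" "\<And>x. \<bar>f x\<bar> \<le> M"
    and v: "v \<in> borel_measurable borel" "\<And>x. 0 \<le> v x" "\<And>x. v x \<le> 1"
    and p: "p \<in> L2" "\<And>x. p x \<ge> 0" and vp: "\<And>x. p x \<noteq> 0 \<Longrightarrow> v x = 1"
    and G: "\<And>e. e \<in> Basis - {et} \<Longrightarrow> G e \<in> L2" "\<And>e. e \<in> Basis - {et} \<Longrightarrow> wderiv \<Omega> e p (G e)"
    and eq: "\<And>\<psi>. test_function \<Omega> \<psi> \<Longrightarrow> (\<integral>x. m x * v x * dir_deriv et \<psi> x \<partial>lborel)
      - (\<Sum>e\<in>Basis - {et}. \<integral>x. (m x * G e x + m x * v x * bb e x) * dir_deriv e \<psi> x \<partial>lborel)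
      + (\<integral>x. f x * m x * v x * \<psi> x \<partial>lborel) = 0"
    and \<phi>: "\<And>e. e \<in> Basis \<Longrightarrow> tdir \<Omega> e \<phi> (\<phi>' e)"
    and \<gamma>: "\<And>e. e \<in> Basis \<Longrightarrow> tdir \<Omega> e \<gamma> (\<gamma>' e)" "\<And>x. \<bar>\<phi> x\<bar> \<le> \<gamma> x"
  shows "(\<integral>x. - m_t x * (\<phi> x * p x) - (\<Sum>e\<in>Basis - {et}. m x * G e x * (\<phi>' e x * p x + \<phi> x * G e x))
      + (\<Sum>e\<in>Basis - {et}. ct' e x * \<phi> x * p x) + f x * m x * (\<phi> x * p x) \<partial>lborel) = 0"
proof -
  let ?S = "Basis - {et}"
  have M0: "M \<ge> 0" using m(2)[of undefined] by linarith
  have [measurable]: "m \<in> borel_measurable borel" "m_t \<in> borel_measurable borel" "f \<in> borel_measurable borel"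
    "v \<in> borel_measurable borel" "\<And>e. bb e \<in> borel_measurable borel" by fact+
  have pm[measurable]: "p \<in> borel_measurable borel" using p by (simp add: L2_def)
  have Gm: "G e \<in> borel_measurable borel" if "e \<in> ?S" for e using G(1)[OF that] by (simp add: L2_def)
  define H where "H \<phi> \<phi>' x = - m_t x * (\<phi> x * p x) - (\<Sum>e\<in>?S. m x * G e x * (\<phi>' e x * p x + \<phi> x * G e x))
      + (\<Sum>e\<in>?S. ct' e x * \<phi> x * p x) + f x * m x * (\<phi> x * p x)" for \<phi> :: "'a \<Rightarrow> real" and \<phi>' :: "'a \<Rightarrow> 'a \<Rightarrow> real" and x
  have nonneg: "integrable lborel (H \<phi> \<phi>') \<and> (\<integral>x. H \<phi> \<phi>' x \<partial>lborel) = 0"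
    if \<phi>0: "\<And>x. \<phi> x \<ge> 0" and t: "\<And>e. e \<in> Basis \<Longrightarrow> tdir \<Omega> e \<phi> (\<phi>' e)" for \<phi> :: "'a \<Rightarrow> real" and \<phi>' :: "'a \<Rightarrow> 'a \<Rightarrow> real"
  proof -
    obtain K B where K: "compact K" "K \<subseteq> \<Omega>" "\<And>x. x \<notin> K \<Longrightarrow> \<phi> x = 0" and B: "B \<ge> 0" "\<And>x. \<bar>\<phi> x\<bar> \<le> B"
      by (rule tdirE[OF t[OF et]]) (rule that)
    have [measurable]: "\<phi> \<in> borel_measurable borel" by (rule tdirD(3)[OF t[OF et]])
    have \<phi>L: "\<phi> \<in> L2" by (rule tdir_L2(1)[OF t[OF et]])
    have i1: "integrable lborel (\<lambda>x. m_t x * (\<phi> x * p x))"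
      using L2_mult_integrable[OF L2_bounded_mult[OF \<phi>L mt(2) mt(1)] p(1)] by (simp add: mult.assoc)
    have fm: "\<bar>f x * m x\<bar> \<le> M * M" for x unfolding abs_mult by (rule mult_mono[OF f(2) m(2) M0]) simp
    have i4: "integrable lborel (\<lambda>x. f x * m x * (\<phi> x * p x))"
      using L2_mult_integrable[OF L2_bounded_mult[OF \<phi>L _ fm] p(1)] by (simp add: mult.assoc)
    have i2: "integrable lborel (\<lambda>x. m x * G e x * (\<phi>' e x * p x + \<phi> x * G e x))" if e: "e \<in> ?S" for e
    proof -
      have eB: "e \<in> Basis" using e by simp
      obtain B' where "\<And>x. \<bar>\<phi>' e x\<bar> \<le> B'" by (rule tdirE[OF t[OF eB]]) (rule that)
      then have "(\<lambda>x. \<phi>' e x * p x + \<phi> x * G e x) \<in> L2"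
        by (intro L2_add L2_bounded_mult[OF p(1) tdirD(4)[OF t[OF eB]]] L2_bounded_mult[OF G(1)[OF e] _ B(2)]) auto
      then show ?thesis by (intro L2_mult_integrable L2_bounded_mult[OF G(1)[OF e] m(1,2)])
    qed
    have tt: "tdir \<Omega> e (\<lambda>x. ct e x * \<phi> x) (\<lambda>x. ct' e x * \<phi> x + ct e x * \<phi>' e x)" if e: "e \<in> ?S" for e
      using e by (intro tdir_mult_local[OF o ct(2)[OF e] ct(3)[OF e] ct(4)[OF e] t]) auto
    have cb: "\<bar>ct e x\<bar> \<le> M * M" for e x unfolding ct(1) abs_mult by (rule mult_mono[OF m(2) bb(2) M0]) simp
    have ctm[measurable]: "ct e \<in> borel_measurable borel" for e unfolding ct(1)[abs_def] by measurable
    have i5: "integrable lborel (\<lambda>x. ct e x * \<phi>' e x * p x)" "integrable lborel (\<lambda>x. ct e x * \<phi> x * G e x)"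
      "integrable lborel (\<lambda>x. ct' e x * \<phi> x * p x)" if e: "e \<in> ?S" for e
    proof -
      have eB: "e \<in> Basis" using e by simp
      have c\<phi>': "(\<lambda>x. ct e x * \<phi>' e x) \<in> L2" by (rule L2_bounded_mult[OF tdir_L2(2)[OF t[OF eB]] ctm cb])
      show a: "integrable lborel (\<lambda>x. ct e x * \<phi>' e x * p x)" by (rule L2_mult_integrable[OF c\<phi>' p(1)])
      show "integrable lborel (\<lambda>x. ct e x * \<phi> x * G e x)"
        by (rule L2_mult_integrable[OF tdir_L2(1)[OF tt[OF e]] G(1)[OF e]])
      have "integrable lborel (\<lambda>x. (ct' e x * \<phi> x + ct e x * \<phi>' e x) * p x)"
        by (rule L2_mult_integrable[OF tdir_L2(2)[OF tt[OF e]] p(1)])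
      from Bochner_Integration.integrable_diff[OF this a]
      show "integrable lborel (\<lambda>x. ct' e x * \<phi> x * p x)" by (simp add: algebra_simps)
    qed
    \<comment> \<open>With the density gone, integration by parts against \<open>p\<close> turns the
      drift into the derivatives \<open>ct'\<close> of \<open>m b\<close>, whose sum is the
      divergence contained in \<open>m F\<close>.\<close>
    have drift: "(\<integral>x. (m x * G e x + m x * v x * bb e x) * (\<phi>' e x * p x + \<phi> x * G e x) \<partial>lborel)
        = (\<integral>x. m x * G e x * (\<phi>' e x * p x + \<phi> x * G e x) \<partial>lborel) - (\<integral>x. ct' e x * \<phi> x * p x \<partial>lborel)" if e: "e \<in> ?S" for e
    proof -
      have eB: "e \<in> Basis" using e by simp
      have [measurable]: "G e \<in> borel_measurable borel" "\<phi>' e \<in> borel_measurable borel" by (rule Gm[OF e], rule tdirD(4)[OF t[OF eB]])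
      have "AE x in lborel. x \<in> \<Omega> \<longrightarrow> p x = 0 \<longrightarrow> G e x = 0"
        by (rule weak_derivative_zero_level[OF o eB p G(1)[OF e] G(2)[OF e]])
      then have "AE x in lborel. (m x * G e x + m x * v x * bb e x) * (\<phi>' e x * p x + \<phi> x * G e x)
        = m x * G e x * (\<phi>' e x * p x + \<phi> x * G e x) + (ct e x * \<phi>' e x * p x + ct e x * \<phi> x * G e x)"
      proof eventually_elim
        case (elim x)
        have "v x * (\<phi>' e x * p x + \<phi> x * G e x) = \<phi>' e x * p x + \<phi> x * G e x"
        proof (cases "p x = 0")
          case True
          then have "\<phi> x * G e x = 0" using elim K(2) K(3)[of x] by (cases "x \<in> \<Omega>") auto
          then show ?thesis using True by simp
        qed (simp add: vp)
        note vX = this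
        have "m x * v x * bb e x * (\<phi>' e x * p x + \<phi> x * G e x) = m x * bb e x * (v x * (\<phi>' e x * p x + \<phi> x * G e x))"
          by (simp only: mult_ac)
        then have "m x * v x * bb e x * (\<phi>' e x * p x + \<phi> x * G e x) = m x * bb e x * (\<phi>' e x * p x + \<phi> x * G e x)"
          unfolding vX .
        then show ?case unfolding ct(1) distrib_right[of "m x * G e x"] by (simp add: algebra_simps)
      qed
      then have "(\<integral>x. (m x * G e x + m x * v x * bb e x) * (\<phi>' e x * p x + \<phi> x * G e x) \<partial>lborel)
        = (\<integral>x. m x * G e x * (\<phi>' e x * p x + \<phi> x * G e x) + (ct e x * \<phi>' e x * p x + ct e x * \<phi> x * G e x) \<partial>lborel)"
        by (intro integral_cong_AE) measurable
      also have "\<dots> = (\<integral>x. m x * G e x * (\<phi>' e x * p x + \<phi> x * G e x) \<partial>lborel)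
         + ((\<integral>x. ct e x * \<phi>' e x * p x \<partial>lborel) + (\<integral>x. ct e x * \<phi> x * G e x \<partial>lborel))"
        using i2[OF e] i5[OF e] by simp
      also have "(\<integral>x. ct e x * \<phi>' e x * p x \<partial>lborel) + (\<integral>x. ct e x * \<phi> x * G e x \<partial>lborel) = - (\<integral>x. ct' e x * \<phi> x * p x \<partial>lborel)"
      proof -
        have "(\<integral>x. (ct' e x * \<phi> x + ct e x * \<phi>' e x) * p x \<partial>lborel) = - (\<integral>x. ct e x * \<phi> x * G e x \<partial>lborel)"
          by (rule weak_integration_by_parts[OF o eB p G(1)[OF e] G(2)[OF e] tt[OF e]])
        also have "(\<integral>x. (ct' e x * \<phi> x + ct e x * \<phi>' e x) * p x \<partial>lborel) = (\<integral>x. ct' e x * \<phi> x * p x \<partial>lborel) + (\<integral>x. ct e x * \<phi>' e x * p x \<partial>lborel)"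
          unfolding distrib_right by (rule Bochner_Integration.integral_add[OF i5(3)[OF e] i5(1)[OF e]])
        finally show ?thesis by linarith
      qed
      finally show ?thesis by simp
    qed
    have v1: "(\<integral>x. f x * m x * v x * (\<phi> x * p x) \<partial>lborel) = (\<integral>x. f x * m x * (\<phi> x * p x) \<partial>lborel)"
    proof (rule Bochner_Integration.integral_cong[OF refl])
      fix x show "f x * m x * v x * (\<phi> x * p x) = f x * m x * (\<phi> x * p x)"
        by (cases "p x = 0") (simp_all add: vp)
    qed
    have J: "- (\<integral>x. m_t x * (\<phi> x * p x) \<partial>lborel)
      - (\<Sum>e\<in>?S. \<integral>x. (m x * G e x + m x * v x * bb e x) * (\<phi>' e x * p x + \<phi> x * G e x) \<partial>lborel)
      + (\<integral>x. f x * m x * v x * (\<phi> x * p x) \<partial>lborel) = 0"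
      by (rule complementarity_of_limit_equation[OF o et m mt bb f v p vp G eq \<phi>0 t])
    have s2: "integrable lborel (\<lambda>x. \<Sum>e\<in>?S. m x * G e x * (\<phi>' e x * p x + \<phi> x * G e x))"
      by (intro Bochner_Integration.integrable_sum i2)
    have s3: "integrable lborel (\<lambda>x. \<Sum>e\<in>?S. ct' e x * \<phi> x * p x)"
      by (intro Bochner_Integration.integrable_sum i5)
    have Hi: "integrable lborel (H \<phi> \<phi>')"
    proof -
      have "integrable lborel (\<lambda>x. - (m_t x * (\<phi> x * p x)) - (\<Sum>e\<in>?S. m x * G e x * (\<phi>' e x * p x + \<phi> x * G e x))
        + (\<Sum>e\<in>?S. ct' e x * \<phi> x * p x) + f x * m x * (\<phi> x * p x))"
        by (intro Bochner_Integration.integrable_add Bochner_Integration.integrable_diff integrable_minus i1 s2 s3 i4)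
      then show ?thesis unfolding H_def by simp
    qed
    have "(\<integral>x. H \<phi> \<phi>' x \<partial>lborel) = (\<integral>x. (- (m_t x * (\<phi> x * p x)) - (\<Sum>e\<in>?S. m x * G e x * (\<phi>' e x * p x + \<phi> x * G e x)))
        + (\<Sum>e\<in>?S. ct' e x * \<phi> x * p x) + f x * m x * (\<phi> x * p x) \<partial>lborel)"
      by (simp add: H_def)
    also have "\<dots> = - (\<integral>x. m_t x * (\<phi> x * p x) \<partial>lborel) - (\<integral>x. (\<Sum>e\<in>?S. m x * G e x * (\<phi>' e x * p x + \<phi> x * G e x)) \<partial>lborel)
        + (\<integral>x. (\<Sum>e\<in>?S. ct' e x * \<phi> x * p x) \<partial>lborel) + (\<integral>x. f x * m x * (\<phi> x * p x) \<partial>lborel)"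
      using i1 s2 s3 i4 by simp
    also have "(\<integral>x. (\<Sum>e\<in>?S. m x * G e x * (\<phi>' e x * p x + \<phi> x * G e x)) \<partial>lborel)
      = (\<Sum>e\<in>?S. \<integral>x. m x * G e x * (\<phi>' e x * p x + \<phi> x * G e x) \<partial>lborel)"
      by (rule Bochner_Integration.integral_sum[OF i2])
    also have "(\<integral>x. (\<Sum>e\<in>?S. ct' e x * \<phi> x * p x) \<partial>lborel) = (\<Sum>e\<in>?S. \<integral>x. ct' e x * \<phi> x * p x \<partial>lborel)"
      by (rule Bochner_Integration.integral_sum[OF i5(3)])
    also have "- (\<integral>x. m_t x * (\<phi> x * p x) \<partial>lborel) - (\<Sum>e\<in>?S. \<integral>x. m x * G e x * (\<phi>' e x * p x + \<phi> x * G e x) \<partial>lborel)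
        + (\<Sum>e\<in>?S. \<integral>x. ct' e x * \<phi> x * p x \<partial>lborel) + (\<integral>x. f x * m x * (\<phi> x * p x) \<partial>lborel)
      = - (\<integral>x. m_t x * (\<phi> x * p x) \<partial>lborel)
      - (\<Sum>e\<in>?S. \<integral>x. (m x * G e x + m x * v x * bb e x) * (\<phi>' e x * p x + \<phi> x * G e x) \<partial>lborel)
      + (\<integral>x. f x * m x * v x * (\<phi> x * p x) \<partial>lborel)"
      by (simp add: drift v1 sum_subtractf)
    also have "\<dots> = 0" by (rule J)
    finally show ?thesis using Hi by simp
  qed
  have \<gamma>0: "\<gamma> x \<ge> 0" for x using order_trans[OF abs_ge_zero \<gamma>(2)] .
  have \<phi>\<gamma>: "\<phi> x + \<gamma> x \<ge> 0" for x using \<gamma>(2)[of x] by linarith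
  have H1: "integrable lborel (H \<gamma> \<gamma>')" "(\<integral>x. H \<gamma> \<gamma>' x \<partial>lborel) = 0"
    using nonneg[of \<gamma> \<gamma>', OF \<gamma>0 \<gamma>(1)] by auto
  have H2: "integrable lborel (H (\<lambda>x. \<phi> x + \<gamma> x) (\<lambda>e x. \<phi>' e x + \<gamma>' e x))"
    "(\<integral>x. H (\<lambda>x. \<phi> x + \<gamma> x) (\<lambda>e x. \<phi>' e x + \<gamma>' e x) x \<partial>lborel) = 0"
    using nonneg[of "\<lambda>x. \<phi> x + \<gamma> x" "\<lambda>e x. \<phi>' e x + \<gamma>' e x", OF \<phi>\<gamma> tdir_add[OF \<phi> \<gamma>(1)]] by auto
  have lin: "H (\<lambda>x. \<phi> x + \<gamma> x) (\<lambda>e x. \<phi>' e x + \<gamma>' e x) x - H \<gamma> \<gamma>' x = H \<phi> \<phi>' x" for x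
  proof -
    have "(\<Sum>e\<in>?S. m x * G e x * ((\<phi>' e x + \<gamma>' e x) * p x + (\<phi> x + \<gamma> x) * G e x))
      = (\<Sum>e\<in>?S. m x * G e x * (\<phi>' e x * p x + \<phi> x * G e x)) + (\<Sum>e\<in>?S. m x * G e x * (\<gamma>' e x * p x + \<gamma> x * G e x))"
      unfolding sum.distrib[symmetric] by (intro sum.cong refl) (simp add: algebra_simps)
    moreover have "(\<Sum>e\<in>?S. ct' e x * (\<phi> x + \<gamma> x) * p x) = (\<Sum>e\<in>?S. ct' e x * \<phi> x * p x) + (\<Sum>e\<in>?S. ct' e x * \<gamma> x * p x)"
      unfolding sum.distrib[symmetric] by (intro sum.cong refl) (simp add: algebra_simps)
    ultimately show ?thesis unfolding H_def by (simp add: algebra_simps)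
  qed
  have "(\<integral>x. H \<phi> \<phi>' x \<partial>lborel) = (\<integral>x. H (\<lambda>x. \<phi> x + \<gamma> x) (\<lambda>e x. \<phi>' e x + \<gamma>' e x) x - H \<gamma> \<gamma>' x \<partial>lborel)"
    by (simp only: lin)
  also have "\<dots> = 0" using H1 H2 by simp
  finally show ?thesis unfolding H_def .
qed

section \<open>The space-time cylinder\<close>

lemma Basis_spacetime:
  "(Basis :: 'n::finite spacetime set) = insert (0, 1) (range (\<lambda>i. (axis i 1, 0)))"
  unfolding Basis_prod_def Basis_vec_def by auto

lemma Basis_minus_time:
  "(Basis :: 'n::finite spacetime set) - {(0, 1)} = range (\<lambda>i. (axis i 1, 0))"
  unfolding Basis_spacetime by auto

lemma sum_space_Basis:
  fixes F :: "'n::finite spacetime \<Rightarrow> 'b::comm_monoid_add"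
  shows "(\<Sum>e\<in>Basis - {(0, 1)}. F e) = (\<Sum>i\<in>UNIV. F (axis i 1, 0))"
proof -
  have "inj (\<lambda>i::'n. (axis i (1::real), 0::real))" by (auto simp: inj_on_def axis_eq_axis)
  then show ?thesis unfolding Basis_minus_time by (subst sum.reindex) (auto simp: o_def)
qed

lemma open_QT: "open (QT T :: 'n::finite spacetime set)"
  unfolding QT_def by (intro open_Times) auto

text \<open>Squaring removes the corner of the positive part: at 0 the increment is of second order.
  Cut-offs made from such squares are therefore continuously differentiable.\<close>

lemma DERIV_max_sq:
  assumes "(f has_real_derivative D) (at s)"
  shows "((\<lambda>s. (max 0 (f s))\<^sup>2) has_real_derivative 2 * max 0 (f s) * D) (at s)"
proof -
  have "((\<lambda>y::real. (max 0 y)\<^sup>2) has_real_derivative 2 * max 0 y) (at y)" for y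
  proof -
    consider "y > 0" | "y < 0" | "y = 0" by linarith
    then show ?thesis
    proof cases
      case 1
      have "((\<lambda>y::real. y\<^sup>2) has_real_derivative 2 * max 0 y) (at y)"
        using 1 by (auto intro!: derivative_eq_intros)
      then show ?thesis
        by (rule DERIV_cong_ev[THEN iffD1, rotated -1])
           (use 1 in \<open>auto intro!: eventually_mono[OF eventually_nhds_in_open[of "{0<..}"]]\<close>)
    next
      case 2
      have "((\<lambda>y::real. 0) has_real_derivative 2 * max 0 y) (at y)" using 2 by (auto intro!: derivative_eq_intros)
      then show ?thesis
        by (rule DERIV_cong_ev[THEN iffD1, rotated -1])
           (use 2 in \<open>auto intro!: eventually_mono[OF eventually_nhds_in_open[of "{..<0}"]]\<close>)
    next
      case 3
      have "((\<lambda>y::real. (max 0 y)\<^sup>2) has_derivative (\<lambda>h. 0)) (at 0)"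
      proof (rule has_derivativeI_sandwich[where e=1 and H="\<lambda>y. \<bar>y\<bar>"])
        fix y :: real assume "y \<noteq> 0"
        moreover have "(max 0 y)\<^sup>2 \<le> \<bar>y\<bar> * \<bar>y\<bar>" by (auto simp: max_def power2_eq_square)
        ultimately show "norm ((max 0 y)\<^sup>2 - (max 0 0)\<^sup>2 - 0) / norm (y - 0) \<le> \<bar>y\<bar>"
          by (simp add: divide_le_eq)
      next
        show "((\<lambda>y. \<bar>y\<bar>) \<longlongrightarrow> 0) (at (0::real))" by (intro tendsto_eq_intros) auto
      qed auto
      then show ?thesis using 3 by (simp add: has_field_derivative_def lambda_zero)
    qed
  qed
  from DERIV_chain2[OF this assms] show ?thesis .
qed

text \<open>A profile in time, fixed by \<open>K\<close>, times a profile in space stretched over a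
  ball of radius \<open>R\<close>. Increasing \<open>R\<close> flattens the space derivatives like
  \<open>1 / R\<close> while the bound on the time derivative and the lower bound on
  \<open>K\<close> are kept, so \<open>L\<close> and \<open>c0\<close> can be chosen before
  \<open>\<epsilon>\<close>.\<close>

lemma QT_cutoff:
  fixes K :: "'n::finite spacetime set"
  assumes T: "T > 0" and K: "compact K" "K \<subseteq> QT T"
  shows "\<exists>L c0. c0 > 0 \<and> (\<forall>\<epsilon>>0. \<exists>\<theta> \<theta>'.
        (\<forall>e\<in>Basis. tdir (QT T) e \<theta> (\<theta>' e)) \<and> (\<forall>x. 0 \<le> \<theta> x \<and> \<theta> x \<le> 1) \<and> (\<forall>x\<in>K. \<theta> x \<ge> c0) \<and>
        (\<forall>e\<in>Basis. \<forall>x. \<bar>\<theta>' e x\<bar> \<le> L) \<and> (\<forall>e\<in>Basis - {(0, 1)}. \<forall>x. \<bar>\<theta>' e x\<bar> \<le> \<epsilon>))"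
proof -
  obtain t0 t1 where t: "0 < t0" "t1 < T" "t0 \<le> t1" "\<And>z. z \<in> K \<Longrightarrow> t0 \<le> snd z \<and> snd z \<le> t1"
  proof (cases "K = {}")
    case True then show ?thesis using T that[of "T/2" "T/2"] by auto
  next
    case False
    have c: "continuous_on K snd" by (intro continuous_intros)
    obtain z0 where z0: "z0 \<in> K" "\<And>z. z \<in> K \<Longrightarrow> snd z0 \<le> snd z" using continuous_attains_inf[OF K(1) False c] by blast
    obtain z1 where z1: "z1 \<in> K" "\<And>z. z \<in> K \<Longrightarrow> snd z \<le> snd z1" using continuous_attains_sup[OF K(1) False c] by blast
    have "0 < snd z \<and> snd z < T" if "z \<in> K" for z using K(2) that by (cases z) (auto simp: QT_def)
    then have "0 < snd z0" "snd z1 < T" "snd z0 \<le> snd z1" using z0 z1 by blast+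
    then show ?thesis using that z0 z1 by blast
  qed
  obtain R0 where R0: "\<And>z. z \<in> K \<Longrightarrow> norm z \<le> R0" using compact_imp_bounded[OF K(1)] unfolding bounded_iff by blast
  define a where "a = t0 / 2"
  define b where "b = (t1 + T) / 2"
  \<comment> \<open>The maximum of \<open>(t - a) * (b - t)\<close>, attained at the midpoint; it
    normalises \<open>A\<close> to be at most 1.\<close>
  define s where "s = (b - a)\<^sup>2 / 4"
  have ab: "0 < a" "a < b" "b < T" "a < t0" "t1 < b" using t by (auto simp: a_def b_def)
  have s0: "s > 0" using ab by (simp add: s_def)
  define A where "A z = (snd z - a) * (b - snd z) / s" for z :: "'n spacetime"
  define A' where "A' e z = (b + a - 2 * snd z) * snd e / s" for e z :: "'n spacetime"
  have A1: "A z \<le> 1" for z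
  proof -
    have "s - (snd z - a) * (b - snd z) = (snd z - (a + b) / 2)\<^sup>2" by (simp add: s_def power2_eq_square field_simps)
    moreover have "(snd z - (a + b) / 2)\<^sup>2 \<ge> 0" by simp
    ultimately have "(snd z - a) * (b - snd z) \<le> s" by linarith
    then show ?thesis using s0 by (simp add: A_def)
  qed
  have Apos: "A z > 0 \<Longrightarrow> a \<le> snd z \<and> snd z \<le> b" for z
    using s0 ab by (auto simp: A_def zero_less_divide_iff zero_less_mult_iff)
  \<comment> \<open>A lower bound for \<open>A\<close> on the time interval occupied by
    \<open>K\<close>, from the smallest value of each factor separately.\<close>
  define am where "am = (t0 - a) * (b - t1) / s"
  have am: "am > 0" using ab s0 by (simp add: am_def)
  have Am: "A z \<ge> am" if "z \<in> K" for z
    unfolding A_def am_def using t(4)[OF that] ab s0 by (intro divide_right_mono mult_mono) auto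
  have bound: "\<exists>\<theta> \<theta>'. (\<forall>e\<in>Basis. tdir (QT T) e \<theta> (\<theta>' e)) \<and> (\<forall>x. 0 \<le> \<theta> x \<and> \<theta> x \<le> 1) \<and> (\<forall>x\<in>K. \<theta> x \<ge> am\<^sup>2 * (1/4)) \<and>
        (\<forall>e\<in>Basis. \<forall>x. \<bar>\<theta>' e x\<bar> \<le> 2 * ((b - a) / s) + 4) \<and> (\<forall>e\<in>Basis - {(0, 1)}. \<forall>x. \<bar>\<theta>' e x\<bar> \<le> \<epsilon>)"
    if \<epsilon>: "\<epsilon> > 0" for \<epsilon> :: real
  proof -
    \<comment> \<open>At least \<open>2 * R0\<close>, so that \<open>Bf\<close> is at least
      \<open>3/4\<close> on \<open>K\<close>, and at least \<open>4 / \<epsilon>\<close>, since the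
      factors 2 from the outer square and from \<open>fst z \<bullet> fst z\<close> lead to space
      derivatives of size at most \<open>4 / R\<close>.\<close>
    define R where "R = max 1 (max (2 * R0) (4 / \<epsilon>))"
    have R: "R \<ge> 1" "R \<ge> 2 * R0" "R \<ge> 4 / \<epsilon>" by (auto simp: R_def)
    have Re: "4 / R \<le> \<epsilon>" "4 / R \<le> 4" using R \<epsilon> by (auto simp: divide_le_eq mult.commute)
    define Bf where "Bf z = 1 - fst z \<bullet> fst z / R\<^sup>2" for z :: "'n spacetime"
    define B' where "B' e z = - (2 * (fst z \<bullet> fst e)) / R\<^sup>2" for e z :: "'n spacetime"
    define \<theta> where "\<theta> z = (max 0 (A z))\<^sup>2 * (max 0 (Bf z))\<^sup>2" for z
    define \<theta>' where "\<theta>' e z = 2 * max 0 (A z) * A' e z * (max 0 (Bf z))\<^sup>2 + (max 0 (A z))\<^sup>2 * (2 * max 0 (Bf z) * B' e z)" for e z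
    have B1: "Bf z \<le> 1" for z by (simp add: Bf_def)
    have Bpos: "norm (fst z) \<le> R" if "Bf z > 0" for z
    proof -
      have "(norm (fst z))\<^sup>2 < R\<^sup>2" using that R by (simp add: Bf_def dot_square_norm divide_less_eq)
      then have "norm (fst z) < R" by (rule power_less_imp_less_base) (use R in linarith)
      then show ?thesis by simp
    qed
    have ml: "0 \<le> max 0 (A z)" "max 0 (A z) \<le> 1" "0 \<le> max 0 (Bf z)" "max 0 (Bf z) \<le> 1" for z
      using A1[of z] B1[of z] by auto
    have sq: "0 \<le> (max 0 (A z))\<^sup>2" "(max 0 (A z))\<^sup>2 \<le> 1" "0 \<le> (max 0 (Bf z))\<^sup>2" "(max 0 (Bf z))\<^sup>2 \<le> 1" for z
      using ml[of z] by (auto intro!: power_le_one)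
    have c: "continuous_on UNIV A" "continuous_on UNIV Bf" "continuous_on UNIV (A' e)" "continuous_on UNIV (B' e)" for e
      unfolding A_def Bf_def A'_def B'_def using s0 R by (intro continuous_intros; simp)+
    have der: "((\<lambda>r. \<theta> (z + r *\<^sub>R e)) has_real_derivative \<theta>' e z) (at 0)" for e z
    proof -
      have dA: "((\<lambda>r. A (z + r *\<^sub>R e)) has_real_derivative A' e z) (at 0)"
        unfolding A_def A'_def using s0 by (auto intro!: derivative_eq_intros simp: field_simps)
      have "((\<lambda>r. (fst z + r *\<^sub>R fst e) \<bullet> (fst z + r *\<^sub>R fst e)) has_real_derivative 2 * (fst z \<bullet> fst e)) (at 0)"
      proof -
        have "((\<lambda>r. fst z \<bullet> fst z + 2 * r * (fst z \<bullet> fst e) + r * r * (fst e \<bullet> fst e)) has_real_derivative 2 * (fst z \<bullet> fst e)) (at 0)"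
          by (auto intro!: derivative_eq_intros)
        then show ?thesis by (simp add: inner_add inner_commute algebra_simps)
      qed
      from DERIV_diff[OF DERIV_const[of 1] DERIV_cdivide[OF this, of "R\<^sup>2"]]
      have dB: "((\<lambda>r. Bf (z + r *\<^sub>R e)) has_real_derivative B' e z) (at 0)"
        unfolding Bf_def B'_def by simp
      from DERIV_mult[OF DERIV_max_sq[OF dA] DERIV_max_sq[OF dB]] show ?thesis
        unfolding \<theta>_def \<theta>'_def by (simp add: algebra_simps)
    qed
    have supp: "\<theta> z = 0 \<and> \<theta>' e z = 0" if "z \<notin> cball 0 R \<times> {a..b}" for e z
    proof -
      have "\<not> (A z > 0 \<and> Bf z > 0)" using that Apos[of z] Bpos[of z] by (cases z) auto
      then have "max 0 (A z) = 0 \<or> max 0 (Bf z) = 0" by auto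
      then show ?thesis by (auto simp: \<theta>_def \<theta>'_def)
    qed
    have td: "tdir (QT T) e \<theta> (\<theta>' e)" for e
      unfolding tdir_def
    proof (intro conjI allI exI[of _ "cball 0 R \<times> {a..b}"] impI)
      show "continuous_on UNIV \<theta>" "continuous_on UNIV (\<theta>' e)"
        unfolding \<theta>_def \<theta>'_def by (intro continuous_intros c)+
      show "compact (cball 0 R \<times> {a..b} :: 'n spacetime set)" by (intro compact_Times) auto
      show "cball 0 R \<times> {a..b} \<subseteq> QT T" using ab by (auto simp: QT_def)
    qed (use der supp in auto)
    have A'b: "max 0 (A z) * \<bar>A' e z\<bar> \<le> (b - a) / s * \<bar>snd e\<bar>" for e z
    proof (cases "A z > 0")
      case True
      then have "\<bar>b + a - 2 * snd z\<bar> \<le> b - a" using Apos[of z] by auto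
      then have "\<bar>A' e z\<bar> \<le> (b - a) * \<bar>snd e\<bar> / s"
        unfolding A'_def using s0 by (simp add: abs_mult divide_right_mono mult_right_mono)
      then show ?thesis using mult_mono[OF ml(2)[of z], of "\<bar>A' e z\<bar>" "(b - a) * \<bar>snd e\<bar> / s"] by simp
    next
      case False
      then have "max 0 (A z) = 0" by simp
      then show ?thesis using ab s0 by simp
    qed
    have B'b: "max 0 (Bf z) * \<bar>B' e z\<bar> \<le> 2 / R" if e: "e \<in> Basis" for e z
    proof (cases "Bf z > 0")
      case True
      have "norm (fst e) \<le> 1" using e norm_fst_le[of "fst e" "snd e"] by simp
      then have "\<bar>fst z \<bullet> fst e\<bar> \<le> R * 1"
        by (intro order_trans[OF Cauchy_Schwarz_ineq2] mult_mono Bpos[OF True]) (use R in auto)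
      then have "\<bar>B' e z\<bar> \<le> 2 * R / R\<^sup>2" unfolding B'_def using R by (simp add: abs_mult divide_right_mono)
      also have "\<dots> = 2 / R" using R by (simp add: power2_eq_square)
      finally show ?thesis using mult_mono[OF ml(4)[of z], of "\<bar>B' e z\<bar>" "2 / R"] by simp
    next
      case False
      then have "max 0 (Bf z) = 0" by simp
      then show ?thesis using R by simp
    qed
    have main: "\<bar>\<theta>' e z\<bar> \<le> 2 * ((b - a) / s * \<bar>snd e\<bar>) + 4 / R" if e: "e \<in> Basis" for e z
    proof -
      have "\<bar>\<theta>' e z\<bar> \<le> 2 * (max 0 (A z) * \<bar>A' e z\<bar>) * (max 0 (Bf z))\<^sup>2 + (max 0 (A z))\<^sup>2 * (2 * (max 0 (Bf z) * \<bar>B' e z\<bar>))"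
        unfolding \<theta>'_def by (rule order_trans[OF abs_triangle_ineq]) (simp add: abs_mult mult_ac)
      also have "\<dots> \<le> 2 * ((b - a) / s * \<bar>snd e\<bar>) * 1 + 1 * (2 * (2 / R))"
        using ml[of z] ab s0 R by (intro add_mono mult_mono A'b B'b[OF e] sq order_refl mult_nonneg_nonneg) auto
      finally show ?thesis by simp
    qed
    have "\<bar>\<theta>' e z\<bar> \<le> 2 * ((b - a) / s) + 4" if e: "e \<in> Basis" for e z
    proof -
      have "\<bar>snd e\<bar> \<le> 1" using e norm_snd_le[where x="fst e" and y="snd e"] by simp
      then have "(b - a) / s * \<bar>snd e\<bar> \<le> (b - a) / s * 1" using ab s0 by (intro mult_left_mono) auto
      then show ?thesis using main[OF e, of z] Re(2) by linarith
    qed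
    moreover have "\<bar>\<theta>' e z\<bar> \<le> \<epsilon>" if e: "e \<in> Basis - {(0, 1)}" for e z
    proof -
      have "snd e = 0" using e unfolding Basis_minus_time by auto
      then show ?thesis using main[of e z] e Re(1) by simp
    qed
    moreover have "0 \<le> \<theta> z \<and> \<theta> z \<le> 1" for z
      unfolding \<theta>_def using sq[of z] mult_le_one[of "(max 0 (A z))\<^sup>2" "(max 0 (Bf z))\<^sup>2"] by simp
    moreover have "\<theta> z \<ge> am\<^sup>2 * (1/4)" if z: "z \<in> K" for z
    proof -
      have "norm (fst z) \<le> R / 2" using R0[OF z] norm_fst_le[of "fst z" "snd z", unfolded prod.collapse] R(2) by linarith
      then have "(norm (fst z))\<^sup>2 \<le> (R / 2)\<^sup>2" by (intro power_mono) auto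
      then have "Bf z \<ge> 3/4" unfolding Bf_def using R by (simp add: dot_square_norm power_divide divide_le_eq)
      then have "(max 0 (Bf z))\<^sup>2 \<ge> (1/2)\<^sup>2" by (intro power_mono) auto
      moreover have "(max 0 (A z))\<^sup>2 \<ge> am\<^sup>2" using Am[OF z] am by (intro power_mono) auto
      ultimately show ?thesis unfolding \<theta>_def by (intro mult_mono) (auto simp: power2_eq_square)
    qed
    ultimately show ?thesis using td by blast
  qed
  have "am\<^sup>2 * (1/4) > 0" using am by simp
  with bound show ?thesis by blast
qed

section \<open>Borel representatives\<close>

text \<open>The assumptions speak of Lebesgue measurable functions on \<open>\<Omega>\<close>,
  whereas translation, Fubini and mollification are applied to Borel functions on the whole space. A
  Borel version extended by zero carries integrals from one setting to the other unchanged.\<close>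

definition rep :: "'a::euclidean_space set \<Rightarrow> ('a \<Rightarrow> real) \<Rightarrow> ('a \<Rightarrow> real) \<Rightarrow> bool" where
  "rep \<Omega> u u' \<longleftrightarrow> u' \<in> borel_measurable borel \<and> (AE x in lborel. x \<in> \<Omega> \<longrightarrow> u x = u' x) \<and> (\<forall>x. x \<notin> \<Omega> \<longrightarrow> u' x = 0)"

lemma repD:
  assumes "rep \<Omega> u u'"
  shows "u' \<in> borel_measurable borel" "AE x in lborel. x \<in> \<Omega> \<longrightarrow> u x = u' x" "x \<notin> \<Omega> \<Longrightarrow> u' x = 0"
  using assms by (auto simp: rep_def)

lemma rep_exists:
  fixes u :: "'a::euclidean_space \<Rightarrow> real"
  assumes o: "open \<Omega>" and u: "u \<in> borel_measurable (lebesgue_on \<Omega>)"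
  obtains u' where "rep \<Omega> u u'"
proof -
  have [measurable]: "\<Omega> \<in> sets borel" using o by simp
  have "(\<lambda>x. indicator \<Omega> x *\<^sub>R u x) \<in> borel_measurable lebesgue"
    using u by (subst (asm) borel_measurable_restrict_space_iff) auto
  then obtain g where g[measurable]: "g \<in> borel_measurable lborel" and ae: "AE x in lborel. indicator \<Omega> x *\<^sub>R u x = g x"
    using completion_ex_borel_measurable_real by blast
  have "rep \<Omega> u (\<lambda>x. indicator \<Omega> x * g x)"
    unfolding rep_def
  proof (intro conjI allI impI)
    show "(\<lambda>x. indicator \<Omega> x * g x) \<in> borel_measurable borel" using g by simp
    show "AE x in lborel. x \<in> \<Omega> \<longrightarrow> u x = indicator \<Omega> x * g x"
      using ae by eventually_elim auto
  qed auto
  then show ?thesis by (rule that)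
qed

lemma rep_integral:
  fixes u :: "'a::euclidean_space \<Rightarrow> real"
  assumes \<Omega>: "\<Omega> \<in> sets borel" and r: "rep \<Omega> u u'"
  shows "(\<integral>x. u x \<partial>lebesgue_on \<Omega>) = (\<integral>x. u' x \<partial>lborel)"
    and "integrable (lebesgue_on \<Omega>) u \<longleftrightarrow> integrable lborel u'"
proof -
  have S: "\<Omega> \<inter> space lebesgue \<in> sets lebesgue" using \<Omega> by auto
  have u'm: "u' \<in> borel_measurable lborel" using repD(1)[OF r] by simp
  have ae: "AE x in lebesgue. u' x = indicator \<Omega> x *\<^sub>R u x"
    using repD(2)[OF r] repD(3)[OF r] unfolding AE_completion_iff by (auto simp: indicator_def elim!: eventually_mono)
  have m: "(\<lambda>x. indicator \<Omega> x *\<^sub>R u x) \<in> borel_measurable lebesgue"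
    using borel_measurable_AE[OF measurable_completion[OF u'm] ae] .
  have "(\<integral>x. u x \<partial>lebesgue_on \<Omega>) = (\<integral>x. indicator \<Omega> x *\<^sub>R u x \<partial>lebesgue)"
    by (rule integral_restrict_space[OF S])
  also have "\<dots> = (\<integral>x. u' x \<partial>lebesgue)"
    by (rule integral_cong_AE[OF m measurable_completion[OF u'm]]) (use ae in \<open>auto elim!: eventually_mono\<close>)
  finally show "(\<integral>x. u x \<partial>lebesgue_on \<Omega>) = (\<integral>x. u' x \<partial>lborel)"
    by (simp add: integral_completion[OF u'm])
  have "integrable (lebesgue_on \<Omega>) u \<longleftrightarrow> integrable lebesgue (\<lambda>x. indicator \<Omega> x *\<^sub>R u x)"
    by (rule integrable_restrict_space[OF S])
  also have "\<dots> \<longleftrightarrow> integrable lebesgue u'"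
    by (rule integrable_cong_AE[OF m measurable_completion[OF u'm]]) (use ae in \<open>auto elim!: eventually_mono\<close>)
  finally show "integrable (lebesgue_on \<Omega>) u \<longleftrightarrow> integrable lborel u'"
    by (simp add: integrable_completion[OF u'm])
qed

lemma rep_L2:
  assumes o: "open \<Omega>" and i: "integrable (lebesgue_on \<Omega>) (\<lambda>x. \<bar>u x\<bar> powr 2)" and r: "rep \<Omega> u u'"
  shows "u' \<in> L2"
proof -
  have [measurable]: "u' \<in> borel_measurable borel" by (rule repD(1)[OF r])
  have "rep \<Omega> (\<lambda>x. \<bar>u x\<bar> powr 2) (\<lambda>x. (u' x)\<^sup>2)"
    unfolding rep_def
  proof (intro conjI allI impI)
    show "AE x in lborel. x \<in> \<Omega> \<longrightarrow> \<bar>u x\<bar> powr 2 = (u' x)\<^sup>2"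
      using repD(2)[OF r] by eventually_elim (auto simp: powr_numeral)
  qed (use repD(3)[OF r] in auto)
  from rep_integral(2)[OF _ this] i o show ?thesis by (simp add: L2_def)
qed

lemma rep_L1:
  assumes o: "open \<Omega>" and u: "u \<in> Lp 1 \<Omega>" and r: "rep \<Omega> u u'"
  shows "integrable lborel u'"
proof -
  have [measurable]: "u' \<in> borel_measurable borel" by (rule repD(1)[OF r])
  have r1: "rep \<Omega> (\<lambda>x. norm (u x) powr 1) (\<lambda>x. \<bar>u' x\<bar>)"
    unfolding rep_def
  proof (intro conjI allI impI)
    show "AE x in lborel. x \<in> \<Omega> \<longrightarrow> norm (u x) powr 1 = \<bar>u' x\<bar>"
      using repD(2)[OF r] by eventually_elim auto
  qed (use repD(3)[OF r] in auto)
  have "integrable lborel (\<lambda>x. \<bar>u' x\<bar>)"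
    using rep_integral(2)[OF _ r1] u o by (simp add: Lp_def)
  then show ?thesis by (simp add: integrable_abs_iff)
qed

lemma rep_mult_test:
  assumes "rep \<Omega> u u'" "\<phi> \<in> borel_measurable borel"
  shows "rep \<Omega> (\<lambda>x. u x * \<phi> x) (\<lambda>x. u' x * \<phi> x)"
  unfolding rep_def
proof (intro conjI allI impI)
  show "(\<lambda>x. u' x * \<phi> x) \<in> borel_measurable borel" using repD(1)[OF assms(1)] assms(2) by measurable
  show "AE x in lborel. x \<in> \<Omega> \<longrightarrow> u x * \<phi> x = u' x * \<phi> x"
    using repD(2)[OF assms(1)] by eventually_elim auto
qed (use repD(3)[OF assms(1)] in auto)

lemma rep_wderiv:
  assumes o: "open \<Omega>" and e: "e \<in> Basis" and w: "is_weak_deriv \<Omega> e u g" and u: "rep \<Omega> u u'" and g: "rep \<Omega> g g'"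
  shows "wderiv \<Omega> e u' g'"
  unfolding wderiv_def
proof (intro allI impI)
  fix \<phi> assume \<phi>: "test_function \<Omega> \<phi>"
  have \<Omega>: "\<Omega> \<in> sets borel" using o by simp
  have "(\<integral>x. u x * dir_deriv e \<phi> x \<partial>lebesgue_on \<Omega>) = - (\<integral>x. g x * \<phi> x \<partial>lebesgue_on \<Omega>)"
    using w \<phi> unfolding is_weak_deriv_def by blast
  then show "(\<integral>x. u' x * dir_deriv e \<phi> x \<partial>lborel) = - (\<integral>x. g' x * \<phi> x \<partial>lborel)"
    unfolding rep_integral(1)[OF \<Omega> rep_mult_test[OF u test_function_borel[OF test_function_dir_deriv[OF \<phi> e]]]]
      rep_integral(1)[OF \<Omega> rep_mult_test[OF g test_function_borel[OF \<phi>]]] .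
qed

text \<open>Local integrability gives measurability on each compact set; along a compact exhaustion
  the restrictions extended by zero converge pointwise. This is needed for gradients selected by
  \<open>SOME\<close>, of which only the defining property is known.\<close>

lemma locally_integrable_measurable:
  assumes o: "open \<Omega>" and u: "locally_integrable \<Omega> u"
  shows "u \<in> borel_measurable (lebesgue_on \<Omega>)"
proof -
  obtain C :: "nat \<Rightarrow> 'a set" where C: "\<And>n. compact (C n)" "\<And>n. C n \<subseteq> \<Omega>"
    "\<And>n. C n \<subseteq> interior (C (Suc n))" "\<Union>(range C) = \<Omega>"
    "\<And>K. compact K \<Longrightarrow> K \<subseteq> \<Omega> \<Longrightarrow> \<exists>N. \<forall>n\<ge>N. K \<subseteq> C n"
    by (rule open_Union_compact_subsets[OF o]) (rule that)
  have Cl: "C n \<inter> space lebesgue \<in> sets lebesgue" for n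
    using C(1) by (simp add: lmeasurable_compact fmeasurableD)
  have "integrable (lebesgue_on (C n)) u" for n using u C(1,2) unfolding locally_integrable_def by blast
  then have "u \<in> borel_measurable (lebesgue_on (C n))" for n by (rule borel_measurable_integrable)
  then have m: "(\<lambda>x. indicator (C n) x *\<^sub>R u x) \<in> borel_measurable lebesgue" for n
    by (subst (asm) borel_measurable_restrict_space_iff[OF Cl])
  have "(\<lambda>x. indicator \<Omega> x *\<^sub>R u x) \<in> borel_measurable lebesgue"
  proof (rule borel_measurable_LIMSEQ_metric[OF m])
    fix x
    show "(\<lambda>n. indicator (C n) x *\<^sub>R u x) \<longlonglongrightarrow> indicator \<Omega> x *\<^sub>R u x"
    proof (cases "x \<in> \<Omega>")
      case True
      then obtain N where "\<forall>n\<ge>N. {x} \<subseteq> C n" using C(5)[of "{x}"] by auto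
      then have "\<forall>\<^sub>F n in sequentially. indicator (C n) x *\<^sub>R u x = indicator \<Omega> x *\<^sub>R u x"
        using True by (auto simp: eventually_sequentially indicator_def intro!: exI[of _ N])
      then show ?thesis by (rule tendsto_eventually)
    next
      case False
      then have "x \<notin> C n" for n using C(2) by blast
      with False show ?thesis by simp
    qed
  qed
  then show ?thesis using o by (subst borel_measurable_restrict_space_iff) auto
qed

lemma rep_loc_integrable:
  assumes u: "locally_integrable \<Omega> u" and r: "rep \<Omega> u u'" and K: "compact K" "K \<subseteq> \<Omega>"
  shows "integrable lborel (\<lambda>x. indicator K x * u' x)"
proof -
  have [measurable]: "u' \<in> borel_measurable borel" by (rule repD(1)[OF r])
  have Kb[measurable]: "K \<in> sets borel" using K by (simp add: borel_compact)
  have "rep K u (\<lambda>x. indicator K x * u' x)"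
    unfolding rep_def
  proof (intro conjI allI impI)
    show "AE x in lborel. x \<in> K \<longrightarrow> u x = indicator K x * u' x"
      using repD(2)[OF r] by eventually_elim (use K(2) in auto)
  qed auto
  from rep_integral(2)[OF Kb this] show ?thesis using u K unfolding locally_integrable_def by blast
qed

lemma weak_deriv_unique:
  assumes o: "open \<Omega>" and e: "e \<in> Basis" and w: "is_weak_deriv \<Omega> e u g1" "is_weak_deriv \<Omega> e u g2"
    and u: "rep \<Omega> u u'" and g: "rep \<Omega> g1 g1'" "rep \<Omega> g2 g2'"
  shows "AE x in lborel. x \<in> \<Omega> \<longrightarrow> g1' x = g2' x"
proof -
  have [measurable]: "g1' \<in> borel_measurable borel" "g2' \<in> borel_measurable borel" using repD(1) g by auto
  have li: "integrable lborel (\<lambda>x. indicator K x * g1' x)" "integrable lborel (\<lambda>x. indicator K x * g2' x)"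
    if "compact K" "K \<subseteq> \<Omega>" for K
    using rep_loc_integrable[OF _ g(1) that] rep_loc_integrable[OF _ g(2) that] w unfolding is_weak_deriv_def by auto
  have "AE x in lborel. x \<in> \<Omega> \<longrightarrow> g1' x - g2' x = 0"
  proof (rule du_Bois_Reymond[OF o])
    show "integrable lborel (\<lambda>x. indicator K x * (g1' x - g2' x))" if "compact K" "K \<subseteq> \<Omega>" for K
      using Bochner_Integration.integrable_diff[OF li[OF that]] by (simp add: right_diff_distrib)
    fix \<psi> assume \<psi>: "test_function \<Omega> \<psi>"
    obtain K where K: "compact K" "K \<subseteq> \<Omega>" "\<And>x. x \<notin> K \<Longrightarrow> \<psi> x = 0" "\<And>x e. x \<notin> K \<Longrightarrow> dir_deriv e \<psi> x = 0"
      by (rule test_functionE[OF \<psi>]) (rule that)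
    obtain B where B: "B \<ge> 0" "\<And>x. \<bar>\<psi> x\<bar> \<le> B" by (rule test_function_bounded[OF \<psi>]) (rule that)
    have [measurable]: "\<psi> \<in> borel_measurable borel" by (rule test_function_borel[OF \<psi>])
    have int: "integrable lborel (\<lambda>x. h x * \<psi> x)" if h: "integrable lborel (\<lambda>x. indicator K x * h x)" "h \<in> borel_measurable borel" for h
    proof (rule Bochner_Integration.integrable_bound[OF integrable_mult_right[OF h(1), of B]])
      show "AE x in lborel. norm (h x * \<psi> x) \<le> norm (B * (indicator K x * h x))"
      proof (rule AE_I2)
        fix x
        show "norm (h x * \<psi> x) \<le> norm (B * (indicator K x * h x))"
          using mult_right_mono[OF B(2)[of x], of "\<bar>h x\<bar>"] K(3)[of x] B(1) by (cases "x \<in> K") (auto simp: abs_mult mult.commute)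
      qed
    qed (use h(2) in measurable)
    have "(\<integral>x. g1' x * \<psi> x \<partial>lborel) = (\<integral>x. g2' x * \<psi> x \<partial>lborel)"
      using rep_wderiv[OF o e w(1) u g(1)] rep_wderiv[OF o e w(2) u g(2)] \<psi> unfolding wderiv_def by auto
    then show "(\<integral>x. (g1' x - g2' x) * \<psi> x \<partial>lborel) = 0"
      using int[OF li(1)[OF K(1,2)]] int[OF li(2)[OF K(1,2)]] by (simp add: left_diff_distrib)
  qed measurable
  then show ?thesis by eventually_elim auto
qed

section \<open>Bounded smooth coefficients\<close>

lemma smooth_bounded_onD:
  fixes u :: "'a::euclidean_space \<Rightarrow> 'b::real_normed_vector"
  assumes u: "smooth_bounded_on \<Omega> u"
  shows "x \<in> \<Omega> \<Longrightarrow> u differentiable (at x)"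
    and "continuous_on \<Omega> u" and "e \<in> Basis \<Longrightarrow> continuous_on \<Omega> (dir_deriv e u)"
    and "\<exists>B. \<forall>x\<in>\<Omega>. norm (u x) \<le> B \<and> (\<forall>e\<in>Basis. norm (dir_deriv e u x) \<le> B)"
proof -
  have d: "iter_deriv vs u differentiable (at x)" if "set vs \<subseteq> Basis" "x \<in> \<Omega>" for vs x
    using u that unfolding smooth_bounded_on_def smooth_on_def by blast
  have b: "bounded (iter_deriv vs u ` \<Omega>)" if "set vs \<subseteq> Basis" for vs
    using u that unfolding smooth_bounded_on_def by blast
  show "u differentiable (at x)" if "x \<in> \<Omega>" for x using d[of "[]" x] that by simp
  then show "continuous_on \<Omega> u"
    by (meson continuous_at_imp_continuous_on differentiable_imp_continuous_within)
  show "continuous_on \<Omega> (dir_deriv e u)" if "e \<in> Basis" for e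
    using d[of "[e]"] that by (auto simp: iter_deriv_Cons intro!: continuous_at_imp_continuous_on differentiable_imp_continuous_within)
  have "\<exists>B. \<forall>x\<in>\<Omega>. norm (dir_deriv e u x) \<le> B" if "e \<in> Basis" for e
    using b[of "[e]"] that unfolding bounded_iff by (auto simp: iter_deriv_Cons)
  then obtain Be where Be: "\<And>e x. e \<in> Basis \<Longrightarrow> x \<in> \<Omega> \<Longrightarrow> norm (dir_deriv e u x) \<le> Be e" by metis
  obtain B0 where B0: "\<And>x. x \<in> \<Omega> \<Longrightarrow> norm (u x) \<le> B0" using b[of "[]"] unfolding bounded_iff by auto
  have "norm (u x) \<le> \<bar>B0\<bar> + (\<Sum>e\<in>Basis. \<bar>Be e\<bar>) \<and> (\<forall>e\<in>Basis. norm (dir_deriv e u x) \<le> \<bar>B0\<bar> + (\<Sum>e\<in>Basis. \<bar>Be e\<bar>))" if x: "x \<in> \<Omega>" for x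
  proof (intro conjI ballI)
    have s: "0 \<le> (\<Sum>e\<in>Basis. \<bar>Be e\<bar>)" by (intro sum_nonneg) auto
    then show "norm (u x) \<le> \<bar>B0\<bar> + (\<Sum>e\<in>Basis. \<bar>Be e\<bar>)" using B0[OF x] by linarith
    fix e :: 'a assume e: "e \<in> Basis"
    have "\<bar>Be e\<bar> \<le> (\<Sum>e\<in>Basis. \<bar>Be e\<bar>)" by (rule member_le_sum[OF e]) auto
    then show "norm (dir_deriv e u x) \<le> \<bar>B0\<bar> + (\<Sum>e\<in>Basis. \<bar>Be e\<bar>)" using Be[OF e x] by linarith
  qed
  then show "\<exists>B. \<forall>x\<in>\<Omega>. norm (u x) \<le> B \<and> (\<forall>e\<in>Basis. norm (dir_deriv e u x) \<le> B)" by blast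
qed

lemma extension_by_zero_derivative:
  fixes u :: "'a::euclidean_space \<Rightarrow> real"
  assumes o: "open \<Omega>" and x: "x \<in> \<Omega>" and d: "u differentiable (at x)"
  shows "((\<lambda>s. indicator \<Omega> (x + s *\<^sub>R e) * u (x + s *\<^sub>R e)) has_real_derivative dir_deriv e u x) (at 0)"
proof -
  have "(u has_derivative frechet_derivative u (at x)) (at x)" using d by (simp add: frechet_derivative_works)
  then have "((\<lambda>x. indicator \<Omega> x * u x) has_derivative frechet_derivative u (at x)) (at x)"
    by (rule has_derivative_transform_within_open[OF _ o x]) simp
  from has_derivative_along[OF this, of e] show ?thesis by (simp add: dir_deriv_def)
qed

lemma extension_by_zero_borel:
  fixes u :: "'a::euclidean_space \<Rightarrow> real"
  assumes "open \<Omega>" "continuous_on \<Omega> u"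
  shows "(\<lambda>x. indicator \<Omega> x * u x) \<in> borel_measurable borel"
  using borel_measurable_continuous_on_indicator[of \<Omega> u] assms by simp

text \<open>\<open>y n\<close> is compared with the midpoint \<open>c\<close> of 1 and its limit. If
  the limit exceeded 1, then \<open>c powr (k n - 1)\<close> would grow without bound, against the
  convergence of the pressures; if it is below 1, the pressures are eventually at most
  \<open>2 * c powr (k n - 1)\<close> and tend to 0.\<close>

lemma limit_density_pressure:
  fixes y k :: "nat \<Rightarrow> real"
  assumes y: "\<And>n. y n \<ge> 0" "y \<longlonglongrightarrow> Y" and k: "filterlim k at_top sequentially" "\<And>n. k n \<ge> 3"
    and P: "(\<lambda>n. k n / (k n - 1) * y n powr (k n - 1)) \<longlonglongrightarrow> P"
  shows "0 \<le> Y" "Y \<le> 1" "0 \<le> P" "P \<noteq> 0 \<Longrightarrow> Y = 1"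
proof -
  show "0 \<le> Y" by (rule LIMSEQ_le_const[OF y(2)]) (use y(1) in auto)
  have c1: "1 \<le> k n / (k n - 1)" "k n / (k n - 1) \<le> 2" for n using k(2)[of n] by (auto simp: divide_le_eq le_divide_eq)
  have t0: "0 \<le> k n / (k n - 1) * y n powr (k n - 1)" for n using c1[of n] by (intro mult_nonneg_nonneg) auto
  show "0 \<le> P" by (rule LIMSEQ_le_const[OF P]) (use t0 in auto)
  have k1: "filterlim (\<lambda>n. k n - 1) at_top sequentially"
    using filterlim_tendsto_add_at_top[OF tendsto_const[of "-1"] k(1)] by (simp add: algebra_simps)
  show Y1: "Y \<le> 1"
  proof (rule ccontr)
    assume "\<not> Y \<le> 1"
    define c where "c = (Y + 1) / 2"
    have c: "1 < c" "c < Y" using \<open>\<not> Y \<le> 1\<close> by (auto simp: c_def)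
    have "filterlim (\<lambda>n. ln c * (k n - 1)) at_top sequentially"
      by (rule filterlim_tendsto_pos_mult_at_top[OF tendsto_const _ k1]) (use c in simp)
    then have ev1: "\<forall>\<^sub>F n in sequentially. ln c * (k n - 1) > P + 1" by (simp add: filterlim_at_top_dense)
    have ev2: "\<forall>\<^sub>F n in sequentially. y n > c" using order_tendstoD(1)[OF y(2) c(2)] .
    have ev3: "\<forall>\<^sub>F n in sequentially. k n / (k n - 1) * y n powr (k n - 1) < P + 1" using order_tendstoD(2)[OF P, of "P + 1"] by simp
    have "\<forall>\<^sub>F n in sequentially. False" using ev1 ev2 ev3
    proof eventually_elim
      case (elim n)
      have "ln c * (k n - 1) \<le> exp (ln c * (k n - 1))" using exp_ge_add_one_self[of "ln c * (k n - 1)"] by linarith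
      also have "\<dots> = c powr (k n - 1)" using c by (simp add: powr_def mult.commute)
      also have "\<dots> \<le> y n powr (k n - 1)" using elim c k(2)[of n] by (intro powr_mono2) auto
      also have "\<dots> \<le> k n / (k n - 1) * y n powr (k n - 1)" using mult_right_mono[OF c1(1)[of n], of "y n powr (k n - 1)"] by simp
      finally show False using elim by linarith
    qed
    then show False by simp
  qed
  show "Y = 1" if P0: "P \<noteq> 0"
  proof (rule ccontr)
    assume "Y \<noteq> 1"
    define c where "c = (Y + 1) / 2"
    have c: "0 < c" "c < 1" "Y < c" using \<open>Y \<noteq> 1\<close> Y1 \<open>0 \<le> Y\<close> by (auto simp: c_def)
    have "filterlim (\<lambda>n. - ln c * (k n - 1)) at_top sequentially"
      by (rule filterlim_tendsto_pos_mult_at_top[OF tendsto_const _ k1]) (use c in simp)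
    then have "filterlim (\<lambda>n. ln c * (k n - 1)) at_bot sequentially"
      by (simp add: filterlim_uminus_at_bot)
    then have "(\<lambda>n. 2 * exp (ln c * (k n - 1))) \<longlonglongrightarrow> 2 * 0"
      by (intro tendsto_mult tendsto_const filterlim_compose[OF exp_at_bot])
    then have l: "(\<lambda>n. 2 * exp (ln c * (k n - 1))) \<longlonglongrightarrow> 0" by simp
    have "\<forall>\<^sub>F n in sequentially. y n < c" using order_tendstoD(2)[OF y(2) c(3)] .
    then have "\<forall>\<^sub>F n in sequentially. norm (k n / (k n - 1) * y n powr (k n - 1)) \<le> 2 * exp (ln c * (k n - 1))"
    proof eventually_elim
      case (elim n)
      have "y n powr (k n - 1) \<le> c powr (k n - 1)" using elim y(1)[of n] k(2)[of n] by (intro powr_mono2) auto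
      also have "\<dots> = exp (ln c * (k n - 1))" using c by (simp add: powr_def mult.commute)
      finally have "k n / (k n - 1) * y n powr (k n - 1) \<le> 2 * exp (ln c * (k n - 1))"
        by (intro mult_mono c1) auto
      then show ?case unfolding real_norm_def abs_of_nonneg[OF t0[of n]] .
    qed
    then have "(\<lambda>n. k n / (k n - 1) * y n powr (k n - 1)) \<longlonglongrightarrow> 0" by (rule Lim_null_comparison[OF _ l])
    then show False using LIMSEQ_unique[OF P] P0 by blast
  qed
qed

section \<open>Complementarity for the limit pressure\<close>

lemma AE_lebesgue_on:
  assumes "\<Omega> \<in> sets borel"
  shows "(AE z in lebesgue_on \<Omega>. P z) \<longleftrightarrow> (AE z in lborel. z \<in> \<Omega> \<longrightarrow> P z)"
  using assms by (subst AE_restrict_space_iff) (auto simp: AE_completion_iff)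

lemma Lp2_inner_rep:
  fixes G :: "'a::euclidean_space \<Rightarrow> 'b::euclidean_space"
  assumes o: "open \<Omega>" and G: "G \<in> Lp 2 \<Omega>" and c: "norm c \<le> 1"
  obtains g where "rep \<Omega> (\<lambda>z. G z \<bullet> c) g" "g \<in> L2"
proof -
  have Gm: "G \<in> borel_measurable (lebesgue_on \<Omega>)" and Gi: "integrable (lebesgue_on \<Omega>) (\<lambda>z. norm (G z) powr 2)"
    using G by (auto simp: Lp_def)
  have m: "(\<lambda>z. G z \<bullet> c) \<in> borel_measurable (lebesgue_on \<Omega>)" using Gm by measurable
  obtain g where g: "rep \<Omega> (\<lambda>z. G z \<bullet> c) g" by (rule rep_exists[OF o m]) (rule that)
  have le: "\<bar>G z \<bullet> c\<bar> \<le> norm (G z)" for z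
  proof -
    have "\<bar>G z \<bullet> c\<bar> \<le> norm (G z) * norm c" by (rule Cauchy_Schwarz_ineq2)
    also have "\<dots> \<le> norm (G z)" by (rule mult_left_le[OF c norm_ge_zero])
    finally show ?thesis .
  qed
  have "integrable (lebesgue_on \<Omega>) (\<lambda>z. \<bar>G z \<bullet> c\<bar> powr 2)"
  proof (rule Bochner_Integration.integrable_bound[OF Gi])
    show "(\<lambda>z. \<bar>G z \<bullet> c\<bar> powr 2) \<in> borel_measurable (lebesgue_on \<Omega>)" using m by measurable
    show "AE z in lebesgue_on \<Omega>. norm (\<bar>G z \<bullet> c\<bar> powr 2) \<le> norm (norm (G z) powr 2)"
      using power_mono[OF le abs_ge_zero, of _ 2] by (intro AE_I2) (simp add: powr_numeral)
  qed
  from rep_L2[OF o this g] g show ?thesis by (intro that)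
qed

text \<open>By definition the selected gradient is no better than locally integrable, but weak
  derivatives agree almost everywhere, so a square integrable representative of any known gradient
  represents the selected one as well.\<close>

lemma weak_space_grad_rep:
  fixes u :: "'n::finite spacetime \<Rightarrow> real"
  assumes u: "rep (QT T) u u'" and G: "is_weak_space_grad T u G" and g: "\<And>i. rep (QT T) (\<lambda>z. G z $ i) (g i)"
  shows "rep (QT T) (\<lambda>z. weak_space_grad T u z $ i) (g i)"
proof -
  have E: "(axis i 1, 0) \<in> (Basis :: 'n spacetime set)" by (simp add: Basis_spacetime)
  have w: "is_weak_space_grad T u (weak_space_grad T u)"
    unfolding weak_space_grad_def by (rule someI[of "is_weak_space_grad T u", OF G])
  have w1: "is_weak_deriv (QT T) (axis i 1, 0) u (\<lambda>z. weak_space_grad T u z $ i)"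
    and w2: "is_weak_deriv (QT T) (axis i 1, 0) u (\<lambda>z. G z $ i)"
    using w G unfolding is_weak_space_grad_def by auto
  have "locally_integrable (QT T) (\<lambda>z. weak_space_grad T u z $ i)" using w1 unfolding is_weak_deriv_def by blast
  from locally_integrable_measurable[OF open_QT this]
  obtain h where h: "rep (QT T) (\<lambda>z. weak_space_grad T u z $ i) h" by (rule rep_exists[OF open_QT]) (rule that)
  have "AE z in lborel. z \<in> QT T \<longrightarrow> h z = g i z" by (rule weak_deriv_unique[OF open_QT E w1 w2 u h g])
  with repD(2)[OF h] have "AE z in lborel. z \<in> QT T \<longrightarrow> weak_space_grad T u z $ i = g i z"
    by eventually_elim auto
  then show ?thesis using repD(1,3)[OF g] by (auto simp: rep_def)
qed

lemma AE_all_index: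
  assumes "\<And>i::'n::finite. AE z in M. P i z" shows "AE z in M. \<forall>i. P i z"
proof -
  have "AE z in M. \<forall>i\<in>UNIV. P i z"
    by (subst AE_ball_countable) (use assms in \<open>auto simp: countable_finite\<close>)
  then show ?thesis by simp
qed

text \<open>Puts the weak formulation into the form used by the energy estimate. Membership of
  \<open>v^k\<close> in the Sobolev space of the space-time cylinder gives weak derivatives in every
  direction, time included, and this legitimises the nonlinear test. Test functions supported in the
  open cylinder do not see the initial data.\<close>

lemma solution_representative:
  fixes m :: "'n::finite spacetime \<Rightarrow> real" and bb :: "'n spacetime \<Rightarrow> 'n spacetime \<Rightarrow> real" and k :: real
  assumes T: "T > 0" and \<delta>: "\<delta> > 0" and k: "k \<ge> 3"
    and mm: "mm \<in> borel_measurable borel" "\<And>z. mm z = indicator (QT T) z * m z" "\<And>z. z \<in> QT T \<Longrightarrow> mm z \<ge> \<delta>" "\<And>z. \<bar>mm z\<bar> \<le> M"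
    and bb: "\<And>e. bb e \<in> borel_measurable borel" "\<And>e z. e \<in> Basis \<Longrightarrow> bb e z = indicator (QT T) z * (b z \<bullet> fst e)" "\<And>e z. \<bar>bb e z\<bar> \<le> M"
    and ff: "ff \<in> borel_measurable borel" "\<And>z. ff z = indicator (QT T) z * f z" "\<And>z. \<bar>ff z\<bar> \<le> M"
    and sol: "nonneg_weak_solution T m b f k r0 \<rho>"
  obtains R g where "rep (QT T) \<rho> R" "R \<in> L2" "\<And>z. R z \<ge> 0"
    "(\<lambda>z. (R z / mm z) powr k) \<in> L2"
    "\<And>e. e \<in> Basis \<Longrightarrow> g e \<in> L2" "\<And>e. e \<in> Basis \<Longrightarrow> wderiv (QT T) e (\<lambda>z. (R z / mm z) powr k) (g e)"
    "\<And>\<psi>. test_function (QT T) \<psi> \<Longrightarrow>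
      (\<integral>z. R z * dir_deriv (0, 1) \<psi> z \<partial>lborel) - (\<Sum>e\<in>Basis - {(0, 1)}. \<integral>z. R z * bb e z * dir_deriv e \<psi> z \<partial>lborel)
      - (\<Sum>e\<in>Basis - {(0, 1)}. \<integral>z. mm z * g e z * dir_deriv e \<psi> z \<partial>lborel)
      + (\<integral>z. ff z * R z * \<psi> z \<partial>lborel) = 0"
proof -
  let ?\<Omega> = "QT T :: 'n spacetime set"
  let ?S = "Basis - {(0, 1)} :: 'n spacetime set"
  let ?W = "\<lambda>z. (\<rho> z / m z) powr k"
  have \<Omega>b: "?\<Omega> \<in> sets borel" by (rule borel_open[OF open_QT])
  have et: "(0, 1) \<in> (Basis :: 'n spacetime set)" by (simp add: Basis_spacetime)
  have s1: "AE z in lborel. z \<in> ?\<Omega> \<longrightarrow> \<rho> z \<ge> 0" and s2: "\<rho> \<in> Lp 2 ?\<Omega>" and s3: "?W \<in> W1 2 ?\<Omega>"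
    using sol unfolding nonneg_weak_solution_def AE_lebesgue_on[OF \<Omega>b] by auto
  have \<rho>m: "\<rho> \<in> borel_measurable (lebesgue_on ?\<Omega>)" using s2 by (simp add: Lp_def)
  obtain R0 where R0: "rep ?\<Omega> \<rho> R0" by (rule rep_exists[OF open_QT \<rho>m]) (rule that)
  \<comment> \<open>Nonnegativity of \<open>\<rho>\<close> holds almost everywhere; the
    representative is changed on a null set to have it everywhere, as the chain rule on the
    half-line demands.\<close>
  define R where "R z = max 0 (R0 z)" for z
  have [measurable]: "R0 \<in> borel_measurable borel" by (rule repD(1)[OF R0])
  have Rrep: "rep ?\<Omega> \<rho> R"
    unfolding rep_def
  proof (intro conjI allI impI)
    show "R \<in> borel_measurable borel" unfolding R_def by measurable
    show "AE z in lborel. z \<in> ?\<Omega> \<longrightarrow> \<rho> z = R z" using s1 repD(2)[OF R0] by eventually_elim (auto simp: R_def)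
  qed (use repD(3)[OF R0] in \<open>auto simp: R_def\<close>)
  have [measurable]: "R \<in> borel_measurable borel" "mm \<in> borel_measurable borel" "ff \<in> borel_measurable borel"
    "\<And>e. bb e \<in> borel_measurable borel" by (rule repD(1)[OF Rrep], fact+)
  have RL: "R \<in> L2" using rep_L2[OF open_QT _ Rrep] s2 by (simp add: Lp_def)
  have R0': "R z \<ge> 0" for z by (simp add: R_def)
  define w where "w z = (R z / mm z) powr k" for z
  have wrep: "rep ?\<Omega> ?W w"
    unfolding rep_def
  proof (intro conjI allI impI)
    show "w \<in> borel_measurable borel" unfolding w_def by measurable
    show "AE z in lborel. z \<in> ?\<Omega> \<longrightarrow> ?W z = w z" using repD(2)[OF Rrep] by eventually_elim (auto simp: w_def mm(2))
  qed (use repD(3)[OF Rrep] in \<open>auto simp: w_def\<close>)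
  obtain G where G: "G \<in> Lp 2 ?\<Omega>" "is_weak_grad ?\<Omega> ?W G" and WL: "?W \<in> Lp 2 ?\<Omega>" using s3 unfolding W1_def by auto
  have wL: "w \<in> L2" using rep_L2[OF open_QT _ wrep] WL by (simp add: Lp_def)
  have "\<exists>g. rep ?\<Omega> (\<lambda>z. G z \<bullet> e) g \<and> g \<in> L2" if "e \<in> Basis" for e
  proof -
    have "norm e \<le> 1" using that by simp
    from Lp2_inner_rep[OF open_QT G(1) this] show ?thesis by metis
  qed
  then obtain g where g: "\<And>e. e \<in> Basis \<Longrightarrow> rep ?\<Omega> (\<lambda>z. G z \<bullet> e) (g e)" "\<And>e. e \<in> Basis \<Longrightarrow> g e \<in> L2" by metis
  have gw: "wderiv ?\<Omega> e w (g e)" if e: "e \<in> Basis" for e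
    by (rule rep_wderiv[OF open_QT e _ wrep g(1)[OF e]]) (use G(2) e in \<open>auto simp: is_weak_grad_def\<close>)
  have Gi: "G z \<bullet> (axis i 1, 0) = fst (G z) $ i" for z i by (cases "G z") (simp add: inner_axis)
  have E: "(axis i 1, 0) \<in> (Basis :: 'n spacetime set)" "(axis i 1, 0) \<in> ?S" for i by (auto simp: Basis_spacetime)
  have wsg: "rep ?\<Omega> (\<lambda>z. weak_space_grad T ?W z $ i) (g (axis i 1, 0))" for i
  proof (rule weak_space_grad_rep[OF wrep, of "\<lambda>z. fst (G z)" "\<lambda>i. g (axis i 1, 0)"])
    show "is_weak_space_grad T ?W (\<lambda>z. fst (G z))"
      using G(2) E(1) unfolding is_weak_space_grad_def is_weak_grad_def Gi[symmetric] by blast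
    show "rep ?\<Omega> (\<lambda>z. fst (G z) $ i) (g (axis i 1, 0))" for i using g(1)[OF E(1)[of i]] unfolding Gi .
  qed
  have gm: "g e \<in> borel_measurable borel" if "e \<in> Basis" for e using g(2)[OF that] by (simp add: L2_def)
  have eqn: "(\<integral>z. R z * dir_deriv (0, 1) \<psi> z \<partial>lborel) - (\<Sum>e\<in>?S. \<integral>z. R z * bb e z * dir_deriv e \<psi> z \<partial>lborel)
      - (\<Sum>e\<in>?S. \<integral>z. mm z * g e z * dir_deriv e \<psi> z \<partial>lborel)
      + (\<integral>z. ff z * R z * \<psi> z \<partial>lborel) = 0" if \<psi>: "test_function ?\<Omega> \<psi>" for \<psi>
  proof -
    have \<psi>': "test_function (UNIV \<times> {..<T}) \<psi>" by (rule test_function_mono[OF \<psi>]) (auto simp: QT_def)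
    obtain K where K: "compact K" "K \<subseteq> ?\<Omega>" "\<And>x. x \<notin> K \<Longrightarrow> \<psi> x = 0" "\<And>x e. x \<notin> K \<Longrightarrow> dir_deriv e \<psi> x = 0"
      by (rule test_functionE[OF \<psi>]) (rule that)
    have \<psi>0: "\<psi> (x, 0) = 0" for x using K(2) by (intro K(3)) (auto simp: QT_def)
    have dm: "dir_deriv e \<psi> \<in> borel_measurable borel" if "e \<in> Basis" for e by (rule test_function_borel[OF test_function_dir_deriv[OF \<psi> that]])
    have [measurable]: "\<psi> \<in> borel_measurable borel" by (rule test_function_borel[OF \<psi>])
    have [measurable]: "dir_deriv (0, 1) \<psi> \<in> borel_measurable borel" by (rule dm[OF et])
    have [measurable]: "dir_deriv (axis i 1, 0) \<psi> \<in> borel_measurable borel" "g (axis i 1, 0) \<in> borel_measurable borel" for i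
      by (rule dm[OF E(1)], rule gm[OF E(1)])
    define H where "H z = - mm z * (\<Sum>i\<in>UNIV. dir_deriv (axis i 1, 0) \<psi> z * g (axis i 1, 0) z)
        - R z * (\<Sum>i\<in>UNIV. dir_deriv (axis i 1, 0) \<psi> z * bb (axis i 1, 0) z) + ff z * \<psi> z * R z" for z
    have r1: "rep ?\<Omega> (\<lambda>z. - \<rho> z * time_deriv \<psi> z) (\<lambda>z. - (R z * dir_deriv (0, 1) \<psi> z))"
      unfolding rep_def
    proof (intro conjI allI impI)
      show "AE z in lborel. z \<in> ?\<Omega> \<longrightarrow> - \<rho> z * time_deriv \<psi> z = - (R z * dir_deriv (0, 1) \<psi> z)"
        using repD(2)[OF Rrep] by eventually_elim (auto simp: time_deriv_def)
    qed (use repD(3)[OF Rrep] in auto)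
    have r2: "rep ?\<Omega> (\<lambda>z. - m z * (space_grad \<psi> z \<bullet> weak_space_grad T ?W z) - \<rho> z * (space_grad \<psi> z \<bullet> b z) + f z * \<psi> z * \<rho> z) H"
      unfolding rep_def
    proof (intro conjI allI impI)
      show "H \<in> borel_measurable borel" unfolding H_def by measurable
      have "AE z in lborel. \<forall>i. z \<in> ?\<Omega> \<longrightarrow> weak_space_grad T ?W z $ i = g (axis i 1, 0) z"
        by (rule AE_all_index) (rule repD(2)[OF wsg])
      then show "AE z in lborel. z \<in> ?\<Omega> \<longrightarrow>
        - m z * (space_grad \<psi> z \<bullet> weak_space_grad T ?W z) - \<rho> z * (space_grad \<psi> z \<bullet> b z) + f z * \<psi> z * \<rho> z = H z"
        using repD(2)[OF Rrep]
      proof eventually_elim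
        case (elim z)
        show ?case
        proof
          assume z: "z \<in> ?\<Omega>"
          have "space_grad \<psi> z \<bullet> weak_space_grad T ?W z = (\<Sum>i\<in>UNIV. dir_deriv (axis i 1, 0) \<psi> z * g (axis i 1, 0) z)"
            using elim z by (simp add: inner_vec_def space_grad_def)
          moreover have "space_grad \<psi> z \<bullet> b z = (\<Sum>i\<in>UNIV. dir_deriv (axis i 1, 0) \<psi> z * bb (axis i 1, 0) z)"
          proof -
            have "bb (axis i 1, 0) z = b z $ i" for i using z by (simp add: bb(2)[OF E(1)] inner_axis)
            then show ?thesis by (simp add: inner_vec_def space_grad_def)
          qed
          moreover have "\<rho> z = R z" using elim z by blast
          ultimately show "- m z * (space_grad \<psi> z \<bullet> weak_space_grad T ?W z) - \<rho> z * (space_grad \<psi> z \<bullet> b z) + f z * \<psi> z * \<rho> z = H z"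
            using z by (simp only: H_def mm(2) ff(2) indicator_simps mult_1)
        qed
      qed
      show "z \<notin> ?\<Omega> \<Longrightarrow> H z = 0" for z using repD(3)[OF Rrep, of z] by (simp add: H_def mm(2) ff(2))
    qed
    have "(\<integral>z. - \<rho> z * time_deriv \<psi> z \<partial>lebesgue_on ?\<Omega>) = (\<integral>x. \<psi> (x, 0) * r0 x \<partial>lebesgue)
      + (\<integral>z. - m z * (space_grad \<psi> z \<bullet> weak_space_grad T ?W z) - \<rho> z * (space_grad \<psi> z \<bullet> b z) + f z * \<psi> z * \<rho> z \<partial>lebesgue_on ?\<Omega>)"
      using sol \<psi>' unfolding nonneg_weak_solution_def by blast
    then have eq0: "- (\<integral>z. R z * dir_deriv (0, 1) \<psi> z \<partial>lborel) = (\<integral>z. H z \<partial>lborel)"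
      unfolding rep_integral(1)[OF \<Omega>b r1] rep_integral(1)[OF \<Omega>b r2] by (simp add: \<psi>0)
    have tL: "dir_deriv e \<psi> \<in> L2" "\<psi> \<in> L2" if "e \<in> Basis" for e using tdir_L2[OF tdir_test_function[OF \<psi> that]] by auto
    have i1: "integrable lborel (\<lambda>z. mm z * g e z * dir_deriv e \<psi> z)" if "e \<in> Basis" for e
      by (rule L2_mult_integrable[OF L2_bounded_mult[OF g(2)[OF that] mm(1,4)] tL(1)[OF that]])
    have i2: "integrable lborel (\<lambda>z. R z * bb e z * dir_deriv e \<psi> z)" if "e \<in> Basis" for e
      using L2_mult_integrable[OF L2_bounded_mult[OF RL bb(1,3)] tL(1)[OF that], of e] by (simp add: mult_ac)
    have i3: "integrable lborel (\<lambda>z. ff z * R z * \<psi> z)"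
      by (rule L2_mult_integrable[OF L2_bounded_mult[OF RL ff(1,3)] tL(2)[OF et]])
    have "H z = - (\<Sum>e\<in>?S. mm z * g e z * dir_deriv e \<psi> z) - (\<Sum>e\<in>?S. R z * bb e z * dir_deriv e \<psi> z) + ff z * R z * \<psi> z" for z
      unfolding H_def sum_space_Basis by (simp add: sum_distrib_left sum_negf mult_ac)
    then have "(\<integral>z. H z \<partial>lborel) = (\<integral>z. - (\<Sum>e\<in>?S. mm z * g e z * dir_deriv e \<psi> z) - (\<Sum>e\<in>?S. R z * bb e z * dir_deriv e \<psi> z) + ff z * R z * \<psi> z \<partial>lborel)"
      by simp
    also have "\<dots> = - (\<integral>z. (\<Sum>e\<in>?S. mm z * g e z * dir_deriv e \<psi> z) \<partial>lborel) - (\<integral>z. (\<Sum>e\<in>?S. R z * bb e z * dir_deriv e \<psi> z) \<partial>lborel) + (\<integral>z. ff z * R z * \<psi> z \<partial>lborel)"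
    proof -
      have "integrable lborel (\<lambda>z. \<Sum>e\<in>?S. mm z * g e z * dir_deriv e \<psi> z)" "integrable lborel (\<lambda>z. \<Sum>e\<in>?S. R z * bb e z * dir_deriv e \<psi> z)"
        by (rule Bochner_Integration.integrable_sum, rule i1, simp, rule Bochner_Integration.integrable_sum, rule i2, simp)
      then show ?thesis using i3 by simp
    qed
    also have "(\<integral>z. (\<Sum>e\<in>?S. mm z * g e z * dir_deriv e \<psi> z) \<partial>lborel) = (\<Sum>e\<in>?S. \<integral>z. mm z * g e z * dir_deriv e \<psi> z \<partial>lborel)"
      by (rule Bochner_Integration.integral_sum, rule i1) simp
    also have "(\<integral>z. (\<Sum>e\<in>?S. R z * bb e z * dir_deriv e \<psi> z) \<partial>lborel) = (\<Sum>e\<in>?S. \<integral>z. R z * bb e z * dir_deriv e \<psi> z \<partial>lborel)"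
      by (rule Bochner_Integration.integral_sum, rule i2) simp
    finally show ?thesis using eq0 by linarith
  qed
  show ?thesis
    by (rule that[OF Rrep RL R0' wL[unfolded w_def[abs_def]] g(2) gw[unfolded w_def[abs_def]] eqn])
qed

section \<open>Derivatives of products and extension of the coefficients by zero\<close>

lemma dir_deriv_mult:
  fixes u v :: "'a::euclidean_space \<Rightarrow> real"
  assumes "u differentiable (at x)" "v differentiable (at x)"
  shows "dir_deriv e (\<lambda>x. u x * v x) x = u x * dir_deriv e v x + dir_deriv e u x * v x"
proof -
  have "((\<lambda>x. u x * v x) has_derivative (\<lambda>h. u x * frechet_derivative v (at x) h + frechet_derivative u (at x) h * v x)) (at x)"
    using assms by (intro has_derivative_mult) (simp_all add: frechet_derivative_works)
  from frechet_derivative_at[OF this] show ?thesis by (simp add: dir_deriv_def fun_eq_iff)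
qed

lemma dir_deriv_inner:
  fixes b :: "'a::euclidean_space \<Rightarrow> 'b::euclidean_space"
  assumes "b differentiable (at x)"
  shows "(\<lambda>x. b x \<bullet> c) differentiable (at x)" "dir_deriv e (\<lambda>x. b x \<bullet> c) x = dir_deriv e b x \<bullet> c"
proof -
  have *: "((\<lambda>x. b x \<bullet> c) has_derivative (\<lambda>h. frechet_derivative b (at x) h \<bullet> c)) (at x)"
    using assms by (intro has_derivative_inner_left) (simp add: frechet_derivative_works)
  then show "(\<lambda>x. b x \<bullet> c) differentiable (at x)" unfolding differentiable_def by blast
  from frechet_derivative_at[OF *] show "dir_deriv e (\<lambda>x. b x \<bullet> c) x = dir_deriv e b x \<bullet> c"
    by (simp add: dir_deriv_def fun_eq_iff)
qed

text \<open>One constant \<open>M\<close> for all coefficients, their products and first derivatives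
  serves all later estimates. \<open>bb\<close> and \<open>ct'\<close> are 0 for \<open>e\<close>
  outside the basis, so that measurability and bounds hold for every \<open>e\<close>; in the time
  direction \<open>bb\<close> vanishes because \<open>fst (0, 1) = 0\<close>.\<close>

lemma coefficient_extension:
  fixes m :: "'n::finite spacetime \<Rightarrow> real" and b :: "'n spacetime \<Rightarrow> real^'n"
  assumes \<delta>: "\<delta> > 0" and A: "constraint_drift_source_assumption T \<delta> m b f"
    and mm_def: "mm = (\<lambda>z. indicator (QT T) z * m z)" and ff_def: "ff = (\<lambda>z. indicator (QT T) z * f z)"
    and m'_def: "m' = (\<lambda>e z. indicator (QT T) z * dir_deriv e m z)"
    and bb_def: "bb = (\<lambda>e z. if e \<in> Basis then indicator (QT T) z * (b z \<bullet> fst e) else 0)"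
    and ct'_def: "ct' = (\<lambda>e z. if e \<in> Basis then indicator (QT T) z * dir_deriv e (\<lambda>z. m z * (b z \<bullet> fst e)) z else 0)"
  obtains M where "mm \<in> borel_measurable borel" "\<And>z. \<bar>mm z\<bar> \<le> M" "\<And>z. mm z \<ge> 0" "\<And>z. z \<in> QT T \<Longrightarrow> mm z \<ge> \<delta>"
    "continuous_on (QT T) mm" "\<And>e. e \<in> Basis \<Longrightarrow> continuous_on (QT T) (m' e)"
    "\<And>e z. z \<in> QT T \<Longrightarrow> ((\<lambda>s. mm (z + s *\<^sub>R e)) has_real_derivative m' e z) (at 0)"
    "\<And>e. e \<in> Basis \<Longrightarrow> m' e \<in> borel_measurable borel" "\<And>e z. e \<in> Basis \<Longrightarrow> \<bar>m' e z\<bar> \<le> M"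
    "ff \<in> borel_measurable borel" "\<And>z. \<bar>ff z\<bar> \<le> M" "\<And>z. \<bar>ff z * mm z\<bar> \<le> M"
    "\<And>e. bb e \<in> borel_measurable borel" "\<And>e z. \<bar>bb e z\<bar> \<le> M" "\<And>e z. \<bar>mm z * bb e z\<bar> \<le> M"
    "\<And>e. continuous_on (QT T) (\<lambda>z. mm z * bb e z)" "\<And>e. continuous_on (QT T) (ct' e)" "\<And>e z. \<bar>ct' e z\<bar> \<le> M"
    "\<And>e z. e \<in> Basis \<Longrightarrow> z \<in> QT T \<Longrightarrow> ((\<lambda>s. mm (z + s *\<^sub>R e) * bb e (z + s *\<^sub>R e)) has_real_derivative ct' e z) (at 0)"
    "\<And>e. ct' e \<in> borel_measurable borel"
proof -
  let ?\<Omega> = "QT T :: 'n spacetime set"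
  have sm: "smooth_bounded_on ?\<Omega> m" and sb: "smooth_bounded_on ?\<Omega> b" and sf: "smooth_bounded_on ?\<Omega> f"
    and m\<delta>: "\<And>z. z \<in> ?\<Omega> \<Longrightarrow> m z \<ge> \<delta>" using A unfolding constraint_drift_source_assumption_def by auto
  obtain B1 where B1: "\<And>z. z \<in> ?\<Omega> \<Longrightarrow> norm (m z) \<le> B1" "\<And>e z. z \<in> ?\<Omega> \<Longrightarrow> e \<in> Basis \<Longrightarrow> norm (dir_deriv e m z) \<le> B1"
    using smooth_bounded_onD(4)[OF sm] by metis
  obtain B2 where B2: "\<And>z. z \<in> ?\<Omega> \<Longrightarrow> norm (b z) \<le> B2" "\<And>e z. z \<in> ?\<Omega> \<Longrightarrow> e \<in> Basis \<Longrightarrow> norm (dir_deriv e b z) \<le> B2"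
    using smooth_bounded_onD(4)[OF sb] by metis
  obtain B3 where B3: "\<And>z. z \<in> ?\<Omega> \<Longrightarrow> norm (f z) \<le> B3" using smooth_bounded_onD(4)[OF sf] by metis
  define B where "B = max 1 (max B1 (max B2 B3))"
  have B: "1 \<le> B" "B1 \<le> B" "B2 \<le> B" "B3 \<le> B" by (auto simp: B_def)
  \<comment> \<open>Twice the square covers the product rule for \<open>m b\<close>, whose two
    summands are each at most \<open>B * B\<close>; \<open>B \<ge> 1\<close> makes the same constant
    dominate \<open>B\<close> itself.\<close>
  define M where "M = 2 * (B * B)"
  have BM: "B \<le> M" "B * B \<le> M" using mult_mono[OF B(1) order_refl, of B] B(1) by (auto simp: M_def)
  have M0: "0 \<le> M" using BM B(1) by linarith
  have n1: "norm (fst e) \<le> 1" if "e \<in> Basis" for e :: "'n spacetime" using that norm_fst_le[of "fst e" "snd e"] by simp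
  have bi: "\<bar>c \<bullet> fst e\<bar> \<le> B" if "norm c \<le> B2" "e \<in> Basis" for c and e :: "'n spacetime"
  proof -
    have "\<bar>c \<bullet> fst e\<bar> \<le> norm c * norm (fst e)" by (rule Cauchy_Schwarz_ineq2)
    also have "\<dots> \<le> norm c" by (rule mult_left_le[OF n1[OF that(2)] norm_ge_zero])
    finally show ?thesis using that(1) B(3) by linarith
  qed
  have mb: "\<bar>m z\<bar> \<le> B" "\<bar>f z\<bar> \<le> B" "e \<in> Basis \<Longrightarrow> \<bar>dir_deriv e m z\<bar> \<le> B" if "z \<in> ?\<Omega>" for z e
    using B1(1)[OF that] B1(2)[OF that, of e] B3[OF that] B by auto
  have dm: "m differentiable (at z)" and db: "b differentiable (at z)" if "z \<in> ?\<Omega>" for z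
    using smooth_bounded_onD(1)[OF sm that] smooth_bounded_onD(1)[OF sb that] .
  note ext = extension_by_zero_borel[OF open_QT]
  have cm: "continuous_on ?\<Omega> m" "continuous_on ?\<Omega> b" "continuous_on ?\<Omega> f" by (rule smooth_bounded_onD(2), fact)+
  have dct: "dir_deriv e (\<lambda>z. m z * (b z \<bullet> fst e)) z = m z * (dir_deriv e b z \<bullet> fst e) + dir_deriv e m z * (b z \<bullet> fst e)"
    if "z \<in> ?\<Omega>" for e z
    by (simp add: dir_deriv_mult[OF dm[OF that] dir_deriv_inner(1)[OF db[OF that]]] dir_deriv_inner(2)[OF db[OF that]])
  have cd: "continuous_on ?\<Omega> (\<lambda>z. dir_deriv e (\<lambda>z. m z * (b z \<bullet> fst e)) z)" if "e \<in> Basis" for e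
  proof -
    have "continuous_on ?\<Omega> (\<lambda>z. m z * (dir_deriv e b z \<bullet> fst e) + dir_deriv e m z * (b z \<bullet> fst e))"
      by (intro continuous_intros cm smooth_bounded_onD(3)[OF sm that] smooth_bounded_onD(3)[OF sb that])
    then show ?thesis by (rule continuous_on_eq) (simp add: dct)
  qed
  show ?thesis
  proof (rule that[of M])
    show "mm \<in> borel_measurable borel" "ff \<in> borel_measurable borel" unfolding mm_def ff_def by (rule ext, fact)+
    show "\<bar>mm z\<bar> \<le> M" for z using mb(1)[of z] BM(1) M0 by (cases "z \<in> ?\<Omega>") (auto simp: mm_def)
    show "mm z \<ge> 0" for z using m\<delta>[of z] \<delta> by (cases "z \<in> ?\<Omega>") (auto simp: mm_def)
    show "mm z \<ge> \<delta>" if "z \<in> ?\<Omega>" for z using m\<delta>[OF that] that by (simp add: mm_def)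
    show "continuous_on ?\<Omega> mm" by (rule continuous_on_eq[OF cm(1)]) (simp add: mm_def)
    show "continuous_on ?\<Omega> (m' e)" if "e \<in> Basis" for e
      by (rule continuous_on_eq[OF smooth_bounded_onD(3)[OF sm that]]) (simp add: m'_def)
    show "((\<lambda>s. mm (z + s *\<^sub>R e)) has_real_derivative m' e z) (at 0)" if "z \<in> ?\<Omega>" for e z
      using extension_by_zero_derivative[OF open_QT that dm[OF that], of e] that by (simp add: mm_def m'_def)
    show "m' e \<in> borel_measurable borel" if "e \<in> Basis" for e unfolding m'_def by (rule ext[OF smooth_bounded_onD(3)[OF sm that]])
    show "\<bar>m' e z\<bar> \<le> M" if "e \<in> Basis" for e z using mb(3)[of z e] that BM(1) M0 by (cases "z \<in> ?\<Omega>") (auto simp: m'_def)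
    show "\<bar>ff z\<bar> \<le> M" for z using mb(2)[of z] BM(1) M0 by (cases "z \<in> ?\<Omega>") (auto simp: ff_def)
    show "\<bar>ff z * mm z\<bar> \<le> M" for z
    proof (cases "z \<in> ?\<Omega>")
      case True
      have "\<bar>f z\<bar> * \<bar>m z\<bar> \<le> B * B" by (rule mult_mono[OF mb(2)[OF True] mb(1)[OF True]]) (use B in auto)
      with True BM(2) show ?thesis by (simp add: ff_def mm_def abs_mult)
    qed (simp add: mm_def M0)
    show "bb e \<in> borel_measurable borel" for e
    proof (cases "e \<in> Basis")
      case True
      have "continuous_on ?\<Omega> (\<lambda>z. b z \<bullet> fst e)" by (intro continuous_intros cm)
      from ext[OF this] True show ?thesis by (simp add: bb_def)
    qed (simp add: bb_def)
    show "\<bar>bb e z\<bar> \<le> M" for e z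
      using bi[OF B2(1)[of z], of e] BM(1) M0 by (cases "z \<in> ?\<Omega>") (auto simp: bb_def)
    show "\<bar>mm z * bb e z\<bar> \<le> M" for e z
    proof (cases "z \<in> ?\<Omega> \<and> e \<in> Basis")
      case True
      then have z: "z \<in> ?\<Omega>" and e: "e \<in> Basis" by auto
      have "\<bar>m z\<bar> * \<bar>b z \<bullet> fst e\<bar> \<le> B * B" by (rule mult_mono[OF mb(1)[OF z] bi[OF B2(1)[OF z] e]]) (use B in auto)
      with True BM(2) show ?thesis by (simp add: bb_def mm_def abs_mult)
    qed (auto simp: mm_def bb_def M0)
    show "continuous_on ?\<Omega> (\<lambda>z. mm z * bb e z)" for e
    proof (cases "e \<in> Basis")
      case True
      have "continuous_on ?\<Omega> (\<lambda>z. m z * (b z \<bullet> fst e))" by (intro continuous_intros cm)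
      then show ?thesis by (rule continuous_on_eq) (simp add: mm_def bb_def True)
    qed (simp add: bb_def)
    show "continuous_on ?\<Omega> (ct' e)" for e
    proof (cases "e \<in> Basis")
      case True
      show ?thesis by (rule continuous_on_eq[OF cd[OF True]]) (simp add: ct'_def True)
    qed (simp add: ct'_def)
    show "ct' e \<in> borel_measurable borel" for e
    proof (cases "e \<in> Basis")
      case True
      from ext[OF cd[OF True]] show ?thesis by (simp add: ct'_def True)
    qed (simp add: ct'_def)
    show "\<bar>ct' e z\<bar> \<le> M" for e z
    proof (cases "z \<in> ?\<Omega> \<and> e \<in> Basis")
      case True
      then have z: "z \<in> ?\<Omega>" and e: "e \<in> Basis" by auto
      have "\<bar>m z * (dir_deriv e b z \<bullet> fst e)\<bar> \<le> B * B" unfolding abs_mult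
        by (rule mult_mono[OF mb(1)[OF z] bi[OF B2(2)[OF z e] e]]) (use B in auto)
      moreover have "\<bar>dir_deriv e m z * (b z \<bullet> fst e)\<bar> \<le> B * B" unfolding abs_mult
        by (rule mult_mono[OF mb(3)[OF z e] bi[OF B2(1)[OF z] e]]) (use B in auto)
      ultimately have "\<bar>m z * (dir_deriv e b z \<bullet> fst e) + dir_deriv e m z * (b z \<bullet> fst e)\<bar> \<le> M"
        unfolding M_def by linarith
      with z e show ?thesis by (simp add: ct'_def dct)
    qed (auto simp: ct'_def M0)
    show "((\<lambda>s. mm (z + s *\<^sub>R e) * bb e (z + s *\<^sub>R e)) has_real_derivative ct' e z) (at 0)" if e: "e \<in> Basis" and z: "z \<in> ?\<Omega>" for e z
    proof -
      have d: "(\<lambda>z. m z * (b z \<bullet> fst e)) differentiable (at z)"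
        by (intro differentiable_mult dm dir_deriv_inner(1) db z)
      have eq: "mm y * bb e y = indicator ?\<Omega> y * (m y * (b y \<bullet> fst e))" for y
        using e by (cases "y \<in> ?\<Omega>") (auto simp: mm_def bb_def)
      have "ct' e z = dir_deriv e (\<lambda>z. m z * (b z \<bullet> fst e)) z" using e z by (simp add: ct'_def)
      with extension_by_zero_derivative[OF open_QT z d, of e] show ?thesis by (simp only: eq)
    qed
  qed
qed

lemma L1_tendsto_rep:
  fixes u :: "real \<Rightarrow> 'a::euclidean_space \<Rightarrow> real"
  assumes o: "open \<Omega>" and l: "L1_tendsto \<Omega> u U" and k: "filterlim k at_top sequentially"
    and r: "\<And>n. rep \<Omega> (u (k n)) (u' n)" "rep \<Omega> U U'"
  shows "(\<lambda>n::nat. \<integral>z. \<bar>u' n z - U' z\<bar> \<partial>lborel) \<longlonglongrightarrow> 0" "integrable lborel U'"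
proof -
  have \<Omega>: "\<Omega> \<in> sets borel" using o by (rule borel_open)
  show "integrable lborel U'" using rep_L1[OF o _ r(2)] l unfolding L1_tendsto_def by blast
  have "((\<lambda>n. LINT x|lebesgue_on \<Omega>. \<bar>u (k n) x - U x\<bar>) \<longlongrightarrow> 0) sequentially"
    by (rule filterlim_compose[OF _ k]) (use l in \<open>auto simp: L1_tendsto_def\<close>)
  moreover have "(LINT x|lebesgue_on \<Omega>. \<bar>u (k n) x - U x\<bar>) = (\<integral>z. \<bar>u' n z - U' z\<bar> \<partial>lborel)" for n
  proof (rule rep_integral(1)[OF \<Omega>], unfold rep_def, intro conjI allI impI)
    have [measurable]: "u' n \<in> borel_measurable borel" "U' \<in> borel_measurable borel" by (rule repD(1)[OF r(1)], rule repD(1)[OF r(2)])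
    show "(\<lambda>z. \<bar>u' n z - U' z\<bar>) \<in> borel_measurable borel" by measurable
    show "AE x in lborel. x \<in> \<Omega> \<longrightarrow> \<bar>u (k n) x - U x\<bar> = \<bar>u' n x - U' x\<bar>"
      using repD(2)[OF r(1)[of n]] repD(2)[OF r(2)] by eventually_elim auto
  qed (use repD(3)[OF r(1)[of n]] repD(3)[OF r(2)] in auto)
  ultimately show "(\<lambda>n::nat. \<integral>z. \<bar>u' n z - U' z\<bar> \<partial>lborel) \<longlonglongrightarrow> 0" by simp
qed

text \<open>L^1 convergence gives almost everywhere convergence along a subsequence; a second
  extraction inside the first makes density and pressure converge together. Where \<open>mm\<close>
  is 0 the quotients are 0 by convention and the pressures vanish, so the pointwise argument covers
  these points too.\<close>

lemma limit_density_pressure_AE: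
  fixes R :: "nat \<Rightarrow> 'a::euclidean_space \<Rightarrow> real"
  assumes R: "\<And>n. integrable lborel (R n)" "integrable lborel R'" "(\<lambda>n. \<integral>z. \<bar>R n z - R' z\<bar> \<partial>lborel) \<longlonglongrightarrow> 0"
      "\<And>n z. R n z \<ge> 0" "\<And>z. mm z \<ge> 0"
    and k: "\<And>n. k n = real (n + N)" "N \<ge> (3::nat)"
    and q: "\<And>n. integrable lborel (\<lambda>z. k n / (k n - 1) * (R n z / mm z) powr (k n - 1))" "integrable lborel p"
      "(\<lambda>n. \<integral>z. \<bar>k n / (k n - 1) * (R n z / mm z) powr (k n - 1) - p z\<bar> \<partial>lborel) \<longlonglongrightarrow> 0"
  shows "AE z in lborel. 0 \<le> R' z / mm z \<and> R' z / mm z \<le> 1 \<and> 0 \<le> p z \<and> (p z \<noteq> 0 \<longrightarrow> R' z / mm z = 1)"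
proof -
  let ?q = "\<lambda>n z. k n / (k n - 1) * (R n z / mm z) powr (k n - 1)"
  obtain r where r: "strict_mono r" "AE z in lborel. (\<lambda>n. R (r n) z - R' z) \<longlonglongrightarrow> 0"
    using tendsto_L1_AE_subseq[of lborel "\<lambda>n z. R n z - R' z"] R(1-3) by auto
  have "(\<lambda>n. \<integral>z. \<bar>?q (r n) z - p z\<bar> \<partial>lborel) \<longlonglongrightarrow> 0"
    using LIMSEQ_subseq_LIMSEQ[OF q(3) r(1)] by (simp add: o_def)
  then obtain s where s: "strict_mono s" "AE z in lborel. (\<lambda>n. ?q (r (s n)) z - p z) \<longlonglongrightarrow> 0"
    using tendsto_L1_AE_subseq[of lborel "\<lambda>n z. ?q (r n) z - p z"] q(1,2) by auto
  have rs: "strict_mono (\<lambda>n. r (s n))" using strict_mono_o[OF r(1) s(1)] by (simp add: o_def)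
  have kt: "filterlim (\<lambda>n. k (r (s n))) at_top sequentially"
  proof (rule filterlim_at_top_mono[OF filterlim_real_sequentially])
    show "\<forall>\<^sub>F n in sequentially. real n \<le> k (r (s n))"
      unfolding k(1) of_nat_le_iff by (intro always_eventually allI trans_le_add1 seq_suble[OF rs])
  qed
  show ?thesis using r(2) s(2)
  proof eventually_elim
    case (elim z)
    have "(\<lambda>n. R (r (s n)) z - R' z) \<longlonglongrightarrow> 0" using LIMSEQ_subseq_LIMSEQ[OF elim(1) s(1)] by (simp add: o_def)
    then have "(\<lambda>n. R (r (s n)) z) \<longlonglongrightarrow> R' z" by (simp add: Lim_null[symmetric])
    then have "(\<lambda>n. R (r (s n)) z / mm z) \<longlonglongrightarrow> R' z / mm z" unfolding divide_inverse by (intro tendsto_mult_right)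
    moreover have "(\<lambda>n. ?q (r (s n)) z) \<longlonglongrightarrow> p z" using elim(2) by (simp add: Lim_null[symmetric])
    moreover have "0 \<le> R (r (s n)) z / mm z" for n using R(4,5) by simp
    moreover have "3 \<le> k (r (s n))" for n using k(2) by (simp add: k(1))
    ultimately show ?case
      using limit_density_pressure[of "\<lambda>n. R (r (s n)) z / mm z" "R' z / mm z" "\<lambda>n. k (r (s n))" "p z"] kt by blast
  qed
qed

lemma tdir_integrable_mult:
  assumes t: "tdir \<Omega> e \<Theta> \<Theta>'" and u: "u \<in> borel_measurable borel" "\<And>x. \<bar>u x\<bar> \<le> B"
  shows "integrable lborel (\<lambda>x. u x * \<Theta>' x)"
proof -
  obtain K C where K: "compact K" "\<And>x. x \<notin> K \<Longrightarrow> \<Theta>' x = 0" and C: "C \<ge> 0" "\<And>x. \<bar>\<Theta>' x\<bar> \<le> C"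
    by (rule tdirE[OF t]) (rule that)
  have [measurable]: "u \<in> borel_measurable borel" "\<Theta>' \<in> borel_measurable borel" using u(1) tdirD(4)[OF t] by auto
  have B: "0 \<le> B" using u(2)[of undefined] by linarith
  show ?thesis
  proof (rule integrable_bounded_support[OF _ _ compact_imp_bounded[OF K(1)]])
    show "\<bar>u x * \<Theta>' x\<bar> \<le> B * C" for x unfolding abs_mult by (rule mult_mono[OF u(2) C(2) B]) simp
  qed (use K(2) in auto)
qed

theorem theorem2p2:
  fixes \<delta> :: real
  assumes "\<delta> > 0"
  shows "\<exists>\<epsilon>>0. \<forall>T>0.
    \<forall>(m :: 'n::finite spacetime \<Rightarrow> real) (b :: 'n spacetime \<Rightarrow> real^'n) (f :: 'n spacetime \<Rightarrow> real)
     (\<rho>0 :: real \<Rightarrow> real^'n \<Rightarrow> real) (\<rho> :: real \<Rightarrow> 'n spacetime \<Rightarrow> real)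
     (\<rho>_inf :: 'n spacetime \<Rightarrow> real) (p_inf :: 'n spacetime \<Rightarrow> real).
      constraint_drift_source_assumption T \<delta> m b f \<longrightarrow>
      initial_data_assumption m \<rho>0 \<longrightarrow>
      hard_constraint_restriction T \<epsilon> m \<longrightarrow>
      complementary_relationship_condition m \<rho>0 \<longrightarrow>
      (\<forall>k>1. nonneg_weak_solution T m b f k (\<rho>0 k) (\<rho> k)) \<longrightarrow>
      L1_tendsto (QT T) \<rho> \<rho>_inf \<longrightarrow>
      L1_tendsto (QT T) (\<lambda>k. pressure k m (\<rho> k)) p_inf \<longrightarrow>
      p_inf \<in> L2_H1_Linf T \<longrightarrow>
      (\<forall>\<phi>. test_function (QT T) \<phi> \<longrightarrow>
        (LINT z|lebesgue_on (QT T).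
           - m z * p_inf z * (space_grad \<phi> z \<bullet> weak_space_grad T p_inf z)
           - m z * \<phi> z * (norm (weak_space_grad T p_inf z))\<^sup>2
           + \<phi> z * p_inf z * m z * source_F m b f z) = 0)"
proof (intro exI[of _ 1] conjI allI impI)
  show "(0::real) < 1" by simp
  fix T :: real and m :: "'n spacetime \<Rightarrow> real" and b :: "'n spacetime \<Rightarrow> real^'n" and f :: "'n spacetime \<Rightarrow> real"
    and \<rho>0 :: "real \<Rightarrow> real^'n \<Rightarrow> real" and \<rho> :: "real \<Rightarrow> 'n spacetime \<Rightarrow> real" and \<rho>_inf p_inf \<phi> :: "'n spacetime \<Rightarrow> real"
  assume T: "0 < T" and A: "constraint_drift_source_assumption T \<delta> m b f"
    and sol: "\<forall>k>1. nonneg_weak_solution T m b f k (\<rho>0 k) (\<rho> k)"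
    and \<rho>lim: "L1_tendsto (QT T) \<rho> \<rho>_inf" and plim: "L1_tendsto (QT T) (\<lambda>k. pressure k m (\<rho> k)) p_inf"
    and p_inf: "p_inf \<in> L2_H1_Linf T" and \<phi>: "test_function (QT T) \<phi>"
  let ?\<Omega> = "QT T :: 'n spacetime set"
  let ?S = "Basis - {(0, 1)} :: 'n spacetime set"
  have \<Omega>b: "?\<Omega> \<in> sets borel" by (rule borel_open[OF open_QT])
  have et: "(0, 1) \<in> (Basis :: 'n spacetime set)" by (simp add: Basis_spacetime)
  have E: "(axis i 1, 0) \<in> (Basis :: 'n spacetime set)" "(axis i 1, 0) \<in> ?S" for i by (auto simp: Basis_spacetime)
  have SB: "e \<in> Basis" if "e \<in> ?S" for e using that by simp
  define mm where "mm z = indicator ?\<Omega> z * m z" for z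
  define ff where "ff z = indicator ?\<Omega> z * f z" for z
  define m' where "m' e z = indicator ?\<Omega> z * dir_deriv e m z" for e z
  define bb where "bb e z = (if e \<in> Basis then indicator ?\<Omega> z * (b z \<bullet> fst e) else 0)" for e z :: "'n spacetime"
  define ct' where "ct' e z = (if e \<in> Basis then indicator ?\<Omega> z * dir_deriv e (\<lambda>z. m z * (b z \<bullet> fst e)) z else 0)" for e z :: "'n spacetime"
  obtain M where mm: "mm \<in> borel_measurable borel" "\<And>z. \<bar>mm z\<bar> \<le> M" "\<And>z. mm z \<ge> 0" "\<And>z. z \<in> ?\<Omega> \<Longrightarrow> mm z \<ge> \<delta>"
    "continuous_on ?\<Omega> mm" "\<And>e. e \<in> Basis \<Longrightarrow> continuous_on ?\<Omega> (m' e)"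
    "\<And>e z. z \<in> ?\<Omega> \<Longrightarrow> ((\<lambda>s. mm (z + s *\<^sub>R e)) has_real_derivative m' e z) (at 0)"
    "\<And>e. e \<in> Basis \<Longrightarrow> m' e \<in> borel_measurable borel" "\<And>e z. e \<in> Basis \<Longrightarrow> \<bar>m' e z\<bar> \<le> M"
    and ff: "ff \<in> borel_measurable borel" "\<And>z. \<bar>ff z\<bar> \<le> M" "\<And>z. \<bar>ff z * mm z\<bar> \<le> M"
    and bb: "\<And>e. bb e \<in> borel_measurable borel" "\<And>e z. \<bar>bb e z\<bar> \<le> M" "\<And>e z. \<bar>mm z * bb e z\<bar> \<le> M"
    and ct: "\<And>e. continuous_on ?\<Omega> (\<lambda>z. mm z * bb e z)" "\<And>e. continuous_on ?\<Omega> (ct' e)" "\<And>e z. \<bar>ct' e z\<bar> \<le> M"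
    "\<And>e z. e \<in> Basis \<Longrightarrow> z \<in> ?\<Omega> \<Longrightarrow> ((\<lambda>s. mm (z + s *\<^sub>R e) * bb e (z + s *\<^sub>R e)) has_real_derivative ct' e z) (at 0)"
    "\<And>e. ct' e \<in> borel_measurable borel"
    by (rule coefficient_extension[OF assms A, of mm ff m' bb ct']; (rule that | simp add: fun_eq_iff mm_def ff_def m'_def bb_def ct'_def))
  have mm0: "mm z = 0" if "z \<notin> ?\<Omega>" for z using that by (simp add: mm_def)

  have "\<forall>\<^sub>F k in at_top. \<rho> k \<in> Lp 1 ?\<Omega> \<and> pressure k m (\<rho> k) \<in> Lp 1 ?\<Omega>"
    using \<rho>lim plim unfolding L1_tendsto_def by (auto intro: eventually_conj)
  then obtain k0 where k0: "\<And>k. k \<ge> k0 \<Longrightarrow> \<rho> k \<in> Lp 1 ?\<Omega> \<and> pressure k m (\<rho> k) \<in> Lp 1 ?\<Omega>"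
    unfolding eventually_at_top_linorder by blast
  \<comment> \<open>A sequence of parameters is enough, as the limits are given. It starts late
    enough for \<open>k n \<ge> 3\<close>, required by the energy estimate, and for the densities
    and pressures to be integrable.\<close>
  define N where "N = max 3 (nat \<lceil>k0\<rceil>)"
  define k where "k n = real (n + N)" for n
  have N: "N \<ge> 3" by (simp add: N_def)
  have k3: "k n \<ge> 3" for n using N by (simp add: k_def)
  have kk0: "k n \<ge> k0" for n
  proof -
    have "k0 \<le> real N" unfolding N_def by linarith
    then show ?thesis by (simp add: k_def)
  qed
  have kt: "filterlim k at_top sequentially"
    by (rule filterlim_at_top_mono[OF filterlim_real_sequentially]) (simp add: k_def)
  have L1: "\<rho> (k n) \<in> Lp 1 ?\<Omega>" "pressure (k n) m (\<rho> (k n)) \<in> Lp 1 ?\<Omega>" for n using k0[OF kk0] by auto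
  \<comment> \<open>Bundles the properties of one representative, so that \<open>R n\<close> and
    \<open>g n\<close> can be chosen for all \<open>n\<close> at once.\<close>
  define Q where "Q n R g \<longleftrightarrow> rep ?\<Omega> (\<rho> (k n)) R \<and> R \<in> L2 \<and> (\<forall>z. R z \<ge> 0) \<and> (\<lambda>z. (R z / mm z) powr k n) \<in> L2 \<and>
      (\<forall>e\<in>Basis. g e \<in> L2) \<and> (\<forall>e\<in>Basis. wderiv ?\<Omega> e (\<lambda>z. (R z / mm z) powr k n) (g e)) \<and>
      (\<forall>\<psi>. test_function ?\<Omega> \<psi> \<longrightarrow>
      (\<integral>z. R z * dir_deriv (0, 1) \<psi> z \<partial>lborel) - (\<Sum>e\<in>?S. \<integral>z. R z * bb e z * dir_deriv e \<psi> z \<partial>lborel)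
      - (\<Sum>e\<in>?S. \<integral>z. mm z * g e z * dir_deriv e \<psi> z \<partial>lborel) + (\<integral>z. ff z * R z * \<psi> z \<partial>lborel) = 0)" for n R g
  have "\<exists>R g. Q n R g" for n
  proof -
    have s: "nonneg_weak_solution T m b f (k n) (\<rho>0 (k n)) (\<rho> (k n))" using sol k3[of n] by auto
    have bb_eq: "bb e z = indicator ?\<Omega> z * (b z \<bullet> fst e)" if "e \<in> Basis" for e z using that by (simp add: bb_def)
    obtain R g where "rep ?\<Omega> (\<rho> (k n)) R" "R \<in> L2" "\<And>z. R z \<ge> 0" "(\<lambda>z. (R z / mm z) powr k n) \<in> L2"
      "\<And>e. e \<in> Basis \<Longrightarrow> g e \<in> L2" "\<And>e. e \<in> Basis \<Longrightarrow> wderiv ?\<Omega> e (\<lambda>z. (R z / mm z) powr k n) (g e)"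
      "\<And>\<psi>. test_function ?\<Omega> \<psi> \<Longrightarrow>
      (\<integral>z. R z * dir_deriv (0, 1) \<psi> z \<partial>lborel) - (\<Sum>e\<in>?S. \<integral>z. R z * bb e z * dir_deriv e \<psi> z \<partial>lborel)
      - (\<Sum>e\<in>?S. \<integral>z. mm z * g e z * dir_deriv e \<psi> z \<partial>lborel) + (\<integral>z. ff z * R z * \<psi> z \<partial>lborel) = 0"
      by (rule solution_representative[OF T assms k3 mm(1) mm_def mm(4) mm(2) bb(1) bb_eq bb(2) ff(1) ff_def ff(2) s]; assumption?) (rule that)
    then have "Q n R g" unfolding Q_def by (intro conjI allI ballI impI)
    then show ?thesis by blast
  qed
  then obtain R g where Q: "\<And>n. Q n (R n) (g n)" by metis
  have Rr: "rep ?\<Omega> (\<rho> (k n)) (R n)" and RL: "R n \<in> L2" and R0: "R n z \<ge> 0" and wL: "(\<lambda>z. (R n z / mm z) powr k n) \<in> L2" for n z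
    using Q[of n] unfolding Q_def by blast+
  have g: "g n e \<in> L2" "wderiv ?\<Omega> e (\<lambda>z. (R n z / mm z) powr k n) (g n e)" if "e \<in> Basis" for n e
    using Q[of n] that unfolding Q_def by blast+
  have Req: "(\<integral>z. R n z * dir_deriv (0, 1) \<psi> z \<partial>lborel) - (\<Sum>e\<in>?S. \<integral>z. R n z * bb e z * dir_deriv e \<psi> z \<partial>lborel)
      - (\<Sum>e\<in>?S. \<integral>z. mm z * g n e z * dir_deriv e \<psi> z \<partial>lborel) + (\<integral>z. ff z * R n z * \<psi> z \<partial>lborel) = 0" if "test_function ?\<Omega> \<psi>" for n \<psi>
    using Q[of n] that unfolding Q_def by blast
  define w where "w n z = (R n z / mm z) powr k n" for n z
  have y0: "R n z / mm z \<ge> 0" for n z using R0 mm(3) by simp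
  have wv: "w n z powr (1 / k n) = R n z / mm z" for n z
    using k3[of n] R0[of n z] mm(3)[of z] by (simp add: w_def powr_powr)
  have wp: "w n z powr (1 - 1 / k n) = (R n z / mm z) powr (k n - 1)" for n z
    using k3[of n] by (simp add: w_def powr_powr right_diff_distrib)
  \<comment> \<open>Outside the cylinder \<open>mm\<close> is 0, so the quotient is 0 by convention,
    and \<open>R n\<close> vanishes there as a representative; the identity needs no restriction to
    the cylinder.\<close>
  have mR: "mm z * (R n z / mm z) = R n z" for n z
    using mm(4)[of z] assms repD(3)[OF Rr, of z n] by (cases "z \<in> ?\<Omega>") (auto simp: mm0)
  have div_le: "\<bar>u / mm z\<bar> \<le> 1 / \<delta> * \<bar>u\<bar>" for u :: real and z
  proof (cases "z \<in> ?\<Omega>")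
    case True
    then show ?thesis using mm(4)[OF True] assms by (simp add: divide_left_mono)
  qed (use assms in \<open>simp add: mm0\<close>)
  have [measurable]: "mm \<in> borel_measurable borel" "ff \<in> borel_measurable borel" "\<And>e. bb e \<in> borel_measurable borel" by fact+
  have div_int: "integrable lborel (\<lambda>z. u z / mm z)" "(\<integral>z. \<bar>u z / mm z\<bar> \<partial>lborel) \<le> 1 / \<delta> * (\<integral>z. \<bar>u z\<bar> \<partial>lborel)"
    if u: "integrable lborel u" for u
  proof -
    have [measurable]: "u \<in> borel_measurable borel" using u by auto
    have i: "integrable lborel (\<lambda>z. 1 / \<delta> * \<bar>u z\<bar>)" by (intro integrable_mult_right integrable_abs u)
    show i2: "integrable lborel (\<lambda>z. u z / mm z)"
    proof (rule Bochner_Integration.integrable_bound[OF i])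
      show "AE z in lborel. norm (u z / mm z) \<le> norm (1 / \<delta> * \<bar>u z\<bar>)"
        by (rule AE_I2) (use div_le assms in simp)
    qed measurable
    have "(\<integral>z. \<bar>u z / mm z\<bar> \<partial>lborel) \<le> (\<integral>z. 1 / \<delta> * \<bar>u z\<bar> \<partial>lborel)"
      by (rule integral_mono[OF integrable_abs[OF i2] i div_le])
    then show "(\<integral>z. \<bar>u z / mm z\<bar> \<partial>lborel) \<le> 1 / \<delta> * (\<integral>z. \<bar>u z\<bar> \<partial>lborel)" by simp
  qed
  have vL: "(\<lambda>z. R n z / mm z) \<in> L2" for n
  proof (rule L2_dominated[OF _ RL[of n] div_le])
    show "(\<lambda>z. R n z / mm z) \<in> borel_measurable borel" using L2_measurable[OF RL[of n]] by measurable
  qed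
  have Ri: "integrable lborel (R n)" for n by (rule rep_L1[OF open_QT L1(1) Rr])
  have qr: "rep ?\<Omega> (pressure (k n) m (\<rho> (k n))) (\<lambda>z. k n / (k n - 1) * (R n z / mm z) powr (k n - 1))" for n
    unfolding rep_def
  proof (intro conjI allI impI)
    have [measurable]: "R n \<in> borel_measurable borel" by (rule repD(1)[OF Rr])
    show "(\<lambda>z. k n / (k n - 1) * (R n z / mm z) powr (k n - 1)) \<in> borel_measurable borel" by measurable
    show "AE z in lborel. z \<in> ?\<Omega> \<longrightarrow> pressure (k n) m (\<rho> (k n)) z = k n / (k n - 1) * (R n z / mm z) powr (k n - 1)"
      using repD(2)[OF Rr[of n]] by eventually_elim (auto simp: pressure_def mm_def)
  qed (simp add: mm0)
  have qi: "integrable lborel (\<lambda>z. k n / (k n - 1) * (R n z / mm z) powr (k n - 1))" for n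
    by (rule rep_L1[OF open_QT L1(2) qr])

  have p_L1: "p_inf \<in> Lp 1 ?\<Omega>" and \<rho>_L1: "\<rho>_inf \<in> Lp 1 ?\<Omega>" using plim \<rho>lim unfolding L1_tendsto_def by auto
  have "p_inf \<in> borel_measurable (lebesgue_on ?\<Omega>)" "\<rho>_inf \<in> borel_measurable (lebesgue_on ?\<Omega>)"
    using p_L1 \<rho>_L1 unfolding Lp_def by auto
  then obtain P0 R' where P0: "rep ?\<Omega> p_inf P0" and R': "rep ?\<Omega> \<rho>_inf R'" by (meson rep_exists[OF open_QT])
  note Rconv = L1_tendsto_rep[OF open_QT \<rho>lim kt Rr R']
  note pconv0 = L1_tendsto_rep[OF open_QT plim kt qr P0]
  \<comment> \<open>The relations between limit density and limit pressure hold almost everywhere.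
    Clipping \<open>V\<close> to the unit interval and restricting \<open>P\<close> to the set
    \<open>V = 1\<close> makes them hold at every point, at the price of changes on null
    sets.\<close>
  define V where "V z = max 0 (min 1 (R' z / mm z))" for z
  define P where "P z = (if V z = 1 then max 0 (P0 z) else 0)" for z
  have [measurable]: "R' \<in> borel_measurable borel" "P0 \<in> borel_measurable borel" by (rule repD(1)[OF R'], rule repD(1)[OF P0])
  have Vm[measurable]: "V \<in> borel_measurable borel" unfolding V_def by measurable
  have Pm[measurable]: "P \<in> borel_measurable borel" unfolding P_def by measurable
  have V01: "0 \<le> V z" "V z \<le> 1" for z by (auto simp: V_def)
  have P_nonneg: "P z \<ge> 0" for z by (simp add: P_def)
  have VP: "V z = 1" if "P z \<noteq> 0" for z using that by (simp add: P_def split: if_splits)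
  have "AE z in lborel. 0 \<le> R' z / mm z \<and> R' z / mm z \<le> 1 \<and> 0 \<le> P0 z \<and> (P0 z \<noteq> 0 \<longrightarrow> R' z / mm z = 1)"
    by (rule limit_density_pressure_AE[OF Ri Rconv(2,1) R0 mm(3) k_def N qi pconv0(2,1)])
  then have "AE z in lborel. V z = R' z / mm z \<and> P z = P0 z"
    by eventually_elim (auto simp: V_def P_def)
  then have Vae: "AE z in lborel. V z = R' z / mm z" and Pae: "AE z in lborel. P z = P0 z" by auto
  have Pr: "rep ?\<Omega> p_inf P"
    unfolding rep_def
  proof (intro conjI allI impI)
    show "AE z in lborel. z \<in> ?\<Omega> \<longrightarrow> p_inf z = P z" using Pae repD(2)[OF P0] by eventually_elim auto
    show "P z = 0" if "z \<notin> ?\<Omega>" for z using repD(3)[OF P0 that] by (simp add: P_def)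
  qed (rule Pm)
  have Pi: "integrable lborel P" by (rule rep_L1[OF open_QT p_L1 Pr])
  have PL: "P \<in> L2" using rep_L2[OF open_QT _ Pr] p_inf by (simp add: L2_H1_Linf_def Lp_def)

  obtain Gp where Gp: "Gp \<in> Lp 2 ?\<Omega>" "is_weak_space_grad T p_inf Gp" using p_inf unfolding L2_H1_Linf_def by blast
  have "\<exists>h. rep ?\<Omega> (\<lambda>z. Gp z \<bullet> fst e) h \<and> h \<in> L2" if "e \<in> Basis" for e :: "'n spacetime"
  proof -
    have e1: "norm (fst e) \<le> 1" using that norm_fst_le[of "fst e" "snd e"] by simp
    obtain h where "rep ?\<Omega> (\<lambda>z. Gp z \<bullet> fst e) h" "h \<in> L2"
      by (rule Lp2_inner_rep[OF open_QT Gp(1) e1]) (rule that)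
    then show ?thesis by (intro exI[of _ h] conjI)
  qed
  then have "\<forall>e\<in>(Basis :: 'n spacetime set). \<exists>h. rep ?\<Omega> (\<lambda>z. Gp z \<bullet> fst e) h \<and> h \<in> L2" by (rule ballI)
  from bchoice[OF this] obtain G where Gs: "\<forall>e\<in>(Basis :: 'n spacetime set). rep ?\<Omega> (\<lambda>z. Gp z \<bullet> fst e) (G e) \<and> G e \<in> L2" ..
  have G: "rep ?\<Omega> (\<lambda>z. Gp z \<bullet> fst e) (G e)" "G e \<in> L2" if "e \<in> Basis" for e
    using bspec[OF Gs that] by simp_all
  have Gi: "rep ?\<Omega> (\<lambda>z. Gp z $ i) (G (axis i 1, 0))" for i using G(1)[OF E(1)[of i]] by (simp add: inner_axis)
  have Gw: "wderiv ?\<Omega> e P (G e)" if e: "e \<in> ?S" for e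
  proof -
    obtain i where i: "e = (axis i 1, 0)" using e unfolding Basis_minus_time by blast
    show ?thesis unfolding i
      by (rule rep_wderiv[OF open_QT E(1) _ Pr Gi]) (use Gp(2) in \<open>simp add: is_weak_space_grad_def\<close>)
  qed
  note GL = G(2)[OF SB]

  \<comment> \<open>For the limit passage time is one direction among the others: its transport
    coefficient is \<open>m\<close>, and the space directions carry \<open>- m b\<close>.\<close>
  define c where "c e z = (if e = (0, 1) then mm z else - (mm z * bb e z))" for e z
  define c' where "c' e z = (if e = (0, 1) then m' e z else - ct' e z)" for e z
  define f0 where "f0 z = ff z * mm z" for z
  have split: "(\<Sum>e\<in>Basis. F e) = F (0, 1) + (\<Sum>e\<in>?S. F e)" for F :: "'n spacetime \<Rightarrow> real"
    by (rule sum.remove[OF finite_Basis et])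
  have lim_eq: "(\<Sum>e\<in>Basis. \<integral>x. c e x * V x * dir_deriv e \<psi> x \<partial>lborel)
      - (\<Sum>e\<in>?S. \<integral>x. mm x * G e x * dir_deriv e \<psi> x \<partial>lborel)
      + (\<integral>x. f0 x * V x * \<psi> x \<partial>lborel) = 0" if \<psi>: "test_function ?\<Omega> \<psi>" for \<psi>
  proof (rule limit_equation[OF open_QT _ N k_def _ _ g(1) _ _ _ mm(1,2) assms mm(4,5) mm(6,7), where w = w and c' = c'])
    show "w n \<in> L2" for n unfolding w_def[abs_def] by (rule wL)
    show "wderiv ?\<Omega> e (w n) (g n e)" if "e \<in> Basis" for n e unfolding w_def[abs_def] by (rule g(2)[OF that])
    show "(\<lambda>x. w n x powr (1 / k n)) \<in> L2" for n unfolding wv by (rule vL)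
    show "integrable lborel (\<lambda>x. w n x powr (1 - 1 / k n))" for n
      using integrable_mult_right[OF qi[of n], of "(k n - 1) / k n"] k3[of n] unfolding wp by simp
    show "c e \<in> borel_measurable borel" for e unfolding c_def by (cases "e = (0, 1)") simp_all
    show "\<bar>c e x\<bar> \<le> M" for e x using mm(2)[of x] bb(3)[of x e] by (simp add: c_def)
    show "\<bar>c' e x\<bar> \<le> M" for e x using mm(9)[OF et, of x] ct(3)[of e x] by (simp add: c'_def)
    show "continuous_on ?\<Omega> (c e)" for e unfolding c_def using mm(5) ct(1)[of e] by (cases "e = (0, 1)") (auto intro: continuous_on_minus)
    show "continuous_on ?\<Omega> (c' e)" for e unfolding c'_def using mm(6)[OF et] ct(2)[of e] by (cases "e = (0, 1)") (auto intro: continuous_on_minus)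
    show "((\<lambda>s. c e (x + s *\<^sub>R e)) has_real_derivative c' e x) (at 0)" if e: "e \<in> Basis" and x: "x \<in> ?\<Omega>" for e x
    proof (cases "e = (0, 1)")
      case True
      then show ?thesis using mm(7)[OF x, of e] by (simp add: c_def c'_def)
    next
      case False
      then show ?thesis using DERIV_minus[OF ct(4)[OF e x]] by (simp add: c_def c'_def)
    qed
    show "f0 \<in> borel_measurable borel" unfolding f0_def by measurable
    show "\<bar>f0 x\<bar> \<le> M" for x unfolding f0_def by (rule ff(3))
    show "(\<Sum>e\<in>Basis. \<integral>x. c e x * w n x powr (1 / k n) * dir_deriv e \<psi> x \<partial>lborel)
      - (\<Sum>e\<in>?S. \<integral>x. mm x * g n e x * dir_deriv e \<psi> x \<partial>lborel)
      + (\<integral>x. f0 x * w n x powr (1 / k n) * \<psi> x \<partial>lborel) = 0" if \<psi>: "test_function ?\<Omega> \<psi>" for n \<psi>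
    proof -
      have c1: "c (0, 1) x * w n x powr (1 / k n) = R n x" for x unfolding wv c_def by (simp only: if_True simp_thms mR)
      have c2: "c e x * w n x powr (1 / k n) * d = - (R n x * bb e x * d)" if "e \<in> ?S" for e x d
      proof -
        have "c e x * w n x powr (1 / k n) * d = - (mm x * (R n x / mm x) * bb e x * d)"
          using that unfolding wv c_def by simp
        then show ?thesis by (simp only: mR)
      qed
      have c3: "f0 x * w n x powr (1 / k n) = ff x * R n x" for x unfolding wv f0_def mult.assoc mR ..
      have "(\<Sum>e\<in>?S. \<integral>x. c e x * w n x powr (1 / k n) * dir_deriv e \<psi> x \<partial>lborel)
          = - (\<Sum>e\<in>?S. \<integral>x. R n x * bb e x * dir_deriv e \<psi> x \<partial>lborel)"
        unfolding sum_negf[symmetric] by (intro sum.cong refl) (simp only: c2 Bochner_Integration.integral_minus)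
      then show ?thesis using Req[OF \<psi>, of n] unfolding split c1 c3 by linarith
    qed
    show "P \<in> L2" "integrable lborel P" by fact+
    show "(\<lambda>n. \<integral>x. \<bar>k n / (k n - 1) * w n x powr (1 - 1 / k n) - P x\<bar> \<partial>lborel) \<longlonglongrightarrow> 0"
    proof -
      have "(\<integral>x. \<bar>k n / (k n - 1) * (R n x / mm x) powr (k n - 1) - P x\<bar> \<partial>lborel)
        = (\<integral>x. \<bar>k n / (k n - 1) * (R n x / mm x) powr (k n - 1) - P0 x\<bar> \<partial>lborel)" for n
      proof (rule integral_cong_AE)
        have [measurable]: "R n \<in> borel_measurable borel" by (rule repD(1)[OF Rr])
        show "(\<lambda>x. \<bar>k n / (k n - 1) * (R n x / mm x) powr (k n - 1) - P x\<bar>) \<in> borel_measurable lborel"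
          "(\<lambda>x. \<bar>k n / (k n - 1) * (R n x / mm x) powr (k n - 1) - P0 x\<bar>) \<in> borel_measurable lborel" by measurable
      qed (use Pae in \<open>auto elim!: eventually_mono\<close>)
      then show ?thesis using pconv0(1) unfolding wp by simp
    qed
    have Ri': "integrable lborel (\<lambda>z. R n z - R' z)" for n by (rule Bochner_Integration.integrable_diff[OF Ri Rconv(2)])
    have dV: "AE x in lborel. (R n x - R' x) / mm x = w n x powr (1 / k n) - V x" for n
      using Vae unfolding wv by eventually_elim (simp add: diff_divide_distrib)
    have Rm: "R n \<in> borel_measurable borel" for n by (rule repD(1)[OF Rr])
    have dm: "(\<lambda>x. w n x powr (1 / k n) - V x) \<in> borel_measurable lborel" for n
      unfolding wv using Rm[of n] by measurable
    have dm2: "(\<lambda>x. (R n x - R' x) / mm x) \<in> borel_measurable lborel" for n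
      using Rm[of n] by measurable
    show "integrable lborel (\<lambda>x. w n x powr (1 / k n) - V x)" for n
      using div_int(1)[OF Ri'[of n]] integrable_cong_AE[OF dm2 dm dV, of n] by blast
    have "(\<integral>x. \<bar>w n x powr (1 / k n) - V x\<bar> \<partial>lborel) = (\<integral>x. \<bar>(R n x - R' x) / mm x\<bar> \<partial>lborel)" for n
    proof (rule integral_cong_AE[OF borel_measurable_abs[OF dm] borel_measurable_abs[OF dm2]])
      show "AE x in lborel. \<bar>w n x powr (1 / k n) - V x\<bar> = \<bar>(R n x - R' x) / mm x\<bar>"
        using dV[of n] by eventually_elim simp
    qed
    then have "norm (\<integral>x. \<bar>w n x powr (1 / k n) - V x\<bar> \<partial>lborel) \<le> 1 / \<delta> * (\<integral>z. \<bar>R n z - R' z\<bar> \<partial>lborel)" for n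
      using div_int(2)[OF Ri'[of n]] by simp
    then show "(\<lambda>n. \<integral>x. \<bar>w n x powr (1 / k n) - V x\<bar> \<partial>lborel) \<longlonglongrightarrow> 0"
      by (intro Lim_null_comparison[OF always_eventually[OF allI] tendsto_mult_right_zero[OF Rconv(1)]])
    show "\<bar>V x\<bar> \<le> 1" for x using V01[of x] by simp
  qed (use P_nonneg GL Gw Vm that QT_cutoff[OF T] in \<open>auto simp: w_def\<close>)
  have eqn: "(\<integral>x. mm x * V x * dir_deriv (0, 1) \<psi> x \<partial>lborel)
      - (\<Sum>e\<in>?S. \<integral>x. (mm x * G e x + mm x * V x * bb e x) * dir_deriv e \<psi> x \<partial>lborel)
      + (\<integral>x. ff x * mm x * V x * \<psi> x \<partial>lborel) = 0" if \<psi>: "test_function ?\<Omega> \<psi>" for \<psi>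
  proof -
    have "(\<integral>x. (mm x * G e x + mm x * V x * bb e x) * dir_deriv e \<psi> x \<partial>lborel)
      = (\<integral>x. mm x * G e x * dir_deriv e \<psi> x \<partial>lborel) - (\<integral>x. c e x * V x * dir_deriv e \<psi> x \<partial>lborel)" if e: "e \<in> ?S" for e
    proof -
      note t = tdir_test_function[OF \<psi> SB[OF e]]
      have i1: "integrable lborel (\<lambda>x. mm x * G e x * dir_deriv e \<psi> x)"
        by (rule L2_mult_integrable[OF L2_bounded_mult[OF GL[OF e] mm(1,2)] tdir_L2(2)[OF t]])
      have "\<bar>c e x * V x\<bar> \<le> M * 1" for x
        unfolding abs_mult using e bb(3)[of x e] V01[of x] mm(2)[of x] by (intro mult_mono) (auto simp: c_def)
      then have i2: "integrable lborel (\<lambda>x. c e x * V x * dir_deriv e \<psi> x)"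
        by (rule tdir_integrable_mult[OF t, rotated]) (use e in \<open>simp add: c_def\<close>)
      have "(mm x * G e x + mm x * V x * bb e x) * dir_deriv e \<psi> x = mm x * G e x * dir_deriv e \<psi> x - c e x * V x * dir_deriv e \<psi> x" for x
        using e by (simp add: c_def algebra_simps)
      then show ?thesis by (simp add: Bochner_Integration.integral_diff[OF i1 i2])
    qed
    then have "(\<Sum>e\<in>?S. \<integral>x. (mm x * G e x + mm x * V x * bb e x) * dir_deriv e \<psi> x \<partial>lborel)
      = (\<Sum>e\<in>?S. \<integral>x. mm x * G e x * dir_deriv e \<psi> x \<partial>lborel) - (\<Sum>e\<in>?S. \<integral>x. c e x * V x * dir_deriv e \<psi> x \<partial>lborel)"
      by (simp add: sum_subtractf)
    then show ?thesis using lim_eq[OF \<psi>] unfolding split by (simp add: c_def f0_def)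
  qed

  obtain K where K: "compact K" "K \<subseteq> ?\<Omega>" "\<And>x. x \<notin> K \<Longrightarrow> \<phi> x = 0" by (rule test_functionE[OF \<phi>]) (rule that)
  obtain B where B: "B \<ge> 0" "\<And>x. \<bar>\<phi> x\<bar> \<le> B" by (rule test_function_bounded[OF \<phi>]) (rule that)
  \<comment> \<open>The cut-off now serves as a nonnegative function dominating
    \<open>\<phi>\<close>: it is at least \<open>c0\<close> on \<open>K\<close>, off which
    \<open>\<phi>\<close> vanishes, so the multiple \<open>B / c0\<close> suffices. Flatness does
    not matter in this role, and \<open>\<epsilon> = 1\<close> is taken.\<close>
  obtain c0 \<theta> \<theta>' where c0: "c0 > 0" and \<theta>: "\<And>e. e \<in> Basis \<Longrightarrow> tdir ?\<Omega> e \<theta> (\<theta>' e)" "\<And>x. 0 \<le> \<theta> x" "\<And>x. x \<in> K \<Longrightarrow> \<theta> x \<ge> c0"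
    using QT_cutoff[OF T K(1,2)] zero_less_one by metis
  have \<phi>\<theta>: "\<bar>\<phi> x\<bar> \<le> B / c0 * \<theta> x" for x
  proof (cases "x \<in> K")
    case True
    have "\<bar>\<phi> x\<bar> \<le> B / c0 * c0" using B(2) c0 by simp
    also have "\<dots> \<le> B / c0 * \<theta> x" using \<theta>(3)[OF True] B(1) c0 by (intro mult_left_mono) auto
    finally show ?thesis .
  qed (use K(3) B(1) c0 \<theta>(2)[of x] in simp)
  have td: "tdir ?\<Omega> e (\<lambda>x. B / c0 * \<theta> x) (\<lambda>x. 0 * \<theta> x + B / c0 * \<theta>' e x)" if "e \<in> Basis" for e
    by (rule tdir_mult_local[OF open_QT _ _ _ \<theta>(1)[OF that]]) auto
  define H where "H x = - m' (0, 1) x * (\<phi> x * P x) - (\<Sum>e\<in>?S. mm x * G e x * (dir_deriv e \<phi> x * P x + \<phi> x * G e x))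
      + (\<Sum>e\<in>?S. ct' e x * \<phi> x * P x) + ff x * mm x * (\<phi> x * P x)" for x
  have "(\<integral>x. H x \<partial>lborel) = 0"
    unfolding H_def
    by (rule complementarity_signed[OF open_QT et mm(1,2,3) mm(9)[OF et] mm(8)[OF et] mm(7) bb(1,2) refl ct(1,2) ct(4)[OF SB] ff(1,2)
      Vm V01 PL P_nonneg VP GL Gw eqn tdir_test_function[OF \<phi>] td \<phi>\<theta>])
  moreover have "rep ?\<Omega> (\<lambda>z. - m z * p_inf z * (space_grad \<phi> z \<bullet> weak_space_grad T p_inf z)
       - m z * \<phi> z * (norm (weak_space_grad T p_inf z))\<^sup>2 + \<phi> z * p_inf z * m z * source_F m b f z) H"
    unfolding rep_def
  proof (intro conjI allI impI)
    have dm: "dir_deriv e \<phi> \<in> borel_measurable borel" if "e \<in> Basis" for e by (rule test_function_borel[OF test_function_dir_deriv[OF \<phi> that]])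
    have [measurable]: "\<phi> \<in> borel_measurable borel" by (rule test_function_borel[OF \<phi>])
    have [measurable]: "m' (0, 1) \<in> borel_measurable borel" by (rule mm(8)[OF et])
    have [measurable]: "dir_deriv (axis i 1, 0) \<phi> \<in> borel_measurable borel" "G (axis i 1, 0) \<in> borel_measurable borel"
      "ct' (axis i 1, 0) \<in> borel_measurable borel" for i
      by (rule dm[OF E(1)], rule repD(1)[OF Gi], rule ct(5))
    show "H \<in> borel_measurable borel" unfolding H_def sum_space_Basis by measurable
    show "H z = 0" if "z \<notin> ?\<Omega>" for z using that by (simp add: H_def mm0 repD(3)[OF Pr])
    have "AE z in lborel. \<forall>i. z \<in> ?\<Omega> \<longrightarrow> weak_space_grad T p_inf z $ i = G (axis i 1, 0) z"
      by (rule AE_all_index) (rule repD(2)[OF weak_space_grad_rep[OF Pr Gp(2) Gi]])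
    then show "AE z in lborel. z \<in> ?\<Omega> \<longrightarrow> - m z * p_inf z * (space_grad \<phi> z \<bullet> weak_space_grad T p_inf z)
       - m z * \<phi> z * (norm (weak_space_grad T p_inf z))\<^sup>2 + \<phi> z * p_inf z * m z * source_F m b f z = H z"
      using repD(2)[OF Pr]
    proof eventually_elim
      case (elim z)
      show ?case
      proof
        assume z: "z \<in> ?\<Omega>"
        have W: "weak_space_grad T p_inf z $ i = G (axis i 1, 0) z" for i using elim(1) z by blast
        have p: "p_inf z = P z" using elim(2) z by blast
        have mz: "mm z = m z" "ff z = f z" "m' (0, 1) z = time_deriv m z" using z by (simp_all add: mm_def ff_def m'_def time_deriv_def)
        have mpos: "m z \<noteq> 0" using mm(4)[OF z] assms by (simp add: mz)
        \<comment> \<open>Multiplication by \<open>m\<close> cancels the division in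
          \<open>source_F\<close>, and the divergence of \<open>m b\<close> appears componentwise as
          \<open>ct'\<close>.\<close>
        have F: "m z * source_F m b f z = (\<Sum>i\<in>UNIV. ct' (axis i 1, 0) z) + m z * f z - time_deriv m z"
          using z mpos E(1) by (simp add: source_F_def space_div_def ct'_def inner_axis)
        have s1: "space_grad \<phi> z \<bullet> weak_space_grad T p_inf z = (\<Sum>i\<in>UNIV. dir_deriv (axis i 1, 0) \<phi> z * G (axis i 1, 0) z)"
          by (simp add: inner_vec_def space_grad_def W)
        have s2: "(norm (weak_space_grad T p_inf z))\<^sup>2 = (\<Sum>i\<in>UNIV. (G (axis i 1, 0) z)\<^sup>2)"
          unfolding power2_norm_eq_inner by (simp add: inner_vec_def W power2_eq_square)
        have h1: "(\<Sum>e\<in>?S. m z * G e z * (dir_deriv e \<phi> z * P z + \<phi> z * G e z))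
          = m z * P z * (\<Sum>i\<in>UNIV. dir_deriv (axis i 1, 0) \<phi> z * G (axis i 1, 0) z) + m z * \<phi> z * (\<Sum>i\<in>UNIV. (G (axis i 1, 0) z)\<^sup>2)"
          unfolding sum_space_Basis sum_distrib_left sum.distrib[symmetric]
          by (intro sum.cong refl) (simp add: algebra_simps power2_eq_square)
        have h2: "(\<Sum>e\<in>?S. ct' e z * \<phi> z * P z) = \<phi> z * P z * (\<Sum>i\<in>UNIV. ct' (axis i 1, 0) z)"
          unfolding sum_space_Basis sum_distrib_left by (intro sum.cong refl) (simp add: mult_ac)
        have "\<phi> z * p_inf z * m z * source_F m b f z = \<phi> z * P z * (m z * source_F m b f z)" unfolding p by (simp add: mult_ac)
        then show "- m z * p_inf z * (space_grad \<phi> z \<bullet> weak_space_grad T p_inf z)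
          - m z * \<phi> z * (norm (weak_space_grad T p_inf z))\<^sup>2 + \<phi> z * p_inf z * m z * source_F m b f z = H z"
          unfolding H_def h1 h2 s1 s2 F mz by (simp add: p algebra_simps)
      qed
    qed
  qed
  ultimately show "(LINT z|lebesgue_on (QT T). - m z * p_inf z * (space_grad \<phi> z \<bullet> weak_space_grad T p_inf z)
       - m z * \<phi> z * (norm (weak_space_grad T p_inf z))\<^sup>2 + \<phi> z * p_inf z * m z * source_F m b f z) = 0"
    using rep_integral(1)[OF \<Omega>b] by simp
qed

end
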